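(* Let $0\le d\le n$, $n\ge1$, and let $X\subset\mathbb{C}^n$ be a closed pure $d$-dimensional complex analytic set. The following are equivalent: (i) $X$ is algebraic; (ii) $\mathcal{H}^{2d}\bigl(\Sigma_\infty(X)\bigr)=0$; (iii) $\dim_H\Sigma_\infty(X)<2d$. Moreover, if $d>0$ and $X$ is algebraic, then $\dim_H\Sigma_\infty(X)=2d-2$.
   Context: A closed pure $d$-dimensional complex analytic set $X\subset\mathbb{C}^n$ is a nonempty closed complex analytic subset having dimension $d$ at each of its points. $X$ is algebraic if it is the common zero set of a family of polynomials in $\mathbb{C}[z_1,\dots,z_n]$. For $A\subset\mathbb{C}^n$, the total tangent cone at infinity is $$C_\infty(A)=\{v\in\mathbb{C}^n:\exists\, x_j\in A,\ t_j>0,\ \|x_j\|\to\infty,\ t_j\to\infty,\ x_j/t_j\to v\}.$$ The projective asymptotic direction set is $\Sigma_\infty(A)=\{\mathbb{C}v: v\in C_\infty(A)\setminus\{0\}\}\subset\mathbb{P}^{n-1}(\mathbb{C})$, where $\mathbb{P}^{n-1}(\mathbb{C})$ is the space of complex lines through the origin in $\mathbb{C}^n$; so $\Sigma_\infty(A)$ is the set of complex lines through $0$ containing a nonzero element of $C_\infty(A)$ (empty if $A$ is bounded). $\mathcal{H}^s$ is $s$-dimensional Hausdorff measure and $\dim_H$ is Hausdorff dimension, taken on $\mathbb{P}^{n-1}(\mathbb{C})$ with respect to a fixed smooth Riemannian metric. Convention: $\dim_H\varnothing=-\infty$ (relevant only when $d=0$). *)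

theory Defs
  imports "HOL-Analysis.Analysis" "HOL-Library.Poly_Mapping"
begin

section \<open>Analytic and algebraic subsets of \<open>\<complex>\<^sup>n\<close>\<close>

text \<open>Throughout, \<open>\<complex>\<^sup>n\<close> is \<^typ>\<open>complex ^ 'n\<close> with \<open>n = CARD('n)\<close>. A function of several complex
  variables is holomorphic if its real Frechet derivative exists and is complex linear.\<close>

definition holomorphic_fun_on :: "(complex ^ 'n \<Rightarrow> complex) \<Rightarrow> (complex ^ 'n) set \<Rightarrow> bool"
  where "holomorphic_fun_on f U \<longleftrightarrow>
    (\<forall>z\<in>U. \<exists>D. (f has_derivative D) (at z) \<and> (\<forall>c v. D (c *s v) = c * D v))"

definition holomorphic_map_on :: "(complex ^ 'n \<Rightarrow> complex ^ 'm) \<Rightarrow> (complex ^ 'n) set \<Rightarrow> bool"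
  where "holomorphic_map_on \<phi> U \<longleftrightarrow> (\<forall>i. holomorphic_fun_on (\<lambda>z. \<phi> z $ i) U)"

definition biholomorphic_between ::
    "(complex ^ 'n) set \<Rightarrow> (complex ^ 'n) set \<Rightarrow> (complex ^ 'n \<Rightarrow> complex ^ 'n) \<Rightarrow> bool"
  where "biholomorphic_between U V \<phi> \<longleftrightarrow> open U \<and> open V \<and> bij_betw \<phi> U V \<and>
    holomorphic_map_on \<phi> U \<and> holomorphic_map_on (inv_into U \<phi>) V"

definition closed_analytic_set :: "(complex ^ 'n) set \<Rightarrow> bool"
  where "closed_analytic_set X \<longleftrightarrow> closed X \<and>
    (\<forall>a\<in>X. \<exists>U F. open U \<and> a \<in> U \<and> finite F \<and> (\<forall>f\<in>F. holomorphic_fun_on f U) \<and>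
      X \<inter> U = {z \<in> U. \<forall>f\<in>F. f z = 0})"

text \<open>The points near which \<open>X\<close> is a \<open>p\<close>-dimensional complex submanifold: a local biholomorphism
  straightens \<open>X\<close> to the coordinate subspace spanned by \<open>p\<close> coordinates.\<close>

definition regular_points :: "(complex ^ 'n) set \<Rightarrow> nat \<Rightarrow> (complex ^ 'n) set"
  where "regular_points X p = {a \<in> X. \<exists>U V \<phi> I. a \<in> U \<and> biholomorphic_between U V \<phi> \<and>
    card I = p \<and> \<phi> ` (X \<inter> U) = {w \<in> V. \<forall>i. i \<notin> I \<longrightarrow> w $ i = 0}}"

text \<open>\<open>dim\<^sub>a X = d\<close>: the dimension at \<open>a\<close> is the largest dimension of \<open>X\<close> at regular points
  arbitrarily close to \<open>a\<close>.\<close>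

definition has_analytic_dim_at :: "(complex ^ 'n) set \<Rightarrow> complex ^ 'n \<Rightarrow> nat \<Rightarrow> bool"
  where "has_analytic_dim_at X a d \<longleftrightarrow> a \<in> closure (regular_points X d) \<and>
    (\<forall>p. a \<in> closure (regular_points X p) \<longrightarrow> p \<le> d)"

definition closed_pure_analytic_set :: "nat \<Rightarrow> (complex ^ 'n) set \<Rightarrow> bool"
  where "closed_pure_analytic_set d X \<longleftrightarrow> X \<noteq> {} \<and> closed_analytic_set X \<and>
    (\<forall>a\<in>X. has_analytic_dim_at X a d)"

text \<open>Elements of \<^typ>\<open>('n \<Rightarrow>\<^sub>0 nat) \<Rightarrow>\<^sub>0 complex\<close> are the polynomials over \<open>\<complex>\<close> in variables
  indexed by \<^typ>\<open>'n\<close>: finitely supported coefficient families on exponent vectors.\<close>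

definition eval_poly :: "(('n::finite \<Rightarrow>\<^sub>0 nat) \<Rightarrow>\<^sub>0 complex) \<Rightarrow> complex ^ 'n \<Rightarrow> complex"
  where "eval_poly P z =
    (\<Sum>m\<in>Poly_Mapping.keys P. Poly_Mapping.lookup P m * (\<Prod>i\<in>UNIV. z $ i ^ Poly_Mapping.lookup m i))"

definition algebraic_set :: "(complex ^ 'n) set \<Rightarrow> bool"
  where "algebraic_set X \<longleftrightarrow>
    (\<exists>\<P> :: (('n \<Rightarrow>\<^sub>0 nat) \<Rightarrow>\<^sub>0 complex) set. X = {z. \<forall>P\<in>\<P>. eval_poly P z = 0})"


section \<open>Asymptotic directions\<close>

definition cone_at_infinity :: "(complex ^ 'n) set \<Rightarrow> (complex ^ 'n) set"
  where "cone_at_infinity A = {v. \<exists>(x :: nat \<Rightarrow> complex ^ 'n) (t :: nat \<Rightarrow> real).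
    (\<forall>j. x j \<in> A) \<and> (\<forall>j. t j > 0) \<and>
    filterlim (\<lambda>j. norm (x j)) at_top sequentially \<and> filterlim t at_top sequentially \<and>
    (\<lambda>j. x j /\<^sub>R t j) \<longlonglongrightarrow> v}"

definition complex_line :: "complex ^ 'n \<Rightarrow> (complex ^ 'n) set"
  where "complex_line v = range (\<lambda>c. c *s v)"

definition projective_space :: "(complex ^ 'n) set set"
  where "projective_space = complex_line ` (- {0})"

definition asymptotic_directions :: "(complex ^ 'n) set \<Rightarrow> (complex ^ 'n) set set"
  where "asymptotic_directions A = complex_line ` (cone_at_infinity A - {0})"


section \<open>Riemannian metrics on projective space\<close>

text \<open>\<open>Ck_on k f S\<close>: \<open>f\<close> is \<open>k\<close> times continuously differentiable on the open set \<open>S\<close>.\<close>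

fun Ck_on :: "nat \<Rightarrow> ('a::euclidean_space \<Rightarrow> 'b::real_normed_vector) \<Rightarrow> 'a set \<Rightarrow> bool"
  where
    "Ck_on 0 f S \<longleftrightarrow> continuous_on S f"
  | "Ck_on (Suc k) f S \<longleftrightarrow> (\<forall>x\<in>S. f differentiable (at x)) \<and>
      (\<forall>v. Ck_on k (\<lambda>x. frechet_derivative f (at x) v) S)"

definition smooth_fun_on :: "('a::euclidean_space \<Rightarrow> 'b::real_normed_vector) \<Rightarrow> 'a set \<Rightarrow> bool"
  where "smooth_fun_on f S \<longleftrightarrow> (\<forall>k. Ck_on k f S)"

text \<open>A smooth Riemannian metric on the space of lines is represented by its pullback \<open>g\<close> along the
  quotient map \<open>\<complex>\<^sup>n - {0} \<rightarrow> \<P>\<^sup>n\<^sup>-\<^sup>1\<close>, whose differential at \<open>v\<close> is onto with kernel \<open>\<complex>v\<close>.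
  The pullbacks of Riemannian metrics are precisely the smooth families of symmetric real bilinear
  forms \<open>g v\<close> that are invariant under the scaling action of \<open>\<complex> - {0}\<close> and positive semidefinite
  with null space exactly \<open>\<complex>v\<close>. The value of \<open>g\<close> at \<open>0\<close> is irrelevant.\<close>

definition riemannian_metric_on_projective_space ::
    "(complex ^ 'n \<Rightarrow> complex ^ 'n \<Rightarrow> complex ^ 'n \<Rightarrow> real) \<Rightarrow> bool"
  where "riemannian_metric_on_projective_space g \<longleftrightarrow>
    (\<forall>a b. smooth_fun_on (\<lambda>v. g v a b) (- {0})) \<and>
    (\<forall>v. v \<noteq> 0 \<longrightarrow>
      bilinear (g v) \<and>
      (\<forall>a b. g v a b = g v b a) \<and>
      (\<forall>a. g v a a \<ge> 0) \<and>
      (\<forall>a. g v a a = 0 \<longleftrightarrow> a \<in> complex_line v) \<and>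
      (\<forall>c a b. c \<noteq> 0 \<longrightarrow> g (c *s v) (c *s a) (c *s b) = g v a b))"

text \<open>Every \<open>C\<^sup>1\<close> curve of lines lifts to a \<open>C\<^sup>1\<close> curve in \<open>\<complex>\<^sup>n - {0}\<close>, and its length can be computed
  on the lift, so this is the geodesic distance of \<open>g\<close>. Plain \<open>C\<^sup>1\<close> curves are used because the
  library's piecewise ones admit unbounded derivatives.\<close>

definition riemannian_dist ::
    "(complex ^ 'n \<Rightarrow> complex ^ 'n \<Rightarrow> complex ^ 'n \<Rightarrow> real) \<Rightarrow>
      (complex ^ 'n) set \<Rightarrow> (complex ^ 'n) set \<Rightarrow> real"
  where "riemannian_dist g K L =
    Inf {integral {0..1} (\<lambda>t. sqrt (g (\<gamma> t) (vector_derivative \<gamma> (at t)) (vector_derivative \<gamma> (at t)))) |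
      \<gamma>. \<gamma> C1_differentiable_on {0..1} \<and> (\<forall>t\<in>{0..1}. \<gamma> t \<noteq> 0) \<and> \<gamma> 0 \<in> K \<and> \<gamma> 1 \<in> L}"


section \<open>Hausdorff measure and dimension\<close>

text \<open>The distance \<open>\<delta>\<close> lives on the carrier \<open>M\<close>. Conventions for the summand \<open>(diam U)\<^sup>s\<close>:
  it is \<open>0\<close> for empty \<open>U\<close>, and \<open>1\<close> for nonempty \<open>U\<close> if \<open>s = 0\<close> (note that
  \<open>0 powr 0 = 0\<close> in the library), so that \<open>\<H>\<^sup>0\<close> is counting measure.
  No normalising constant is included.\<close>

definition diam_power :: "('a \<Rightarrow> 'a \<Rightarrow> real) \<Rightarrow> real \<Rightarrow> 'a set \<Rightarrow> ennreal"
  where "diam_power \<delta> s U =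
    (if U = {} then 0 else if s = 0 then 1
     else ennreal ((SUP (x, y)\<in>U \<times> U. \<delta> x y) powr s))"

definition hausdorff_premeasure ::
    "'a set \<Rightarrow> ('a \<Rightarrow> 'a \<Rightarrow> real) \<Rightarrow> real \<Rightarrow> real \<Rightarrow> 'a set \<Rightarrow> ennreal"
  where "hausdorff_premeasure M \<delta> s \<epsilon> A =
    (INF U \<in> {U :: nat \<Rightarrow> 'a set. A \<subseteq> (\<Union>i. U i) \<and>
        (\<forall>i. U i \<subseteq> M \<and> (\<forall>x\<in>U i. \<forall>y\<in>U i. \<delta> x y \<le> \<epsilon>))}.
      suminf (\<lambda>i. diam_power \<delta> s (U i)))"

definition hausdorff_measure :: "'a set \<Rightarrow> ('a \<Rightarrow> 'a \<Rightarrow> real) \<Rightarrow> real \<Rightarrow> 'a set \<Rightarrow> ennreal"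
  where "hausdorff_measure M \<delta> s A = (SUP \<epsilon>\<in>{0<..}. hausdorff_premeasure M \<delta> s \<epsilon> A)"

definition hausdorff_dim :: "'a set \<Rightarrow> ('a \<Rightarrow> 'a \<Rightarrow> real) \<Rightarrow> 'a set \<Rightarrow> ereal"
  where "hausdorff_dim M \<delta> A =
    (if A = {} then -\<infinity> else Inf {ereal s | s. s \<ge> 0 \<and> hausdorff_measure M \<delta> s A = 0})"

end

theory Submission
  imports Defs "HOL-Complex_Analysis.Complex_Analysis"
begin

text \<open>
  Algebraic sets. If \<open>X\<close> is algebraic and not all of \<open>\<complex>\<^sup>n\<close>, the top form of a polynomial vanishing on
  \<open>X\<close> vanishes on the cone at infinity, so \<open>X\<close> projects properly along any direction \<open>v\<close> off the zeros
  of that form, and the image is again algebraic: it is cut out by the products of polynomials over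
  the fibers, which are entire of polynomial growth. Iterating gives a linear subspace \<open>L\<close> meeting the cone only
  in \<open>0\<close> with \<open>X + L = \<complex>\<^sup>n\<close>, and then \<open>L\<close> has codimension \<open>d\<close>. Therefore the cone projects onto \<open>\<complex>\<^sup>n / L\<close>, which bounds
  the dimension of the directions from below. From above, every coordinate of \<open>L\<close> satisfies on the cone a
  homogeneous equation that is monic in it; splitting the cone according to the order of
  vanishing in that coordinate exhibits it as a countable union of Lipschitz graphs over
  \<open>d\<close>-dimensional coordinates.

  Conversely, if \<open>\<H>\<^sup>s(\<Sigma>) = 0\<close> with \<open>s \<le> 2d\<close>, a volume estimate shows that the cone together with any
  linear subspace of codimension larger than \<open>d\<close> does not sweep out \<open>\<complex>\<^sup>n\<close>; so one can
  enlarge \<open>L\<close> step by step to codimension \<open>d\<close> while it meets the cone only in \<open>0\<close>. Then the projections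
  of \<open>X\<close> along hyperplanes of \<open>L\<close> are hypersurfaces whose fibers grow linearly, hence are zero sets of
  polynomials, and these separate \<open>X\<close> from every other point.

  Several complex variables enter only through functions that are continuous and holomorphic on
  complex lines.
\<close>

section \<open>Functions holomorphic along complex lines\<close>

text \<open>Individual points of a fiber do not vary holomorphically, but their weighted power sums
  do, because the argument principle writes them as circle integrals. Symmetric functions of fibers
  therefore carry the argument: products over fibers give equations of projections, and a
  discriminant of tuples separates the sheets on each line off isolated points. Purity of dimension
  enters through topology: by invariance of domain the projection of a suitable chart of X is open,
  which rules out thin components of the hypersurfaces X + L' and makes their fibers lower
  semicontinuous. The decisive number is 2(k-1), where k is the codimension of L: it is the real
  dimension of the space of complex lines in C^n / L. Directions that are null for H^s with s <=
  2(k-1) cannot fill that space, and k >= d+1 gives 2d <= 2(k-1). This is why vanishing measure in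
  dimension 2d, far above the true dimension 2d-2, already forces algebraicity. The cone at infinity
  is defined with positive real factors only, so arguments about directions carry an extra complex
  factor.\<close>

lemma norm_smult: "norm (c *s (v::complex^'n)) = norm c * norm v"
  by (simp add: norm_vec_def norm_mult L2_set_right_distrib)

lemma tendsto_smult [tendsto_intros]:
  fixes g :: "'a \<Rightarrow> complex^'n"
  assumes "(f \<longlongrightarrow> a) F" "(g \<longlongrightarrow> b) F"
  shows "((\<lambda>x. f x *s g x) \<longlongrightarrow> a *s b) F"
  unfolding vector_scalar_mult_def by (intro tendsto_intros assms)

lemma continuous_on_smult [continuous_intros]:
  fixes g :: "'a::topological_space \<Rightarrow> complex^'n"
  assumes "continuous_on S f" "continuous_on S g"
  shows "continuous_on S (\<lambda>x. f x *s g x)"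
  using assms unfolding continuous_on_def by (auto intro: tendsto_smult)

text \<open>On open sets this is ordinary holomorphy by Osgood's lemma. The form is chosen because
  products, quotients and circle integrals with parameters preserve it by one-variable
  arguments.\<close>

definition line_holomorphic_on :: "(complex^'n \<Rightarrow> complex) \<Rightarrow> (complex^'n) set \<Rightarrow> bool" where
  "line_holomorphic_on f U \<longleftrightarrow> continuous_on U f \<and>
     (\<forall>z u. (\<lambda>x. f (z + x *s u)) holomorphic_on {x. z + x *s u \<in> U})"

lemma open_line_preimage:
  assumes "open (U::(complex^'n) set)" shows "open {x. z + x *s u \<in> U}"
proof -
  have "continuous_on UNIV (\<lambda>x. z + x *s u)" by (intro continuous_intros)
  from open_vimage[OF assms this] show ?thesis by (simp add: vimage_def)
qed

lemma line_holomorphic_onI: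
  assumes "continuous_on U f"
    "\<And>z u. (\<lambda>x. f (z + x *s u)) holomorphic_on {x. z + x *s u \<in> U}"
  shows "line_holomorphic_on f U"
  using assms by (simp add: line_holomorphic_on_def)

lemma line_holomorphic_onD:
  assumes "line_holomorphic_on f U"
  shows "continuous_on U f" "(\<lambda>x. f (z + x *s u)) holomorphic_on {x. z + x *s u \<in> U}"
  using assms by (auto simp: line_holomorphic_on_def)

lemma line_holomorphic_on_subset:
  "line_holomorphic_on f U \<Longrightarrow> V \<subseteq> U \<Longrightarrow> line_holomorphic_on f V"
  unfolding line_holomorphic_on_def
  by (meson Collect_mono continuous_on_subset holomorphic_on_subset in_mono)

lemma line_holomorphic_on_cong:
  assumes "\<And>z. z \<in> U \<Longrightarrow> f z = g z"
  shows "line_holomorphic_on f U \<longleftrightarrow> line_holomorphic_on g U"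
proof -
  have "continuous_on U f \<longleftrightarrow> continuous_on U g" by (rule continuous_on_cong) (auto simp: assms)
  moreover have "(\<lambda>x. f (z + x *s u)) holomorphic_on {x. z + x *s u \<in> U} \<longleftrightarrow>
     (\<lambda>x. g (z + x *s u)) holomorphic_on {x. z + x *s u \<in> U}" for z u
    by (rule holomorphic_cong) (auto simp: assms)
  ultimately show ?thesis by (simp add: line_holomorphic_on_def)
qed

lemma line_holomorphic_const [simp]: "line_holomorphic_on (\<lambda>z. c) U"
  by (simp add: line_holomorphic_on_def)

lemma line_holomorphic_add:
  "line_holomorphic_on f U \<Longrightarrow> line_holomorphic_on g U \<Longrightarrow> line_holomorphic_on (\<lambda>z. f z + g z) U"
  by (rule line_holomorphic_onI) (auto intro!: continuous_intros holomorphic_intros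
      dest: line_holomorphic_onD)

lemma line_holomorphic_mult:
  "line_holomorphic_on f U \<Longrightarrow> line_holomorphic_on g U \<Longrightarrow> line_holomorphic_on (\<lambda>z. f z * g z) U"
  by (rule line_holomorphic_onI) (auto intro!: continuous_intros holomorphic_intros
      dest: line_holomorphic_onD)

lemma line_holomorphic_divide:
  "line_holomorphic_on f U \<Longrightarrow> line_holomorphic_on g U \<Longrightarrow> (\<And>z. z \<in> U \<Longrightarrow> g z \<noteq> 0) \<Longrightarrow>
    line_holomorphic_on (\<lambda>z. f z / g z) U"
  by (rule line_holomorphic_onI) (auto intro!: continuous_intros holomorphic_intros
      dest: line_holomorphic_onD)

lemma line_holomorphic_sum:
  "(\<And>i. i \<in> I \<Longrightarrow> line_holomorphic_on (f i) U) \<Longrightarrow> line_holomorphic_on (\<lambda>z. \<Sum>i\<in>I. f i z) U"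
  by (rule line_holomorphic_onI) (auto intro!: continuous_intros holomorphic_intros
      dest: line_holomorphic_onD)

lemma line_holomorphic_prod:
  "(\<And>i. i \<in> I \<Longrightarrow> line_holomorphic_on (f i) U) \<Longrightarrow> line_holomorphic_on (\<lambda>z. \<Prod>i\<in>I. f i z) U"
  by (rule line_holomorphic_onI) (auto intro!: continuous_intros holomorphic_intros
      dest: line_holomorphic_onD)

lemma line_holomorphic_compose:
  assumes "line_holomorphic_on f U" "g holomorphic_on S" "\<And>z. z \<in> U \<Longrightarrow> f z \<in> S"
  shows "line_holomorphic_on (\<lambda>z. g (f z)) U"
proof (rule line_holomorphic_onI)
  show "continuous_on U (\<lambda>z. g (f z))"
    using continuous_on_compose2[OF holomorphic_on_imp_continuous_on[OF assms(2)]
        line_holomorphic_onD(1)[OF assms(1)]] assms(3) by blast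
  show "(\<lambda>x. g (f (z + x *s u))) holomorphic_on {x. z + x *s u \<in> U}" for z u
    using holomorphic_on_compose_gen[OF line_holomorphic_onD(2)[OF assms(1)] assms(2)] assms(3)
    by (auto simp: o_def)
qed

lemma line_holomorphic_shift:
  assumes "line_holomorphic_on f U" "\<And>z. z \<in> B \<Longrightarrow> z + a \<in> U"
  shows "line_holomorphic_on (\<lambda>z. f (z + a)) B"
proof (rule line_holomorphic_onI)
  show "continuous_on B (\<lambda>z. f (z + a))"
    by (rule continuous_on_compose2[OF line_holomorphic_onD(1)[OF assms(1)]])
      (auto intro!: continuous_intros assms)
  show "(\<lambda>x. f (z + x *s u + a)) holomorphic_on {x. z + x *s u \<in> B}" for z u
  proof -
    have eq: "z + a + x *s u = z + x *s u + a" for x by simp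
    have "(\<lambda>x. f (z + a + x *s u)) holomorphic_on {x. z + x *s u \<in> B}"
      by (rule holomorphic_on_subset[OF line_holomorphic_onD(2)[OF assms(1)]])
        (unfold eq, use assms(2) in blast)
    then show ?thesis unfolding eq .
  qed
qed

lemma line_holomorphic_local:
  assumes "\<And>z. z \<in> U \<Longrightarrow> \<exists>V. open V \<and> z \<in> V \<and> line_holomorphic_on f V"
  shows "line_holomorphic_on f U"
proof (rule line_holomorphic_onI)
  show "continuous_on U f"
    unfolding continuous_on_eq_continuous_within
  proof
    fix z assume "z \<in> U"
    then obtain V where V: "open V" "z \<in> V" "line_holomorphic_on f V" using assms by blast
    then have "isCont f z" using line_holomorphic_onD(1) continuous_on_eq_continuous_at by blast
    then show "continuous (at z within U) f" by (rule continuous_at_imp_continuous_at_within)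
  qed
  fix z u
  show "(\<lambda>x. f (z + x *s u)) holomorphic_on {x. z + x *s u \<in> U}"
    unfolding holomorphic_on_def
  proof clarify
    fix x assume "z + x *s u \<in> U"
    then obtain V where V: "open V" "z + x *s u \<in> V" "line_holomorphic_on f V" using assms by blast
    have "(\<lambda>x. f (z + x *s u)) field_differentiable at x"
      using holomorphic_on_imp_differentiable_at[OF line_holomorphic_onD(2)[OF V(3)] open_line_preimage[OF V(1)]]
        V(2) by simp
    then show "(\<lambda>x. f (z + x *s u)) field_differentiable at x within {x. z + x *s u \<in> U}"
      by (rule field_differentiable_at_within)
  qed
qed

lemma holomorphic_fun_on_imp_line_holomorphic:
  assumes "holomorphic_fun_on f U" "open U"
  shows "line_holomorphic_on f U"
proof (rule line_holomorphic_onI)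
  show "continuous_on U f"
    using assms unfolding holomorphic_fun_on_def
    by (meson continuous_at_imp_continuous_on has_derivative_continuous)
  fix z u
  show "(\<lambda>x. f (z + x *s u)) holomorphic_on {x. z + x *s u \<in> U}"
    unfolding holomorphic_on_def
  proof clarify
    fix x assume "z + x *s u \<in> U"
    then obtain D where D: "(f has_derivative D) (at (z + x *s u))" "\<forall>c v. D (c *s v) = c * D v"
      using assms unfolding holomorphic_fun_on_def by blast
    have "bounded_linear (\<lambda>c. c *s u)"
      by (rule bounded_linear_intro[where K="norm u"])
        (auto simp: norm_smult vector_sadd_rdistrib vec_eq_iff)
    then have "((\<lambda>x. z + x *s u) has_derivative (\<lambda>c. c *s u)) (at x)"
      by (auto intro!: derivative_eq_intros bounded_linear_imp_has_derivative)
    from diff_chain_at[OF this D(1)] have "((\<lambda>x. f (z + x *s u)) has_derivative (\<lambda>c. c * D u)) (at x)"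
      by (simp add: o_def D(2))
    then have "((\<lambda>x. f (z + x *s u)) has_field_derivative D u) (at x)"
      by (simp add: has_field_derivative_def mult_commute_abs)
    then show "(\<lambda>x. f (z + x *s u)) field_differentiable at x within {x. z + x *s u \<in> U}"
      using field_differentiable_at_within field_differentiable_def by blast
  qed
qed

section \<open>Circle integrals depending on parameters\<close>

lemma continuous_on_circle_integral:
  fixes F :: "'a::topological_space \<Rightarrow> complex \<Rightarrow> complex"
  assumes "continuous_on (P \<times> sphere t r) (\<lambda>(p,w). F p w)" "0 \<le> r"
  shows "continuous_on P (\<lambda>p. contour_integral (circlepath t r) (F p))"
proof -
  let ?g = "\<lambda>p s. F p (circlepath t r s) * vector_derivative (circlepath t r) (at s)"
  have cp: "circlepath t r s \<in> sphere t r" for s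
    using assms(2) by (auto simp: circlepath dist_norm norm_mult)
  have "continuous_on (P \<times> cbox 0 1) (\<lambda>x. (fst x, circlepath t r (snd x)))"
    by (auto simp: circlepath intro!: continuous_intros)
  from continuous_on_compose2[OF assms(1) this]
  have "continuous_on (P \<times> cbox 0 1) (\<lambda>x. F (fst x) (circlepath t r (snd x)))"
    using cp by fastforce
  then have "continuous_on (P \<times> cbox 0 1) (\<lambda>(p,s). ?g p s)"
    unfolding vector_derivative_circlepath split_beta by (intro continuous_intros)
  from integral_continuous_on_param[OF this] show ?thesis
    by (simp add: contour_integral_integral)
qed

lemma deriv_eq_circle_integral:
  assumes "f holomorphic_on U" "cball x0 r \<subseteq> U" "x \<in> ball x0 r"
  shows "deriv f x = 1 / (2 * of_real pi * \<i>) * contour_integral (circlepath x0 r) (\<lambda>u. f u / (u - x)^2)"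
proof (rule DERIV_imp_deriv, rule Cauchy_derivative_integral_circlepath(2))
  show "continuous_on (cball x0 r) f"
    using assms holomorphic_on_imp_continuous_on continuous_on_subset by blast
  show "f holomorphic_on ball x0 r"
    using assms ball_subset_cball holomorphic_on_subset by (metis subset_trans)
qed (use assms in auto)

text \<open>Cauchy's formula writes the derivative as a circle integral of \<open>F\<close> itself,
  so joint continuity passes from \<open>F\<close> to the derivative although \<open>K\<close> is
  just a set of topological parameters.\<close>

lemma continuous_on_deriv_param:
  fixes F :: "complex \<Rightarrow> 'a::t2_space \<Rightarrow> complex"
  assumes "open U" and cont: "continuous_on (U \<times> K) (\<lambda>(x,w). F x w)"
    and hol: "\<And>w. w \<in> K \<Longrightarrow> (\<lambda>x. F x w) holomorphic_on U"
  shows "continuous_on (U \<times> K) (\<lambda>(x,w). deriv (\<lambda>x. F x w) x)"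
  unfolding continuous_on_eq_continuous_within
proof clarify
  fix x0 w0 assume x0: "x0 \<in> U" and w0: "w0 \<in> K"
  obtain r where r: "r > 0" "cball x0 r \<subseteq> U" using \<open>open U\<close> x0 open_contains_cball by blast
  let ?G = "\<lambda>p u. F u (snd p) / (u - fst p)^2"
  have ball: "continuous_on (ball x0 r \<times> K) (\<lambda>p. contour_integral (circlepath x0 r) (?G p))"
  proof (rule continuous_on_circle_integral)
    have "continuous_on ((ball x0 r \<times> K) \<times> sphere x0 r) (\<lambda>q. F (snd q) (snd (fst q)))"
      by (rule continuous_on_compose2[OF cont, where f="\<lambda>q. (snd q, snd (fst q))", simplified])
        (use r in \<open>auto intro!: continuous_intros\<close>)
    then show "continuous_on ((ball x0 r \<times> K) \<times> sphere x0 r) (\<lambda>(p,u). ?G p u)"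
      unfolding split_beta by (intro continuous_intros) auto
  qed (use r in auto)
  have "continuous_on (ball x0 r \<times> K) (\<lambda>(x,w). deriv (\<lambda>x. F x w) x)
     = continuous_on (ball x0 r \<times> K) (\<lambda>p. 1 / (2 * of_real pi * \<i>) * contour_integral (circlepath x0 r) (?G p))"
    by (rule continuous_on_cong) (use deriv_eq_circle_integral[OF hol r(2)] in auto)
  with ball have "continuous_on (ball x0 r \<times> K) (\<lambda>(x,w). deriv (\<lambda>x. F x w) x)"
    by (auto intro!: continuous_intros)
  then have "continuous (at (x0,w0) within (ball x0 r \<times> K)) (\<lambda>(x,w). deriv (\<lambda>x. F x w) x)"
    using r w0 by (simp add: continuous_on_eq_continuous_within)
  moreover have "at (x0,w0) within (ball x0 r \<times> K) = at (x0,w0) within (U \<times> K)"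
    by (rule at_within_nhd[where S="ball x0 r \<times> UNIV"])
      (use r ball_subset_cball in \<open>auto intro: open_Times\<close>)
  ultimately show "continuous (at (x0,w0) within (U \<times> K)) (\<lambda>(x,w). deriv (\<lambda>x. F x w) x)" by simp
qed

text \<open>Differentiation under the integral sign. The Leibniz rule asks for joint continuity of
  the derivative, supplied by \<open>continuous_on_deriv_param\<close>, and for a convex domain,
  hence the passage to balls.\<close>

lemma circle_integral_holomorphic:
  assumes "open U" "0 \<le> r" and cont: "continuous_on (U \<times> sphere t r) (\<lambda>(x,w). F x w)"
    and hol: "\<And>w. w \<in> sphere t r \<Longrightarrow> (\<lambda>x. F x w) holomorphic_on U"
  shows "(\<lambda>x. contour_integral (circlepath t r) (F x)) holomorphic_on U"
  unfolding holomorphic_on_def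
proof
  fix x0 assume x0: "x0 \<in> U"
  obtain e where e: "e > 0" "ball x0 e \<subseteq> U" using \<open>open U\<close> x0 open_contains_ball by blast
  let ?c = "circlepath t r" and ?v = "\<lambda>s. vector_derivative (circlepath t r) (at s)"
  have cp: "?c s \<in> sphere t r" for s
    using assms(2) by (auto simp: circlepath dist_norm norm_mult)
  have cpc: "continuous_on (ball x0 e \<times> cbox 0 1) (\<lambda>x. (fst x, ?c (snd x)))"
    by (auto simp: circlepath intro!: continuous_intros)
  have "(\<lambda>x. integral (cbox 0 1) (\<lambda>s. F x (?c s) * ?v s)) holomorphic_on ball x0 e"
  proof (rule leibniz_rule_holomorphic[where fx="\<lambda>x s. deriv (\<lambda>x. F x (?c s)) x * ?v s"])
    fix x s assume x: "x \<in> ball x0 e"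
    have "((\<lambda>x. F x (?c s)) has_field_derivative deriv (\<lambda>x. F x (?c s)) x) (at x)"
      using holomorphic_derivI[OF hol[OF cp] \<open>open U\<close>] x e by blast
    from has_field_derivative_at_within[OF this]
    have "((\<lambda>x. F x (?c s)) has_field_derivative deriv (\<lambda>x. F x (?c s)) x) (at x within ball x0 e)" .
    from DERIV_cmult_right[OF this, of "?v s"]
    show "((\<lambda>x. F x (?c s) * ?v s) has_field_derivative deriv (\<lambda>x. F x (?c s)) x * ?v s) (at x within ball x0 e)"
      by (simp add: mult.commute)
  next
    fix x assume x: "x \<in> ball x0 e"
    have "continuous_on (cbox 0 1) (\<lambda>s. F x (?c s))"
      by (rule continuous_on_compose2[OF cont, where f="\<lambda>s. (x, ?c s)", simplified])
        (use x e cp in \<open>auto simp: circlepath intro!: continuous_intros\<close>)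
    then show "(\<lambda>s. F x (?c s) * ?v s) integrable_on cbox 0 1"
      unfolding vector_derivative_circlepath by (intro integrable_continuous continuous_intros)
  next
    have "continuous_on (ball x0 e \<times> cbox 0 1) (\<lambda>q. deriv (\<lambda>x. F x (?c (snd q))) (fst q))"
      using continuous_on_compose2[OF continuous_on_deriv_param[OF \<open>open U\<close> cont hol] cpc] e cp
      by fastforce
    then show "continuous_on (ball x0 e \<times> cbox 0 1) (\<lambda>(x, s). deriv (\<lambda>x. F x (?c s)) x * ?v s)"
      unfolding vector_derivative_circlepath split_beta by (intro continuous_intros)
  qed auto
  then have "(\<lambda>x. contour_integral ?c (F x)) holomorphic_on ball x0 e"
    by (simp add: contour_integral_integral)
  then have "(\<lambda>x. contour_integral ?c (F x)) field_differentiable at x0"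
    using e holomorphic_on_imp_differentiable_at[of _ "ball x0 e"] by auto
  then show "(\<lambda>x. contour_integral ?c (F x)) field_differentiable at x0 within U"
    by (rule field_differentiable_at_within)
qed

lemma line_holomorphic_circle_integral:
  assumes "open B" "0 \<le> r" and cont: "continuous_on (B \<times> sphere t r) (\<lambda>(z,w). F z w)"
    and hol: "\<And>w. w \<in> sphere t r \<Longrightarrow> line_holomorphic_on (\<lambda>z. F z w) B"
  shows "line_holomorphic_on (\<lambda>z. contour_integral (circlepath t r) (F z)) B"
proof (rule line_holomorphic_onI)
  show "continuous_on B (\<lambda>z. contour_integral (circlepath t r) (F z))"
    by (rule continuous_on_circle_integral[OF cont \<open>0 \<le> r\<close>])
  fix z u
  show "(\<lambda>x. contour_integral (circlepath t r) (F (z + x *s u))) holomorphic_on {x. z + x *s u \<in> B}"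
  proof (rule circle_integral_holomorphic[OF open_line_preimage[OF \<open>open B\<close>] \<open>0 \<le> r\<close>])
    show "continuous_on ({x. z + x *s u \<in> B} \<times> sphere t r) (\<lambda>(x,w). F (z + x *s u) w)"
      unfolding split_beta
      by (rule continuous_on_compose2[OF cont, where f="\<lambda>q. (z + fst q *s u, snd q)", simplified])
        (auto intro!: continuous_intros)
  qed (rule line_holomorphic_onD(2)[OF hol])
qed

section \<open>Families of one-variable functions with a holomorphic parameter\<close>

definition param_holomorphic ::
    "(complex^'n) set \<Rightarrow> complex set \<Rightarrow> (complex^'n \<Rightarrow> complex \<Rightarrow> complex) \<Rightarrow> bool" where
  "param_holomorphic B D h \<longleftrightarrow> continuous_on (B \<times> D) (\<lambda>(z,x). h z x) \<and>
     (\<forall>z\<in>B. h z holomorphic_on D) \<and> (\<forall>x\<in>D. line_holomorphic_on (\<lambda>z. h z x) B)"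

lemma param_holomorphicD:
  assumes "param_holomorphic B D h"
  shows "continuous_on (B \<times> D) (\<lambda>(z,x). h z x)" "z \<in> B \<Longrightarrow> h z holomorphic_on D"
    "x \<in> D \<Longrightarrow> line_holomorphic_on (\<lambda>z. h z x) B"
  using assms by (auto simp: param_holomorphic_def)

lemma param_holomorphic_subset:
  assumes "param_holomorphic B D h" "B' \<subseteq> B" "D' \<subseteq> D"
  shows "param_holomorphic B' D' h"
  using assms unfolding param_holomorphic_def
  by (meson Sigma_mono continuous_on_subset holomorphic_on_subset line_holomorphic_on_subset subsetD)

lemma param_holomorphic_translate:
  fixes v :: "complex^'n"
  assumes f: "line_holomorphic_on f U" and sub: "\<And>z x. z \<in> B \<Longrightarrow> x \<in> D \<Longrightarrow> z + x *s v \<in> U"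
  shows "param_holomorphic B D (\<lambda>z x. f (z + x *s v))"
  unfolding param_holomorphic_def
proof (intro conjI ballI)
  show "continuous_on (B \<times> D) (\<lambda>(z,x). f (z + x *s v))"
    unfolding split_beta
    by (rule continuous_on_compose2[OF line_holomorphic_onD(1)[OF f]])
      (use sub in \<open>auto intro!: continuous_intros\<close>)
  show "(\<lambda>x. f (z + x *s v)) holomorphic_on D" if "z \<in> B" for z
    using line_holomorphic_onD(2)[OF f, of z v] by (rule holomorphic_on_subset) (use sub that in auto)
  show "line_holomorphic_on (\<lambda>z. f (z + x *s v)) B" if "x \<in> D" for x
    by (rule line_holomorphic_shift[OF f]) (use sub that in auto)
qed

text \<open>For fixed \<open>x\<close> the derivative at \<open>x\<close> is an integral over a
  circle around \<open>x\<close> that does not move with \<open>z\<close>; this reduces holomorphy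
  in \<open>z\<close> to that of circle integrals.\<close>

lemma param_holomorphic_deriv:
  assumes h: "param_holomorphic B D h" and "open B" "open D"
  shows "param_holomorphic B D (\<lambda>z. deriv (h z))"
  unfolding param_holomorphic_def
proof (intro conjI ballI)
  note hc = param_holomorphicD(1)[OF h]
  have "continuous_on (D \<times> B) (\<lambda>(x,z). h z x)"
    unfolding split_beta
    by (rule continuous_on_compose2[OF hc, where f="\<lambda>q. (snd q, fst q)", simplified])
      (auto intro!: continuous_intros)
  from continuous_on_deriv_param[OF \<open>open D\<close> this param_holomorphicD(2)[OF h]]
  have c: "continuous_on (D \<times> B) (\<lambda>(x,z). deriv (h z) x)" by simp
  show "continuous_on (B \<times> D) (\<lambda>(z,x). deriv (h z) x)"
    unfolding split_beta
    by (rule continuous_on_compose2[OF c, where f="\<lambda>q. (snd q, fst q)", simplified])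
      (auto intro!: continuous_intros)
  show "deriv (h z) holomorphic_on D" if "z \<in> B" for z
    using holomorphic_deriv[OF param_holomorphicD(2)[OF h that] \<open>open D\<close>] .
  fix x assume x: "x \<in> D"
  obtain r where r: "r > 0" "cball x r \<subseteq> D" using \<open>open D\<close> x open_contains_cball by blast
  have "line_holomorphic_on (\<lambda>z. contour_integral (circlepath x r) (\<lambda>u. h z u / (u - x)^2)) B"
  proof (rule line_holomorphic_circle_integral[OF \<open>open B\<close>])
    have "continuous_on (B \<times> sphere x r) (\<lambda>(z,u). h z u)"
      by (rule continuous_on_subset[OF hc]) (use r in auto)
    then show "continuous_on (B \<times> sphere x r) (\<lambda>(z,u). h z u / (u - x)^2)"
      unfolding split_beta by (intro continuous_intros) (use r in auto)
    show "line_holomorphic_on (\<lambda>z. h z u / (u - x)\<^sup>2) B" if "u \<in> sphere x r" for u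
      by (rule line_holomorphic_divide) (use that r param_holomorphicD(3)[OF h] in auto)
  qed (use r in auto)
  then have "line_holomorphic_on (\<lambda>z. 1 / (2 * of_real pi * \<i>) *
      contour_integral (circlepath x r) (\<lambda>u. h z u / (u - x)^2)) B"
    by (intro line_holomorphic_mult line_holomorphic_const)
  then show "line_holomorphic_on (\<lambda>z. deriv (h z) x) B"
    by (rule line_holomorphic_on_cong[THEN iffD1, rotated])
      (use deriv_eq_circle_integral[OF param_holomorphicD(2)[OF h] r(2)] r in simp)
qed

section \<open>Symmetric functions of zeros\<close>

definition zeros_in :: "(complex \<Rightarrow> complex) \<Rightarrow> complex \<Rightarrow> real \<Rightarrow> complex set" where
  "zeros_in g t r = {p \<in> ball t r. g p = 0}"

text \<open>\<open>zorder\<close> is integer valued. At the zeros considered below it is positive,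
  so the conversion to \<open>nat\<close> loses nothing.\<close>

definition zmult :: "(complex \<Rightarrow> complex) \<Rightarrow> complex \<Rightarrow> nat" where
  "zmult g p = nat (zorder g p)"

text \<open>A function without zeros on the circle is not identically zero, and the closed disc is
  compact in the larger ball. The constant case is split off because isolation of zeros is a
  statement about nonconstant functions.\<close>

lemma finite_zeros_in:
  assumes g: "g holomorphic_on ball t R" and r: "0 < r" "r < R" and nz: "\<And>w. w \<in> sphere t r \<Longrightarrow> g w \<noteq> 0"
  shows "finite (zeros_in g t r)"
proof (cases "g constant_on ball t R")
  case True
  have "t + of_real r \<in> sphere t r" using r by (auto simp: dist_norm)
  moreover have "sphere t r \<subseteq> ball t R" "ball t r \<subseteq> ball t R" using r by auto
  ultimately have "zeros_in g t r = {}" using True nz unfolding constant_on_def zeros_in_def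
    by (smt (verit) Collect_empty_eq subsetD)
  then show ?thesis by simp
next
  case False
  have "finite {z \<in> cball t r. g z = 0}"
    by (rule holomorphic_compact_finite_zeros[OF g]) (use r False in auto)
  then show ?thesis by (rule rev_finite_subset) (auto simp: zeros_in_def)
qed

lemma zorder_zeros_in_pos:
  assumes g: "g holomorphic_on ball t R" and r: "0 < r" "r < R" and nz: "\<And>w. w \<in> sphere t r \<Longrightarrow> g w \<noteq> 0"
    and p: "p \<in> zeros_in g t r"
  shows "zorder g p > 0"
proof -
  let ?S = "ball t r - (zeros_in g t r - {p})"
  have "open ?S" using finite_zeros_in[OF assms(1-4)] by (simp add: finite_imp_closed open_Diff)
  moreover have "p \<in> ?S" "\<forall>w\<in>?S. w \<noteq> p \<longrightarrow> g w \<noteq> 0" using p by (auto simp: zeros_in_def)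
  ultimately have "eventually (\<lambda>w. g w \<noteq> 0) (at p)" unfolding eventually_at_topological by blast
  then have "frequently (\<lambda>w. g w \<noteq> 0) (at p)" by (rule eventually_frequently[rotated]) simp
  then show ?thesis
    using zorder_pos_iff[OF g] p r by (auto simp: zeros_in_def)
qed

lemma zmult_pos:
  assumes "g holomorphic_on ball t R" "0 < r" "r < R" "\<And>w. w \<in> sphere t r \<Longrightarrow> g w \<noteq> 0"
    "p \<in> zeros_in g t r"
  shows "zmult g p > 0"
  using zorder_zeros_in_pos[OF assms] by (simp add: zmult_def)

lemma zero_sum_eq_circle_integral:
  assumes g: "g holomorphic_on ball t R" and h: "h holomorphic_on ball t R"
    and r: "0 < r" "r < R" and nz: "\<And>w. w \<in> sphere t r \<Longrightarrow> g w \<noteq> 0"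
  shows "contour_integral (circlepath t r) (\<lambda>x. deriv g x * h x / g x) =
    2 * pi * \<i> * (\<Sum>p\<in>zeros_in g t r. of_nat (zmult g p) * h p)"
proof -
  \<comment> \<open>The argument principle needs an open set around the closed disc with finitely
    many zeros. Zeros between the two circles contribute nothing, since the inner circle does not
    wind around them.\<close>
  define r2 where "r2 = (r + R) / 2"
  have r2: "r < r2" "r2 < R" using r by (auto simp: r2_def)
  let ?pz = "{w \<in> ball t r2. g w = 0 \<or> w \<in> {}}"
  have fin: "finite ?pz"
  proof (cases "g constant_on ball t R")
    case True
    have "t + of_real r \<in> sphere t r" using r by (auto simp: dist_norm)
    moreover have "sphere t r \<subseteq> ball t R" "ball t r2 \<subseteq> ball t R" using r r2 by auto
    ultimately have "?pz = {}" using True nz unfolding constant_on_def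
      by (smt (verit) Collect_empty_eq empty_iff subsetD)
    then show ?thesis by (metis finite.emptyI)
  next
    case False
    have "finite {z \<in> cball t r2. g z = 0}"
      by (rule holomorphic_compact_finite_zeros[OF g]) (use r r2 False in auto)
    then show ?thesis by (rule rev_finite_subset) auto
  qed
  have "contour_integral (circlepath t r) (\<lambda>x. deriv g x * h x / g x) = 2 * pi * \<i> *
          (\<Sum>p\<in>?pz. winding_number (circlepath t r) p * h p * zorder g p)"
  proof (rule argument_principle)
    show "g holomorphic_on ball t r2 - {}" "h holomorphic_on ball t r2"
      using g h r2 by (auto intro: holomorphic_on_subset)
    show "path_image (circlepath t r) \<subseteq> ball t r2 - ?pz"
      using r r2 nz by auto
    show "\<forall>z. z \<notin> ball t r2 \<longrightarrow> winding_number (circlepath t r) z = 0"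
    proof clarify
      fix z assume "z \<notin> ball t r2"
      then show "winding_number (circlepath t r) z = 0"
        using r r2 by (intro winding_number_zero_outside[where s="cball t r"]) auto
    qed
  qed (use fin in auto)
  also have "(\<Sum>p\<in>?pz. winding_number (circlepath t r) p * h p * zorder g p) =
     (\<Sum>p\<in>zeros_in g t r. winding_number (circlepath t r) p * h p * zorder g p)"
  proof (rule sum.mono_neutral_right[OF fin])
    show "zeros_in g t r \<subseteq> ?pz" using r2 by (auto simp: zeros_in_def)
    show "\<forall>i\<in>?pz - zeros_in g t r. winding_number (circlepath t r) i * h i * of_int (zorder g i) = 0"
    proof
      fix i assume i: "i \<in> ?pz - zeros_in g t r"
      then have "i \<notin> cball t r" using nz[of i] by (force simp: zeros_in_def)
      then have "winding_number (circlepath t r) i = 0"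
        using r by (intro winding_number_zero_outside[where s="cball t r"]) auto
      then show "winding_number (circlepath t r) i * h i * of_int (zorder g i) = 0" by simp
    qed
  qed
  also have "\<dots> = (\<Sum>p\<in>zeros_in g t r. of_nat (zmult g p) * h p)"
  proof (rule sum.cong[OF refl])
    fix p assume p: "p \<in> zeros_in g t r"
    then have "winding_number (circlepath t r) p = 1"
      using winding_number_circlepath[of p t r] by (auto simp: zeros_in_def dist_norm norm_minus_commute)
    moreover have "of_int (zorder g p) = (of_nat (zmult g p) :: complex)"
      using zorder_zeros_in_pos[OF g r nz p] unfolding zmult_def by (metis less_imp_le of_int_of_nat_eq int_nat_eq)
    ultimately show "winding_number (circlepath t r) p * h p * of_int (zorder g p) = of_nat (zmult g p) * h p"
      by simp
  qed
  finally show ?thesis .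
qed

text \<open>The zeros may collide and branch as z varies, but the sum is a circle integral over a
  fixed circle whose integrand is line holomorphic in z.\<close>

lemma zero_sum_line_holomorphic:
  assumes f: "param_holomorphic B (ball t R) f" and h: "param_holomorphic B (ball t R) h"
    and "open B" and r: "0 < r" "r < R"
    and nz: "\<And>z w. z \<in> B \<Longrightarrow> w \<in> sphere t r \<Longrightarrow> f z w \<noteq> 0"
  shows "line_holomorphic_on (\<lambda>z. \<Sum>p\<in>zeros_in (f z) t r. of_nat (zmult (f z) p) * h z p) B"
proof -
  note f' = param_holomorphic_deriv[OF f \<open>open B\<close> open_ball]
  have sub: "sphere t r \<subseteq> ball t R" using r by auto
  then have sub2: "B \<times> sphere t r \<subseteq> B \<times> ball t R" by auto
  have "line_holomorphic_on (\<lambda>z. contour_integral (circlepath t r) (\<lambda>x. deriv (f z) x * h z x / f z x)) B"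
  proof (rule line_holomorphic_circle_integral[OF \<open>open B\<close>])
    show "continuous_on (B \<times> sphere t r) (\<lambda>(z,w). deriv (f z) w * h z w / f z w)"
      using continuous_on_subset[OF param_holomorphicD(1)[OF f] sub2]
        continuous_on_subset[OF param_holomorphicD(1)[OF h] sub2]
        continuous_on_subset[OF param_holomorphicD(1)[OF f'] sub2] nz
      unfolding split_beta by (intro continuous_intros) auto
    show "line_holomorphic_on (\<lambda>z. deriv (f z) w * h z w / f z w) B" if "w \<in> sphere t r" for w
      using param_holomorphicD(3)[OF f] param_holomorphicD(3)[OF f'] param_holomorphicD(3)[OF h] that sub nz
      by (intro line_holomorphic_mult line_holomorphic_divide) blast+
  qed (use r in auto)
  then have "line_holomorphic_on (\<lambda>z. 1 / (2 * of_real pi * \<i>) *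
      contour_integral (circlepath t r) (\<lambda>x. deriv (f z) x * h z x / f z x)) B"
    by (intro line_holomorphic_mult line_holomorphic_const)
  then show ?thesis
  proof (rule line_holomorphic_on_cong[THEN iffD1, rotated])
    fix z assume z: "z \<in> B"
    have "f z holomorphic_on ball t R" "h z holomorphic_on ball t R"
      using z f h by (auto dest: param_holomorphicD)
    from zero_sum_eq_circle_integral[OF this r nz[OF z]]
    show "1 / (2 * of_real pi * \<i>) * contour_integral (circlepath t r) (\<lambda>x. deriv (f z) x * h z x / f z x) =
       (\<Sum>p\<in>zeros_in (f z) t r. of_nat (zmult (f z) p) * h z p)"
      by simp
  qed
qed

lemma param_holomorphic_of_holomorphic:
  assumes "k holomorphic_on D" shows "param_holomorphic B D (\<lambda>z. k)"
proof -
  have "continuous_on (B \<times> D) (\<lambda>x. k (snd x))"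
    by (rule continuous_on_compose2[OF holomorphic_on_imp_continuous_on[OF assms]])
      (auto intro!: continuous_intros)
  then show ?thesis using assms by (simp add: param_holomorphic_def split_beta)
qed

lemma param_holomorphic_compose:
  assumes h: "param_holomorphic B D h" and g: "g holomorphic_on S"
    and sub: "\<And>z x. z \<in> B \<Longrightarrow> x \<in> D \<Longrightarrow> h z x \<in> S"
  shows "param_holomorphic B D (\<lambda>z x. g (h z x))"
  unfolding param_holomorphic_def
proof (intro conjI ballI)
  show "continuous_on (B \<times> D) (\<lambda>(z, x). g (h z x))"
    using continuous_on_compose2[OF holomorphic_on_imp_continuous_on[OF g] param_holomorphicD(1)[OF h]] sub
    by (force simp: split_beta)
  show "(\<lambda>x. g (h z x)) holomorphic_on D" if "z \<in> B" for z
    using holomorphic_on_compose_gen[OF param_holomorphicD(2)[OF h that] g] sub that by (auto simp: o_def)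
  show "line_holomorphic_on (\<lambda>z. g (h z x)) B" if "x \<in> D" for x
    using line_holomorphic_compose[OF param_holomorphicD(3)[OF h that] g] sub that by auto
qed

lemma connected_of_nat_constant:
  fixes N :: "'a::topological_space \<Rightarrow> nat"
  assumes "connected B" "continuous_on B (\<lambda>z. of_nat (N z) :: complex)"
  shows "\<exists>p. \<forall>z\<in>B. N z = p"
proof -
  have "(\<lambda>z. of_nat (N z) :: complex) constant_on B"
  proof (rule continuous_discrete_range_constant[OF assms])
    fix x
    have "1 \<le> norm (of_nat (N y) - of_nat (N x) :: complex)" if "of_nat (N y) \<noteq> (of_nat (N x) :: complex)" for y
    proof -
      have "of_nat (N y) - of_nat (N x) = (of_int (int (N y) - int (N x)) :: complex)" by simp
      then have "norm (of_nat (N y) - of_nat (N x) :: complex) = \<bar>of_int (int (N y) - int (N x))\<bar>"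
        by (metis norm_of_int)
      moreover have "int (N y) - int (N x) \<noteq> 0" using that by auto
      then have "\<bar>int (N y) - int (N x)\<bar> \<ge> 1" by linarith
      then have "\<bar>of_int (int (N y) - int (N x)) :: real\<bar> \<ge> 1" by linarith
      ultimately show ?thesis by simp
    qed
    then show "\<exists>e>0. \<forall>y. y \<in> B \<and> of_nat (N y) \<noteq> (of_nat (N x) :: complex) \<longrightarrow> e \<le> norm (of_nat (N y) - of_nat (N x) :: complex)"
      by (intro exI[of _ 1]) auto
  qed
  then show ?thesis unfolding constant_on_def by (metis of_nat_eq_iff)
qed

text \<open>Weight 1 turns the zero sum into the number of zeros with multiplicity, a continuous
  integer-valued function on a connected set.\<close>

lemma zero_count_constant:
  assumes "param_holomorphic B (ball t R) f" "open B" "connected B" "0 < r" "r < R"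
    "\<And>z w. z \<in> B \<Longrightarrow> w \<in> sphere t r \<Longrightarrow> f z w \<noteq> 0"
  shows "\<exists>p. \<forall>z\<in>B. (\<Sum>q\<in>zeros_in (f z) t r. zmult (f z) q) = p"
proof (rule connected_of_nat_constant[OF \<open>connected B\<close>])
  have "line_holomorphic_on (\<lambda>z. \<Sum>p\<in>zeros_in (f z) t r. of_nat (zmult (f z) p) * 1) B"
    by (rule zero_sum_line_holomorphic) (use assms in \<open>auto intro: param_holomorphic_of_holomorphic\<close>)
  from line_holomorphic_onD(1)[OF this]
  show "continuous_on B (\<lambda>z. of_nat (\<Sum>q\<in>zeros_in (f z) t r. zmult (f z) q) :: complex)" by simp
qed

section \<open>Products over zeros\<close>

lemma poly_mean_roots_of_unity:
  assumes "degree (q :: complex poly) < N"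
  shows "(\<Sum>j<N. poly q (M * cis (2 * pi * real j / real N))) = of_nat N * poly q 0"
proof -
  have N: "N > 0" using assms by simp
  let ?w = "\<lambda>j. cis (2 * pi * real j / real N)"
  have pw: "?w j ^ i = ?w i ^ j" for i j
    using Complex.DeMoivre[of "2 * pi * real j / real N" i] Complex.DeMoivre[of "2 * pi * real i / real N" j]
    by (simp add: algebra_simps)
  have gs: "(\<Sum>j<N. ?w j ^ i) = (if i = 0 then of_nat N else 0)" if "i < N" for i
  proof (cases "i = 0")
    case False
    have ne: "?w i \<noteq> 1"
    proof
      assume "?w i = 1"
      then have "?w i = ?w 0" by simp
      moreover have "inj_on ?w {..<N}" using Complex.bij_betw_roots_unity[OF N] by (simp add: bij_betw_def)
      ultimately have "i = 0" using that N by (intro inj_onD[of ?w "{..<N}"]) auto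
      then show False using False by simp
    qed
    have "?w i ^ N = 1" using N cis_multiple_2pi[of "real i"] by (simp add: Complex.DeMoivre mult_ac)
    then have "(\<Sum>j<N. ?w i ^ j) = 0" using ne by (simp add: geometric_sum)
    then show ?thesis using False by (simp add: pw)
  qed simp
  have "(\<Sum>j<N. poly q (M * ?w j)) = (\<Sum>j<N. \<Sum>i\<le>degree q. coeff q i * M ^ i * ?w j ^ i)"
    by (simp add: poly_altdef power_mult_distrib mult.assoc)
  also have "\<dots> = (\<Sum>i\<le>degree q. coeff q i * M ^ i * (\<Sum>j<N. ?w j ^ i))"
    by (subst sum.swap) (simp add: sum_distrib_left)
  also have "\<dots> = (\<Sum>i\<le>degree q. coeff q i * M ^ i * (if i = 0 then of_nat N else 0))"
    using assms by (intro sum.cong refl) (simp add: gs)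
  also have "\<dots> = of_nat N * poly q 0" by (simp add: if_distrib sum.delta poly_0_coeff_0 cong: if_cong)
  finally show ?thesis .
qed

lemma poly_prod_shift:
  fixes a :: "'a \<Rightarrow> complex"
  assumes "finite Z"
  shows "\<exists>q. degree q \<le> (\<Sum>p\<in>Z. m p) \<and> (\<forall>s. poly q s = (\<Prod>p\<in>Z. (s + a p) ^ m p))"
  using assms
proof induction
  case empty
  then show ?case by (intro exI[of _ 1]) auto
next
  case (insert x F)
  then obtain q where q: "degree q \<le> (\<Sum>p\<in>F. m p)" "\<forall>s. poly q s = (\<Prod>p\<in>F. (s + a p) ^ m p)" by blast
  have "degree ([:a x, 1:] ^ m x * q) \<le> m x + (\<Sum>p\<in>F. m p)"
    using degree_mult_le[of "[:a x, 1:] ^ m x" q] degree_power_le[of "[:a x, 1:]" "m x"] q(1) by simp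
  then show ?case using insert q(2) by (intro exI[of _ "[:a x, 1:] ^ m x * q"]) (auto simp: add.commute)
qed

text \<open>For large \<open>s\<close> the product \<open>\<Prod>(s + h(p))\<close> over the zeros \<open>p\<close> is the exponential of a
  zero sum of logarithms; averaging over the points \<open>s = M\<omega>\<^sup>j\<close> recovers its value at \<open>s = 0\<close>.\<close>

lemma zero_prod_line_holomorphic:
  assumes f: "param_holomorphic B (ball t R) f" and h: "param_holomorphic B (ball t R) h"
    and B: "open B" "connected B" and r: "0 < r" "r < R"
    and nz: "\<And>z w. z \<in> B \<Longrightarrow> w \<in> sphere t r \<Longrightarrow> f z w \<noteq> 0"
    and M: "\<And>z w. z \<in> B \<Longrightarrow> w \<in> ball t R \<Longrightarrow> norm (h z w) < M"
  shows "line_holomorphic_on (\<lambda>z. \<Prod>p\<in>zeros_in (f z) t r. h z p ^ zmult (f z) p) B"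
proof (cases "B = {}")
  case True
  then show ?thesis by (auto simp: line_holomorphic_on_def holomorphic_on_def)
next
  case False
  then obtain z0 where "z0 \<in> B" by blast
  then have M0: "M > 0" using M[of z0 t] r by (smt (verit) centre_in_ball norm_ge_zero)
  obtain n where n: "\<And>z. z \<in> B \<Longrightarrow> (\<Sum>q\<in>zeros_in (f z) t r. zmult (f z) q) = n"
    using zero_count_constant[OF f B r nz] by blast
  have fin: "finite (zeros_in (f z) t r)" if "z \<in> B" for z
    using finite_zeros_in[OF param_holomorphicD(2)[OF f that] r nz[OF that]] .
  \<comment> \<open>These points have modulus \<open>M\<close>, which exceeds every |h|, so 1 + h/s
    stays in the right half-plane, where \<open>Ln\<close> is holomorphic. There are n + 1 of them
    because the product is a polynomial in s of degree at most n and the averaging needs more nodes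
    than the degree.\<close>
  let ?s = "\<lambda>j. of_real M * cis (2 * pi * real j / real (Suc n))"
  have ns: "norm (?s j) = M" for j using M0 by (simp add: norm_mult)
  then have s0: "?s j \<noteq> 0" for j using M0 by (metis norm_zero less_irrefl)
  have lt: "norm (h z w / ?s j) < 1" if "z \<in> B" "w \<in> ball t R" for z w j
    using M[OF that] M0 ns by (simp add: norm_divide del: norm_mult)
  have small: "1 + h z w / ?s j \<notin> \<real>\<^sub>\<le>\<^sub>0" if "z \<in> B" "w \<in> ball t R" for z w j
  proof -
    have "\<bar>Re (h z w / ?s j)\<bar> < 1" using lt[OF that] abs_Re_le_cmod le_less_trans by blast
    then have "Re (1 + h z w / ?s j) > 0" by simp
    then show ?thesis using complex_nonpos_Reals_iff by force
  qed
  let ?R = "\<lambda>j z. ?s j ^ n * exp (\<Sum>p\<in>zeros_in (f z) t r. of_nat (zmult (f z) p) * Ln (1 + h z p / ?s j))"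
  have R: "line_holomorphic_on (?R j) B" for j
  proof -
    have "param_holomorphic B (ball t R) (\<lambda>z y. (\<lambda>x. Ln (1 + x / ?s j)) (h z y))"
    proof (rule param_holomorphic_compose[OF h])
      show "(\<lambda>x. Ln (1 + x / ?s j)) holomorphic_on {x. 1 + x / ?s j \<notin> \<real>\<^sub>\<le>\<^sub>0}"
        by (rule holomorphic_intros | use s0 in force)+
    qed (use small in auto)
    from zero_sum_line_holomorphic[OF f this B(1) r nz]
    have "line_holomorphic_on (\<lambda>z. \<Sum>p\<in>zeros_in (f z) t r. of_nat (zmult (f z) p) * Ln (1 + h z p / ?s j)) B"
      by simp
    then have "line_holomorphic_on (\<lambda>z. exp (\<Sum>p\<in>zeros_in (f z) t r. of_nat (zmult (f z) p) * Ln (1 + h z p / ?s j))) B"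
      by (rule line_holomorphic_compose[where S=UNIV]) (auto intro!: holomorphic_intros)
    then show ?thesis by (intro line_holomorphic_mult line_holomorphic_const)
  qed
  have eq: "?R j z = (\<Prod>p\<in>zeros_in (f z) t r. (?s j + h z p) ^ zmult (f z) p)" if z: "z \<in> B" for z j
  proof -
    have "exp (\<Sum>p\<in>zeros_in (f z) t r. of_nat (zmult (f z) p) * Ln (1 + h z p / ?s j))
       = (\<Prod>p\<in>zeros_in (f z) t r. exp (of_nat (zmult (f z) p) * Ln (1 + h z p / ?s j)))"
      by (rule exp_sum[OF fin[OF z]])
    also have "\<dots> = (\<Prod>p\<in>zeros_in (f z) t r. (1 + h z p / ?s j) ^ zmult (f z) p)"
    proof (rule prod.cong[OF refl])
      fix p assume "p \<in> zeros_in (f z) t r"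
      then have "p \<in> ball t R" using r by (auto simp: zeros_in_def)
      then have "1 + h z p / ?s j \<noteq> 0" using small[OF z, of p j] by force
      then show "exp (of_nat (zmult (f z) p) * Ln (1 + h z p / ?s j)) = (1 + h z p / ?s j) ^ zmult (f z) p"
        by (simp add: exp_of_nat_mult)
    qed
    finally have 1: "?R j z = ?s j ^ n * (\<Prod>p\<in>zeros_in (f z) t r. (1 + h z p / ?s j) ^ zmult (f z) p)" by simp
    have "?s j ^ n = (\<Prod>p\<in>zeros_in (f z) t r. ?s j ^ zmult (f z) p)"
      unfolding n[OF z, symmetric] by (rule power_sum)
    then have "?R j z = (\<Prod>p\<in>zeros_in (f z) t r. (?s j * (1 + h z p / ?s j)) ^ zmult (f z) p)"
      unfolding 1 by (simp only: prod.distrib[symmetric] power_mult_distrib)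
    moreover have "?s j * (1 + h z p / ?s j) = ?s j + h z p" for p
      using s0[of j] by (simp add: distrib_left del: mult_eq_0_iff)
    ultimately show ?thesis by (simp only:)
  qed
  have "line_holomorphic_on (\<lambda>z. 1 / of_nat (Suc n) * (\<Sum>j<Suc n. ?R j z)) B"
    by (intro line_holomorphic_mult line_holomorphic_const line_holomorphic_sum R)
  then show ?thesis
  proof (rule line_holomorphic_on_cong[THEN iffD1, rotated])
    fix z assume z: "z \<in> B"
    obtain q where q: "degree q \<le> n" "\<And>s. poly q s = (\<Prod>p\<in>zeros_in (f z) t r. (s + h z p) ^ zmult (f z) p)"
      using poly_prod_shift[OF fin[OF z], of "zmult (f z)" "h z"] n[OF z] by auto
    have "(\<Sum>j<Suc n. ?R j z) = (\<Sum>j<Suc n. poly q (?s j))"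
      by (rule sum.cong[OF refl]) (simp only: eq[OF z] q(2))
    also have "\<dots> = of_nat (Suc n) * poly q 0"
      using q(1) by (intro poly_mean_roots_of_unity) simp
    finally show "1 / of_nat (Suc n) * (\<Sum>j<Suc n. ?R j z) = (\<Prod>p\<in>zeros_in (f z) t r. h z p ^ zmult (f z) p)"
      using q(2)[of 0] by (simp del: of_nat_Suc lessThan_Suc sum.lessThan_Suc)
  qed
qed

section \<open>Polynomial functions\<close>

text \<open>Functions instead of coefficient families: substitution and products then need no
  bookkeeping. \<open>polyfun_iff_eval_poly\<close> identifies them with the functions
  \<open>eval_poly P\<close>.\<close>

inductive polyfun :: "(complex^'n \<Rightarrow> complex) \<Rightarrow> bool" where
  const: "polyfun (\<lambda>z. c)"
| coord: "polyfun (\<lambda>z. z $ i)"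
| add: "polyfun f \<Longrightarrow> polyfun g \<Longrightarrow> polyfun (\<lambda>z. f z + g z)"
| mult: "polyfun f \<Longrightarrow> polyfun g \<Longrightarrow> polyfun (\<lambda>z. f z * g z)"

lemma polyfun_sum: "(\<And>i. i \<in> I \<Longrightarrow> polyfun (f i)) \<Longrightarrow> polyfun (\<lambda>z. \<Sum>i\<in>I. f i z)"
  by (induction I rule: infinite_finite_induct) (auto intro: polyfun.intros)

lemma polyfun_prod: "(\<And>i. i \<in> I \<Longrightarrow> polyfun (f i)) \<Longrightarrow> polyfun (\<lambda>z. \<Prod>i\<in>I. f i z)"
  by (induction I rule: infinite_finite_induct) (auto intro: polyfun.intros)

lemma polyfun_power: "polyfun f \<Longrightarrow> polyfun (\<lambda>z. f z ^ n)"
  by (induction n) (auto intro: polyfun.intros)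

lemma polyfun_compose:
  fixes \<phi> :: "complex^'n \<Rightarrow> complex^'m"
  assumes "polyfun P" "\<And>i. polyfun (\<lambda>z. \<phi> z $ i)"
  shows "polyfun (\<lambda>z. P (\<phi> z))"
  using assms(1) by induction (auto intro: polyfun.intros assms(2))

section \<open>Polynomial functions versus coefficient families\<close>

lemma eval_poly_superset:
  assumes "finite S" "Poly_Mapping.keys P \<subseteq> S"
  shows "eval_poly P z = (\<Sum>m\<in>S. Poly_Mapping.lookup P m * (\<Prod>i\<in>UNIV. z $ i ^ Poly_Mapping.lookup m i))"
  unfolding eval_poly_def by (rule sum.mono_neutral_left) (use assms in \<open>auto simp: in_keys_iff\<close>)

lemma eval_poly_add: "eval_poly (P + Q) z = eval_poly P z + eval_poly Q z"
proof -
  let ?S = "Poly_Mapping.keys P \<union> Poly_Mapping.keys Q"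
  have "Poly_Mapping.keys (P + Q) \<subseteq> ?S" by (rule Poly_Mapping.keys_add)
  then show ?thesis
    by (simp add: eval_poly_superset[where S="?S"] lookup_add distrib_right sum.distrib)
qed

lemma eval_poly_zero: "eval_poly 0 z = 0"
  by (simp add: eval_poly_def)

lemma eval_poly_sum: "eval_poly (\<Sum>i\<in>I. P i) z = (\<Sum>i\<in>I. eval_poly (P i) z)"
  by (induction I rule: infinite_finite_induct) (simp_all add: eval_poly_add eval_poly_zero)

lemma eval_poly_single:
  "eval_poly (Poly_Mapping.single m c) z = c * (\<Prod>i\<in>UNIV. z $ i ^ Poly_Mapping.lookup m i)"
  by (subst eval_poly_superset[where S="{m}"]) auto

lemma eval_poly_mult: "\<exists>R. \<forall>z. eval_poly R z = eval_poly P z * eval_poly Q z"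
proof -
  let ?R = "\<Sum>m\<in>Poly_Mapping.keys P. \<Sum>m'\<in>Poly_Mapping.keys Q.
     Poly_Mapping.single (m + m') (Poly_Mapping.lookup P m * Poly_Mapping.lookup Q m')"
  have "eval_poly ?R z = eval_poly P z * eval_poly Q z" for z
    unfolding eval_poly_sum eval_poly_single
    by (simp add: eval_poly_def sum_product lookup_add power_add prod.distrib mult_ac)
  then show ?thesis by blast
qed

lemma polyfun_iff_eval_poly: "polyfun f \<longleftrightarrow> (\<exists>P. f = eval_poly P)"
proof
  assume "polyfun f"
  then show "\<exists>P. f = eval_poly P"
  proof induction
    case (const c)
    have "(\<lambda>z::complex^'a. c) = eval_poly (Poly_Mapping.single 0 c)" by (auto simp: eval_poly_single)
    then show ?case by blast
  next
    case (coord i)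
    have "(\<Prod>j\<in>UNIV. z $ j ^ Poly_Mapping.lookup (Poly_Mapping.single i (1::nat)) j) = z $ i" for z :: "complex^'a"
    proof -
      have "z $ j ^ Poly_Mapping.lookup (Poly_Mapping.single i (1::nat)) j = (if j = i then z $ i else 1)" for j
        by (auto simp: lookup_single when_def)
      then show ?thesis by (simp add: prod.delta)
    qed
    then have "(\<lambda>z::complex^'a. z $ i) = eval_poly (Poly_Mapping.single (Poly_Mapping.single i 1) 1)"
      by (auto simp: eval_poly_single)
    then show ?case by blast
  next
    case (add f g)
    then obtain P Q where "f = eval_poly P" "g = eval_poly Q" by blast
    then have "(\<lambda>z. f z + g z) = eval_poly (P + Q)" by (auto simp: eval_poly_add)
    then show ?case by blast
  next
    case (mult f g)
    then obtain P Q where "f = eval_poly P" "g = eval_poly Q" by blast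
    moreover obtain R where "\<forall>z. eval_poly R z = eval_poly P z * eval_poly Q z" using eval_poly_mult by blast
    ultimately have "(\<lambda>z. f z * g z) = eval_poly R" by auto
    then show ?case by blast
  qed
next
  assume "\<exists>P. f = eval_poly P"
  then obtain P where f: "f = (\<lambda>z. eval_poly P z)" by auto
  show "polyfun f" unfolding f eval_poly_def
    by (intro polyfun_sum polyfun.mult polyfun_prod polyfun_power polyfun.coord polyfun.const)
qed

text \<open>Enlarging the family to all polynomials vanishing on X reduces algebraicity to
  separating one outside point at a time; both directions of the theorem use it in this
  form.\<close>

lemma algebraic_set_iff_polyfun:
  "algebraic_set X \<longleftrightarrow> (\<forall>p. p \<notin> X \<longrightarrow> (\<exists>P. polyfun P \<and> (\<forall>x\<in>X. P x = 0) \<and> P p \<noteq> 0))"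
proof
  assume "algebraic_set X"
  then show "\<forall>p. p \<notin> X \<longrightarrow> (\<exists>P. polyfun P \<and> (\<forall>x\<in>X. P x = 0) \<and> P p \<noteq> 0)"
    unfolding algebraic_set_def polyfun_iff_eval_poly by blast
next
  assume *: "\<forall>p. p \<notin> X \<longrightarrow> (\<exists>P. polyfun P \<and> (\<forall>x\<in>X. P x = 0) \<and> P p \<noteq> 0)"
  have "X = {z. \<forall>P\<in>{P. \<forall>x\<in>X. eval_poly P x = 0}. eval_poly P z = 0}"
  proof (intro equalityI subsetI)
    fix z assume z: "z \<in> {z. \<forall>P\<in>{P. \<forall>x\<in>X. eval_poly P x = 0}. eval_poly P z = 0}"
    show "z \<in> X"
    proof (rule ccontr)
      assume "z \<notin> X"
      then obtain P where "\<forall>x\<in>X. eval_poly P x = 0" "eval_poly P z \<noteq> 0"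
        using * unfolding polyfun_iff_eval_poly by blast
      then show False using z by blast
    qed
  qed auto
  then show "algebraic_set X" unfolding algebraic_set_def by blast
qed

lemma polyfun_line_holomorphic: "polyfun P \<Longrightarrow> line_holomorphic_on P U"
proof (induction rule: polyfun.induct)
  case (coord i)
  show ?case
    by (rule line_holomorphic_onI) (auto intro!: continuous_intros holomorphic_intros)
qed (auto intro: line_holomorphic_add line_holomorphic_mult)

lemma polyfun_continuous: "polyfun P \<Longrightarrow> continuous_on S P"
  using line_holomorphic_onD(1) polyfun_line_holomorphic by blast

text \<open>Restriction to a family of lines, as a polynomial in the line parameter whose
  coefficients are polynomial in z and whose degree is uniformly bounded. With a = 0 it yields
  homogeneous parts, with constant b directional derivatives.\<close>

lemma polyfun_expand:
  fixes a b :: "complex^'m \<Rightarrow> complex^'n"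
  assumes "polyfun P" and a: "\<And>i. polyfun (\<lambda>z. a z $ i)" and b: "\<And>i. polyfun (\<lambda>z. b z $ i)"
  shows "\<exists>q D. (\<forall>z x. P (a z + x *s b z) = poly (q z) x) \<and> (\<forall>k. polyfun (\<lambda>z. coeff (q z) k)) \<and>
    (\<forall>z. degree (q z) \<le> D)"
  using assms(1)
proof induction
  case (const c)
  have "polyfun (\<lambda>z. coeff [:c:] k)" for k by (rule polyfun.const)
  then show ?case by (intro exI[of _ "\<lambda>z. [:c:]"] exI[of _ 0]) auto
next
  case (coord i)
  have "polyfun (\<lambda>z. coeff [:a z $ i, b z $ i:] k)" for k
  proof -
    consider "k = 0" | "k = 1" | k' where "k = Suc (Suc k')" by (metis One_nat_def not0_implies_Suc)
    then show ?thesis by cases (simp_all add: a b polyfun.const)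
  qed
  then show ?case by (intro exI[of _ "\<lambda>z. [:a z $ i, b z $ i:]"] exI[of _ 1]) auto
next
  case (add f g)
  then obtain q D q' D' where "\<forall>z x. f (a z + x *s b z) = poly (q z) x" "\<forall>k. polyfun (\<lambda>z. coeff (q z) k)"
    "\<forall>z. degree (q z) \<le> D" "\<forall>z x. g (a z + x *s b z) = poly (q' z) x" "\<forall>k. polyfun (\<lambda>z. coeff (q' z) k)"
    "\<forall>z. degree (q' z) \<le> D'" by blast
  then show ?case
    by (intro exI[of _ "\<lambda>z. q z + q' z"] exI[of _ "max D D'"])
      (auto intro!: polyfun.add degree_add_le intro: order_trans[OF _ max.cobounded1] order_trans[OF _ max.cobounded2])
next
  case (mult f g)
  then obtain q D q' D' where "\<forall>z x. f (a z + x *s b z) = poly (q z) x" "\<forall>k. polyfun (\<lambda>z. coeff (q z) k)"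
    "\<forall>z. degree (q z) \<le> D" "\<forall>z x. g (a z + x *s b z) = poly (q' z) x" "\<forall>k. polyfun (\<lambda>z. coeff (q' z) k)"
    "\<forall>z. degree (q' z) \<le> D'" by blast
  then show ?case
    by (intro exI[of _ "\<lambda>z. q z * q' z"] exI[of _ "D + D'"])
      (auto simp: coeff_mult intro!: polyfun_sum polyfun.mult order_trans[OF degree_mult_le] add_mono)
qed

text \<open>Both bounds are proved in one induction because the Lipschitz constant of a product
  involves the sup bounds of its factors.\<close>

lemma polyfun_lipschitz:
  assumes "polyfun P"
  shows "\<exists>K\<ge>0. \<forall>x y. norm x \<le> R \<longrightarrow> norm y \<le> R \<longrightarrow>
     norm (P x) \<le> K \<and> norm (P x - P y) \<le> K * norm (x - y)"
  using assms
proof induction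
  case (const c)
  show ?case by (intro exI[of _ "norm c"]) auto
next
  case (coord i)
  have 1: "norm (x $ i) \<le> norm x" "norm (x $ i - y $ i) \<le> norm (x - y)" for x y :: "complex^'a"
    using Finite_Cartesian_Product.norm_nth_le[of x i] Finite_Cartesian_Product.norm_nth_le[of "x - y" i] by simp_all
  have 2: "norm x \<le> max 1 R" if "norm x \<le> R" for x :: "complex^'a" using that by simp
  have 3: "norm (x - y) \<le> max 1 R * norm (x - y)" for x y :: "complex^'a"
    using mult_right_mono[of 1 "max 1 R" "norm (x - y)"] by simp
  show ?case
    by (intro exI[of _ "max 1 R"] conjI allI impI)
      (auto intro: order_trans[OF 1(1)] order_trans[OF 1(2)] simp: 2 3)
next
  case (add f g)
  then obtain K L where K: "K \<ge> 0" "\<And>x y. norm x \<le> R \<Longrightarrow> norm y \<le> R \<Longrightarrow> norm (f x) \<le> K \<and> norm (f x - f y) \<le> K * norm (x - y)"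
    and L: "L \<ge> 0" "\<And>x y. norm x \<le> R \<Longrightarrow> norm y \<le> R \<Longrightarrow> norm (g x) \<le> L \<and> norm (g x - g y) \<le> L * norm (x - y)"
    by metis
  show ?case
  proof (intro exI[of _ "K + L"] conjI allI impI)
    fix x y :: "complex^'a" assume xy: "norm x \<le> R" "norm y \<le> R"
    show "norm (f x + g x) \<le> K + L" using K(2)[OF xy] L(2)[OF xy] norm_triangle_mono by blast
    have "norm (f x + g x - (f y + g y)) \<le> norm (f x - f y) + norm (g x - g y)"
      by (metis add_diff_add norm_triangle_ineq)
    then show "norm (f x + g x - (f y + g y)) \<le> (K + L) * norm (x - y)"
      using K(2)[OF xy] L(2)[OF xy] by (simp add: distrib_right)
  qed (use K L in auto)
next
  case (mult f g)
  then obtain K L where K: "K \<ge> 0" "\<And>x y. norm x \<le> R \<Longrightarrow> norm y \<le> R \<Longrightarrow> norm (f x) \<le> K \<and> norm (f x - f y) \<le> K * norm (x - y)"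
    and L: "L \<ge> 0" "\<And>x y. norm x \<le> R \<Longrightarrow> norm y \<le> R \<Longrightarrow> norm (g x) \<le> L \<and> norm (g x - g y) \<le> L * norm (x - y)"
    by metis
  show ?case
  proof (intro exI[of _ "2 * K * L"] conjI allI impI)
    fix x y :: "complex^'a" assume xy: "norm x \<le> R" "norm y \<le> R"
    have a: "norm (f x * g x) \<le> K * L"
      unfolding norm_mult using K(2)[OF xy] L(2)[OF xy] K(1) by (intro mult_mono) auto
    moreover have "0 \<le> K * L" using K L by simp
    ultimately show "norm (f x * g x) \<le> 2 * K * L" by linarith
    have "f x * g x - f y * g y = f x * (g x - g y) + (f x - f y) * g y" by (simp add: algebra_simps)
    then have "norm (f x * g x - f y * g y) \<le> norm (f x) * norm (g x - g y) + norm (f x - f y) * norm (g y)"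
      by (metis norm_mult norm_triangle_ineq)
    also have "\<dots> \<le> K * (L * norm (x - y)) + (K * norm (x - y)) * L"
      using K(2)[OF xy] L(2)[OF xy] L(2)[OF xy(2) xy(2)] K(1) L(1) by (intro add_mono mult_mono) auto
    finally show "norm (f x * g x - f y * g y) \<le> 2 * K * L * norm (x - y)" by (simp add: algebra_simps)
  qed (use K L in auto)
qed

lemma polyfun_growth:
  assumes "polyfun P" shows "\<exists>K N. K \<ge> 0 \<and> (\<forall>z. norm (P z) \<le> K * (1 + norm z) ^ N)"
  using assms
proof induction
  case (const c)
  show ?case by (intro exI[of _ "norm c"] exI[of _ 0]) auto
next
  case (coord i)
  have "norm (z $ i) \<le> 1 * (1 + norm z) ^ 1" for z :: "complex^'a"
    using Finite_Cartesian_Product.norm_nth_le[of z i] by simp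
  then show ?case by (intro exI[of _ 1] exI[of _ "1::nat"]) simp
next
  case (add f g)
  then obtain K N L M where K: "K \<ge> 0" "\<And>z. norm (f z) \<le> K * (1 + norm z) ^ N"
    and L: "L \<ge> 0" "\<And>z. norm (g z) \<le> L * (1 + norm z) ^ M" by metis
  have "norm (f z + g z) \<le> (K + L) * (1 + norm z) ^ (N + M)" for z
  proof -
    have "norm (f z) \<le> K * (1 + norm z) ^ (N + M)"
      by (rule order_trans[OF K(2)]) (use K(1) in \<open>intro mult_left_mono power_increasing, auto\<close>)
    moreover have "norm (g z) \<le> L * (1 + norm z) ^ (N + M)"
      by (rule order_trans[OF L(2)]) (use L(1) in \<open>intro mult_left_mono power_increasing, auto\<close>)
    ultimately show ?thesis using norm_triangle_ineq[of "f z" "g z"] by (simp add: distrib_right)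
  qed
  then show ?case using K(1) L(1) by (intro exI[of _ "K + L"] exI[of _ "N + M"]) auto
next
  case (mult f g)
  then obtain K N L M where K: "K \<ge> 0" "\<And>z. norm (f z) \<le> K * (1 + norm z) ^ N"
    and L: "L \<ge> 0" "\<And>z. norm (g z) \<le> L * (1 + norm z) ^ M" by metis
  have "norm (f z * g z) \<le> (K * L) * (1 + norm z) ^ (N + M)" for z
    using mult_mono[OF K(2) L(2), of z z] K(1) by (simp add: norm_mult power_add mult_ac)
  then show ?case using K(1) L(1) by (intro exI[of _ "K * L"] exI[of _ "N + M"]) auto
qed

section \<open>Growth, homogeneous parts and interpolation\<close>

lemma polynomial_growth_imp_poly:
  assumes "g holomorphic_on UNIV" "\<And>x. norm (g x) \<le> K * (1 + norm x) ^ m" "K \<ge> 0"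
  shows "\<exists>q. degree q \<le> m \<and> (\<forall>x. g x = poly q x)"
proof -
  have "norm (g x) \<le> (K * 2 ^ m) * norm x ^ m" if "1 \<le> norm x" for x
  proof -
    have "(1 + norm x) ^ m \<le> (2 * norm x) ^ m" using that by (intro power_mono) auto
    then have "K * (1 + norm x) ^ m \<le> K * (2 * norm x) ^ m" using assms(3) by (rule mult_left_mono)
    then show ?thesis using assms(2)[of x] by (simp add: power_mult_distrib)
  qed
  from Liouville_polynomial[OF assms(1) this]
  have eq: "g \<xi> = (\<Sum>k\<le>m. (deriv ^^ k) g 0 / fact k * \<xi> ^ k)" for \<xi> .
  let ?q = "\<Sum>k\<le>m. monom ((deriv ^^ k) g 0 / fact k) k"
  have "degree ?q \<le> m" by (intro degree_sum_le) (auto intro: order_trans[OF degree_monom_le])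
  moreover have "g x = poly ?q x" for x by (subst eq) (simp add: poly_sum poly_monom)
  ultimately show ?thesis by blast
qed

text \<open>The k-th homogeneous part is the coefficient of x^k in P(x z). Comparing the polynomials
  x -> P(x c z) and x -> P(x z) gives the homogeneity.\<close>

lemma polyfun_homogeneous:
  assumes "polyfun (P :: complex^'n \<Rightarrow> complex)"
  shows "\<exists>D T. (\<forall>k. polyfun (T k)) \<and> (\<forall>k c z. T k (c *s z) = c ^ k * T k z) \<and> (\<forall>z. P z = (\<Sum>k\<le>D. T k z)) \<and>
    (\<forall>k>D. \<forall>z. T k z = 0)"
proof -
  obtain q D where q: "\<And>z x. P (0 + x *s z) = poly (q z) x" "\<And>k. polyfun (\<lambda>z. coeff (q z) k)"
      "\<And>z. degree (q z) \<le> D"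
  proof -
    have 0: "polyfun (\<lambda>z::complex^'n. (0::complex^'n) $ i)" for i by (rule polyfun.const)
    show ?thesis using polyfun_expand[OF assms 0 polyfun.coord] that by blast
  qed
  have "q (c *s z) = q z \<circ>\<^sub>p [:0, c:]" for c z
  proof (rule poly_eq_poly_eq_iff[THEN iffD1])
    show "poly (q (c *s z)) = poly (q z \<circ>\<^sub>p [:0, c:])"
    proof
      fix x
      have "poly (q (c *s z)) x = P (0 + (x * c) *s z)"
        using q(1)[of x "c *s z"] by (simp add: vector_smult_assoc)
      then show "poly (q (c *s z)) x = poly (q z \<circ>\<^sub>p [:0, c:]) x"
        unfolding q(1) by (simp add: poly_pcompose mult.commute)
    qed
  qed
  then have "coeff (q (c *s z)) k = c ^ k * coeff (q z) k" for c z k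
    by (simp add: coeff_pcompose_linear)
  moreover have "P z = (\<Sum>k\<le>D. coeff (q z) k)" for z
  proof -
    have "P z = poly (q z) 1" using q(1)[of 1 z] by simp
    also have "\<dots> = (\<Sum>k\<le>D. coeff (q z) k * 1 ^ k)" 
      unfolding poly_altdef by (rule sum.mono_neutral_left) (use q(3)[of z] in \<open>auto simp: coeff_eq_0\<close>)
    finally show ?thesis by simp
  qed
  moreover have "\<forall>k>D. \<forall>z. coeff (q z) k = 0" using q(3) by (meson coeff_eq_0 le_less_trans)
  ultimately show ?thesis using q(2)
    by (intro exI[of _ D] exI[of _ "\<lambda>k z. coeff (q z) k"]) auto
qed

text \<open>P(x)/t^D is the sum of T_k(x/t) t^(k-D), and the terms with k < D tend to zero.\<close>

lemma top_form_limit: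
  fixes T :: "nat \<Rightarrow> complex^'n \<Rightarrow> complex"
  assumes T: "\<And>k. polyfun (T k)" "\<And>k c z. T k (c *s z) = c ^ k * T k z"
    and P: "\<And>z. P z = (\<Sum>k\<le>D. T k z)"
    and t: "filterlim t at_infinity F" and x: "((\<lambda>n. inverse (t n) *s x n) \<longlongrightarrow> c) F"
  shows "((\<lambda>n. P (x n) / t n ^ D) \<longlongrightarrow> T D c) F"
proof -
  have Tl: "((\<lambda>n. T k (inverse (t n) *s x n)) \<longlongrightarrow> T k c) F" for k
    using polyfun_continuous[OF T(1)[of k], of UNIV] x
    by (metis UNIV_I continuous_on_eq_continuous_at isCont_tendsto_compose open_UNIV)
  have inv0: "((\<lambda>n. inverse (t n)) \<longlongrightarrow> 0) F" using t tendsto_inverse_0 filterlim_compose by blast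
  have lim: "((\<lambda>n. \<Sum>k\<le>D. T k (inverse (t n) *s x n) * inverse (t n) ^ (D - k)) \<longlongrightarrow>
      (\<Sum>k\<le>D. T k c * 0 ^ (D - k))) F"
    by (intro tendsto_intros Tl inv0)
  have "(\<Sum>k\<le>D. T k c * 0 ^ (D - k)) = (\<Sum>k\<le>D. if k = D then T D c else 0)"
    by (rule sum.cong) (auto simp: power_0_left)
  then have lim0: "(\<Sum>k\<le>D. T k c * 0 ^ (D - k)) = T D c" by simp
  have "eventually (\<lambda>n. t n \<noteq> 0) F"
    using filterlim_at_infinity_imp_eventually_ne[OF t] .
  then have "eventually (\<lambda>n. (\<Sum>k\<le>D. T k (inverse (t n) *s x n) * inverse (t n) ^ (D - k)) = P (x n) / t n ^ D) F"
  proof eventually_elim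
    case (elim n)
    have "T k (inverse (t n) *s x n) * inverse (t n) ^ (D - k) = T k (x n) / t n ^ D" if "k \<le> D" for k
      using elim that by (simp add: T(2) power_diff field_simps power_inverse)
    then show ?case by (simp add: P sum_divide_distrib)
  qed
  with lim show ?thesis unfolding lim0 by (rule Lim_transform_eventually)
qed

text \<open>On each complex line through 0 the growth bound forces degree at most m, so parts beyond
  m vanish identically. The top index is thereby prescribed as the growth exponent; that this top
  form is nonzero has to be shown separately.\<close>

lemma polyfun_homogeneous_growth:
  assumes P: "polyfun (P :: complex^'n \<Rightarrow> complex)" and gr: "\<And>z. norm (P z) \<le> K * (1 + norm z) ^ m" "K \<ge> 0"
  shows "\<exists>T. (\<forall>k. polyfun (T k)) \<and> (\<forall>k c z. T k (c *s z) = c ^ k * T k z) \<and> (\<forall>z. P z = (\<Sum>k\<le>m. T k z))"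
proof -
  obtain D T where T: "\<And>k. polyfun (T k)" "\<And>k c z. T k (c *s z) = c ^ k * T k z"
    "\<And>z. P z = (\<Sum>k\<le>D. T k z)" "\<And>k z. k > D \<Longrightarrow> T k z = 0"
    using polyfun_homogeneous[OF P] by metis
  have big: "T k z = 0" if "k > m" for k z
  proof -
    let ?q = "\<Sum>k\<le>D. monom (T k z) k"
    have q: "P (y *s z) = poly ?q y" for y
      by (simp add: T poly_sum poly_monom mult.commute)
    have "\<exists>q. degree q \<le> m \<and> (\<forall>x. poly ?q x = poly q x)"
    proof (rule polynomial_growth_imp_poly)
      fix x :: complex
      have "1 + norm (x *s z) \<le> (1 + norm z) * (1 + norm x)"
        by (simp add: norm_smult algebra_simps)
      then have "(1 + norm (x *s z)) ^ m \<le> ((1 + norm z) * (1 + norm x)) ^ m"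
        by (rule power_mono) (simp add: add_nonneg_nonneg)
      then have "K * (1 + norm (x *s z)) ^ m \<le> K * ((1 + norm z) * (1 + norm x)) ^ m"
        using gr(2) by (rule mult_left_mono)
      then show "norm (poly ?q x) \<le> (K * (1 + norm z) ^ m) * (1 + norm x) ^ m"
        using gr(1)[of "x *s z"] by (simp only: q power_mult_distrib mult.assoc)
    qed (use gr in \<open>auto intro!: holomorphic_intros\<close>)
    then obtain q where "degree q \<le> m" "poly ?q = poly q" by blast
    then have "degree ?q \<le> m" by (metis poly_eq_poly_eq_iff)
    then have "coeff ?q k = 0" using that by (simp add: coeff_eq_0)
    moreover have "coeff ?q k = (if k \<le> D then T k z else 0)"
      by (simp add: coeff_sum if_distrib sum.delta' cong: if_cong)
    ultimately show ?thesis using T(4)[of k z] by (cases "k \<le> D") auto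
  qed
  have "P z = (\<Sum>k\<le>m. T k z)" for z
  proof -
    have "P z = (\<Sum>k\<le>max D m. T k z)"
      unfolding T(3) by (rule sum.mono_neutral_left) (auto simp: T(4))
    also have "\<dots> = (\<Sum>k\<le>m. T k z)" by (rule sum.mono_neutral_right) (auto simp: big)
    finally show ?thesis .
  qed
  then show ?thesis using T by blast
qed

text \<open>The basis polynomials \<open>L\<close> are chosen before \<open>q\<close>, so they can
  multiply values that depend on further variables.\<close>

lemma lagrange_interpolation:
  fixes c :: "nat \<Rightarrow> complex"
  assumes inj: "inj_on c {..m}"
  shows "\<exists>L. \<forall>q. degree q \<le> m \<longrightarrow> q = (\<Sum>a\<le>m. smult (poly q (c a)) (L a))"
proof -
  define L where "L a = (\<Prod>b\<in>{..m}-{a}. smult (1 / (c a - c b)) [:- c b, 1:])" for a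
  have deg: "degree (L a) \<le> m" if "a \<le> m" for a
  proof -
    have "degree (L a) \<le> (\<Sum>b\<in>{..m}-{a}. degree (smult (1 / (c a - c b)) [:- c b, 1:]))"
      unfolding L_def using degree_prod_sum_le[of "{..m}-{a}" "\<lambda>b. smult (1 / (c a - c b)) [:- c b, 1:]"] by (simp only: o_def) simp
    also have "\<dots> \<le> (\<Sum>b\<in>{..m}-{a}. 1)" by (intro sum_mono order_trans[OF degree_smult_le]) simp
    also have "\<dots> = m" using that by simp
    finally show ?thesis .
  qed
  have val: "poly (L a) (c b) = (if a = b then 1 else 0)" if "a \<le> m" "b \<le> m" for a b
  proof (cases "a = b")
    case True
    have "poly (L a) (c a) = (\<Prod>b\<in>{..m}-{a}. (1 / (c a - c b)) * (c a - c b))"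
      unfolding L_def poly_prod poly_smult by simp
    also have "\<dots> = (\<Prod>b\<in>{..m}-{a}. 1)"
      using inj that by (intro prod.cong refl) (auto simp: inj_on_def)
    finally show ?thesis using True by simp
  next
    case False
    then show ?thesis using that by (auto simp: L_def poly_prod intro!: prod_zero)
  qed
  have "q = (\<Sum>a\<le>m. smult (poly q (c a)) (L a))" if q: "degree q \<le> m" for q
  proof (rule ccontr)
    let ?d = "q - (\<Sum>a\<le>m. smult (poly q (c a)) (L a))"
    assume "\<not> ?thesis"
    then have "?d \<noteq> 0" by simp
    have "degree ?d \<le> m"
      by (intro degree_diff_le q degree_sum_le order_trans[OF degree_smult_le] deg) simp_all
    moreover have "poly ?d (c b) = 0" if "b \<in> {..m}" for b
    proof -
      have "(\<Sum>a\<le>m. poly q (c a) * poly (L a) (c b)) = (\<Sum>a\<le>m. if a = b then poly q (c a) else 0)"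
        using that by (intro sum.cong) (auto simp: val)
      then show ?thesis using that by (simp add: poly_sum)
    qed
    then have "c ` {..m} \<subseteq> {x. poly ?d x = 0}" by blast
    then have "card (c ` {..m}) \<le> card {x. poly ?d x = 0}"
      by (rule card_mono[OF poly_roots_finite[OF \<open>?d \<noteq> 0\<close>]])
    then have "Suc m \<le> degree ?d" using inj card_poly_roots_bound[OF \<open>?d \<noteq> 0\<close>] by (simp add: card_image)
    ultimately show False by simp
  qed
  then show ?thesis by blast
qed

text \<open>Interpolation in one coordinate after the other shows that \<open>E\<close> is polynomial on a cube;
  lines through the centre of the cube carry this over to the whole of \<open>G\<close>.\<close>

lemma polyfun_of_lines:
  fixes E :: "complex^'n \<Rightarrow> complex"
  assumes G: "open G" "z1 \<in> G"
    and lines: "\<And>z u. z \<in> G \<Longrightarrow> \<exists>q. degree q \<le> m \<and> (\<forall>y. z + y *s u \<in> G \<longrightarrow> E (z + y *s u) = poly q y)"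
  shows "\<exists>P. polyfun P \<and> (\<forall>z\<in>G. E z = P z)"
proof -
  obtain e where e: "e > 0" "ball z1 e \<subseteq> G" using G open_contains_ball by blast
  \<comment> \<open>The norm is at most the sum of the n coordinate norms, so the polydisc
    \<open>Q\<close> of radius \<delta> stays within e/2 of its centre.\<close>
  define \<delta> where "\<delta> = e / (2 * real CARD('n))"
  have \<delta>: "\<delta> > 0" using e by (simp add: \<delta>_def)
  define Q where "Q = {z :: complex^'n. \<forall>i. norm (z $ i - z1 $ i) < \<delta>}"
  have QG: "Q \<subseteq> G"
  proof
    fix z assume z: "z \<in> Q"
    have "norm (z - z1) \<le> (\<Sum>i\<in>UNIV. norm ((z - z1) $ i))" by (simp add: norm_vec_def L2_set_le_sum)
    also have "\<dots> \<le> (\<Sum>i\<in>(UNIV::'n set). \<delta>)" using z by (intro sum_mono) (auto simp: Q_def less_imp_le)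
    also have "\<dots> < e" using e by (simp add: \<delta>_def)
    finally have "z \<in> ball z1 e" by (simp add: dist_norm norm_minus_commute)
    then show "z \<in> G" using e by blast
  qed
  \<comment> \<open>m + 1 distinct nodes per coordinate, all inside the polydisc, which determine a
    polynomial of degree at most m.\<close>
  define c where "c i a = z1 $ i + of_real (\<delta> / (real a + 2))" for i a
  have inj: "inj_on (c i) {..m}" for i using \<delta> by (auto simp: c_def inj_on_def field_simps)
  have cQ: "norm (c i a - z1 $ i) < \<delta>" for i a
  proof -
    have "norm (c i a - z1 $ i) = \<delta> / (real a + 2)" using \<delta> unfolding c_def add_diff_cancel_left' norm_of_real by simp
    also have "\<dots> < \<delta>" using \<delta> by (simp add: divide_less_eq)
    finally show ?thesis .
  qed
  define upd where "upd z j s = (\<chi> i. if i = j then s else z $ i)" for z :: "complex^'n" and j s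
  \<comment> \<open>Induction on the set \<open>I\<close> of coordinates that are free to move; the
    others are frozen at the values of \<open>w\<close>.\<close>
  have main: "finite I \<Longrightarrow> w \<in> Q \<Longrightarrow> \<exists>P. polyfun P \<and> (\<forall>z\<in>Q. (\<forall>i. i \<notin> I \<longrightarrow> z $ i = w $ i) \<longrightarrow> E z = P z)" for I w
  proof (induction I arbitrary: w rule: finite_induct)
    case empty
    then show ?case
      by (intro exI[of _ "\<lambda>z. E w"]) (auto intro: polyfun.const simp: vec_eq_iff[symmetric])
  next
    case (insert j I)
    have "upd w j (c j a) \<in> Q" for a using insert.prems cQ by (auto simp: Q_def upd_def)
    from insert.IH[OF this] obtain P where P: "\<And>a. polyfun (P a)"
      "\<And>a z. z \<in> Q \<Longrightarrow> (\<forall>i. i \<notin> I \<longrightarrow> z $ i = upd w j (c j a) $ i) \<Longrightarrow> E z = P a z" by metis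
    obtain L where L: "\<And>q. degree q \<le> m \<Longrightarrow> q = (\<Sum>a\<le>m. smult (poly q (c j a)) (L a))"
      using lagrange_interpolation[OF inj] by metis
    let ?P = "\<lambda>z. \<Sum>a\<le>m. P a (upd z j (c j a)) * poly (L a) (z $ j)"
    have "polyfun (\<lambda>z. upd z j s $ i)" for s i
      by (cases "i = j") (auto simp: upd_def intro: polyfun.intros)
    moreover have "polyfun (\<lambda>z. poly (L a) (z $ j))" for a
      unfolding poly_altdef by (intro polyfun_sum polyfun.mult polyfun_power polyfun.const polyfun.coord)
    ultimately have "polyfun ?P"
      by (intro polyfun_sum polyfun.mult polyfun_compose[OF P(1)])
    moreover have "E z = ?P z" if z: "z \<in> Q" "\<forall>i. i \<notin> insert j I \<longrightarrow> z $ i = w $ i" for z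
    proof -
      have zs: "z + y *s axis j 1 = upd z j (z $ j + y)" for y
        by (simp add: vec_eq_iff upd_def axis_def)
      obtain q where q: "degree q \<le> m" "\<And>y. z + y *s axis j 1 \<in> G \<Longrightarrow> E (z + y *s axis j 1) = poly q y"
        using lines[of z "axis j 1"] z QG by blast
      let ?q = "q \<circ>\<^sub>p [:- (z $ j), 1:]"
      have val: "poly ?q s = E (upd z j s)" if "upd z j s \<in> Q" for s
        using q(2)[of "s - z $ j", unfolded zs] that QG by (auto simp: poly_pcompose)
      have uQ: "upd z j (c j a) \<in> Q" for a using z cQ by (auto simp: Q_def upd_def)
      have uz: "upd z j (z $ j) = z" by (simp add: upd_def vec_eq_iff)
      have "degree ?q \<le> m" using q(1) by (simp add: degree_pcompose)
      from L[OF this] have "poly ?q (z $ j) = poly (\<Sum>a\<le>m. smult (poly ?q (c j a)) (L a)) (z $ j)" by simp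
      then have "E z = (\<Sum>a\<le>m. poly ?q (c j a) * poly (L a) (z $ j))"
        using val[of "z $ j"] z(1) by (simp add: uz poly_sum)
      also have "\<dots> = ?P z"
      proof (rule sum.cong[OF refl])
        fix a
        have "E (upd z j (c j a)) = P a (upd z j (c j a))"
          by (rule P(2)[OF uQ]) (use z(2) in \<open>auto simp: upd_def\<close>)
        then show "poly ?q (c j a) * poly (L a) (z $ j) = P a (upd z j (c j a)) * poly (L a) (z $ j)"
          using val[OF uQ] by simp
      qed
      finally show ?thesis .
    qed
    ultimately show ?case by blast
  qed
  have z1Q: "z1 \<in> Q" using \<delta> by (simp add: Q_def)
  obtain P where P: "polyfun P" "\<And>z. z \<in> Q \<Longrightarrow> E z = P z" using main[of UNIV z1] z1Q by auto
  have "E z = P z" if z: "z \<in> G" for z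
  proof -
    let ?u = "z - z1"
    obtain q where q: "\<And>y. z1 + y *s ?u \<in> G \<Longrightarrow> E (z1 + y *s ?u) = poly q y"
      using lines[OF G(2), of ?u] by blast
    obtain p where p: "\<And>h. P (z1 + h *s ?u) = poly p h"
    proof -
      have 0: "polyfun (\<lambda>z::complex^'n. w $ i)" for i and w :: "complex^'n" by (rule polyfun.const)
      show ?thesis using polyfun_expand[OF P(1) 0[of z1] 0[of ?u]] that by blast
    qed
    have "open Q"
    proof -
      have "Q = (\<Inter>i. {z. norm (z $ i - z1 $ i) < \<delta>})" by (auto simp: Q_def)
      then show ?thesis by (auto intro!: open_INT open_Collect_less continuous_intros)
    qed
    from open_line_preimage[OF this, of z1 ?u] obtain d where d: "d > 0" "ball 0 d \<subseteq> {y. z1 + y *s ?u \<in> Q}"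
      using z1Q openE[of "{y. z1 + y *s ?u \<in> Q}" 0] by auto
    \<comment> \<open>A single polynomial \<open>q\<close> represents \<open>E\<close> on the whole
      trace of this line in \<open>G\<close>, so agreement with \<open>P\<close> near
      \<open>z1\<close> carries over to parameter 1 even if that trace is disconnected.\<close>
    have "ball 0 d \<subseteq> {x. poly (q - p) x = 0}" using d(2) q p P(2) QG by fastforce
    moreover have "infinite (ball (0::complex) d)" using d(1) by (simp add: uncountable_ball uncountable_infinite)
    ultimately have "q - p = 0" using poly_roots_finite[of "q - p"] finite_subset by blast
    then show ?thesis using q[of 1] p[of 1] z by simp
  qed
  then show ?thesis using P(1) by blast
qed

text \<open>Liouville on each line. The degree bound m is the same for all lines because 1 + |z +
  xu| <= (1 + |z| + |u|)(1 + |x|).\<close>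

lemma entire_line_growth_polyfun:
  assumes R: "line_holomorphic_on (R :: complex^'n \<Rightarrow> complex) UNIV"
    and gr: "\<And>z. norm (R z) \<le> K * (1 + norm z) ^ m" "K \<ge> 0"
  shows "polyfun R"
proof -
  have "\<exists>P. polyfun P \<and> (\<forall>z\<in>UNIV. R z = P z)"
  proof (rule polyfun_of_lines[where m=m])
    fix z u :: "complex^'n"
    have "\<exists>q. degree q \<le> m \<and> (\<forall>x. R (z + x *s u) = poly q x)"
    proof (rule polynomial_growth_imp_poly)
      show "(\<lambda>x. R (z + x *s u)) holomorphic_on UNIV" using line_holomorphic_onD(2)[OF R] by simp
      fix x
      have "1 + norm (z + x *s u) \<le> (1 + norm z + norm u) * (1 + norm x)"
      proof -
        have "0 \<le> norm x * norm z" by simp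
        moreover have "(1 + norm z + norm u) * (1 + norm x) =
            1 + norm z + norm u + norm x + norm x * norm z + norm x * norm u"
          by (simp add: algebra_simps)
        ultimately show ?thesis
          using norm_triangle_ineq[of z "x *s u", unfolded norm_smult] norm_ge_zero[of u] norm_ge_zero[of x]
          by linarith
      qed
      then have "(1 + norm (z + x *s u)) ^ m \<le> ((1 + norm z + norm u) * (1 + norm x)) ^ m"
        by (rule power_mono) (simp add: add_nonneg_nonneg)
      then have "K * (1 + norm (z + x *s u)) ^ m \<le> K * ((1 + norm z + norm u) * (1 + norm x)) ^ m"
        using gr(2) by (rule mult_left_mono)
      then show "norm (R (z + x *s u)) \<le> (K * (1 + norm z + norm u) ^ m) * (1 + norm x) ^ m"
        using gr(1)[of "z + x *s u"] by (simp only: power_mult_distrib mult.assoc)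
    qed (use gr in auto)
    then show "\<exists>q. degree q \<le> m \<and> (\<forall>x. z + x *s u \<in> UNIV \<longrightarrow> R (z + x *s u) = poly q x)" by auto
  qed auto
  then obtain P where "polyfun P" "R = P" by auto
  then show ?thesis by simp
qed

section \<open>Analytic sets and their projections along a line\<close>

text \<open>The description by equations is put as separation: each point of \<open>U\<close>
  outside \<open>X\<close> is excluded by some function. This suits projections, whose equations are
  produced one omitted point at a time. Points \<open>a\<close> off \<open>X\<close> are included so
  that the neighbourhoods cover the whole space.\<close>

definition locally_analytic :: "(complex^'n) set \<Rightarrow> bool" where
  "locally_analytic X \<longleftrightarrow> closed X \<and> (\<forall>a. \<exists>U. open U \<and> a \<in> U \<and>
     (\<forall>z\<in>U - X. \<exists>f. line_holomorphic_on f U \<and> (\<forall>x\<in>X \<inter> U. f x = 0) \<and> f z \<noteq> 0))"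

lemma closed_analytic_imp_locally_analytic:
  assumes "closed_analytic_set X" shows "locally_analytic X"
  unfolding locally_analytic_def
proof (intro conjI allI)
  show "closed X" using assms by (simp add: closed_analytic_set_def)
  fix a
  show "\<exists>U. open U \<and> a \<in> U \<and> (\<forall>z\<in>U - X. \<exists>f. line_holomorphic_on f U \<and> (\<forall>x\<in>X \<inter> U. f x = 0) \<and> f z \<noteq> 0)"
  proof (cases "a \<in> X")
    case True
    with assms obtain U F where U: "open U" "a \<in> U" "\<forall>f\<in>F. holomorphic_fun_on f U"
      "X \<inter> U = {z \<in> U. \<forall>f\<in>F. f z = 0}"
      unfolding closed_analytic_set_def by blast
    have "\<exists>f. line_holomorphic_on f U \<and> (\<forall>x\<in>X \<inter> U. f x = 0) \<and> f z \<noteq> 0" if z: "z \<in> U - X" for z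
    proof -
      obtain f where "f \<in> F" "f z \<noteq> 0" using z U(4) by blast
      moreover have "\<forall>x\<in>X \<inter> U. f x = 0" using \<open>f \<in> F\<close> U(4) by blast
      ultimately show ?thesis using holomorphic_fun_on_imp_line_holomorphic[OF _ U(1)] U(3) by blast
    qed
    then show ?thesis using U by blast
  next
    case False
    have "\<forall>z\<in>- X - X. \<exists>f. line_holomorphic_on f (- X) \<and> (\<forall>x\<in>X \<inter> - X. f x = 0) \<and> f z \<noteq> 0"
      by (intro ballI exI[of _ "\<lambda>z. 1"]) auto
    then show ?thesis using \<open>closed X\<close> False by (intro exI[of _ "- X"]) auto
  qed
qed

definition fiber :: "(complex^'n) set \<Rightarrow> complex^'n \<Rightarrow> complex^'n \<Rightarrow> complex set" where
  "fiber X v z = {t. z + t *s v \<in> X}"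

text \<open>Properness of the projection along \<open>v\<close> in quantitative form. The linear
  rate makes products over fibers grow polynomially.\<close>

definition fiber_growth :: "(complex^'n) set \<Rightarrow> complex^'n \<Rightarrow> bool" where
  "fiber_growth X v \<longleftrightarrow> (\<exists>K\<ge>0. \<forall>z. \<forall>t\<in>fiber X v z. norm t \<le> K * (1 + norm z))"

lemma fiber_add: "t \<in> fiber X v (z + s *s v) \<longleftrightarrow> t + s \<in> fiber X v z"
  by (simp add: fiber_def vector_sadd_rdistrib add_ac)

text \<open>Upper semicontinuity from properness: parameters outside \<open>W\<close> over points
  tending to \<open>a\<close> would be bounded and accumulate at a parameter over \<open>a\<close>
  outside \<open>W\<close>.\<close>

lemma fiber_upper:
  assumes "closed X" "fiber_growth X v" "open W" "fiber X v a \<subseteq> W"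
  shows "\<exists>\<delta>>0. \<forall>z\<in>ball a \<delta>. fiber X v z \<subseteq> W"
proof (rule ccontr)
  assume neg: "\<not> ?thesis"
  have "\<exists>z t. z \<in> ball a (1 / real (Suc n)) \<and> t \<in> fiber X v z \<and> t \<notin> W" for n
  proof -
    have "1 / real (Suc n) > 0" by simp
    then show ?thesis using neg by (meson subsetI)
  qed
  then obtain z t where zt: "\<And>n. z n \<in> ball a (1 / real (Suc n))" "\<And>n. t n \<in> fiber X v (z n)" "\<And>n. t n \<notin> W"
    by metis
  obtain K where K: "K \<ge> 0" "\<And>z t. t \<in> fiber X v z \<Longrightarrow> norm t \<le> K * (1 + norm z)"
    using assms(2) unfolding fiber_growth_def by blast
  have dz: "dist (z n) a < 1 / real (Suc n)" for n using zt(1)[of n] by (simp add: dist_commute)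
  have "z \<longlonglongrightarrow> a"
    using LIMSEQ_norm_0[of "\<lambda>n. z n - a"] dz by (simp add: dist_norm LIM_zero_iff)
  have "t n \<in> cball 0 (K * (2 + norm a))" for n
  proof -
    have "1 / real (Suc n) \<le> 1" by simp
    then have "norm (z n) \<le> 1 + norm a"
      using dz[of n] norm_triangle_ineq2[of "z n" a] unfolding dist_norm by linarith
    then have "K * (1 + norm (z n)) \<le> K * (2 + norm a)" using K(1) by (intro mult_left_mono) auto
    then show ?thesis using K(2)[OF zt(2)[of n]] by simp
  qed
  then have "\<forall>n. t n \<in> cball 0 (K * (2 + norm a))" by blast
  with compact_cball[of "0::complex" "K * (2 + norm a)"]
  obtain l r where l: "strict_mono (r::nat\<Rightarrow>nat)" "(t \<circ> r) \<longlonglongrightarrow> l"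
    unfolding compact_def by metis
  have zr: "(z \<circ> r) \<longlonglongrightarrow> a" using LIMSEQ_subseq_LIMSEQ[OF \<open>z \<longlonglongrightarrow> a\<close> l(1)] .
  have lim: "(\<lambda>n. (z \<circ> r) n + (t \<circ> r) n *s v) \<longlonglongrightarrow> a + l *s v" by (intro tendsto_intros zr l)
  have "(z \<circ> r) n + (t \<circ> r) n *s v \<in> X" for n using zt(2)[of "r n"] by (simp add: fiber_def)
  from closed_sequentially[OF assms(1) this lim] have "a + l *s v \<in> X" .
  then have "l \<in> W" using assms(4) by (auto simp: fiber_def)
  with l(2) assms(3) have "eventually (\<lambda>n. (t \<circ> r) n \<in> W) sequentially" by (rule topological_tendstoD)
  then show False using zt(3) by (simp add: eventually_sequentially)
qed

lemma fiber_compact: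
  assumes "closed X" "fiber_growth X v"
  shows "compact (fiber X v z)"
proof -
  have "continuous_on UNIV (\<lambda>t. z + t *s v)" by (intro continuous_intros)
  from closed_vimage[OF assms(1) this] have "closed (fiber X v z)" by (simp add: fiber_def vimage_def)
  moreover have "bounded (fiber X v z)"
    using assms(2) unfolding fiber_growth_def bounded_iff by blast
  ultimately show ?thesis by (simp add: compact_eq_bounded_closed)
qed

text \<open>By the identity theorem a limit point of the fiber has a whole disc in the fiber. So the
  limit points form an open and closed subset of the plane that is bounded, hence empty.\<close>

lemma fiber_finite:
  assumes X: "locally_analytic X" "fiber_growth X v"
  shows "finite (fiber X v z)"
proof (rule ccontr)
  assume inf: "infinite (fiber X v z)"
  define D where "D = {t. t islimpt fiber X v z}"
  have cpt: "compact (fiber X v z)" using X fiber_compact unfolding locally_analytic_def by blast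
  have "closed D" unfolding D_def by (rule closed_limpts)
  have DK: "D \<subseteq> fiber X v z" using compact_imp_closed[OF cpt] by (auto simp: D_def closed_limpt)
  have "\<exists>e>0. ball t e \<subseteq> D" if t: "t \<in> D" for t
  proof -
    obtain U where U: "open U" "z + t *s v \<in> U"
      "\<And>w. w \<in> U - X \<Longrightarrow> \<exists>f. line_holomorphic_on f U \<and> (\<forall>x\<in>X \<inter> U. f x = 0) \<and> f w \<noteq> 0"
      using X unfolding locally_analytic_def by metis
    obtain e where e: "e > 0" "ball t e \<subseteq> {y. z + y *s v \<in> U}"
      using openE[OF open_line_preimage[OF U(1), of z v], of t] U(2) by auto
    have sub: "ball t e \<subseteq> fiber X v z"
    proof (rule ccontr)
      assume "\<not> ?thesis"
      then obtain y where y: "y \<in> ball t e" "y \<notin> fiber X v z" by blast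
      then obtain f where f: "line_holomorphic_on f U" "\<And>x. x \<in> X \<inter> U \<Longrightarrow> f x = 0" "f (z + y *s v) \<noteq> 0"
      proof -
        have "z + y *s v \<in> U - X" using y e by (auto simp: fiber_def)
        then show ?thesis using U(3) that by blast
      qed
      have "t islimpt (fiber X v z \<inter> ball t e)"
        using t e(1) unfolding D_def mem_Collect_eq by (metis centre_in_ball eventually_at_in_open' islimpt_Int_eventually open_ball)
      have "f (z + y *s v) = 0"
      proof (rule analytic_continuation[where f="\<lambda>y. f (z + y *s v)" and S="ball t e" and U="fiber X v z \<inter> ball t e"])
        show "(\<lambda>y. f (z + y *s v)) holomorphic_on ball t e"
          using line_holomorphic_onD(2)[OF f(1)] e(2) holomorphic_on_subset by blast
        show "t islimpt fiber X v z \<inter> ball t e" by fact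
        show "f (z + \<sigma> *s v) = 0" if "\<sigma> \<in> fiber X v z \<inter> ball t e" for \<sigma>
          using that e(2) by (intro f(2)) (auto simp: fiber_def)
      qed (use e y in auto)
      then show False using f(3) by blast
    qed
    have "ball t e \<subseteq> D"
    proof
      fix s assume s: "s \<in> ball t e"
      then have "s islimpt ball t e" by (simp add: interior_limit_point)
      then show "s \<in> D" unfolding D_def using sub islimpt_subset by blast
    qed
    then show ?thesis using e by blast
  qed
  then have "open D" using open_contains_ball by blast
  obtain t where "t \<in> D" using inf cpt unfolding D_def compact_eq_Bolzano_Weierstrass by blast
  then have "D = UNIV" using \<open>closed D\<close> \<open>open D\<close> clopen by blast
  then have "bounded (UNIV :: complex set)" using DK cpt compact_imp_bounded by (metis top.extremum_uniqueI)
  then show False by (simp add: not_bounded_UNIV)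
qed

section \<open>Local resultants and analyticity of projections\<close>

lemma nonvanishing_near:
  fixes F :: "'a::metric_space \<Rightarrow> complex \<Rightarrow> complex"
  assumes "compact K" "continuous_on (B \<times> K) (\<lambda>(z,w). F z w)" "open B" "z0 \<in> B" "\<And>w. w \<in> K \<Longrightarrow> F z0 w \<noteq> 0"
  shows "\<exists>\<delta>>0. ball z0 \<delta> \<subseteq> B \<and> (\<forall>z\<in>ball z0 \<delta>. \<forall>w\<in>K. F z w \<noteq> 0)"
proof -
  obtain T where T: "open T" "T \<inter> (B \<times> K) = (\<lambda>(z,w). F z w) -` (- {0}) \<inter> (B \<times> K)"
    using assms(2) unfolding continuous_on_open_invariant by (metis open_Compl closed_singleton)
  have sub: "{z0} \<times> K \<subseteq> T \<inter> B \<times> UNIV" using T(2) assms(4,5) by fastforce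
  have "open (T \<inter> B \<times> UNIV)" using T(1) assms(3) by (auto intro: open_Int open_Times)
  from Elementary_Topology.tube_lemma[OF assms(1) this sub]
  obtain X0 where X0: "z0 \<in> X0" "open X0" "X0 \<times> K \<subseteq> T \<inter> B \<times> UNIV" by blast
  obtain \<delta> where \<delta>: "\<delta> > 0" "ball z0 \<delta> \<subseteq> X0 \<inter> B"
    using openE[of "X0 \<inter> B" z0] X0 assms(3,4) by blast
  have "F z w \<noteq> 0" if "z \<in> ball z0 \<delta>" "w \<in> K" for z w
  proof -
    have "(z, w) \<in> T \<inter> (B \<times> K)" using that \<delta> X0(3) by blast
    then show ?thesis unfolding T(2) by simp
  qed
  then show ?thesis using \<delta> by blast
qed

text \<open>A complex vector space is not a finite union of proper subspaces: f + c g avoids all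
  zeros in question for every c off a finite set.\<close>

lemma span_avoid:
  fixes \<F> :: "('a \<Rightarrow> complex) set"
  assumes cl: "\<And>f g c. f \<in> \<F> \<Longrightarrow> g \<in> \<F> \<Longrightarrow> (\<lambda>x. f x + c * g x) \<in> \<F>" and ne: "\<F> \<noteq> {}"
    and "finite T" "\<And>t. t \<in> T \<Longrightarrow> \<exists>f\<in>\<F>. f t \<noteq> 0"
  shows "\<exists>f\<in>\<F>. \<forall>t\<in>T. f t \<noteq> 0"
  using assms(3,4)
proof (induction T rule: finite_induct)
  case empty
  then show ?case using ne by blast
next
  case (insert x T)
  then obtain f where f: "f \<in> \<F>" "\<forall>t\<in>T. f t \<noteq> 0" by blast
  obtain g where g: "g \<in> \<F>" "g x \<noteq> 0" using insert.prems by blast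
  obtain c where c: "c \<notin> insert 0 (insert (- f x / g x) ((\<lambda>t. - f t / g t) ` T))"
  proof -
    have "finite (insert 0 (insert (- f x / g x) ((\<lambda>t. - f t / g t) ` T)))" using insert.hyps by simp
    from ex_new_if_finite[OF infinite_UNIV_char_0 this] that show ?thesis by blast
  qed
  have "f t + c * g t \<noteq> 0" if t: "t \<in> insert x T" for t
  proof
    assume z: "f t + c * g t = 0"
    show False
    proof (cases "g t = 0")
      case True
      then show ?thesis using z f(2) g(2) t by auto
    next
      case False
      then have "c = - f t / g t" using z by (simp add: field_simps add_eq_0_iff)
      then show ?thesis using c t by auto
    qed
  qed
  then show ?case using cl[OF f(1) g(1), of c] by (intro bexI[of _ "\<lambda>x. f x + c * g x"]) auto
qed

text \<open>The starting position of Weierstrass preparation. The fiber being finite, some point of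
  the line near \<open>t0\<close> is off \<open>X\<close>, and a local function excluding it has an
  isolated zero at \<open>t0\<close>. A small circle around \<open>t0\<close> is then zero free over
  \<open>z0\<close>, and over nearby \<open>z\<close> by compactness. The larger radius
  \<open>R\<close> is the margin needed by the argument principle.\<close>

lemma analytic_local_data:
  fixes v :: "complex^'n"
  assumes X: "locally_analytic X" "fiber_growth X v" and t0: "t0 \<in> fiber X v z0" and "\<epsilon> > 0"
  obtains f r R \<delta> U where "0 < r" "r < R" "R < \<epsilon>" "\<delta> > 0"
    "\<And>z \<tau>. z \<in> cball z0 \<delta> \<Longrightarrow> \<tau> \<in> cball t0 R \<Longrightarrow> z + \<tau> *s v \<in> U"
    "line_holomorphic_on f U" "\<And>x. x \<in> X \<inter> U \<Longrightarrow> f x = 0"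
    "\<And>z. z \<in> U - X \<Longrightarrow> \<exists>f. line_holomorphic_on f U \<and> (\<forall>x\<in>X \<inter> U. f x = 0) \<and> f z \<noteq> 0"
    "\<And>z w. z \<in> ball z0 \<delta> \<Longrightarrow> w \<in> sphere t0 r \<Longrightarrow> f (z + w *s v) \<noteq> 0"
proof -
  let ?a = "z0 + t0 *s v"
  obtain U where U: "open U" "?a \<in> U"
    "\<And>w. w \<in> U - X \<Longrightarrow> \<exists>f. line_holomorphic_on f U \<and> (\<forall>x\<in>X \<inter> U. f x = 0) \<and> f w \<noteq> 0"
    using X unfolding locally_analytic_def by metis
  obtain \<rho> where \<rho>: "\<rho> > 0" "ball ?a \<rho> \<subseteq> U" using U openE by blast
  \<comment> \<open>The displacement in z costs at most \<rho>/3 and the one along \<open>v\<close>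
    less than \<rho>/2, together less than \<rho>.\<close>
  define R1 where "R1 = min (\<epsilon> / 2) (\<rho> / (3 * (norm v + 1)))"
  have R1: "R1 > 0" "R1 < \<epsilon>" "R1 * norm v < \<rho> / 2"
  proof -
    have n: "norm v + 1 > 0" by (simp add: add_nonneg_pos)
    then show "R1 > 0" using \<rho> \<open>\<epsilon> > 0\<close> by (simp add: R1_def)
    show "R1 < \<epsilon>" using \<open>\<epsilon> > 0\<close> by (simp add: R1_def)
    have "R1 * norm v \<le> (\<rho> / (3 * (norm v + 1))) * (norm v + 1)"
      using n \<rho> \<open>R1 > 0\<close> by (intro mult_mono) (auto simp: R1_def)
    also have "\<dots> = \<rho> / 3" using n by (simp add: field_simps)
    finally show "R1 * norm v < \<rho> / 2" using \<rho> by simp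
  qed
  have inU: "z + \<tau> *s v \<in> U" if "z \<in> cball z0 (\<rho> / 3)" "\<tau> \<in> cball t0 R1" for z \<tau>
  proof -
    have "?a - (z + \<tau> *s v) = (z0 - z) + (t0 - \<tau>) *s v" by (simp add: vec_eq_iff algebra_simps)
    then have "norm (?a - (z + \<tau> *s v)) \<le> norm (z0 - z) + norm (t0 - \<tau>) * norm v"
      by (metis norm_triangle_ineq norm_smult)
    also have "\<dots> \<le> \<rho> / 3 + R1 * norm v"
      using that by (intro add_mono mult_right_mono) (auto simp: dist_norm)
    also have "\<dots> < \<rho>" using R1 \<rho> by simp
    finally show ?thesis using \<rho> by (auto simp: dist_norm)
  qed
  have "\<exists>\<tau>1. \<tau>1 \<in> ball t0 R1 \<and> \<tau>1 \<notin> fiber X v z0"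
  proof (rule ccontr)
    assume "\<not> ?thesis"
    then have "ball t0 R1 \<subseteq> fiber X v z0" by blast
    then have "finite (ball t0 R1)" using fiber_finite[OF X] finite_subset by blast
    then show False using R1(1) uncountable_ball[of R1 t0] countable_finite by blast
  qed
  then obtain \<tau>1 where \<tau>1: "\<tau>1 \<in> ball t0 R1" "\<tau>1 \<notin> fiber X v z0" by blast
  have "z0 + \<tau>1 *s v \<in> U - X" using \<tau>1 inU[of z0 \<tau>1] \<rho> by (auto simp: fiber_def)
  from U(3)[OF this] obtain f where f: "line_holomorphic_on f U" "\<And>x. x \<in> X \<inter> U \<Longrightarrow> f x = 0" "f (z0 + \<tau>1 *s v) \<noteq> 0"
    by blast
  have f0: "f ?a = 0" using f(2) U(2) t0 by (auto simp: fiber_def)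
  have hol: "(\<lambda>\<tau>. f (z0 + \<tau> *s v)) holomorphic_on ball t0 R1"
    by (rule holomorphic_on_subset[OF line_holomorphic_onD(2)[OF f(1)]]) (use inU[of z0] \<rho> in auto)
  obtain r0 where r0: "0 < r0" "ball t0 r0 \<subseteq> ball t0 R1" "\<And>\<tau>. \<tau> \<in> ball t0 r0 - {t0} \<Longrightarrow> f (z0 + \<tau> *s v) \<noteq> 0"
    using isolated_zeros[OF hol open_ball connected_ball, of t0 \<tau>1] R1 f0 f(3) \<tau>1 by auto
  define R where "R = min R1 r0 / 2"
  define r where "r = R / 2"
  have R: "0 < r" "r < R" "R < R1" "R < r0" "R < \<epsilon>" using R1 r0 by (auto simp: R_def r_def)
  have cont: "continuous_on (ball z0 (\<rho> / 3) \<times> sphere t0 r) (\<lambda>(z,w). f (z + w *s v))"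
    unfolding split_beta
    by (rule continuous_on_compose2[OF line_holomorphic_onD(1)[OF f(1)]])
      (use inU R in \<open>auto intro!: continuous_intros\<close>)
  obtain \<delta> where \<delta>: "\<delta> > 0" "ball z0 \<delta> \<subseteq> ball z0 (\<rho> / 3)"
    "\<And>z w. z \<in> ball z0 \<delta> \<Longrightarrow> w \<in> sphere t0 r \<Longrightarrow> f (z + w *s v) \<noteq> 0"
  proof -
    have "z0 \<in> ball z0 (\<rho> / 3)" "\<And>w. w \<in> sphere t0 r \<Longrightarrow> f (z0 + w *s v) \<noteq> 0"
      using \<rho> R r0(3) by auto
    from nonvanishing_near[OF compact_sphere cont open_ball this] that show ?thesis by blast
  qed
  show ?thesis
  proof (rule that[of r R "min \<delta> (\<rho> / 3)" U f])
    show "0 < min \<delta> (\<rho> / 3)" using \<delta> \<rho> by simp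
    show "z + \<tau> *s v \<in> U" if "z \<in> cball z0 (min \<delta> (\<rho> / 3))" "\<tau> \<in> cball t0 R" for z \<tau>
      using that R by (intro inU) auto
  qed (use R f U \<delta> in auto)
qed

lemma param_holomorphic_local:
  fixes v :: "complex^'n"
  assumes "\<And>z x. z \<in> cball z0 \<delta> \<Longrightarrow> x \<in> cball t0 R \<Longrightarrow> z + x *s v \<in> U" "line_holomorphic_on f U"
  shows "param_holomorphic (ball z0 \<delta>) (ball t0 R) (\<lambda>z x. f (z + x *s v))"
  using assms by (intro param_holomorphic_translate) auto

lemma param_local_bounded:
  fixes v :: "complex^'n"
  assumes "\<And>z y. z \<in> cball z0 \<delta> \<Longrightarrow> y \<in> cball t0 R \<Longrightarrow> z + y *s v \<in> U" "line_holomorphic_on f U"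
  shows "\<exists>M. \<forall>z\<in>ball z0 \<delta>. \<forall>w\<in>ball t0 R. norm (f (z + w *s v)) < M"
proof -
  let ?C = "(\<lambda>q. f (fst q + snd q *s v)) ` (cball z0 \<delta> \<times> cball t0 R)"
  have "continuous_on (cball z0 \<delta> \<times> cball t0 R) (\<lambda>q. f (fst q + snd q *s v))"
    by (rule continuous_on_compose2[OF line_holomorphic_onD(1)[OF assms(2)]])
      (use assms(1) in \<open>auto intro!: continuous_intros\<close>)
  then have "compact ?C" by (rule compact_continuous_image) (intro compact_Times compact_cball)
  from compact_imp_bounded[OF this] obtain M where M: "\<forall>x\<in>?C. norm x \<le> M" unfolding bounded_iff ..
  have "norm (f (z + w *s v)) < M + 1" if "z \<in> ball z0 \<delta>" "w \<in> ball t0 R" for z w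
  proof -
    have "(z, w) \<in> cball z0 \<delta> \<times> cball t0 R" using that by auto
    then have "f (z + w *s v) \<in> ?C" by force
    from bspec[OF M this] show ?thesis by simp
  qed
  then show ?thesis by blast
qed

text \<open>A local resultant: the product of h(x + pv) over the zeros p of f on the line through x,
  with multiplicity. A point of X above x is a common zero of f and h and kills the product; over
  the given z, \<open>span_avoid\<close> supplies an h that is nonzero at every zero of f.\<close>

lemma projection_local:
  fixes v :: "complex^'n"
  assumes r: "0 < r" "r < R" and "\<delta> > 0"
    and inU: "\<And>z u. z \<in> cball z0 \<delta> \<Longrightarrow> u \<in> cball t0 R \<Longrightarrow> z + u *s v \<in> U"
    and f: "line_holomorphic_on f U" "\<And>x. x \<in> X \<inter> U \<Longrightarrow> f x = 0"
    and hull: "\<And>z. z \<in> U - X \<Longrightarrow> \<exists>f. line_holomorphic_on f U \<and> (\<forall>x\<in>X \<inter> U. f x = 0) \<and> f z \<noteq> 0"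
    and nz: "\<And>z w. z \<in> ball z0 \<delta> \<Longrightarrow> w \<in> sphere t0 r \<Longrightarrow> f (z + w *s v) \<noteq> 0"
    and z: "z \<in> ball z0 \<delta>" "\<And>u. u \<in> ball t0 r \<Longrightarrow> u \<notin> fiber X v z"
  shows "\<exists>P. line_holomorphic_on P (ball z0 \<delta>) \<and>
     (\<forall>x\<in>ball z0 \<delta>. (\<exists>u\<in>ball t0 r. u \<in> fiber X v x) \<longrightarrow> P x = 0) \<and> P z \<noteq> 0"
proof -
  define g where "g z u = f (z + u *s v)" for z u
  have g: "param_holomorphic (ball z0 \<delta>) (ball t0 R) g"
    unfolding g_def by (rule param_holomorphic_local[OF inU f(1)])
  have gnz: "g z w \<noteq> 0" if "z \<in> ball z0 \<delta>" "w \<in> sphere t0 r" for z w using nz[OF that] by (simp add: g_def)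
  have fin: "finite (zeros_in (g x) t0 r)" if "x \<in> ball z0 \<delta>" for x
    using finite_zeros_in[OF param_holomorphicD(2)[OF g that] r gnz[OF that]] .
  let ?F = "{h. line_holomorphic_on h U \<and> (\<forall>x\<in>X \<inter> U. h x = 0)}"
  have "\<exists>h\<in>?F. \<forall>y\<in>(\<lambda>u. z + u *s v) ` zeros_in (g z) t0 r. h y \<noteq> 0"
  proof (rule span_avoid)
    show "(\<lambda>x. h x + c * k x) \<in> ?F" if "h \<in> ?F" "k \<in> ?F" for h k c
      using that by (auto intro!: line_holomorphic_add line_holomorphic_mult)
    show "?F \<noteq> {}" using f by blast
    show "finite ((\<lambda>u. z + u *s v) ` zeros_in (g z) t0 r)" using fin z by blast
    fix y assume "y \<in> (\<lambda>u. z + u *s v) ` zeros_in (g z) t0 r"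
    then obtain u where u: "u \<in> ball t0 r" "y = z + u *s v" by (auto simp: zeros_in_def)
    then have "y \<in> U - X" using inU[of z u] z r by (auto simp: fiber_def)
    then show "\<exists>f\<in>?F. f y \<noteq> 0" using hull by blast
  qed
  then obtain h where h: "line_holomorphic_on h U" "\<And>x. x \<in> X \<inter> U \<Longrightarrow> h x = 0"
    "\<And>u. u \<in> zeros_in (g z) t0 r \<Longrightarrow> h (z + u *s v) \<noteq> 0" by blast
  obtain M where M: "\<And>z w. z \<in> ball z0 \<delta> \<Longrightarrow> w \<in> ball t0 R \<Longrightarrow> norm (h (z + w *s v)) < M"
    using param_local_bounded[OF inU h(1)] by blast
  let ?P = "\<lambda>x. \<Prod>p\<in>zeros_in (g x) t0 r. h (x + p *s v) ^ zmult (g x) p"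
  have "line_holomorphic_on ?P (ball z0 \<delta>)"
    by (rule zero_prod_line_holomorphic[OF g param_holomorphic_local[OF inU h(1)] _ _ r gnz M]) auto
  moreover have "?P x = 0" if x: "x \<in> ball z0 \<delta>" "u \<in> ball t0 r" "u \<in> fiber X v x" for x u
  proof -
    have xU: "x + u *s v \<in> X \<inter> U" using x r by (auto simp: fiber_def intro!: inU)
    then have "u \<in> zeros_in (g x) t0 r" using x f(2) by (auto simp: zeros_in_def g_def)
    moreover have "zmult (g x) u > 0"
      by (rule zmult_pos[OF param_holomorphicD(2)[OF g x(1)] r gnz[OF x(1)]]) (use calculation in auto)
    ultimately show ?thesis using fin[OF x(1)] h(2)[OF xU] by (auto simp: prod_zero_iff)
  qed
  moreover have "?P z \<noteq> 0" using h(3) fin[OF z(1)] by (simp add: prod_zero_iff)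
  ultimately show ?thesis by blast
qed

text \<open>The finite case of Remmert's mapping theorem. The fiber over \<open>a\<close> is finite
  and nearby fibers stay in small discs around its points, so the product of one local resultant per
  disc excludes the given point.\<close>

theorem projection_locally_analytic:
  fixes v :: "complex^'n"
  assumes X: "locally_analytic X" "fiber_growth X v"
  shows "locally_analytic {z. fiber X v z \<noteq> {}}" (is "locally_analytic ?A")
  unfolding locally_analytic_def
proof (intro conjI allI)
  have clX: "closed X" using X unfolding locally_analytic_def by blast
  have "open (- ?A)" unfolding open_contains_ball
  proof
    fix a assume "a \<in> - ?A"
    then have "fiber X v a \<subseteq> {}" by simp
    from fiber_upper[OF clX X(2) open_empty this] show "\<exists>e>0. ball a e \<subseteq> - ?A" by fastforce
  qed
  then show "closed ?A" by (simp add: open_closed)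
  fix a
  have "\<forall>t\<in>fiber X v a. \<exists>r \<delta>. r > 0 \<and> \<delta> > 0 \<and> (\<forall>z\<in>ball a \<delta>. (\<forall>y\<in>ball t r. y \<notin> fiber X v z) \<longrightarrow>
     (\<exists>P. line_holomorphic_on P (ball a \<delta>) \<and>
       (\<forall>x\<in>ball a \<delta>. (\<exists>y\<in>ball t r. y \<in> fiber X v x) \<longrightarrow> P x = 0) \<and> P z \<noteq> 0))"
  proof
    fix t assume t: "t \<in> fiber X v a"
    show "\<exists>r \<delta>. r > 0 \<and> \<delta> > 0 \<and> (\<forall>z\<in>ball a \<delta>. (\<forall>y\<in>ball t r. y \<notin> fiber X v z) \<longrightarrow>
     (\<exists>P. line_holomorphic_on P (ball a \<delta>) \<and>
       (\<forall>x\<in>ball a \<delta>. (\<exists>y\<in>ball t r. y \<in> fiber X v x) \<longrightarrow> P x = 0) \<and> P z \<noteq> 0))"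
    proof (rule analytic_local_data[OF X t zero_less_one])
      fix f r R \<delta> U
      assume d: "0 < r" "r < R" "R < (1::real)" "0 < \<delta>"
        "\<And>z y. z \<in> cball a \<delta> \<Longrightarrow> y \<in> cball t R \<Longrightarrow> z + y *s v \<in> U"
        "line_holomorphic_on f U" "\<And>x. x \<in> X \<inter> U \<Longrightarrow> f x = 0"
        "\<And>z. z \<in> U - X \<Longrightarrow> \<exists>f. line_holomorphic_on f U \<and> (\<forall>x\<in>X \<inter> U. f x = 0) \<and> f z \<noteq> 0"
        "\<And>z w. z \<in> ball a \<delta> \<Longrightarrow> w \<in> sphere t r \<Longrightarrow> f (z + w *s v) \<noteq> 0"
      show ?thesis
        by (intro exI[of _ r] exI[of _ \<delta>] conjI ballI impI d(1,4) projection_local[OF d(1,2,4-9)]) auto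
    qed
  qed
  then obtain r \<delta> where r: "\<And>t. t \<in> fiber X v a \<Longrightarrow> r t > 0" "\<And>t. t \<in> fiber X v a \<Longrightarrow> \<delta> t > 0"
    "\<And>t z. t \<in> fiber X v a \<Longrightarrow> z \<in> ball a (\<delta> t) \<Longrightarrow> (\<forall>y\<in>ball t (r t). y \<notin> fiber X v z) \<Longrightarrow>
     (\<exists>P. line_holomorphic_on P (ball a (\<delta> t)) \<and>
       (\<forall>x\<in>ball a (\<delta> t). (\<exists>y\<in>ball t (r t). y \<in> fiber X v x) \<longrightarrow> P x = 0) \<and> P z \<noteq> 0)"
    unfolding bchoice_iff by blast
  have fin: "finite (fiber X v a)" by (rule fiber_finite[OF X])
  have "fiber X v a \<subseteq> (\<Union>t\<in>fiber X v a. ball t (r t))" using r(1) by fastforce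
  from fiber_upper[OF clX X(2) _ this] obtain \<delta>0 where \<delta>0: "\<delta>0 > 0"
    "\<And>z. z \<in> ball a \<delta>0 \<Longrightarrow> fiber X v z \<subseteq> (\<Union>t\<in>fiber X v a. ball t (r t))" by blast
  define d where "d = Min (insert \<delta>0 (\<delta> ` fiber X v a))"
  have d: "d > 0" "d \<le> \<delta>0" "\<And>t. t \<in> fiber X v a \<Longrightarrow> d \<le> \<delta> t"
    using fin r(2) \<delta>0(1) by (auto simp: d_def)
  have "\<exists>f. line_holomorphic_on f (ball a d) \<and> (\<forall>x\<in>?A \<inter> ball a d. f x = 0) \<and> f z \<noteq> 0" if z: "z \<in> ball a d - ?A" for z
  proof -
    have "\<exists>P. line_holomorphic_on P (ball a (\<delta> t)) \<and>
       (\<forall>x\<in>ball a (\<delta> t). (\<exists>y\<in>ball t (r t). y \<in> fiber X v x) \<longrightarrow> P x = 0) \<and> P z \<noteq> 0" if "t \<in> fiber X v a" for t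
      by (rule r(3)[OF that]) (use z d(3)[OF that] in auto)
    then obtain P where P: "\<And>t. t \<in> fiber X v a \<Longrightarrow> line_holomorphic_on (P t) (ball a (\<delta> t))"
      "\<And>t x y. t \<in> fiber X v a \<Longrightarrow> x \<in> ball a (\<delta> t) \<Longrightarrow> y \<in> ball t (r t) \<Longrightarrow> y \<in> fiber X v x \<Longrightarrow> P t x = 0"
      "\<And>t. t \<in> fiber X v a \<Longrightarrow> P t z \<noteq> 0" by metis
    let ?P = "\<lambda>x. \<Prod>t\<in>fiber X v a. P t x"
    have "line_holomorphic_on ?P (ball a d)"
      by (intro line_holomorphic_prod line_holomorphic_on_subset[OF P(1)] subset_ball d(3))
    moreover have "?P x = 0" if x: "x \<in> ?A \<inter> ball a d" for x
    proof -
      obtain y where y: "y \<in> fiber X v x" using x by blast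
      then obtain t where t: "t \<in> fiber X v a" "y \<in> ball t (r t)" using \<delta>0(2)[of x] x d(2) by fastforce
      then have "P t x = 0" using P(2)[OF t(1) _ t(2) y] x d(3)[OF t(1)] by simp
      then show ?thesis using t(1) fin by (auto simp: prod_zero_iff)
    qed
    moreover have "?P z \<noteq> 0" using P(3) fin by (simp add: prod_zero_iff)
    ultimately show ?thesis by blast
  qed
  then show "\<exists>U. open U \<and> a \<in> U \<and> (\<forall>z\<in>U - ?A. \<exists>f. line_holomorphic_on f U \<and> (\<forall>x\<in>?A \<inter> U. f x = 0) \<and> f z \<noteq> 0)"
    using d(1) by (intro exI[of _ "ball a d"]) auto
qed

text \<open>For a hypersurface on which the projection along \<open>v\<close> is proper, this
  excludes components of lower dimension, whose points could not be continued to all neighbouring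
  fibers.\<close>

definition thick :: "(complex^'n) set \<Rightarrow> complex^'n \<Rightarrow> bool" where
  "thick X v \<longleftrightarrow> (\<forall>W. open W \<and> W \<inter> X \<noteq> {} \<longrightarrow> interior {z. \<exists>t. z + t *s v \<in> W \<inter> X} \<noteq> {})"

text \<open>The identity theorem on the complex line joining \<open>p\<close> to \<open>z\<close>,
  whose trace in the ball is convex and hence connected.\<close>

lemma line_holomorphic_zero_on_ball:
  fixes c :: "complex^'n"
  assumes P: "line_holomorphic_on P (ball c \<delta>)" and p: "p \<in> ball c \<delta>" and "e > 0"
    and zero: "\<And>x. x \<in> ball p e \<Longrightarrow> x \<in> ball c \<delta> \<Longrightarrow> P x = 0" and z: "z \<in> ball c \<delta>"
  shows "P z = 0"
proof -
  let ?S = "{u. p + u *s (z - p) \<in> ball c \<delta>}"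
  have opS: "open ?S" by (rule open_line_preimage) simp
  have "convex ?S"
  proof (rule convexI)
    fix x y :: complex and a b :: real
    assume xy: "x \<in> ?S" "y \<in> ?S" and ab: "0 \<le> a" "0 \<le> b" "a + b = 1"
    have "p + (a *\<^sub>R x + b *\<^sub>R y) *s (z - p) = a *\<^sub>R (p + x *s (z - p)) + b *\<^sub>R (p + y *s (z - p))"
    proof -
      have "a *\<^sub>R p + b *\<^sub>R p = p" using ab(3) by (metis scaleR_left.add scaleR_one)
      moreover have "(a *\<^sub>R x + b *\<^sub>R y) *s w = a *\<^sub>R (x *s w) + b *\<^sub>R (y *s w)" for w :: "complex^'n"
        by (simp add: vec_eq_iff distrib_right)
      moreover have "a *\<^sub>R (p + q) + b *\<^sub>R (p + q') = (a *\<^sub>R p + b *\<^sub>R p) + (a *\<^sub>R q + b *\<^sub>R q')"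
        for q q' :: "complex^'n" by (simp add: scaleR_add_right)
      ultimately show ?thesis by metis
    qed
    moreover have "a *\<^sub>R (p + x *s (z - p)) + b *\<^sub>R (p + y *s (z - p)) \<in> ball c \<delta>"
      using convexD[OF convex_ball _ _ ab] xy by blast
    ultimately show "a *\<^sub>R x + b *\<^sub>R y \<in> ?S" by simp
  qed
  then have conS: "connected ?S" by (rule convex_connected)
  let ?O = "{u. p + u *s (z - p) \<in> ball p e \<inter> ball c \<delta>}"
  have opO: "open ?O" by (rule open_line_preimage) auto
  have "0 \<in> ?O" using \<open>e > 0\<close> p by simp
  have "P (p + 1 *s (z - p)) = 0"
  proof (rule analytic_continuation[where f="\<lambda>u. P (p + u *s (z - p))" and S="?S" and U="?O" and \<xi>=0])
    show "(\<lambda>u. P (p + u *s (z - p))) holomorphic_on ?S" by (rule line_holomorphic_onD(2)[OF P])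
    show "0 islimpt ?O" using opO \<open>0 \<in> ?O\<close> by (simp add: interior_limit_point interior_open)
    show "P (p + u *s (z - p)) = 0" if "u \<in> ?O" for u
      using that zero by blast
    show "1 \<in> ?S" using z by simp
  qed (use opS conS p in auto)
  then show ?thesis by simp
qed

text \<open>Lower semicontinuity of fibers. Thickness gives a small ball of base points whose fiber
  meets the disc; a local resultant excluding some z would vanish on that ball and therefore
  identically.\<close>

lemma fiber_open:
  fixes v :: "complex^'n"
  assumes Y: "locally_analytic Y" "fiber_growth Y v" "thick Y v" and t1: "t1 \<in> fiber Y v z1" and "\<epsilon> > 0"
  shows "\<exists>\<delta>>0. \<forall>z\<in>ball z1 \<delta>. \<exists>t\<in>ball t1 \<epsilon>. t \<in> fiber Y v z"
proof -
  \<comment> \<open>For v = 0 a nonempty fiber would be the whole plane, contrary to its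
    finiteness.\<close>
  have v0: "norm v > 0"
  proof (rule ccontr)
    assume "\<not> norm v > 0"
    then have "v = 0" by simp
    moreover have "z1 \<in> Y" using t1 \<open>v = 0\<close> by (auto simp: fiber_def split: if_splits)
    ultimately have "fiber Y v z1 = UNIV" by (simp add: fiber_def)
    then show False using fiber_finite[OF Y(1,2), of z1] by (simp add: infinite_UNIV_char_0)
  qed
  obtain f r R \<delta> U where
    d: "0 < r" "r < R" "R < \<epsilon>" "\<delta> > 0"
    "\<And>z u. z \<in> cball z1 \<delta> \<Longrightarrow> u \<in> cball t1 R \<Longrightarrow> z + u *s v \<in> U"
    "line_holomorphic_on f U" "\<And>x. x \<in> Y \<inter> U \<Longrightarrow> f x = 0"
    "\<And>z. z \<in> U - Y \<Longrightarrow> \<exists>f. line_holomorphic_on f U \<and> (\<forall>x\<in>Y \<inter> U. f x = 0) \<and> f z \<noteq> 0"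
    "\<And>z w. z \<in> ball z1 \<delta> \<Longrightarrow> w \<in> sphere t1 r \<Longrightarrow> f (z + w *s v) \<noteq> 0"
    by (rule analytic_local_data[OF Y(1,2) t1 \<open>\<epsilon> > 0\<close>]) (rule that; assumption)
  \<comment> \<open>Three errors smaller than \<eta> occur in \<open>inA\<close>; their sum must
    stay below r |v| to keep the parameter in the disc of radius r.\<close>
  define \<eta> where "\<eta> = min \<delta> (r * norm v) / 3"
  have \<eta>: "\<eta> > 0" "3 * \<eta> \<le> \<delta>" "3 * \<eta> \<le> r * norm v" using d v0 by (auto simp: \<eta>_def)
  let ?y = "z1 + t1 *s v"
  let ?W = "{z. \<exists>t. z + t *s v \<in> ball ?y \<eta> \<inter> Y}"
  have "?y \<in> ball ?y \<eta> \<inter> Y" using t1 \<eta> by (simp add: fiber_def)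
  then have "ball ?y \<eta> \<inter> Y \<noteq> {}" by blast
  then have "interior ?W \<noteq> {}" using Y(3)[unfolded thick_def, rule_format, of "ball ?y \<eta>"] by simp
  then obtain z' where z': "z' \<in> interior ?W" by blast
  then obtain t where t: "z' + t *s v \<in> ball ?y \<eta> \<inter> Y" using interior_subset by blast
  obtain e where e: "e > 0" "ball z' e \<subseteq> ?W" using z' by (auto simp: mem_interior)
  \<comment> \<open>The swept-out ball may lie far away along \<open>v\<close>. Shifting by (t - t1)
    v moves its centre near \<open>z1\<close> and only relabels fiber parameters.\<close>
  let ?z = "z' + (t - t1) *s v"
  have zz: "?z = z' + t *s v - t1 *s v" by (simp add: vec_eq_iff algebra_simps)
  have "norm (z1 - ?z) = norm (?y - (z' + t *s v))" unfolding zz by (simp add: algebra_simps)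
  then have zin: "norm (z1 - ?z) < \<eta>" using t by (simp add: dist_norm)
  have inA: "\<exists>u\<in>ball t1 r. u \<in> fiber Y v x" if x: "x \<in> ball ?z (min e \<eta>)" for x
  proof -
    have "x - (t - t1) *s v \<in> ball z' e" using x by (simp add: dist_norm algebra_simps)
    then obtain t' where t': "x - (t - t1) *s v + t' *s v \<in> ball ?y \<eta> \<inter> Y" using e by blast
    let ?u = "t' - (t - t1)"
    have eq: "x - (t - t1) *s v + t' *s v = x + ?u *s v" by (simp add: vec_eq_iff algebra_simps)
    have "(t1 - ?u) *s v = (?y - (x + ?u *s v)) + (x - ?z) + (?z - z1)"
      by (simp add: vec_eq_iff algebra_simps)
    then have "norm ((t1 - ?u) *s v) \<le> norm (?y - (x + ?u *s v)) + norm (x - ?z) + norm (?z - z1)"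
      by (metis norm_triangle_ineq norm_triangle_mono order_refl)
    also have "\<dots> < \<eta> + \<eta> + \<eta>"
      using t' x zin unfolding eq by (intro add_strict_mono) (auto simp: dist_norm norm_minus_commute)
    also have "\<dots> \<le> r * norm v" using \<eta> by simp
    finally have "norm (t1 - ?u) * norm v < r * norm v" unfolding norm_smult .
    then have "norm (t1 - ?u) < r" using v0 mult_less_cancel_right_pos by blast
    then show ?thesis using t' unfolding eq by (intro bexI[of _ ?u]) (auto simp: fiber_def dist_norm)
  qed
  have "\<exists>u\<in>ball t1 r. u \<in> fiber Y v z" if z: "z \<in> ball z1 \<delta>" for z
  proof (rule ccontr)
    assume "\<not> ?thesis"
    then have none: "u \<notin> fiber Y v z" if "u \<in> ball t1 r" for u using that by blast
    from projection_local[OF d(1,2,4-9) z none] obtain P where P: "line_holomorphic_on P (ball z1 \<delta>)"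
      "\<And>x u. x \<in> ball z1 \<delta> \<Longrightarrow> u \<in> ball t1 r \<Longrightarrow> u \<in> fiber Y v x \<Longrightarrow> P x = 0" "P z \<noteq> 0" by blast
    have zb: "?z \<in> ball z1 \<delta>" using zin \<eta> by (simp add: dist_norm)
    have "P z = 0"
    proof (rule line_holomorphic_zero_on_ball[OF P(1) zb _ _ z])
      show "P x = 0" if "x \<in> ball ?z (min e \<eta>)" "x \<in> ball z1 \<delta>" for x
        using inA[OF that(1)] P(2)[OF that(2)] by blast
    qed (use e \<eta> in simp)
    then show False using P(3) by simp
  qed
  moreover have "ball t1 r \<subseteq> ball t1 \<epsilon>" using d by auto
  ultimately show ?thesis using d(4) by blast
qed

section \<open>Root systems\<close>

lemma finite_separation:
  fixes T :: "complex set"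
  assumes "finite T"
  shows "\<exists>e>0. \<forall>s\<in>T. \<forall>t\<in>T. s \<noteq> t \<longrightarrow> ball s e \<inter> ball t e = {}"
proof -
  let ?D = "(\<lambda>(s,t). dist s t) ` {(s,t) \<in> T \<times> T. s \<noteq> t}"
  have "finite {(s,t) \<in> T \<times> T. s \<noteq> t}" by (rule finite_subset[of _ "T \<times> T"]) (use assms in auto)
  then have fin: "finite (insert 1 ?D)" by blast
  define e where "e = Min (insert 1 ?D) / 2"
  have "Min (insert 1 ?D) > 0" using fin by (subst Min_gr_iff) auto
  then have "e > 0" by (simp add: e_def)
  moreover have "ball s e \<inter> ball t e = {}" if "s \<in> T" "t \<in> T" "s \<noteq> t" for s t
  proof -
    have "dist s t \<in> insert 1 ?D" using that by force
    then have "2 * e \<le> dist s t" using fin by (simp add: e_def)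
    then show ?thesis by (auto simp: disjoint_iff) (smt (verit) dist_triangle2 dist_commute)
  qed
  ultimately show ?thesis by blast
qed

text \<open>A smaller circle isolates \<tau> and remains zero free for nearby parameters; the
  constant count of zeros keeps at least one inside.\<close>

lemma disc_roots_local:
  assumes g: "param_holomorphic B (ball t R) g" and B: "open B" and r: "0 < r" "r < R"
    and nz: "\<And>z w. z \<in> B \<Longrightarrow> w \<in> sphere t r \<Longrightarrow> g z w \<noteq> 0"
    and z1: "z1 \<in> B" and \<tau>: "\<tau> \<in> zeros_in (g z1) t r" and "\<epsilon> > 0"
  shows "\<exists>r' B1. 0 < r' \<and> r' < \<epsilon> \<and> ball \<tau> r' \<subseteq> ball t r \<and> open B1 \<and> z1 \<in> B1 \<and> B1 \<subseteq> B \<and>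
     (\<forall>k. line_holomorphic_on (\<lambda>z. \<Sum>p\<in>zeros_in (g z) \<tau> r'. of_nat (zmult (g z) p) * p ^ k) B1) \<and>
     (\<forall>z\<in>B1. zeros_in (g z) \<tau> r' \<noteq> {})"
proof -
  have fin: "finite (zeros_in (g z1) t r)"
    by (rule finite_zeros_in[OF param_holomorphicD(2)[OF g z1] r nz[OF z1]])
  have op: "open (ball t r - (zeros_in (g z1) t r - {\<tau>}))" using fin by (intro open_Diff finite_imp_closed) auto
  have "\<tau> \<in> ball t r - (zeros_in (g z1) t r - {\<tau>})" using \<tau> by (auto simp: zeros_in_def)
  with op obtain e where e: "e > 0" "ball \<tau> e \<subseteq> ball t r - (zeros_in (g z1) t r - {\<tau>})" by (meson openE)
  define R' where "R' = min e \<epsilon> / 2"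
  define r' where "r' = R' / 2"
  have r': "0 < r'" "r' < R'" "R' < e" "R' < \<epsilon>" using e \<open>\<epsilon> > 0\<close> by (auto simp: R'_def r'_def)
  have sub: "ball \<tau> R' \<subseteq> ball t r" using r' e by (meson subset_ball less_imp_le subset_trans Diff_subset)
  have sub2: "ball \<tau> R' \<subseteq> ball t R" using sub r by (meson subset_ball less_imp_le subset_trans)
  have g': "param_holomorphic B (ball \<tau> R') g" by (rule param_holomorphic_subset[OF g]) (use sub2 in auto)
  have nzr: "g z1 w \<noteq> 0" if "w \<in> sphere \<tau> r'" for w
  proof
    assume "g z1 w = 0"
    moreover have "w \<in> ball \<tau> e" "w \<in> ball t r" using that r' sub by (auto simp: subset_iff)
    ultimately have "w \<in> zeros_in (g z1) t r - {\<tau>}" using that r' by (auto simp: zeros_in_def)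
    then show False using e(2) \<open>w \<in> ball \<tau> e\<close> by blast
  qed
  have "continuous_on (B \<times> sphere \<tau> r') (\<lambda>(z,w). g z w)"
    by (rule continuous_on_subset[OF param_holomorphicD(1)[OF g']]) (use r' in auto)
  from nonvanishing_near[OF compact_sphere this B z1 nzr] obtain \<delta> where \<delta>: "\<delta> > 0" "ball z1 \<delta> \<subseteq> B"
    "\<And>z w. z \<in> ball z1 \<delta> \<Longrightarrow> w \<in> sphere \<tau> r' \<Longrightarrow> g z w \<noteq> 0" by blast
  have g1: "param_holomorphic (ball z1 \<delta>) (ball \<tau> R') g" by (rule param_holomorphic_subset[OF g' \<delta>(2)]) auto
  have "line_holomorphic_on (\<lambda>z. \<Sum>p\<in>zeros_in (g z) \<tau> r'. of_nat (zmult (g z) p) * p ^ k) (ball z1 \<delta>)" for k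
    by (rule zero_sum_line_holomorphic[OF g1 param_holomorphic_of_holomorphic open_ball r'(1,2) \<delta>(3)])
      (auto intro!: holomorphic_intros)
  moreover have "zeros_in (g z) \<tau> r' \<noteq> {}" if z: "z \<in> ball z1 \<delta>" for z
  proof
    assume em: "zeros_in (g z) \<tau> r' = {}"
    obtain p where p: "\<And>z. z \<in> ball z1 \<delta> \<Longrightarrow> (\<Sum>q\<in>zeros_in (g z) \<tau> r'. zmult (g z) q) = p"
      using zero_count_constant[OF g1 open_ball connected_ball r'(1,2) \<delta>(3)] by blast
    have "p = 0" using p[OF z] em by simp
    have z1b: "z1 \<in> ball z1 \<delta>" using \<delta> by simp
    note hol = param_holomorphicD(2)[OF g1 z1b]
    have \<tau>z: "\<tau> \<in> zeros_in (g z1) \<tau> r'" using \<tau> r' by (auto simp: zeros_in_def)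
    have "zmult (g z1) \<tau> > 0" by (rule zmult_pos[OF hol r'(1,2) \<delta>(3)[OF z1b] \<tau>z])
    moreover have "finite (zeros_in (g z1) \<tau> r')" by (rule finite_zeros_in[OF hol r'(1,2) \<delta>(3)[OF z1b]])
    ultimately show False using p[OF z1b] \<open>p = 0\<close> \<tau>z by auto
  qed
  moreover have "ball \<tau> r' \<subseteq> ball t r" using sub r' by (meson subset_ball less_imp_le subset_trans)
  ultimately show ?thesis using r' \<delta> by (intro exI[of _ r'] exI[of _ "ball z1 \<delta>"]) auto
qed

text \<open>The roots of a local Weierstrass polynomial, with multiplicities \<open>w\<close>,
  described through power sums instead of coefficients; the last clause localises this at each root.
  Fibers of an analytic set are only contained in such a system, since a function vanishing on the
  set may have further zeros.\<close>

definition root_system ::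
    "(complex^'n) set \<Rightarrow> (complex^'n \<Rightarrow> complex set) \<Rightarrow> (complex^'n \<Rightarrow> complex \<Rightarrow> nat) \<Rightarrow> bool" where
  "root_system B Z w \<longleftrightarrow> open B \<and> (\<forall>z\<in>B. finite (Z z) \<and> (\<forall>t\<in>Z z. w z t > 0)) \<and>
     (\<forall>k. line_holomorphic_on (\<lambda>z. \<Sum>t\<in>Z z. of_nat (w z t) * t ^ k) B) \<and>
     (\<forall>z1\<in>B. \<forall>x\<in>Z z1. \<forall>\<epsilon>>0. \<exists>r B1. 0 < r \<and> r < \<epsilon> \<and> open B1 \<and> z1 \<in> B1 \<and> B1 \<subseteq> B \<and>
        (\<forall>k. line_holomorphic_on (\<lambda>z. \<Sum>t\<in>Z z \<inter> ball x r. of_nat (w z t) * t ^ k) B1) \<and>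
        (\<forall>z\<in>B1. Z z \<inter> ball x r \<noteq> {}))"

lemma root_systemD:
  assumes "root_system B Z w"
  shows "open B" "z \<in> B \<Longrightarrow> finite (Z z)" "z \<in> B \<Longrightarrow> t \<in> Z z \<Longrightarrow> w z t > 0"
    "line_holomorphic_on (\<lambda>z. \<Sum>t\<in>Z z. of_nat (w z t) * t ^ k) B"
  using assms unfolding root_system_def by blast+

text \<open>The roots are the zeros of one local function per point of the fiber over
  \<open>z0\<close>, taken in disjoint discs; nearby fibers do not leave these discs.\<close>

lemma root_system_exists:
  fixes v :: "complex^'n"
  assumes X: "locally_analytic X" "fiber_growth X v"
  shows "\<exists>d Z w. d > 0 \<and> root_system (ball z0 d) Z w \<and> (\<forall>z\<in>ball z0 d. fiber X v z \<subseteq> Z z)"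
proof -
  have clX: "closed X" using X unfolding locally_analytic_def by blast
  let ?T = "fiber X v z0"
  have finT: "finite ?T" by (rule fiber_finite[OF X])
  obtain \<epsilon> where \<epsilon>: "\<epsilon> > 0" "\<And>s t. s \<in> ?T \<Longrightarrow> t \<in> ?T \<Longrightarrow> s \<noteq> t \<Longrightarrow> ball s \<epsilon> \<inter> ball t \<epsilon> = {}"
    using finite_separation[OF finT] by blast
  have "\<exists>f r R \<delta>. 0 < r \<and> r < R \<and> R < \<epsilon> \<and> \<delta> > 0 \<and>
    param_holomorphic (ball z0 \<delta>) (ball t R) (\<lambda>z y. f (z + y *s v)) \<and>
    (\<forall>z\<in>ball z0 \<delta>. \<forall>y\<in>ball t r. y \<in> fiber X v z \<longrightarrow> f (z + y *s v) = 0) \<and>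
    (\<forall>z\<in>ball z0 \<delta>. \<forall>w\<in>sphere t r. f (z + w *s v) \<noteq> 0)" if t: "t \<in> ?T" for t
  proof (rule analytic_local_data[OF X t \<epsilon>(1)])
    fix f r R \<delta> U
    assume d: "0 < r" "r < R" "R < \<epsilon>" "0 < \<delta>"
        "\<And>z y. z \<in> cball z0 \<delta> \<Longrightarrow> y \<in> cball t R \<Longrightarrow> z + y *s v \<in> U"
        "line_holomorphic_on f U" "\<And>x. x \<in> X \<inter> U \<Longrightarrow> f x = 0"
        "\<And>z. z \<in> U - X \<Longrightarrow> \<exists>f. line_holomorphic_on f U \<and> (\<forall>x\<in>X \<inter> U. f x = 0) \<and> f z \<noteq> 0"
        "\<And>z w. z \<in> ball z0 \<delta> \<Longrightarrow> w \<in> sphere t r \<Longrightarrow> f (z + w *s v) \<noteq> 0"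
    have "f (z + y *s v) = 0" if "z \<in> ball z0 \<delta>" "y \<in> ball t r" "y \<in> fiber X v z" for z y
      by (rule d(7)) (use that d(2) d(5)[of z y] in \<open>auto simp: fiber_def\<close>)
    then show ?thesis using d param_holomorphic_local[OF d(5,6)]
      by (intro exI[of _ f] exI[of _ r] exI[of _ R] exI[of _ \<delta>]) auto
  qed
  then have "\<forall>t\<in>?T. \<exists>f r R \<delta>. 0 < r \<and> r < R \<and> R < \<epsilon> \<and> \<delta> > 0 \<and>
    param_holomorphic (ball z0 \<delta>) (ball t R) (\<lambda>z y. f (z + y *s v)) \<and>
    (\<forall>z\<in>ball z0 \<delta>. \<forall>y\<in>ball t r. y \<in> fiber X v z \<longrightarrow> f (z + y *s v) = 0) \<and>
    (\<forall>z\<in>ball z0 \<delta>. \<forall>w\<in>sphere t r. f (z + w *s v) \<noteq> 0)" by blast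
  then obtain f r R \<delta> where d: "\<forall>t\<in>?T. 0 < r t \<and> r t < R t \<and> R t < \<epsilon> \<and> \<delta> t > 0 \<and>
    param_holomorphic (ball z0 (\<delta> t)) (ball t (R t)) (\<lambda>z y. f t (z + y *s v)) \<and>
    (\<forall>z\<in>ball z0 (\<delta> t). \<forall>y\<in>ball t (r t). y \<in> fiber X v z \<longrightarrow> f t (z + y *s v) = 0) \<and>
    (\<forall>z\<in>ball z0 (\<delta> t). \<forall>w\<in>sphere t (r t). f t (z + w *s v) \<noteq> 0)"
    unfolding bchoice_iff by blast
  have dr: "0 < r t" "r t < R t" "R t < \<epsilon>" "\<delta> t > 0" if "t \<in> ?T" for t using d that by blast+
  have "?T \<subseteq> (\<Union>t\<in>?T. ball t (r t))" using dr(1) by fastforce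
  from fiber_upper[OF clX X(2) _ this] obtain \<delta>0 where \<delta>0: "\<delta>0 > 0"
    "\<And>z. z \<in> ball z0 \<delta>0 \<Longrightarrow> fiber X v z \<subseteq> (\<Union>t\<in>?T. ball t (r t))" by blast
  define D where "D = Min (insert \<delta>0 (\<delta> ` ?T))"
  have D: "D > 0" "D \<le> \<delta>0" "\<And>t. t \<in> ?T \<Longrightarrow> D \<le> \<delta> t"
    using finT dr(4) \<delta>0(1) by (auto simp: D_def)
  define B where "B = ball z0 D"
  define g where "g t z y = f t (z + y *s v)" for t z y
  have BD: "B \<subseteq> ball z0 (\<delta> t)" if "t \<in> ?T" for t unfolding B_def by (rule subset_ball[OF D(3)[OF that]])
  have g: "param_holomorphic B (ball t (R t)) (g t)" if "t \<in> ?T" for t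
    unfolding g_def by (rule param_holomorphic_subset[OF _ BD[OF that] order_refl]) (use d that in blast)
  have gnz: "g t z w \<noteq> 0" if "t \<in> ?T" "z \<in> B" "w \<in> sphere t (r t)" for t z w
    unfolding g_def using d BD that by blast
  have openB: "open B" by (simp add: B_def)
  define Zt where "Zt t z = zeros_in (g t z) t (r t)" for t z
  define Z where "Z z = (\<Union>t\<in>?T. Zt t z)" for z
  \<comment> \<open>A sum over all discs makes the weight independent of a choice of disc;
    disjointness leaves a single term.\<close>
  define w where "w z p = (\<Sum>t\<in>?T. if p \<in> ball t (r t) then zmult (g t z) p else 0)" for z p
  have finZt: "finite (Zt t z)" if "t \<in> ?T" "z \<in> B" for t z
    unfolding Zt_def by (rule finite_zeros_in[OF param_holomorphicD(2)[OF g[OF that(1)] that(2)] dr(1,2)[OF that(1)] gnz[OF that]])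
  have Ztb: "Zt t z \<subseteq> ball t (r t)" for t z by (auto simp: Zt_def zeros_in_def)
  have dis: "ball s (r s) \<inter> ball t (r t) = {}" if "s \<in> ?T" "t \<in> ?T" "s \<noteq> t" for s t
  proof -
    have "ball s (r s) \<subseteq> ball s \<epsilon>" "ball t (r t) \<subseteq> ball t \<epsilon>"
      using dr(2,3)[OF that(1)] dr(2,3)[OF that(2)] by (auto intro!: subset_ball)
    then show ?thesis using \<epsilon>(2)[OF that] by blast
  qed
  have wt: "w z p = zmult (g t z) p" if "t \<in> ?T" "p \<in> ball t (r t)" for z t p
  proof -
    have "w z p = (\<Sum>s\<in>?T. if s = t then zmult (g t z) p else 0)"
      unfolding w_def
    proof (rule sum.cong[OF refl])
      fix s assume "s \<in> ?T"
      then have "p \<notin> ball s (r s)" if "s \<noteq> t" using dis[of s t] \<open>t \<in> ?T\<close> \<open>p \<in> ball t (r t)\<close> that by blast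
      then show "(if p \<in> ball s (r s) then zmult (g s z) p else 0) = (if s = t then zmult (g t z) p else 0)"
        using \<open>p \<in> ball t (r t)\<close> by auto
    qed
    then show ?thesis using finT that by simp
  qed
  have "root_system B Z w"
    unfolding root_system_def
  proof (intro conjI ballI allI impI)
    fix z assume z: "z \<in> B"
    show "finite (Z z)" unfolding Z_def using finT finZt z by blast
    fix p assume "p \<in> Z z"
    then obtain t where t: "t \<in> ?T" "p \<in> Zt t z" by (auto simp: Z_def)
    have "zmult (g t z) p > 0"
      by (rule zmult_pos[OF param_holomorphicD(2)[OF g[OF t(1)] z] dr(1,2)[OF t(1)] gnz[OF t(1) z]])
        (assumption, rule t(2)[unfolded Zt_def])
    then show "w z p > 0" using wt t Ztb by (metis subsetD)
  next
    fix k
    have "line_holomorphic_on (\<lambda>z. \<Sum>t\<in>?T. \<Sum>p\<in>Zt t z. of_nat (zmult (g t z) p) * p ^ k) B"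
    proof (rule line_holomorphic_sum)
      fix t assume t: "t \<in> ?T"
      show "line_holomorphic_on (\<lambda>z. \<Sum>p\<in>Zt t z. of_nat (zmult (g t z) p) * p ^ k) B"
        unfolding Zt_def
        by (rule zero_sum_line_holomorphic[OF g[OF t] param_holomorphic_of_holomorphic openB dr(1,2)[OF t] gnz[OF t]])
          (auto intro!: holomorphic_intros)
    qed
    then show "line_holomorphic_on (\<lambda>z. \<Sum>t\<in>Z z. of_nat (w z t) * t ^ k) B"
    proof (rule line_holomorphic_on_cong[THEN iffD1, rotated])
      fix z assume z: "z \<in> B"
      have "(\<Sum>p\<in>Z z. of_nat (w z p) * p ^ k) = (\<Sum>t\<in>?T. \<Sum>p\<in>Zt t z. of_nat (w z p) * p ^ k)"
        unfolding Z_def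
      proof (rule sum.UNION_disjoint[OF finT])
        show "\<forall>i\<in>?T. \<forall>j\<in>?T. i \<noteq> j \<longrightarrow> Zt i z \<inter> Zt j z = {}" using dis Ztb by blast
      qed (use finZt z in blast)
      also have "\<dots> = (\<Sum>t\<in>?T. \<Sum>p\<in>Zt t z. of_nat (zmult (g t z) p) * p ^ k)"
        using wt Ztb by (intro sum.cong refl) (metis subsetD)
      finally show "(\<Sum>t\<in>?T. \<Sum>p\<in>Zt t z. of_nat (zmult (g t z) p) * p ^ k) = (\<Sum>p\<in>Z z. of_nat (w z p) * p ^ k)" ..
    qed
  next
    fix z1 y and e :: real assume z1: "z1 \<in> B" and "y \<in> Z z1" and e: "e > 0"
    then obtain t where t: "t \<in> ?T" "y \<in> zeros_in (g t z1) t (r t)" by (auto simp: Z_def Zt_def)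
    from disc_roots_local[OF g[OF t(1)] openB dr(1,2)[OF t(1)] gnz[OF t(1)] z1 t(2) e]
    obtain r' B1 where r': "0 < r'" "r' < e" "ball y r' \<subseteq> ball t (r t)" "open B1" "z1 \<in> B1" "B1 \<subseteq> B"
      "\<And>k. line_holomorphic_on (\<lambda>z. \<Sum>p\<in>zeros_in (g t z) y r'. of_nat (zmult (g t z) p) * p ^ k) B1"
      "\<And>z. z \<in> B1 \<Longrightarrow> zeros_in (g t z) y r' \<noteq> {}" by blast
    have eq: "Z z \<inter> ball y r' = zeros_in (g t z) y r'" for z
    proof
      show "Z z \<inter> ball y r' \<subseteq> zeros_in (g t z) y r'"
      proof
        fix p assume p: "p \<in> Z z \<inter> ball y r'"
        then obtain s where s: "s \<in> ?T" "p \<in> Zt s z" by (auto simp: Z_def)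
        then have "s = t" using dis[OF s(1) t(1)] Ztb p r'(3) by blast
        then show "p \<in> zeros_in (g t z) y r'" using s p by (simp add: Zt_def zeros_in_def)
      qed
      show "zeros_in (g t z) y r' \<subseteq> Z z \<inter> ball y r'"
      proof
        fix p assume p: "p \<in> zeros_in (g t z) y r'"
        then have "p \<in> Zt t z" using r'(3) by (auto simp: Zt_def zeros_in_def subset_iff)
        then show "p \<in> Z z \<inter> ball y r'" using t(1) p by (auto simp: Z_def zeros_in_def)
      qed
    qed
    have "(\<Sum>p\<in>Z z \<inter> ball y r'. of_nat (w z p) * p ^ k) = (\<Sum>p\<in>zeros_in (g t z) y r'. of_nat (zmult (g t z) p) * p ^ k)" for z k
      unfolding eq by (intro sum.cong refl) (use wt[OF t(1)] r'(3) in \<open>auto simp: zeros_in_def subset_iff\<close>)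
    with r' eq show "\<exists>r B1. 0 < r \<and> r < e \<and> open B1 \<and> z1 \<in> B1 \<and> B1 \<subseteq> B \<and>
        (\<forall>k. line_holomorphic_on (\<lambda>z. \<Sum>t\<in>Z z \<inter> ball y r. of_nat (w z t) * t ^ k) B1) \<and>
        (\<forall>z\<in>B1. Z z \<inter> ball y r \<noteq> {})"
      by (intro exI[of _ r'] exI[of _ B1]) simp
  qed (rule openB)
  moreover have "fiber X v z \<subseteq> Z z" if z: "z \<in> B" for z
  proof
    fix p assume p: "p \<in> fiber X v z"
    have "z \<in> ball z0 \<delta>0" using z D(2) by (auto simp: B_def)
    then obtain t where t: "t \<in> ?T" "p \<in> ball t (r t)" using \<delta>0(2) p by blast
    have "f t (z + p *s v) = 0" using d t BD[OF t(1)] z p by blast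
    then show "p \<in> Z z" using t by (auto simp: Z_def Zt_def zeros_in_def g_def)
  qed
  ultimately show ?thesis using D(1) unfolding B_def by blast
qed

text \<open>The power sum with k = 0 is the total weight, constant on a connected set, and each root
  has weight at least 1.\<close>

lemma root_system_card_bounded:
  assumes rs: "root_system B Z w" and "connected B"
  shows "\<exists>N. \<forall>z\<in>B. card (Z z) \<le> N"
proof -
  have "continuous_on B (\<lambda>z. of_nat (\<Sum>t\<in>Z z. w z t) :: complex)"
    using line_holomorphic_onD(1)[OF root_systemD(4)[OF rs, of 0]] by simp
  from connected_of_nat_constant[OF assms(2) this] obtain p where p: "\<forall>z\<in>B. (\<Sum>t\<in>Z z. w z t) = p" by blast
  have "card (Z z) \<le> p" if "z \<in> B" for z
  proof -
    have "card (Z z) = (\<Sum>t\<in>Z z. 1)" by simp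
    also have "\<dots> \<le> (\<Sum>t\<in>Z z. w z t)"
      using root_systemD(3)[OF rs that] by (intro sum_mono) (simp add: Suc_le_eq)
    finally show ?thesis using p that by simp
  qed
  then show ?thesis by blast
qed

text \<open>Every small disc around a root over \<open>z1\<close> keeps a root, so if the number of
  roots does not grow there is exactly one in each disc. It is then the quotient of the first by the
  zeroth local power sum, a function that is holomorphic even where several roots share a
  disc.\<close>

lemma root_system_local:
  assumes rs: "root_system B Z w" and z1: "z1 \<in> B"
  obtains r B1 \<sigma> where "open B1" "z1 \<in> B1" "B1 \<subseteq> B" "\<And>x. x \<in> Z z1 \<Longrightarrow> r x > 0"
    "\<And>x. x \<in> Z z1 \<Longrightarrow> line_holomorphic_on (\<sigma> x) B1"
    "\<And>x x'. x \<in> Z z1 \<Longrightarrow> x' \<in> Z z1 \<Longrightarrow> x \<noteq> x' \<Longrightarrow> ball x (r x) \<inter> ball x' (r x') = {}"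
    "\<And>z. z \<in> B1 \<Longrightarrow> card (Z z) \<le> card (Z z1) \<Longrightarrow>
        (\<forall>x\<in>Z z1. \<sigma> x z \<in> ball x (r x)) \<and> Z z = (\<lambda>x. \<sigma> x z) ` Z z1"
proof -
  have fin: "finite (Z z1)" using root_systemD(2)[OF rs z1] .
  obtain e where e: "e > 0" "\<And>s t. s \<in> Z z1 \<Longrightarrow> t \<in> Z z1 \<Longrightarrow> s \<noteq> t \<Longrightarrow> ball s e \<inter> ball t e = {}"
    using finite_separation[OF fin] by blast
  have "\<forall>x\<in>Z z1. \<exists>r B1. 0 < r \<and> r < e \<and> open B1 \<and> z1 \<in> B1 \<and> B1 \<subseteq> B \<and>
        (\<forall>k. line_holomorphic_on (\<lambda>z. \<Sum>t\<in>Z z \<inter> ball x r. of_nat (w z t) * t ^ k) B1) \<and>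
        (\<forall>z\<in>B1. Z z \<inter> ball x r \<noteq> {})"
    using rs z1 e(1) unfolding root_system_def by blast
  then obtain r BB where rB: "\<forall>x\<in>Z z1. 0 < r x \<and> r x < e \<and> open (BB x) \<and> z1 \<in> BB x \<and> BB x \<subseteq> B \<and>
        (\<forall>k. line_holomorphic_on (\<lambda>z. \<Sum>t\<in>Z z \<inter> ball x (r x). of_nat (w z t) * t ^ k) (BB x)) \<and>
        (\<forall>z\<in>BB x. Z z \<inter> ball x (r x) \<noteq> {})"
    unfolding bchoice_iff by blast
  define B1 where "B1 = B \<inter> (\<Inter>x\<in>Z z1. BB x)"
  have B1: "open B1" "z1 \<in> B1" "B1 \<subseteq> B" "\<And>x. x \<in> Z z1 \<Longrightarrow> B1 \<subseteq> BB x"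
    unfolding B1_def using rB z1 fin root_systemD(1)[OF rs] by (auto intro!: open_Int open_INT)
  define \<sigma> where "\<sigma> x z = (\<Sum>t\<in>Z z \<inter> ball x (r x). of_nat (w z t) * t ^ 1) / (\<Sum>t\<in>Z z \<inter> ball x (r x). of_nat (w z t) * t ^ 0)" for x z
  have dis: "ball x (r x) \<inter> ball x' (r x') = {}" if "x \<in> Z z1" "x' \<in> Z z1" "x \<noteq> x'" for x x'
  proof -
    have "r x < e" "r x' < e" using rB that(1,2) by blast+
    then have "ball x (r x) \<subseteq> ball x e" "ball x' (r x') \<subseteq> ball x' e"
      by (simp_all add: subset_ball)
    then show ?thesis using e(2)[OF that] by blast
  qed
  have hol: "line_holomorphic_on (\<sigma> x) B1" if x: "x \<in> Z z1" for x
    unfolding \<sigma>_def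
  proof (rule line_holomorphic_divide)
    show "line_holomorphic_on (\<lambda>z. \<Sum>t\<in>Z z \<inter> ball x (r x). of_nat (w z t) * t ^ 1) B1"
      by (rule line_holomorphic_on_subset[OF _ B1(4)[OF x]]) (use rB x in blast)
    show "line_holomorphic_on (\<lambda>z. \<Sum>t\<in>Z z \<inter> ball x (r x). of_nat (w z t) * t ^ 0) B1"
      by (rule line_holomorphic_on_subset[OF _ B1(4)[OF x]]) (use rB x in blast)
    fix z assume z: "z \<in> B1"
    then obtain p where p: "p \<in> Z z \<inter> ball x (r x)" using rB x B1(4)[OF x] by blast
    have zB: "z \<in> B" using z B1(3) by blast
    have "(\<Sum>t\<in>Z z \<inter> ball x (r x). w z t) \<noteq> 0"
      using p root_systemD(2,3)[OF rs zB] by (metis IntD1 finite_Int less_numeral_extra(3) sum_eq_0_iff)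
    then have "of_nat (\<Sum>t\<in>Z z \<inter> ball x (r x). w z t) \<noteq> (0::complex)" unfolding of_nat_eq_0_iff .
    then show "(\<Sum>t\<in>Z z \<inter> ball x (r x). of_nat (w z t) * t ^ 0) \<noteq> 0" by simp
  qed
  have main: "(\<forall>x\<in>Z z1. \<sigma> x z \<in> ball x (r x)) \<and> Z z = (\<lambda>x. \<sigma> x z) ` Z z1"
    if z: "z \<in> B1" and cd: "card (Z z) \<le> card (Z z1)" for z
  proof -
    have zB: "z \<in> B" using z B1(3) by blast
    have finz: "finite (Z z)" using root_systemD(2)[OF rs zB] .
    have "\<forall>x\<in>Z z1. \<exists>p. p \<in> Z z \<inter> ball x (r x)" using rB z B1(4) by blast
    then obtain p where p: "\<And>x. x \<in> Z z1 \<Longrightarrow> p x \<in> Z z \<inter> ball x (r x)" by metis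
    have inj: "inj_on p (Z z1)"
      by (rule inj_onI) (metis (no_types, lifting) IntD2 dis disjoint_iff p)
    have img: "p ` Z z1 = Z z"
      by (rule card_seteq[OF finz]) (use p cd card_image[OF inj] in auto)
    have single: "Z z \<inter> ball x (r x) = {p x}" if x: "x \<in> Z z1" for x
    proof -
      have "q = p x" if q: "q \<in> Z z \<inter> ball x (r x)" for q
      proof -
        obtain x' where "x' \<in> Z z1" "q = p x'" using q img by blast
        then show ?thesis using dis[OF x, of x'] p[of x'] q by blast
      qed
      then show ?thesis using p[OF x] by blast
    qed
    have "\<sigma> x z = p x" if x: "x \<in> Z z1" for x
    proof -
      have "w z (p x) > 0" using root_systemD(3)[OF rs zB] p[OF x] by blast
      then show ?thesis by (simp add: \<sigma>_def single[OF x])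
    qed
    then show ?thesis using p img by auto
  qed
  show ?thesis
  proof (rule that[OF B1(1-3) _ hol dis main])
    show "r x > 0" if "x \<in> Z z1" for x using rB that by blast
  qed
qed

text \<open>On a subset \<open>T\<close> the roots are separated near a point where their number is largest, and
  those lying in \<open>X\<close> do not change near a point where their number is then smallest.\<close>

lemma fiber_selection:
  fixes v :: "complex^'n"
  assumes X: "locally_analytic X" "fiber_growth X v" and T: "T \<noteq> {}"
  obtains y U and A :: "complex set" and x D where "y \<in> T" "open U" "y \<in> U"
    "\<And>a. a \<in> A \<Longrightarrow> open (D a)" "\<And>a. a \<in> A \<Longrightarrow> continuous_on (T \<inter> U) (x a)"
    "\<And>a c. a \<in> A \<Longrightarrow> c \<in> A \<Longrightarrow> a \<noteq> c \<Longrightarrow> D a \<inter> D c = {}"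
    "\<And>z. z \<in> T \<inter> U \<Longrightarrow> fiber X v z = (\<lambda>a. x a z) ` A"
    "\<And>z a. z \<in> T \<inter> U \<Longrightarrow> a \<in> A \<Longrightarrow> x a z \<in> D a"
proof -
  have clX: "closed X" using X unfolding locally_analytic_def by blast
  obtain y0 where y0: "y0 \<in> T" using T by blast
  obtain d Z w where d: "d > 0" and rs: "root_system (ball y0 d) Z w"
    and sub: "\<And>z. z \<in> ball y0 d \<Longrightarrow> fiber X v z \<subseteq> Z z"
    using root_system_exists[OF X, of y0] by blast
  obtain N where N: "\<And>z. z \<in> ball y0 d \<Longrightarrow> card (Z z) \<le> N"
    using root_system_card_bounded[OF rs connected_ball] by blast
  have "\<exists>y. y \<in> T \<inter> ball y0 d \<and> (\<forall>z. z \<in> T \<inter> ball y0 d \<longrightarrow> card (Z z) \<le> card (Z y))"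
    by (rule Lattices_Big.ex_has_greatest_nat[where k=y0 and b="Suc N"]) (use y0 d N in \<open>auto simp: less_Suc_eq_le\<close>)
  then obtain y1 where y1: "y1 \<in> T" "y1 \<in> ball y0 d" "\<And>z. z \<in> T \<inter> ball y0 d \<Longrightarrow> card (Z z) \<le> card (Z y1)" by blast
  obtain r B1 \<sigma> where L: "open B1" "y1 \<in> B1" "B1 \<subseteq> ball y0 d" "\<And>u. u \<in> Z y1 \<Longrightarrow> r u > 0"
    "\<And>u. u \<in> Z y1 \<Longrightarrow> line_holomorphic_on (\<sigma> u) B1"
    "\<And>u u'. u \<in> Z y1 \<Longrightarrow> u' \<in> Z y1 \<Longrightarrow> u \<noteq> u' \<Longrightarrow> ball u (r u) \<inter> ball u' (r u') = {}"
    "\<And>z. z \<in> B1 \<Longrightarrow> card (Z z) \<le> card (Z y1) \<Longrightarrow>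
        (\<forall>u\<in>Z y1. \<sigma> u z \<in> ball u (r u)) \<and> Z z = (\<lambda>u. \<sigma> u z) ` Z y1"
    by (rule root_system_local[OF rs y1(2)]) (rule that; assumption)
  have fin: "finite (Z y1)" using root_systemD(2)[OF rs y1(2)] .
  define a where "a y = {u \<in> Z y1. \<sigma> u y \<in> fiber X v y}" for y
  have sig: "(\<forall>u\<in>Z y1. \<sigma> u z \<in> ball u (r u)) \<and> Z z = (\<lambda>u. \<sigma> u z) ` Z y1" if "z \<in> T \<inter> B1" for z
    using L(7)[of z] y1(3)[of z] that L(3) by blast
  have fa: "fiber X v z = (\<lambda>u. \<sigma> u z) ` a z" if "z \<in> T \<inter> B1" for z
  proof -
    have "z \<in> ball y0 d" using that L(3) by blast
    then have "fiber X v z \<subseteq> (\<lambda>u. \<sigma> u z) ` Z y1" using sub[of z] sig[OF that] by simp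
    then show ?thesis by (auto simp: a_def)
  qed
  have "\<exists>y. y \<in> T \<inter> B1 \<and> (\<forall>z. z \<in> T \<inter> B1 \<longrightarrow> card (a y) \<le> card (a z))"
    by (rule ex_has_least_nat[where k=y1]) (use y1 L in auto)
  then obtain y2 where y2: "y2 \<in> T \<inter> B1" "\<And>z. z \<in> T \<inter> B1 \<Longrightarrow> card (a y2) \<le> card (a z)" by blast
  have "\<exists>V. open V \<and> y2 \<in> V \<and> (\<forall>z\<in>V \<inter> B1. \<sigma> u z \<notin> fiber X v z)" if u: "u \<in> Z y1 - a y2" for u
  proof -
    have "continuous_on B1 (\<lambda>z. z + \<sigma> u z *s v)"
      using line_holomorphic_onD(1)[OF L(5)] u by (intro continuous_intros) auto
    then have "open (B1 \<inter> (\<lambda>z. z + \<sigma> u z *s v) -` (- X))"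
      using L(1) clX by (intro continuous_open_preimage) auto
    moreover have "y2 \<in> B1 \<inter> (\<lambda>z. z + \<sigma> u z *s v) -` (- X)" using u y2 by (auto simp: a_def fiber_def)
    ultimately show ?thesis by (intro exI[of _ "B1 \<inter> (\<lambda>z. z + \<sigma> u z *s v) -` (- X)"]) (auto simp: fiber_def)
  qed
  then obtain V where V: "\<And>u. u \<in> Z y1 - a y2 \<Longrightarrow> open (V u) \<and> y2 \<in> V u \<and> (\<forall>z\<in>V u \<inter> B1. \<sigma> u z \<notin> fiber X v z)"
    by metis
  define U where "U = B1 \<inter> (\<Inter>u\<in>Z y1 - a y2. V u)"
  have U: "open U" "y2 \<in> U" "U \<subseteq> B1"
    unfolding U_def using V L(1) y2 fin by (auto intro!: open_Int open_INT)
  \<comment> \<open>Roots outside X stay outside near \<open>y2\<close>, so the labels of the fiber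
    can only shrink; the minimality of their number at \<open>y2\<close> forbids it.\<close>
  have aeq: "a z = a y2" if z: "z \<in> T \<inter> U" for z
  proof -
    have "a z \<subseteq> a y2" using z V unfolding U_def a_def by blast
    moreover have "finite (a y2)" using fin by (simp add: a_def)
    moreover have "card (a y2) \<le> card (a z)" using y2(2) z U(3) by blast
    ultimately show ?thesis by (simp add: card_seteq)
  qed
  have A: "a y2 \<subseteq> Z y1" by (auto simp: a_def)
  show ?thesis
  proof (rule that[of y2 U "a y2" "\<lambda>u. ball u (r u)" \<sigma>])
    show "continuous_on (T \<inter> U) (\<sigma> u)" if "u \<in> a y2" for u
      by (rule continuous_on_subset[OF line_holomorphic_onD(1)[OF L(5)]]) (use that A U in auto)
    show "ball u (r u) \<inter> ball u' (r u') = {}" if "u \<in> a y2" "u' \<in> a y2" "u \<noteq> u'" for u u'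
      using L(6) that A by blast
    show "fiber X v z = (\<lambda>u. \<sigma> u z) ` a y2" if "z \<in> T \<inter> U" for z
      using fa[of z] aeq[OF that] that U(3) by auto
    show "\<sigma> u z \<in> ball u (r u)" if "z \<in> T \<inter> U" "u \<in> a y2" for z u
      using sig[of z] that A U(3) by blast
  qed (use y2 U in auto)
qed

text \<open>Multiplying out one factor \<rho>(a) - \<rho>(b) gives two sums of the same shape with
  one exponent raised. Without such factors the sum over tuples is a product of power sums.\<close>

lemma tuple_sum_holomorphic:
  fixes Z :: "complex \<Rightarrow> complex set" and w :: "complex \<Rightarrow> complex \<Rightarrow> nat" and M :: nat
  assumes fin: "\<And>x. x \<in> S \<Longrightarrow> finite (Z x)"
    and hol: "\<And>k. (\<lambda>x. \<Sum>t\<in>Z x. of_nat (w x t) * t ^ k) holomorphic_on S"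
    and L: "set L \<subseteq> {..<M} \<times> {..<M}"
  shows "(\<lambda>x. \<Sum>\<rho>\<in>PiE {..<M} (\<lambda>_. Z x). (\<Prod>a<M. of_nat (w x (\<rho> a)) * \<rho> a ^ k a) *
     prod_list (map (\<lambda>(a,b). \<rho> a - \<rho> b) L)) holomorphic_on S"
  using L
proof (induction L arbitrary: k)
  case Nil
  have "(\<Sum>\<rho>\<in>PiE {..<M} (\<lambda>_. Z x). \<Prod>a<M. of_nat (w x (\<rho> a)) * \<rho> a ^ k a) =
     (\<Prod>a<M. \<Sum>t\<in>Z x. of_nat (w x t) * t ^ k a)" if "x \<in> S" for x
    by (rule prod_sum_PiE[symmetric]) (use fin[OF that] in auto)
  moreover have "(\<lambda>x. \<Prod>a<M. \<Sum>t\<in>Z x. of_nat (w x t) * t ^ k a) holomorphic_on S"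
    by (intro holomorphic_intros hol)
  ultimately show ?case by (simp cong: holomorphic_cong)
next
  case (Cons ab L)
  obtain a b where ab: "ab = (a,b)" "a < M" "b < M" using Cons.prems by (cases ab) auto
  have pr: "(\<Prod>c<M. of_nat (w x (\<rho> c)) * \<rho> c ^ (k(a := Suc (k a))) c) =
      \<rho> a * (\<Prod>c<M. of_nat (w x (\<rho> c)) * \<rho> c ^ k c :: complex)" if "a < M" for a x \<rho>
  proof -
    have "(\<Prod>c<M. of_nat (w x (\<rho> c)) * \<rho> c ^ (k(a := Suc (k a))) c) =
        (\<Prod>c<M. (if c = a then \<rho> a else 1) * (of_nat (w x (\<rho> c)) * \<rho> c ^ k c))"
      by (rule prod.cong) auto
    also have "\<dots> = (\<Prod>c<M. if c = a then \<rho> a else 1) * (\<Prod>c<M. of_nat (w x (\<rho> c)) * \<rho> c ^ k c)"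
      by (rule prod.distrib)
    finally show ?thesis using that by simp
  qed
  let ?F = "\<lambda>k x. \<Sum>\<rho>\<in>PiE {..<M} (\<lambda>_. Z x). (\<Prod>a<M. of_nat (w x (\<rho> a)) * \<rho> a ^ k a) *
     prod_list (map (\<lambda>(a,b). \<rho> a - \<rho> b) L)"
  have "(\<lambda>x. ?F (k(a := Suc (k a))) x - ?F (k(b := Suc (k b))) x) holomorphic_on S"
    by (intro holomorphic_intros Cons.IH) (use Cons.prems in auto)
  moreover have "?F (k(a := Suc (k a))) x - ?F (k(b := Suc (k b))) x =
     (\<Sum>\<rho>\<in>PiE {..<M} (\<lambda>_. Z x). (\<Prod>a<M. of_nat (w x (\<rho> a)) * \<rho> a ^ k a) *
     prod_list (map (\<lambda>(a,b). \<rho> a - \<rho> b) (ab # L)))" for x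
    unfolding pr[OF ab(2)] pr[OF ab(3)] sum_subtractf[symmetric]
    by (rule sum.cong) (auto simp: ab(1) algebra_simps)
  ultimately show ?case by simp
qed

text \<open>The discriminant of the \<open>M\<close>-tuples of roots, which vanishes exactly where fewer than \<open>M\<close> roots are distinct.\<close>

lemma generic_card:
  fixes Z :: "complex \<Rightarrow> complex set" and w :: "complex \<Rightarrow> complex \<Rightarrow> nat"
  assumes "S \<noteq> {}" and fin: "\<And>\<zeta>. \<zeta> \<in> S \<Longrightarrow> finite (Z \<zeta>)" and N: "\<And>\<zeta>. \<zeta> \<in> S \<Longrightarrow> card (Z \<zeta>) \<le> N"
    and w: "\<And>\<zeta> t. \<zeta> \<in> S \<Longrightarrow> t \<in> Z \<zeta> \<Longrightarrow> w \<zeta> t > 0"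
    and hol: "\<And>k. (\<lambda>\<zeta>. \<Sum>t\<in>Z \<zeta>. of_nat (w \<zeta> t) * t ^ k) holomorphic_on S"
  shows "\<exists>M \<delta>. \<delta> holomorphic_on S \<and> (\<exists>\<zeta>\<in>S. \<delta> \<zeta> \<noteq> 0) \<and> (\<forall>\<zeta>\<in>S. \<delta> \<zeta> \<noteq> 0 \<longrightarrow> card (Z \<zeta>) = M)"
proof -
  obtain \<zeta>0 where "\<zeta>0 \<in> S" using assms(1) by blast
  have "\<exists>\<zeta>. \<zeta> \<in> S \<and> (\<forall>\<xi>. \<xi> \<in> S \<longrightarrow> card (Z \<xi>) \<le> card (Z \<zeta>))"
    by (rule Lattices_Big.ex_has_greatest_nat[where k=\<zeta>0 and b="Suc N"]) (use \<open>\<zeta>0 \<in> S\<close> N in \<open>auto simp: less_Suc_eq_le\<close>)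
  then obtain \<zeta>1 where \<zeta>1: "\<zeta>1 \<in> S" "\<And>\<xi>. \<xi> \<in> S \<Longrightarrow> card (Z \<xi>) \<le> card (Z \<zeta>1)" by blast
  define M where "M = card (Z \<zeta>1)"
  have "finite {(a,b). a < M \<and> b < M \<and> a \<noteq> b}"
    by (rule finite_subset[of _ "{..<M} \<times> {..<M}"]) auto
  \<comment> \<open>All ordered pairs are listed, so the product of differences is invariant under
    permuting the entries of a tuple.\<close>
  then obtain L where L: "set L = {(a,b). a < M \<and> b < M \<and> a \<noteq> b}" "distinct L"
    using finite_distinct_list by blast
  define \<delta> where "\<delta> \<zeta> = (\<Sum>\<rho>\<in>PiE {..<M} (\<lambda>_. Z \<zeta>). (\<Prod>a<M. of_nat (w \<zeta> (\<rho> a)) * \<rho> a ^ (0::nat)) *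
     prod_list (map (\<lambda>(a,b). \<rho> a - \<rho> b) L))" for \<zeta>
  have "\<delta> holomorphic_on S"
    unfolding \<delta>_def by (rule tuple_sum_holomorphic[OF fin hol, where k="\<lambda>_. 0"]) (use L in auto)
  have nin: "prod_list (map (\<lambda>(a,b). \<rho> a - \<rho> b) L) = 0" if "\<not> inj_on \<rho> {..<M}" for \<rho> :: "nat \<Rightarrow> complex"
  proof -
    obtain a b where "a < M" "b < M" "a \<noteq> b" "\<rho> a = \<rho> b" using \<open>\<not> inj_on \<rho> {..<M}\<close> by (auto simp: inj_on_def)
    then have "(a,b) \<in> set L" "(\<lambda>(a,b). \<rho> a - \<rho> b) (a,b) = 0" using L by auto
    then show ?thesis unfolding prod_list_zero_iff by (metis image_eqI set_map)
  qed
  have lt: "card (Z \<zeta>) = M" if \<zeta>: "\<zeta> \<in> S" "\<delta> \<zeta> \<noteq> 0" for \<zeta>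
  proof -
    obtain \<rho> where \<rho>: "\<rho> \<in> PiE {..<M} (\<lambda>_. Z \<zeta>)" "prod_list (map (\<lambda>(a,b). \<rho> a - \<rho> b) L) \<noteq> 0"
      using \<zeta>(2) unfolding \<delta>_def by (metis (no_types, lifting) mult_zero_right sum.neutral)
    then have "inj_on \<rho> {..<M}" using nin by blast
    then have "M \<le> card (Z \<zeta>)"
      using card_inj_on_le[of \<rho> "{..<M}" "Z \<zeta>"] \<rho>(1) fin[OF \<zeta>(1)] by (auto simp: PiE_iff)
    then show ?thesis using \<zeta>1(2)[OF \<zeta>(1)] by (simp add: M_def)
  qed
  \<comment> \<open>At a point with the maximal number \<open>M\<close> of roots the nonzero
    summands come from bijections onto the root set. By symmetry they all equal
    \<open>W * V\<close>, so nothing cancels.\<close>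
  have "\<delta> \<zeta>1 \<noteq> 0"
  proof -
    let ?Z = "Z \<zeta>1"
    note finZ = fin[OF \<zeta>1(1)]
    let ?P = "PiE {..<M} (\<lambda>_. ?Z)"
    let ?I = "{\<rho> \<in> ?P. inj_on \<rho> {..<M}}"
    define V where "V = (\<Prod>(x,y)\<in>{(x,y). x \<in> ?Z \<and> y \<in> ?Z \<and> x \<noteq> y}. x - y)"
    define W where "W = (\<Prod>t\<in>?Z. of_nat (w \<zeta>1 t) :: complex)"
    have fP: "finite ?P" using finZ by (intro finite_PiE) auto
    have val: "(\<Prod>a<M. of_nat (w \<zeta>1 (\<rho> a)) * \<rho> a ^ 0) * prod_list (map (\<lambda>(a,b). \<rho> a - \<rho> b) L) = W * V"
      if \<rho>: "\<rho> \<in> ?I" for \<rho>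
    proof -
      have "\<rho> ` {..<M} = ?Z"
        by (rule card_subset_eq[OF finZ]) (use \<rho> card_image[of \<rho> "{..<M}"] in \<open>auto simp: M_def PiE_iff\<close>)
      then have bij: "bij_betw \<rho> {..<M} ?Z" using \<rho> by (simp add: bij_betw_def)
      have 1: "(\<Prod>a<M. of_nat (w \<zeta>1 (\<rho> a)) :: complex) = W"
        unfolding W_def by (rule prod.reindex_bij_betw[OF bij])
      have bij2: "bij_betw (\<lambda>(a,b). (\<rho> a, \<rho> b)) {(a,b). a < M \<and> b < M \<and> a \<noteq> b} {(x,y). x \<in> ?Z \<and> y \<in> ?Z \<and> x \<noteq> y}"
        unfolding bij_betw_def
      proof
        have inj: "\<And>a b. a < M \<Longrightarrow> b < M \<Longrightarrow> \<rho> a = \<rho> b \<Longrightarrow> a = b" using bij by (auto simp: bij_betw_def inj_on_def)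
        then show "inj_on (\<lambda>(a,b). (\<rho> a, \<rho> b)) {(a,b). a < M \<and> b < M \<and> a \<noteq> b}" by (auto simp: inj_on_def)
        have im: "\<And>a. a < M \<Longrightarrow> \<rho> a \<in> ?Z" "\<And>x. x \<in> ?Z \<Longrightarrow> \<exists>a<M. x = \<rho> a" using bij by (auto simp: bij_betw_def)
        show "(\<lambda>(a,b). (\<rho> a, \<rho> b)) ` {(a,b). a < M \<and> b < M \<and> a \<noteq> b} = {(x,y). x \<in> ?Z \<and> y \<in> ?Z \<and> x \<noteq> y}"
        proof (intro equalityI subsetI)
          fix q assume "q \<in> {(x,y). x \<in> ?Z \<and> y \<in> ?Z \<and> x \<noteq> y}"
          then obtain a b where "a < M" "b < M" "q = (\<rho> a, \<rho> b)" "\<rho> a \<noteq> \<rho> b" using im(2) by blast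
          then show "q \<in> (\<lambda>(a,b). (\<rho> a, \<rho> b)) ` {(a,b). a < M \<and> b < M \<and> a \<noteq> b}" by (intro image_eqI[of _ _ "(a,b)"]) auto
        qed (use inj im(1) in auto)
      qed
      have "prod_list (map (\<lambda>(a,b). \<rho> a - \<rho> b) L) = (\<Prod>(a,b)\<in>set L. \<rho> a - \<rho> b)"
        using L(2) by (simp add: prod.distinct_set_conv_list)
      also have "\<dots> = (\<Prod>q\<in>{(a,b). a < M \<and> b < M \<and> a \<noteq> b}. (\<lambda>(x,y). x - y) ((\<lambda>(a,b). (\<rho> a, \<rho> b)) q))"
        unfolding L(1) by (rule prod.cong) auto
      also have "\<dots> = V" unfolding V_def by (rule prod.reindex_bij_betw[OF bij2])
      finally show ?thesis using 1 by simp
    qed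
    have "\<delta> \<zeta>1 = (\<Sum>\<rho>\<in>?I. (\<Prod>a<M. of_nat (w \<zeta>1 (\<rho> a)) * \<rho> a ^ 0) * prod_list (map (\<lambda>(a,b). \<rho> a - \<rho> b) L))"
      unfolding \<delta>_def by (rule sum.mono_neutral_right[OF fP]) (use nin in auto)
    also have "\<dots> = (\<Sum>\<rho>\<in>?I. W * V)" by (rule sum.cong[OF refl val])
    finally have eq: "\<delta> \<zeta>1 = of_nat (card ?I) * (W * V)" by simp
    have "W \<noteq> 0" unfolding W_def using finZ w[OF \<zeta>1(1)] by (auto simp: prod_zero_iff)
    moreover have "V \<noteq> 0"
    proof -
      have "finite {(x,y). x \<in> ?Z \<and> y \<in> ?Z \<and> x \<noteq> y}"
        by (rule finite_subset[of _ "?Z \<times> ?Z"]) (use finZ in auto)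
      then show ?thesis unfolding V_def by (auto simp: prod_zero_iff)
    qed
    moreover have "?I \<noteq> {}"
    proof -
      obtain h where h: "bij_betw h {..<M} ?Z" using finZ by (metis M_def ex_bij_betw_nat_finite lessThan_atLeast0)
      have "restrict h {..<M} \<in> ?I" using h by (auto simp: bij_betw_def inj_on_def)
      then show ?thesis by blast
    qed
    then have "card ?I \<noteq> 0" using fP by simp
    ultimately show ?thesis unfolding eq by simp
  qed
  then show ?thesis using \<open>\<delta> holomorphic_on S\<close> lt \<zeta>1(1) by blast
qed

section \<open>Hypersurfaces with fibers of linear growth\<close>

text \<open>Openness moves each fiber point a little, and disjoint neighbourhoods keep the moved
  points distinct.\<close>

lemma fiber_near:
  fixes v :: "complex^'n"
  assumes Y: "locally_analytic Y" "fiber_growth Y v" "thick Y v" and "\<epsilon> > 0"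
  shows "\<exists>\<delta>>0. \<forall>z\<in>ball z0 \<delta>. \<exists>p. (\<forall>t\<in>fiber Y v z0. p t \<in> ball t \<epsilon>) \<and> inj_on p (fiber Y v z0) \<and>
     p ` fiber Y v z0 \<subseteq> fiber Y v z"
proof -
  let ?T = "fiber Y v z0"
  have fin: "finite ?T" by (rule fiber_finite[OF Y(1,2)])
  obtain e where e: "e > 0" "\<And>s t. s \<in> ?T \<Longrightarrow> t \<in> ?T \<Longrightarrow> s \<noteq> t \<Longrightarrow> ball s e \<inter> ball t e = {}"
    using finite_separation[OF fin] by blast
  have "min e \<epsilon> > 0" using e \<open>\<epsilon> > 0\<close> by simp
  then have "\<forall>t\<in>?T. \<exists>\<delta>>0. \<forall>z\<in>ball z0 \<delta>. \<exists>s\<in>ball t (min e \<epsilon>). s \<in> fiber Y v z"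
    using fiber_open[OF Y] by blast
  then obtain d where d: "\<forall>t\<in>?T. d t > 0 \<and> (\<forall>z\<in>ball z0 (d t). \<exists>s\<in>ball t (min e \<epsilon>). s \<in> fiber Y v z)"
    unfolding bchoice_iff by blast
  define \<delta> where "\<delta> = Min (insert 1 (d ` ?T))"
  have \<delta>: "\<delta> > 0" "\<And>t. t \<in> ?T \<Longrightarrow> \<delta> \<le> d t" using fin d by (auto simp: \<delta>_def)
  have "\<exists>p. (\<forall>t\<in>?T. p t \<in> ball t \<epsilon>) \<and> inj_on p ?T \<and> p ` ?T \<subseteq> fiber Y v z" if z: "z \<in> ball z0 \<delta>" for z
  proof -
    have "\<forall>t\<in>?T. \<exists>s. s \<in> ball t (min e \<epsilon>) \<and> s \<in> fiber Y v z"
    proof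
      fix t assume t: "t \<in> ?T"
      then have "z \<in> ball z0 (d t)" using \<delta>(2)[OF t] z by simp
      then show "\<exists>s. s \<in> ball t (min e \<epsilon>) \<and> s \<in> fiber Y v z" using d t by blast
    qed
    then obtain p where p: "\<forall>t\<in>?T. p t \<in> ball t (min e \<epsilon>) \<and> p t \<in> fiber Y v z" unfolding bchoice_iff by blast
    have "inj_on p ?T"
    proof (rule inj_onI, rule ccontr)
      fix s t assume st: "s \<in> ?T" "t \<in> ?T" "p s = p t" "s \<noteq> t"
      then have "p s \<in> ball s e \<inter> ball t e" using p by auto
      then show False using e(2) st by blast
    qed
    then show ?thesis using p by (intro exI[of _ p]) auto
  qed
  then show ?thesis using \<delta>(1) by blast
qed

lemma fiber_card_lower:
  fixes v :: "complex^'n"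
  assumes Y: "locally_analytic Y" "fiber_growth Y v" "thick Y v"
  shows "\<exists>\<delta>>0. \<forall>z\<in>ball z0 \<delta>. card (fiber Y v z0) \<le> card (fiber Y v z)"
proof -
  obtain \<delta> where \<delta>: "\<delta> > 0" "\<forall>z\<in>ball z0 \<delta>. \<exists>p. (\<forall>t\<in>fiber Y v z0. p t \<in> ball t 1) \<and> inj_on p (fiber Y v z0) \<and>
     p ` fiber Y v z0 \<subseteq> fiber Y v z"
    using fiber_near[OF Y zero_less_one, of z0] by blast
  have "card (fiber Y v z0) \<le> card (fiber Y v z)" if z: "z \<in> ball z0 \<delta>" for z
  proof -
    obtain p where "inj_on p (fiber Y v z0)" "p ` fiber Y v z0 \<subseteq> fiber Y v z" using \<delta>(2) z by blast
    then show ?thesis by (rule card_inj_on_le) (rule fiber_finite[OF Y(1,2)])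
  qed
  then show ?thesis using \<delta>(1) by blast
qed

lemma prod_near:
  fixes f :: "'a \<Rightarrow> complex"
  assumes "finite T" "\<eta> > 0"
  shows "\<exists>\<epsilon>>0. \<forall>p. (\<forall>t\<in>T. dist (p t) (f t) < \<epsilon>) \<longrightarrow> dist (\<Prod>t\<in>T. p t) (\<Prod>t\<in>T. f t) < \<eta>"
  using assms
proof (induction T arbitrary: \<eta> rule: finite_induct)
  case empty
  then show ?case by (intro exI[of _ 1]) auto
next
  case (insert x T)
  let ?y = "\<Prod>t\<in>T. f t"
  have "isCont (\<lambda>q. fst q * snd q) (f x, ?y)" by (intro continuous_intros)
  then obtain d where d: "d > 0" "\<And>q. dist q (f x, ?y) < d \<Longrightarrow> dist (fst q * snd q) (f x * ?y) < \<eta>"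
    using \<open>\<eta> > 0\<close> unfolding continuous_at_eps_delta by auto
  obtain \<epsilon> where \<epsilon>: "\<epsilon> > 0" "\<And>p. (\<forall>t\<in>T. dist (p t) (f t) < \<epsilon>) \<Longrightarrow> dist (\<Prod>t\<in>T. p t) ?y < d / 2"
    using insert.IH[of "d / 2"] d(1) by auto
  have "dist (\<Prod>t\<in>insert x T. p t) (\<Prod>t\<in>insert x T. f t) < \<eta>" if p: "\<forall>t\<in>insert x T. dist (p t) (f t) < min \<epsilon> (d / 2)" for p
  proof -
    have 1: "dist (p x) (f x) < d / 2" "dist (\<Prod>t\<in>T. p t) ?y < d / 2" using p \<epsilon>(2) by auto
    have "dist (p x, \<Prod>t\<in>T. p t) (f x, ?y) \<le> dist (p x) (f x) + dist (\<Prod>t\<in>T. p t) ?y"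
      unfolding dist_Pair_Pair by (rule sqrt_sum_squares_le_sum) auto
    then have "dist (p x, \<Prod>t\<in>T. p t) (f x, ?y) < d" using 1 by linarith
    from d(2)[OF this] show ?thesis using insert.hyps by simp
  qed
  then show ?case using \<epsilon>(1) d(1) by (intro exI[of _ "min \<epsilon> (d / 2)"]) auto
qed

text \<open>Where the number of fiber points does not grow, the injection from the old fiber into
  the new one is a bijection, so the products are close.\<close>

lemma fiber_prod_near:
  fixes v :: "complex^'n"
  assumes Y: "locally_analytic Y" "fiber_growth Y v" "thick Y v" and "\<eta> > 0"
  shows "\<exists>\<delta>>0. \<forall>z\<in>ball z0 \<delta>. card (fiber Y v z) \<le> card (fiber Y v z0) \<longrightarrow>
     dist (\<Prod>(fiber Y v z)) (\<Prod>(fiber Y v z0)) < \<eta>"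
proof -
  let ?T = "fiber Y v z0"
  have fin: "finite ?T" by (rule fiber_finite[OF Y(1,2)])
  obtain \<epsilon> where \<epsilon>: "\<epsilon> > 0" "\<And>p. (\<forall>t\<in>?T. dist (p t) t < \<epsilon>) \<Longrightarrow> dist (\<Prod>t\<in>?T. p t) (\<Prod>t\<in>?T. t) < \<eta>"
    using prod_near[OF fin \<open>\<eta> > 0\<close>, of "\<lambda>t. t"] by blast
  obtain \<delta> where \<delta>: "\<delta> > 0" "\<And>z. z \<in> ball z0 \<delta> \<Longrightarrow> \<exists>p. (\<forall>t\<in>?T. p t \<in> ball t \<epsilon>) \<and> inj_on p ?T \<and> p ` ?T \<subseteq> fiber Y v z"
    using fiber_near[OF Y \<epsilon>(1), of z0] by blast
  have "dist (\<Prod>(fiber Y v z)) (\<Prod>?T) < \<eta>" if z: "z \<in> ball z0 \<delta>" "card (fiber Y v z) \<le> card ?T" for z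
  proof -
    obtain p where p: "\<forall>t\<in>?T. p t \<in> ball t \<epsilon>" "inj_on p ?T" "p ` ?T \<subseteq> fiber Y v z" using \<delta>(2)[OF z(1)] by blast
    have "p ` ?T = fiber Y v z"
      by (rule card_seteq[OF fiber_finite[OF Y(1,2)] p(3)]) (use z(2) card_image[OF p(2)] in simp)
    then have "\<Prod>(fiber Y v z) = (\<Prod>t\<in>?T. p t)" using prod.reindex[OF p(2), of "\<lambda>x. x"] by simp
    then show ?thesis using \<epsilon>(2)[of p] p(1) by (simp add: dist_commute)
  qed
  then show ?thesis using \<delta>(1) by blast
qed

text \<open>Where the roots number no more than over \<open>z1\<close>, they are given by
  holomorphic functions \<open>\<sigma> x\<close>. A root in the fiber remains in it by openness of
  the projection, a root outside remains outside because Y is closed; so the fiber is a fixed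
  selection of these functions.\<close>

lemma fiber_locally_constant:
  fixes v :: "complex^'n"
  assumes Y: "locally_analytic Y" "fiber_growth Y v" "thick Y v"
    and rs: "root_system B Z w" "\<And>z. z \<in> B \<Longrightarrow> fiber Y v z \<subseteq> Z z" and z1: "z1 \<in> B"
  obtains B2 \<sigma> where "open B2" "z1 \<in> B2" "B2 \<subseteq> B" "\<And>x. x \<in> fiber Y v z1 \<Longrightarrow> line_holomorphic_on (\<sigma> x) B2"
    "\<And>z. z \<in> B2 \<Longrightarrow> card (Z z) \<le> card (Z z1) \<Longrightarrow>
       inj_on (\<lambda>x. \<sigma> x z) (fiber Y v z1) \<and> fiber Y v z = (\<lambda>x. \<sigma> x z) ` fiber Y v z1"
proof -
  have clY: "closed Y" using Y unfolding locally_analytic_def by blast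
  obtain r B1 \<sigma> where L: "open B1" "z1 \<in> B1" "B1 \<subseteq> B" "\<And>x. x \<in> Z z1 \<Longrightarrow> r x > 0"
    "\<And>x. x \<in> Z z1 \<Longrightarrow> line_holomorphic_on (\<sigma> x) B1"
    "\<And>x x'. x \<in> Z z1 \<Longrightarrow> x' \<in> Z z1 \<Longrightarrow> x \<noteq> x' \<Longrightarrow> ball x (r x) \<inter> ball x' (r x') = {}"
    "\<And>z. z \<in> B1 \<Longrightarrow> card (Z z) \<le> card (Z z1) \<Longrightarrow>
        (\<forall>x\<in>Z z1. \<sigma> x z \<in> ball x (r x)) \<and> Z z = (\<lambda>x. \<sigma> x z) ` Z z1"
    by (rule root_system_local[OF rs(1) z1]) (rule that; assumption)
  let ?T = "fiber Y v z1"
  have fin: "finite (Z z1)" using root_systemD(2)[OF rs(1) z1] .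
  have TZ: "?T \<subseteq> Z z1" using rs(2) z1 .
  have s1: "\<sigma> x z1 = x" if x: "x \<in> Z z1" for x
  proof -
    have *: "\<forall>x\<in>Z z1. \<sigma> x z1 \<in> ball x (r x)" "Z z1 = (\<lambda>x. \<sigma> x z1) ` Z z1" using L(7)[OF L(2)] by auto
    then obtain x' where x': "x' \<in> Z z1" "x = \<sigma> x' z1" using x by blast
    then have "x \<in> ball x (r x) \<inter> ball x' (r x')" using * L(4)[OF x] by auto
    then have "x = x'" using L(6)[OF x x'(1)] by blast
    then show ?thesis using x' by simp
  qed
  have "\<forall>x\<in>Z z1. \<exists>V. open V \<and> z1 \<in> V \<and> (\<forall>z\<in>V \<inter> B1. card (Z z) \<le> card (Z z1) \<longrightarrow> (\<sigma> x z \<in> fiber Y v z \<longleftrightarrow> x \<in> ?T))"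
  proof
    fix x assume x: "x \<in> Z z1"
    show "\<exists>V. open V \<and> z1 \<in> V \<and> (\<forall>z\<in>V \<inter> B1. card (Z z) \<le> card (Z z1) \<longrightarrow> (\<sigma> x z \<in> fiber Y v z \<longleftrightarrow> x \<in> ?T))"
    proof (cases "x \<in> ?T")
      case True
      obtain \<delta> where \<delta>: "\<delta> > 0" "\<And>z. z \<in> ball z1 \<delta> \<Longrightarrow> \<exists>t\<in>ball x (r x). t \<in> fiber Y v z"
        using fiber_open[OF Y True L(4)[OF x]] by blast
      have "\<sigma> x z \<in> fiber Y v z" if z: "z \<in> ball z1 \<delta> \<inter> B1" "card (Z z) \<le> card (Z z1)" for z
      proof -
        obtain t where t: "t \<in> ball x (r x)" "t \<in> fiber Y v z" using \<delta>(2) z by blast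
        have "t \<in> Z z" using rs(2)[of z] L(3) z t by blast
        then obtain x' where x': "x' \<in> Z z1" "t = \<sigma> x' z" using L(7)[of z] z by auto
        then have "t \<in> ball x' (r x')" using L(7)[of z] z by blast
        then have "x' = x" using L(6)[OF x'(1) x] t(1) by blast
        then show ?thesis using t(2) x'(2) by simp
      qed
      then show ?thesis using True \<delta>(1) by (intro exI[of _ "ball z1 \<delta>"]) auto
    next
      case False
      have "continuous_on B1 (\<lambda>z. z + \<sigma> x z *s v)"
        using line_holomorphic_onD(1)[OF L(5)[OF x]] by (intro continuous_intros)
      then have "open (B1 \<inter> (\<lambda>z. z + \<sigma> x z *s v) -` (- Y))"
        using L(1) clY by (intro continuous_open_preimage) auto
      moreover have "z1 \<in> B1 \<inter> (\<lambda>z. z + \<sigma> x z *s v) -` (- Y)"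
        using False L(2) s1[OF x] by (simp add: fiber_def)
      ultimately show ?thesis using False
        by (intro exI[of _ "B1 \<inter> (\<lambda>z. z + \<sigma> x z *s v) -` (- Y)"]) (auto simp: fiber_def)
    qed
  qed
  then obtain V where V: "\<forall>x\<in>Z z1. open (V x) \<and> z1 \<in> V x \<and>
      (\<forall>z\<in>V x \<inter> B1. card (Z z) \<le> card (Z z1) \<longrightarrow> (\<sigma> x z \<in> fiber Y v z \<longleftrightarrow> x \<in> ?T))"
    unfolding bchoice_iff by blast
  define B2 where "B2 = B1 \<inter> (\<Inter>x\<in>Z z1. V x)"
  have B2: "open B2" "z1 \<in> B2" "B2 \<subseteq> B1" "\<And>x. x \<in> Z z1 \<Longrightarrow> B2 \<subseteq> V x"
    unfolding B2_def using V L(1,2) fin by (auto intro!: open_Int open_INT)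
  show ?thesis
  proof (rule that[OF B2(1,2)])
    show "B2 \<subseteq> B" using B2 L by blast
    show "line_holomorphic_on (\<sigma> x) B2" if "x \<in> ?T" for x
      by (rule line_holomorphic_on_subset[OF L(5) B2(3)]) (use that TZ in blast)
    fix z assume z: "z \<in> B2" "card (Z z) \<le> card (Z z1)"
    have zB1: "z \<in> B1" using z B2 by blast
    note Lz = L(7)[OF zB1 z(2)]
    have inj: "inj_on (\<lambda>x. \<sigma> x z) (Z z1)"
    proof (rule inj_onI, rule ccontr)
      fix s t assume st: "s \<in> Z z1" "t \<in> Z z1" "\<sigma> s z = \<sigma> t z" "s \<noteq> t"
      have "\<sigma> s z \<in> ball s (r s)" "\<sigma> t z \<in> ball t (r t)" using Lz st(1,2) by blast+
      then show False using L(6)[OF st(1,2,4)] st(3) by auto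
    qed
    have sig: "\<sigma> x z \<in> fiber Y v z \<longleftrightarrow> x \<in> ?T" if "x \<in> Z z1" for x
      using V that z zB1 B2(4)[OF that] by blast
    have "fiber Y v z \<subseteq> Z z" using rs(2) L(3) zB1 by blast
    then have "fiber Y v z = (\<lambda>x. \<sigma> x z) ` ?T"
      using Lz sig TZ by (auto simp: image_iff subset_iff)
    then show "inj_on (\<lambda>x. \<sigma> x z) ?T \<and> fiber Y v z = (\<lambda>x. \<sigma> x z) ` ?T"
      using inj_on_subset[OF inj TZ] by blast
  qed
qed

lemma isCont_eventually_eq:
  assumes "eventually (\<lambda>x. f x = f a) (nhds a)" shows "isCont f a"
  using assms unfolding isCont_def by (intro tendsto_eventually) (simp add: eventually_nhds_conv_at)

text \<open>On a line the discriminant vanishes at most at isolated points, so the root number is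
  constant on a punctured disc. There the fibers are locally given by holomorphic functions, and
  connectedness of the punctured disc makes their number constant.\<close>

lemma fiber_generic_on_line:
  fixes v :: "complex^'n"
  assumes Y: "locally_analytic Y" "fiber_growth Y v" "thick Y v"
  shows "\<exists>\<rho>>0. \<exists>m. (\<forall>\<zeta>\<in>ball 0 \<rho> - {0}. card (fiber Y v (z0 + \<zeta> *s u)) = m) \<and>
     (\<lambda>\<zeta>. \<Prod>(fiber Y v (z0 + \<zeta> *s u))) holomorphic_on (ball 0 \<rho> - {0}) \<and> card (fiber Y v z0) \<le> m"
proof -
  obtain d Z w where d: "d > 0" and rs: "root_system (ball z0 d) Z w"
    and sub: "\<And>z. z \<in> ball z0 d \<Longrightarrow> fiber Y v z \<subseteq> Z z"
    using root_system_exists[OF Y(1,2), of z0] by blast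
  obtain N where N: "\<And>z. z \<in> ball z0 d \<Longrightarrow> card (Z z) \<le> N"
    using root_system_card_bounded[OF rs connected_ball] by blast
  have "0 \<in> {\<zeta>. z0 + \<zeta> *s u \<in> ball z0 d}" using d by simp
  from openE[OF open_line_preimage[OF open_ball] this] obtain \<rho>0 where \<rho>0: "\<rho>0 > 0"
    "ball 0 \<rho>0 \<subseteq> {\<zeta>. z0 + \<zeta> *s u \<in> ball z0 d}" by blast
  have inB: "z0 + \<zeta> *s u \<in> ball z0 d" if "\<zeta> \<in> ball 0 \<rho>0" for \<zeta> using that \<rho>0 by blast
  have "\<exists>M \<delta>. \<delta> holomorphic_on ball 0 \<rho>0 \<and> (\<exists>\<zeta>\<in>ball 0 \<rho>0. \<delta> \<zeta> \<noteq> 0) \<and>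
      (\<forall>\<zeta>\<in>ball 0 \<rho>0. \<delta> \<zeta> \<noteq> 0 \<longrightarrow> card (Z (z0 + \<zeta> *s u)) = M)"
  proof (rule generic_card[where w="\<lambda>\<zeta>. w (z0 + \<zeta> *s u)" and N=N])
    show "(\<lambda>\<zeta>. \<Sum>t\<in>Z (z0 + \<zeta> *s u). of_nat (w (z0 + \<zeta> *s u) t) * t ^ k) holomorphic_on ball 0 \<rho>0" for k
      using line_holomorphic_onD(2)[OF root_systemD(4)[OF rs, of k]] holomorphic_on_subset[OF _ \<rho>0(2)] by blast
  qed (use \<rho>0 inB root_systemD(2,3)[OF rs] N in auto)
  then obtain M \<delta> where \<delta>: "\<delta> holomorphic_on ball 0 \<rho>0" "\<exists>\<zeta>\<in>ball 0 \<rho>0. \<delta> \<zeta> \<noteq> 0"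
    "\<And>\<zeta>. \<zeta> \<in> ball 0 \<rho>0 \<Longrightarrow> \<delta> \<zeta> \<noteq> 0 \<Longrightarrow> card (Z (z0 + \<zeta> *s u)) = M" by blast
  obtain \<beta> where \<beta>: "\<beta> \<in> ball 0 \<rho>0" "\<delta> \<beta> \<noteq> 0" using \<delta>(2) by blast
  have "eventually (\<lambda>\<zeta>. \<delta> \<zeta> \<noteq> 0) (at 0)"
    by (rule non_zero_neighbour_alt[OF \<delta>(1) open_ball connected_ball _ \<beta>, THEN eventually_mono]) (use \<rho>0 in auto)
  then obtain \<rho>1 where \<rho>1: "\<rho>1 > 0" "\<And>\<zeta>. \<zeta> \<noteq> 0 \<Longrightarrow> dist \<zeta> 0 < \<rho>1 \<Longrightarrow> \<delta> \<zeta> \<noteq> 0"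
    unfolding eventually_at by auto
  define \<rho> where "\<rho> = min \<rho>0 \<rho>1"
  have \<rho>: "\<rho> > 0" using \<rho>0 \<rho>1 by (simp add: \<rho>_def)
  let ?S = "ball 0 \<rho> - {0::complex}"
  have cM: "card (Z (z0 + \<zeta> *s u)) = M" and inB': "z0 + \<zeta> *s u \<in> ball z0 d" if "\<zeta> \<in> ?S" for \<zeta>
    using that \<delta>(3)[of \<zeta>] \<rho>1(2)[of \<zeta>] inB[of \<zeta>] by (auto simp: \<rho>_def)
  have opS: "open ?S" by (simp add: open_delete)
  have loc: "\<exists>e>0. ball \<zeta>1 e \<subseteq> ?S \<and> (\<forall>\<zeta>\<in>ball \<zeta>1 e. card (fiber Y v (z0 + \<zeta> *s u)) = card (fiber Y v (z0 + \<zeta>1 *s u))) \<and>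
      (\<lambda>\<zeta>. \<Prod>(fiber Y v (z0 + \<zeta> *s u))) holomorphic_on ball \<zeta>1 e" if \<zeta>1: "\<zeta>1 \<in> ?S" for \<zeta>1
  proof -
    let ?z1 = "z0 + \<zeta>1 *s u"
    obtain B2 \<sigma> where B2: "open B2" "?z1 \<in> B2" "B2 \<subseteq> ball z0 d" "\<And>y. y \<in> fiber Y v ?z1 \<Longrightarrow> line_holomorphic_on (\<sigma> y) B2"
      "\<And>z. z \<in> B2 \<Longrightarrow> card (Z z) \<le> card (Z ?z1) \<Longrightarrow>
         inj_on (\<lambda>y. \<sigma> y z) (fiber Y v ?z1) \<and> fiber Y v z = (\<lambda>y. \<sigma> y z) ` fiber Y v ?z1"
      by (rule fiber_locally_constant[OF Y rs sub inB'[OF \<zeta>1]]) (assumption | (rule that; assumption))+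
    have "open (?S \<inter> {\<zeta>. z0 + \<zeta> *s u \<in> B2})" using opS open_line_preimage[OF B2(1)] by blast
    moreover have "\<zeta>1 \<in> ?S \<inter> {\<zeta>. z0 + \<zeta> *s u \<in> B2}" using \<zeta>1 B2(2) by blast
    ultimately obtain e where e: "e > 0" "ball \<zeta>1 e \<subseteq> ?S \<inter> {\<zeta>. z0 + \<zeta> *s u \<in> B2}" by (meson openE)
    have f: "inj_on (\<lambda>y. \<sigma> y (z0 + \<zeta> *s u)) (fiber Y v ?z1) \<and>
        fiber Y v (z0 + \<zeta> *s u) = (\<lambda>y. \<sigma> y (z0 + \<zeta> *s u)) ` fiber Y v ?z1" if "\<zeta> \<in> ball \<zeta>1 e" for \<zeta>
    proof (rule B2(5))
      have "\<zeta> \<in> ?S" using that e by blast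
      then show "card (Z (z0 + \<zeta> *s u)) \<le> card (Z ?z1)" using cM \<zeta>1 by simp
    qed (use that e in blast)
    have "card (fiber Y v (z0 + \<zeta> *s u)) = card (fiber Y v ?z1)" if "\<zeta> \<in> ball \<zeta>1 e" for \<zeta>
      using f[OF that] card_image by metis
    moreover have "(\<lambda>\<zeta>. \<Prod>(fiber Y v (z0 + \<zeta> *s u))) holomorphic_on ball \<zeta>1 e"
    proof -
      have "(\<lambda>\<zeta>. \<Prod>y\<in>fiber Y v ?z1. \<sigma> y (z0 + \<zeta> *s u)) holomorphic_on ball \<zeta>1 e"
        by (intro holomorphic_on_prod holomorphic_on_subset[OF line_holomorphic_onD(2)[OF B2(4)]]) (use e in auto)
      moreover have "(\<Prod>y\<in>fiber Y v ?z1. \<sigma> y (z0 + \<zeta> *s u)) = \<Prod>(fiber Y v (z0 + \<zeta> *s u))" if "\<zeta> \<in> ball \<zeta>1 e" for \<zeta>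
        using f[OF that] prod.reindex[of "\<lambda>y. \<sigma> y (z0 + \<zeta> *s u)" "fiber Y v ?z1" "\<lambda>x. x"] by simp
      ultimately show ?thesis by (rule holomorphic_transform)
    qed
    ultimately show ?thesis using e by blast
  qed
  have cont: "continuous_on ?S (\<lambda>\<zeta>. of_nat (card (fiber Y v (z0 + \<zeta> *s u))) :: complex)"
    unfolding continuous_on_eq_continuous_at[OF opS]
  proof
    fix \<zeta>1 assume "\<zeta>1 \<in> ?S"
    from loc[OF this] obtain e where e: "e > 0" "\<forall>\<zeta>\<in>ball \<zeta>1 e. card (fiber Y v (z0 + \<zeta> *s u)) = card (fiber Y v (z0 + \<zeta>1 *s u))" by blast
    have "eventually (\<lambda>\<zeta>. \<zeta> \<in> ball \<zeta>1 e) (nhds \<zeta>1)" using e(1) by (intro eventually_nhds_in_open) auto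
    then have "eventually (\<lambda>\<zeta>. of_nat (card (fiber Y v (z0 + \<zeta> *s u))) = (of_nat (card (fiber Y v (z0 + \<zeta>1 *s u))) :: complex)) (nhds \<zeta>1)"
      by eventually_elim (use e(2) in simp)
    then show "isCont (\<lambda>\<zeta>. of_nat (card (fiber Y v (z0 + \<zeta> *s u))) :: complex) \<zeta>1"
      by (rule isCont_eventually_eq)
  qed
  have "connected ?S" by (rule connected_punctured_ball) simp
  from connected_of_nat_constant[OF this cont] obtain m where m: "\<And>\<zeta>. \<zeta> \<in> ?S \<Longrightarrow> card (fiber Y v (z0 + \<zeta> *s u)) = m" by blast
  have hol: "(\<lambda>\<zeta>. \<Prod>(fiber Y v (z0 + \<zeta> *s u))) holomorphic_on ?S"
    unfolding holomorphic_on_def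
  proof
    fix \<zeta>1 assume "\<zeta>1 \<in> ?S"
    from loc[OF this] obtain e where e: "e > 0" "(\<lambda>\<zeta>. \<Prod>(fiber Y v (z0 + \<zeta> *s u))) holomorphic_on ball \<zeta>1 e" by blast
    have "(\<lambda>\<zeta>. \<Prod>(fiber Y v (z0 + \<zeta> *s u))) field_differentiable at \<zeta>1"
      by (rule holomorphic_on_imp_differentiable_at[OF e(2)]) (use e in auto)
    then show "(\<lambda>\<zeta>. \<Prod>(fiber Y v (z0 + \<zeta> *s u))) field_differentiable at \<zeta>1 within ?S"
      by (rule field_differentiable_at_within)
  qed
  obtain \<delta>' where \<delta>': "\<delta>' > 0" "\<And>z. z \<in> ball z0 \<delta>' \<Longrightarrow> card (fiber Y v z0) \<le> card (fiber Y v z)"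
    using fiber_card_lower[OF Y] by blast
  have "0 \<in> {\<zeta>. z0 + \<zeta> *s u \<in> ball z0 \<delta>'}" using \<delta>' by simp
  from openE[OF open_line_preimage[OF open_ball] this] obtain \<rho>2 where \<rho>2: "\<rho>2 > 0"
    "ball 0 \<rho>2 \<subseteq> {\<zeta>. z0 + \<zeta> *s u \<in> ball z0 \<delta>'}" by blast
  define s where "s = min \<rho> \<rho>2 / 2"
  have s: "0 < s" "s < \<rho>" "s < \<rho>2" using \<rho> \<rho>2(1) by (auto simp: s_def)
  let ?\<zeta> = "of_real s :: complex"
  have "?\<zeta> \<in> ?S" "?\<zeta> \<in> ball 0 \<rho>2" using s by auto
  then have "card (fiber Y v z0) \<le> m" using m[of ?\<zeta>] \<delta>'(2) \<rho>2(2) by blast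
  then show ?thesis using \<rho> m hol by blast
qed

text \<open>Neighbouring punctured discs overlap, so the generic number is locally constant along
  the line and hence constant.\<close>

lemma fiber_card_on_line:
  fixes v :: "complex^'n"
  assumes Y: "locally_analytic Y" "fiber_growth Y v" "thick Y v"
  obtains m where "\<And>\<zeta>0. card (fiber Y v (z + \<zeta>0 *s u)) \<le> m"
    "\<And>\<zeta>0. \<exists>\<rho>>0. (\<forall>\<zeta>\<in>ball \<zeta>0 \<rho> - {\<zeta>0}. card (fiber Y v (z + \<zeta> *s u)) = m) \<and>
     (\<lambda>\<zeta>. \<Prod>(fiber Y v (z + \<zeta> *s u))) holomorphic_on (ball \<zeta>0 \<rho> - {\<zeta>0})"
proof -
  let ?f = "\<lambda>\<zeta>. fiber Y v (z + \<zeta> *s u)"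
  have "\<exists>\<rho> m. \<rho> > 0 \<and> (\<forall>\<zeta>\<in>ball \<zeta>0 \<rho> - {\<zeta>0}. card (?f \<zeta>) = m) \<and>
     (\<lambda>\<zeta>. \<Prod>(?f \<zeta>)) holomorphic_on (ball \<zeta>0 \<rho> - {\<zeta>0}) \<and> card (?f \<zeta>0) \<le> m" for \<zeta>0
  proof -
    obtain \<rho> m where g: "\<rho> > 0" "\<forall>\<zeta>\<in>ball 0 \<rho> - {0}. card (fiber Y v ((z + \<zeta>0 *s u) + \<zeta> *s u)) = m"
      "(\<lambda>\<zeta>. \<Prod>(fiber Y v ((z + \<zeta>0 *s u) + \<zeta> *s u))) holomorphic_on (ball 0 \<rho> - {0})" "card (?f \<zeta>0) \<le> m"
      using fiber_generic_on_line[OF Y, of "z + \<zeta>0 *s u" u] by blast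
    have eq: "(z + \<zeta>0 *s u) + (\<zeta> - \<zeta>0) *s u = z + \<zeta> *s u" for \<zeta>
      by (simp add: vec_eq_iff algebra_simps)
    have shift: "\<zeta> - \<zeta>0 \<in> ball 0 \<rho> - {0}" if "\<zeta> \<in> ball \<zeta>0 \<rho> - {\<zeta>0}" for \<zeta>
      using that by (auto simp: dist_norm norm_minus_commute)
    have "\<forall>\<zeta>\<in>ball \<zeta>0 \<rho> - {\<zeta>0}. card (?f \<zeta>) = m" using g(2) shift eq by metis
    moreover have "(\<lambda>\<zeta>. \<Prod>(?f \<zeta>)) holomorphic_on (ball \<zeta>0 \<rho> - {\<zeta>0})"
    proof -
      have "((\<lambda>\<zeta>. \<Prod>(fiber Y v ((z + \<zeta>0 *s u) + \<zeta> *s u))) \<circ> (\<lambda>\<zeta>. \<zeta> - \<zeta>0)) holomorphic_on (ball \<zeta>0 \<rho> - {\<zeta>0})"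
        by (rule holomorphic_on_compose_gen[OF _ g(3)]) (auto intro!: holomorphic_intros shift)
      then show ?thesis unfolding o_def eq .
    qed
    ultimately show ?thesis using g(1,4) by blast
  qed
  then obtain \<rho> m where gm: "\<And>\<zeta>0. \<rho> \<zeta>0 > 0" "\<And>\<zeta>0 \<zeta>. \<zeta> \<in> ball \<zeta>0 (\<rho> \<zeta>0) - {\<zeta>0} \<Longrightarrow> card (?f \<zeta>) = m \<zeta>0"
     "\<And>\<zeta>0. (\<lambda>\<zeta>. \<Prod>(?f \<zeta>)) holomorphic_on (ball \<zeta>0 (\<rho> \<zeta>0) - {\<zeta>0})" "\<And>\<zeta>0. card (?f \<zeta>0) \<le> m \<zeta>0"
    by metis
  have same: "m \<zeta>1 = m \<zeta>0" if "\<zeta>1 \<in> ball \<zeta>0 (\<rho> \<zeta>0)" for \<zeta>0 \<zeta>1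
  proof (cases "\<zeta>1 = \<zeta>0")
    case False
    have "open (ball \<zeta>0 (\<rho> \<zeta>0) \<inter> ball \<zeta>1 (\<rho> \<zeta>1) - {\<zeta>0})" by (intro open_delete open_Int open_ball)
    moreover have "\<zeta>1 \<in> ball \<zeta>0 (\<rho> \<zeta>0) \<inter> ball \<zeta>1 (\<rho> \<zeta>1) - {\<zeta>0}" using that False gm(1)[of \<zeta>1] by simp
    ultimately obtain e where e: "e > 0" "ball \<zeta>1 e \<subseteq> ball \<zeta>0 (\<rho> \<zeta>0) \<inter> ball \<zeta>1 (\<rho> \<zeta>1) - {\<zeta>0}" by (meson openE)
    let ?\<xi> = "\<zeta>1 + of_real (e / 2)"
    have "?\<xi> \<in> ball \<zeta>1 e" "?\<xi> \<noteq> \<zeta>1" using e(1) by (auto simp: dist_norm)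
    then have "?\<xi> \<in> ball \<zeta>0 (\<rho> \<zeta>0) - {\<zeta>0}" "?\<xi> \<in> ball \<zeta>1 (\<rho> \<zeta>1) - {\<zeta>1}" using e(2) by blast+
    then have "card (?f ?\<xi>) = m \<zeta>0" "card (?f ?\<xi>) = m \<zeta>1" using gm(2) by blast+
    then show ?thesis by simp
  qed simp
  have "continuous_on UNIV (\<lambda>\<zeta>. of_nat (m \<zeta>) :: complex)"
    unfolding continuous_on_eq_continuous_at[OF open_UNIV]
  proof
    fix \<zeta>0
    have "eventually (\<lambda>\<zeta>. \<zeta> \<in> ball \<zeta>0 (\<rho> \<zeta>0)) (nhds \<zeta>0)" using gm(1) by (intro eventually_nhds_in_open) auto
    then have "eventually (\<lambda>\<zeta>. of_nat (m \<zeta>) = (of_nat (m \<zeta>0) :: complex)) (nhds \<zeta>0)"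
      by eventually_elim (use same in simp)
    then show "isCont (\<lambda>\<zeta>. of_nat (m \<zeta>) :: complex) \<zeta>0" by (rule isCont_eventually_eq)
  qed
  then obtain M where M: "\<And>\<zeta>. m \<zeta> = M" using connected_of_nat_constant[OF connected_UNIV] by auto
  show ?thesis
  proof (rule that[of M])
    show "card (?f \<zeta>0) \<le> M" for \<zeta>0 using gm(4) M by simp
    show "\<exists>\<rho>>0. (\<forall>\<zeta>\<in>ball \<zeta>0 \<rho> - {\<zeta>0}. card (?f \<zeta>) = M) \<and> (\<lambda>\<zeta>. \<Prod>(?f \<zeta>)) holomorphic_on (ball \<zeta>0 \<rho> - {\<zeta>0})" for \<zeta>0
      using gm(1-3) unfolding M by blast
  qed
qed

text \<open>The product over the fiber is bounded near the exceptional points, so these are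
  removable, and the extension is entire of growth m, thus a polynomial. Wherever the fiber has the
  full number m of points the product is continuous, hence equal to the extension.\<close>

lemma fiber_prod_on_line:
  fixes v :: "complex^'n"
  assumes Y: "locally_analytic Y" "fiber_growth Y v" "thick Y v"
    and m: "\<And>\<zeta>0. card (fiber Y v (z + \<zeta>0 *s u)) \<le> m"
    "\<And>\<zeta>0. \<exists>\<rho>>0. (\<forall>\<zeta>\<in>ball \<zeta>0 \<rho> - {\<zeta>0}. card (fiber Y v (z + \<zeta> *s u)) = m) \<and>
     (\<lambda>\<zeta>. \<Prod>(fiber Y v (z + \<zeta> *s u))) holomorphic_on (ball \<zeta>0 \<rho> - {\<zeta>0})"
    and K: "K \<ge> 0" "\<And>z t. t \<in> fiber Y v z \<Longrightarrow> norm t \<le> K * (1 + norm z)"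
  shows "\<exists>q. degree q \<le> m \<and> (\<forall>\<zeta>. card (fiber Y v (z + \<zeta> *s u)) = m \<longrightarrow> \<Prod>(fiber Y v (z + \<zeta> *s u)) = poly q \<zeta>)"
proof -
  let ?f = "\<lambda>\<zeta>. fiber Y v (z + \<zeta> *s u)"
  let ?E = "\<lambda>\<zeta>. \<Prod>(?f \<zeta>)"
  let ?b = "\<lambda>\<zeta>. (K * (1 + norm (z + \<zeta> *s u))) ^ m"
  have Eb: "norm (?E \<zeta>) \<le> ?b \<zeta>" if "card (?f \<zeta>) = m" for \<zeta>
  proof -
    have "norm (?E \<zeta>) = (\<Prod>t\<in>?f \<zeta>. norm t)" by (rule prod_norm[symmetric])
    also have "\<dots> \<le> (\<Prod>t\<in>?f \<zeta>. K * (1 + norm (z + \<zeta> *s u)))" by (rule prod_mono) (use K(2) in auto)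
    finally show ?thesis using that by simp
  qed
  have bc: "isCont ?b \<zeta>" for \<zeta>
  proof -
    have "continuous_on UNIV ?b" by (intro continuous_intros)
    then show ?thesis by (simp add: continuous_on_eq_continuous_at)
  qed
  have "\<exists>\<rho> g. \<rho> > 0 \<and> (\<forall>\<zeta>\<in>ball \<zeta>0 \<rho> - {\<zeta>0}. card (?f \<zeta>) = m) \<and> ?E holomorphic_on (ball \<zeta>0 \<rho> - {\<zeta>0}) \<and>
      g holomorphic_on ball \<zeta>0 \<rho> \<and> (\<forall>\<zeta>\<in>ball \<zeta>0 \<rho> - {\<zeta>0}. g \<zeta> = ?E \<zeta>)" for \<zeta>0
  proof -
    obtain \<rho> where \<rho>: "\<rho> > 0" "\<forall>\<zeta>\<in>ball \<zeta>0 \<rho> - {\<zeta>0}. card (?f \<zeta>) = m" "?E holomorphic_on (ball \<zeta>0 \<rho> - {\<zeta>0})"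
      using m(2) by blast
    have "eventually (\<lambda>\<zeta>. \<zeta> \<in> ball \<zeta>0 \<rho> - {\<zeta>0}) (at \<zeta>0)"
      using \<rho>(1) eventually_at_in_open[of "ball \<zeta>0 \<rho>" \<zeta>0] by auto
    moreover have "eventually (\<lambda>\<zeta>. ?b \<zeta> < ?b \<zeta>0 + 1) (at \<zeta>0)"
      using order_tendstoD(2)[OF bc[of \<zeta>0, unfolded isCont_def], of "?b \<zeta>0 + 1"] by simp
    ultimately have "eventually (\<lambda>\<zeta>. norm (?E \<zeta>) \<le> ?b \<zeta>0 + 1) (at \<zeta>0)"
    proof eventually_elim
      case (elim \<zeta>)
      then have "norm (?E \<zeta>) \<le> ?b \<zeta>" using \<rho>(2) by (intro Eb) blast
      then show ?case using elim by linarith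
    qed
    then have "\<exists>B. eventually (\<lambda>\<zeta>. norm (?E \<zeta>) \<le> B) (at \<zeta>0)" by blast
    then obtain g where "g holomorphic_on ball \<zeta>0 \<rho>" "\<forall>\<zeta>\<in>ball \<zeta>0 \<rho> - {\<zeta>0}. g \<zeta> = ?E \<zeta>"
      using holomorphic_on_extend_bounded[OF \<rho>(3)] \<rho>(1) by (auto simp: interior_open)
    then show ?thesis using \<rho> by blast
  qed
  then obtain \<rho> g where g: "\<And>\<zeta>0. \<rho> \<zeta>0 > 0" "\<And>\<zeta>0 \<zeta>. \<zeta> \<in> ball \<zeta>0 (\<rho> \<zeta>0) - {\<zeta>0} \<Longrightarrow> card (?f \<zeta>) = m"
    "\<And>\<zeta>0. ?E holomorphic_on (ball \<zeta>0 (\<rho> \<zeta>0) - {\<zeta>0})" "\<And>\<zeta>0. g \<zeta>0 holomorphic_on ball \<zeta>0 (\<rho> \<zeta>0)"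
    "\<And>\<zeta>0 \<zeta>. \<zeta> \<in> ball \<zeta>0 (\<rho> \<zeta>0) - {\<zeta>0} \<Longrightarrow> g \<zeta>0 \<zeta> = ?E \<zeta>"
    by metis
  define F where "F \<zeta> = g \<zeta> \<zeta>" for \<zeta>
  have lim: "(?E \<longlongrightarrow> F \<zeta>) (at \<zeta>)" for \<zeta>
  proof -
    have "isCont (g \<zeta>) \<zeta>"
      using holomorphic_on_imp_continuous_on[OF g(4)] g(1)[of \<zeta>] by (simp add: continuous_on_eq_continuous_at)
    then have "(g \<zeta> \<longlongrightarrow> F \<zeta>) (at \<zeta>)" by (simp add: isCont_def F_def)
    moreover have "eventually (\<lambda>\<xi>. \<xi> \<in> ball \<zeta> (\<rho> \<zeta>) - {\<zeta>}) (at \<zeta>)"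
      using g(1)[of \<zeta>] eventually_at_in_open[of "ball \<zeta> (\<rho> \<zeta>)" \<zeta>] by auto
    then have "eventually (\<lambda>\<xi>. g \<zeta> \<xi> = ?E \<xi>) (at \<zeta>)" by eventually_elim (rule g(5))
    ultimately show ?thesis by (rule Lim_transform_eventually)
  qed
  have FE: "F \<zeta> = ?E \<zeta>" if "isCont ?E \<zeta>" for \<zeta>
    using LIM_unique[OF lim[of \<zeta>]] that by (auto simp: isCont_def)
  have Fg: "F \<zeta> = g \<zeta>0 \<zeta>" if \<zeta>: "\<zeta> \<in> ball \<zeta>0 (\<rho> \<zeta>0)" for \<zeta> \<zeta>0
  proof (cases "\<zeta> = \<zeta>0")
    case False
    have "isCont ?E \<zeta>"
      using holomorphic_on_imp_continuous_on[OF g(3)[of \<zeta>0]] \<zeta> False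
        continuous_on_eq_continuous_at[of "ball \<zeta>0 (\<rho> \<zeta>0) - {\<zeta>0}" ?E] by (simp add: open_delete)
    then show ?thesis using FE g(5)[of \<zeta> \<zeta>0] \<zeta> False by simp
  qed (simp add: F_def)
  have "F holomorphic_on UNIV"
    unfolding holomorphic_on_def
  proof
    fix \<zeta>0
    have "F holomorphic_on ball \<zeta>0 (\<rho> \<zeta>0)"
      by (rule holomorphic_transform[OF g(4)]) (rule Fg[symmetric])
    then have "F field_differentiable at \<zeta>0"
      using g(1)[of \<zeta>0] by (intro holomorphic_on_imp_differentiable_at[of F "ball \<zeta>0 (\<rho> \<zeta>0)"]) auto
    then show "F field_differentiable at \<zeta>0 within UNIV" by simp
  qed
  moreover have "norm (F \<zeta>) \<le> (K * (1 + norm z + norm u)) ^ m * (1 + norm \<zeta>) ^ m" for \<zeta>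
  proof -
    have "norm (F \<zeta>) \<le> ?b \<zeta>"
    proof (rule tendsto_le[OF _ bc[of \<zeta>, unfolded isCont_def] tendsto_norm[OF lim]])
      have "eventually (\<lambda>\<xi>. \<xi> \<in> ball \<zeta> (\<rho> \<zeta>) - {\<zeta>}) (at \<zeta>)"
        using g(1)[of \<zeta>] eventually_at_in_open[of "ball \<zeta> (\<rho> \<zeta>)" \<zeta>] by auto
      then show "eventually (\<lambda>\<xi>. norm (?E \<xi>) \<le> ?b \<xi>) (at \<zeta>)" by eventually_elim (intro Eb g(2))
    qed simp
    also have "\<dots> \<le> (K * ((1 + norm z + norm u) * (1 + norm \<zeta>))) ^ m"
    proof (rule power_mono)
      have "0 \<le> norm \<zeta> * norm z" by simp
      moreover have "(1 + norm z + norm u) * (1 + norm \<zeta>) =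
          1 + norm z + norm u + norm \<zeta> + norm \<zeta> * norm z + norm \<zeta> * norm u"
        by (simp add: algebra_simps)
      ultimately have "1 + norm (z + \<zeta> *s u) \<le> (1 + norm z + norm u) * (1 + norm \<zeta>)"
        using norm_triangle_ineq[of z "\<zeta> *s u", unfolded norm_smult] norm_ge_zero[of u] norm_ge_zero[of \<zeta>]
        by linarith
      then show "K * (1 + norm (z + \<zeta> *s u)) \<le> K * ((1 + norm z + norm u) * (1 + norm \<zeta>))"
        using K(1) by (rule mult_left_mono)
    qed (use K(1) in \<open>simp add: add_nonneg_nonneg\<close>)
    also have "\<dots> = (K * (1 + norm z + norm u)) ^ m * (1 + norm \<zeta>) ^ m"
      by (simp only: power_mult_distrib mult.assoc)
    finally show ?thesis .
  qed
  ultimately obtain q where q: "degree q \<le> m" "\<And>\<zeta>. F \<zeta> = poly q \<zeta>"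
    using polynomial_growth_imp_poly[of F "(K * (1 + norm z + norm u)) ^ m" m] K(1) by (auto simp: add_nonneg_nonneg)
  have "?E \<zeta> = poly q \<zeta>" if c: "card (?f \<zeta>) = m" for \<zeta>
  proof -
    have "isCont ?E \<zeta>"
      unfolding continuous_at_eps_delta
    proof (intro allI impI)
      fix \<eta> :: real assume "\<eta> > 0"
      from fiber_prod_near[OF Y this, of "z + \<zeta> *s u"] obtain \<delta> where \<delta>: "\<delta> > 0"
        "\<And>y. y \<in> ball (z + \<zeta> *s u) \<delta> \<Longrightarrow> card (fiber Y v y) \<le> card (?f \<zeta>) \<Longrightarrow> dist (\<Prod>(fiber Y v y)) (?E \<zeta>) < \<eta>" by blast
      have "\<zeta> \<in> {\<xi>. z + \<xi> *s u \<in> ball (z + \<zeta> *s u) \<delta>}" using \<delta>(1) by simp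
      from openE[OF open_line_preimage[OF open_ball] this] obtain e where e: "e > 0"
        "ball \<zeta> e \<subseteq> {\<xi>. z + \<xi> *s u \<in> ball (z + \<zeta> *s u) \<delta>}" by blast
      have "dist (?E \<xi>) (?E \<zeta>) < \<eta>" if "dist \<xi> \<zeta> < e" for \<xi>
      proof (rule \<delta>(2))
        have "\<xi> \<in> ball \<zeta> e" using that by (simp add: dist_commute)
        then show "z + \<xi> *s u \<in> ball (z + \<zeta> *s u) \<delta>" using e(2) by blast
        show "card (?f \<xi>) \<le> card (?f \<zeta>)" using m(1) c by simp
      qed
      then show "\<exists>d>0. \<forall>x'. dist x' \<zeta> < d \<longrightarrow> dist (?E x') (?E \<zeta>) < \<eta>" using e(1) by blast
    qed
    then show ?thesis using FE q(2) by simp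
  qed
  then show ?thesis using q(1) by blast
qed

text \<open>The equation is the product of all fiber parameters, polynomial on the open set of base
  points with the full number m of them, and its zeros are the points with fiber parameter 0. The
  growth exponent m and the factorisation along \<open>v\<close> are exported because together they
  show that the form of degree m does not vanish at \<open>v\<close>.\<close>

theorem hypersurface_polynomial:
  fixes v :: "complex^'n"
  assumes Y: "locally_analytic Y" "fiber_growth Y v" "thick Y v" and ne: "Y \<noteq> {}"
  obtains P m K z1 where "polyfun P" "Y = {z. P z = 0}" "K \<ge> 0" "\<And>z. norm (P z) \<le> K * (1 + norm z) ^ m"
    "\<And>x. P (z1 + x *s v) = (\<Prod>t\<in>fiber Y v z1. t - x)" "card (fiber Y v z1) = m"
proof -
  have clY: "closed Y" using Y unfolding locally_analytic_def by blast
  have fin: "finite (fiber Y v z)" for z by (rule fiber_finite[OF Y(1,2)])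
  let ?N = "\<lambda>z. card (fiber Y v z)" and ?E = "\<lambda>z. \<Prod>(fiber Y v z)"
  obtain K where K: "K \<ge> 0" "\<And>z t. t \<in> fiber Y v z \<Longrightarrow> norm t \<le> K * (1 + norm z)"
    using Y(2) unfolding fiber_growth_def by blast
  obtain z0 where z0: "z0 \<in> Y" using ne by blast
  obtain d Z w where d: "d > 0" and rs: "root_system (ball z0 d) Z w"
    and sub: "\<And>z. z \<in> ball z0 d \<Longrightarrow> fiber Y v z \<subseteq> Z z"
    using root_system_exists[OF Y(1,2), of z0] by blast
  obtain N where N: "\<And>z. z \<in> ball z0 d \<Longrightarrow> card (Z z) \<le> N"
    using root_system_card_bounded[OF rs connected_ball] by blast
  have "?N z \<le> N" if "z \<in> ball z0 d" for z
    using card_mono[OF root_systemD(2)[OF rs that] sub[OF that]] N[OF that] by simp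
  then have "\<exists>z. z \<in> ball z0 d \<and> (\<forall>y. y \<in> ball z0 d \<longrightarrow> ?N y \<le> ?N z)"
    by (intro Lattices_Big.ex_has_greatest_nat[where k=z0 and b="Suc N"]) (use d in \<open>auto simp: less_Suc_eq_le\<close>)
  then obtain z1 where z1: "z1 \<in> ball z0 d" "\<And>y. y \<in> ball z0 d \<Longrightarrow> ?N y \<le> ?N z1" by blast
  define m where "m = ?N z1"
  have "0 \<in> fiber Y v z0" using z0 by (simp add: fiber_def)
  then have "m \<ge> 1" using z1(2)[of z0] d fin by (auto simp: m_def Suc_le_eq card_gt_0_iff)
  have gen: "\<exists>l. (\<forall>\<zeta>0. ?N (z + \<zeta>0 *s u) \<le> l) \<and> (\<forall>\<zeta>0. \<exists>\<rho>>0. (\<forall>\<zeta>\<in>ball \<zeta>0 \<rho> - {\<zeta>0}. ?N (z + \<zeta> *s u) = l) \<and>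
     (\<lambda>\<zeta>. ?E (z + \<zeta> *s u)) holomorphic_on (ball \<zeta>0 \<rho> - {\<zeta>0}))" for z u
    by (rule fiber_card_on_line[OF Y, of z u]) blast
  \<comment> \<open>The maximum over the ball is global: the line from \<open>z1\<close> to z has
    one generic number, and this number is attained inside the ball.\<close>
  have Nm: "?N z \<le> m" for z
  proof -
    obtain l where l: "\<And>\<zeta>0. ?N (z1 + \<zeta>0 *s (z - z1)) \<le> l"
      "\<And>\<zeta>0. \<exists>\<rho>>0. \<forall>\<zeta>\<in>ball \<zeta>0 \<rho> - {\<zeta>0}. ?N (z1 + \<zeta> *s (z - z1)) = l"
      using gen[of z1 "z - z1"] by blast
    obtain \<rho> where \<rho>: "\<rho> > 0" "\<forall>\<zeta>\<in>ball 0 \<rho> - {0}. ?N (z1 + \<zeta> *s (z - z1)) = l" using l(2) by blast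
    have "0 \<in> {\<zeta>. z1 + \<zeta> *s (z - z1) \<in> ball z0 d}" using z1(1) by simp
    from openE[OF open_line_preimage[OF open_ball] this] obtain e where e: "e > 0"
      "ball 0 e \<subseteq> {\<zeta>. z1 + \<zeta> *s (z - z1) \<in> ball z0 d}" by blast
    define s where "s = min \<rho> e / 2"
    have s: "0 < s" "s < \<rho>" "s < e" using \<rho>(1) e(1) by (auto simp: s_def)
    let ?\<zeta> = "of_real s :: complex"
    have "?\<zeta> \<in> ball 0 \<rho> - {0}" "?\<zeta> \<in> ball 0 e" using s by auto
    then have "?N (z1 + ?\<zeta> *s (z - z1)) = l" "z1 + ?\<zeta> *s (z - z1) \<in> ball z0 d" using \<rho>(2) e(2) by blast+
    then have "l \<le> m" using z1(2) by (auto simp: m_def)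
    then show ?thesis using l(1)[of 1] by simp
  qed
  define G where "G = {z. ?N z = m}"
  have z1G: "z1 \<in> G" by (simp add: G_def m_def)
  have opG: "open G" unfolding open_contains_ball
  proof
    fix z assume z: "z \<in> G"
    obtain \<delta> where \<delta>: "\<delta> > 0" "\<forall>y\<in>ball z \<delta>. ?N z \<le> ?N y" using fiber_card_lower[OF Y] by blast
    have "ball z \<delta> \<subseteq> G" using \<delta>(2) Nm z unfolding G_def by (auto intro: le_antisym)
    then show "\<exists>e>0. ball z e \<subseteq> G" using \<delta>(1) by blast
  qed
  have genm: "(\<forall>\<zeta>0. \<exists>\<rho>>0. (\<forall>\<zeta>\<in>ball \<zeta>0 \<rho> - {\<zeta>0}. ?N (z + \<zeta> *s u) = m) \<and>
     (\<lambda>\<zeta>. ?E (z + \<zeta> *s u)) holomorphic_on (ball \<zeta>0 \<rho> - {\<zeta>0}))" if z: "z \<in> G" for z u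
  proof -
    obtain l where l: "\<forall>\<zeta>0. ?N (z + \<zeta>0 *s u) \<le> l" "\<forall>\<zeta>0. \<exists>\<rho>>0. (\<forall>\<zeta>\<in>ball \<zeta>0 \<rho> - {\<zeta>0}. ?N (z + \<zeta> *s u) = l) \<and>
     (\<lambda>\<zeta>. ?E (z + \<zeta> *s u)) holomorphic_on (ball \<zeta>0 \<rho> - {\<zeta>0})" using gen by blast
    have "m \<le> l" using l(1)[rule_format, of 0] z by (simp add: G_def)
    moreover obtain \<rho> where \<rho>: "\<rho> > 0" "\<forall>\<zeta>\<in>ball 0 \<rho> - {0}. ?N (z + \<zeta> *s u) = l" using l(2) by blast
    have "of_real (\<rho> / 2) \<in> ball 0 \<rho> - {0::complex}" using \<rho>(1) by auto
    then have "l \<le> m" using \<rho>(2) Nm by metis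
    ultimately show ?thesis using l(2) by simp
  qed
  have "\<exists>P. polyfun P \<and> (\<forall>z\<in>G. ?E z = P z)"
  proof (rule polyfun_of_lines[OF opG z1G])
    fix z u :: "complex^'n" assume z: "z \<in> G"
    from fiber_prod_on_line[OF Y Nm genm[OF z, rule_format] K]
    show "\<exists>q. degree q \<le> m \<and> (\<forall>\<zeta>. z + \<zeta> *s u \<in> G \<longrightarrow> ?E (z + \<zeta> *s u) = poly q \<zeta>)"
      by (simp add: G_def)
  qed
  then obtain P where P: "polyfun P" "\<And>z. z \<in> G \<Longrightarrow> P z = ?E z" by metis
  have Pc: "isCont P z" for z using polyfun_continuous[OF P(1), of UNIV] by (simp add: continuous_on_eq_continuous_at)
  let ?y = "\<lambda>z \<zeta>. z1 + \<zeta> *s (z - z1)"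
  have ylim: "(?y z \<longlongrightarrow> z) (at 1)" for z
  proof -
    have "continuous_on UNIV (?y z)" by (intro continuous_intros)
    then have "isCont (?y z) 1" by (simp add: continuous_on_eq_continuous_at)
    then show ?thesis by (simp add: isCont_def)
  qed
  \<comment> \<open>The line from \<open>z1\<close> to z lies in \<open>G\<close> except for
    isolated points, so every z is a limit of points at which \<open>P\<close> is the product over
    the fiber.\<close>
  have yG: "eventually (\<lambda>\<zeta>. ?y z \<zeta> \<in> G) (at 1)" for z
  proof -
    obtain \<rho> where \<rho>: "\<rho> > 0" "\<forall>\<zeta>\<in>ball 1 \<rho> - {1}. ?N (?y z \<zeta>) = m" using genm[OF z1G, of "z - z1"] by blast
    have "eventually (\<lambda>\<zeta>. \<zeta> \<in> ball 1 \<rho> - {1::complex}) (at 1)"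
      using \<rho>(1) eventually_at_in_open[of "ball 1 \<rho>" "1::complex"] by auto
    then show ?thesis by eventually_elim (use \<rho>(2) in \<open>simp add: G_def\<close>)
  qed
  have Plim: "((\<lambda>\<zeta>. P (?y z \<zeta>)) \<longlongrightarrow> P z) (at 1)" for z
    by (rule isCont_tendsto_compose[OF Pc ylim])
  have EG: "norm (?E z) \<le> (K * (1 + norm z)) ^ m" if "z \<in> G" for z
  proof -
    have "norm (?E z) = (\<Prod>t\<in>fiber Y v z. norm t)" by (rule prod_norm[symmetric])
    also have "\<dots> \<le> (\<Prod>t\<in>fiber Y v z. K * (1 + norm z))" by (rule prod_mono) (use K(2) in auto)
    finally show ?thesis using that by (simp add: G_def)
  qed
  have Pgr: "norm (P z) \<le> K ^ m * (1 + norm z) ^ m" for z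
  proof -
    have "norm (P z) \<le> (K * (1 + norm z)) ^ m"
    proof (rule tendsto_le[OF _ _ tendsto_norm[OF Plim[of z]]])
      show "((\<lambda>\<zeta>. (K * (1 + norm (?y z \<zeta>))) ^ m) \<longlongrightarrow> (K * (1 + norm z)) ^ m) (at 1)"
        by (intro tendsto_intros ylim)
      show "eventually (\<lambda>\<zeta>. norm (P (?y z \<zeta>)) \<le> (K * (1 + norm (?y z \<zeta>))) ^ m) (at 1)"
        using yG[of z] by eventually_elim (use EG P(2) in simp)
    qed simp
    then show ?thesis by (simp add: power_mult_distrib)
  qed
  \<comment> \<open>If 0 is not a fiber parameter over z, nearby fibers avoid a disc of radius
    \<epsilon>, and |P| >= \<epsilon>^m survives the limit.\<close>
  have nz: "z \<in> Y" if Pz: "P z = 0" for z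
  proof (rule ccontr)
    assume "z \<notin> Y"
    then have "0 \<in> - fiber Y v z" by (simp add: fiber_def)
    moreover have "open (- fiber Y v z)" by (intro open_Compl finite_imp_closed fin)
    ultimately obtain \<epsilon> where \<epsilon>: "\<epsilon> > 0" "cball 0 \<epsilon> \<subseteq> - fiber Y v z" by (meson open_contains_cball)
    then have "fiber Y v z \<subseteq> - cball 0 \<epsilon>" by blast
    from fiber_upper[OF clY Y(2) _ this] obtain \<delta> where \<delta>: "\<delta> > 0" "\<forall>y\<in>ball z \<delta>. fiber Y v y \<subseteq> - cball 0 \<epsilon>"
      by (auto simp: open_Compl)
    have "eventually (\<lambda>\<zeta>. ?y z \<zeta> \<in> ball z \<delta>) (at 1)"
      using topological_tendstoD[OF ylim[of z] open_ball, of z \<delta>] \<delta>(1) by simp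
    then have ev: "eventually (\<lambda>\<zeta>. \<epsilon> ^ m \<le> norm (P (?y z \<zeta>))) (at 1)" using yG[of z]
    proof eventually_elim
      case (elim \<zeta>)
      have "\<epsilon> ^ m = (\<Prod>t\<in>fiber Y v (?y z \<zeta>). \<epsilon>)" using elim(2) by (simp add: G_def)
      also have "\<dots> \<le> (\<Prod>t\<in>fiber Y v (?y z \<zeta>). norm t)"
      proof (rule prod_mono)
        fix t assume "t \<in> fiber Y v (?y z \<zeta>)"
        then have "t \<in> - cball 0 \<epsilon>" using \<delta>(2) elim(1) by blast
        then show "0 \<le> \<epsilon> \<and> \<epsilon> \<le> norm t" using \<epsilon>(1) by auto
      qed
      also have "\<dots> = norm (P (?y z \<zeta>))" using P(2)[OF elim(2)] by (simp add: prod_norm)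
      finally show ?case .
    qed
    have "\<epsilon> ^ m \<le> norm (P z)"
      by (rule tendsto_le[OF _ tendsto_norm[OF Plim[of z]] tendsto_const ev]) simp
    then show False using Pz zero_less_power[OF \<epsilon>(1), of m] by simp
  qed
  \<comment> \<open>If 0 is a fiber parameter over z, nearby fibers contain an element smaller than
    \<epsilon> while the others are bounded by \<open>C\<close>; \<epsilon> is tuned so that the
    limit would give |P z| <= |P z| / 2.\<close>
  have zn: "P z = 0" if zY: "z \<in> Y" for z
  proof (rule ccontr)
    assume Pz: "P z \<noteq> 0"
    define C where "C = max 1 (K * (2 + norm z))"
    have C: "C \<ge> 1" by (simp add: C_def)
    define \<epsilon> where "\<epsilon> = norm (P z) / (2 * C ^ m)"
    have \<epsilon>: "\<epsilon> > 0" using Pz C by (simp add: \<epsilon>_def)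
    have 0: "0 \<in> fiber Y v z" using zY by (simp add: fiber_def)
    obtain \<delta> where \<delta>: "\<delta> > 0" "\<forall>y\<in>ball z \<delta>. \<exists>t\<in>ball 0 \<epsilon>. t \<in> fiber Y v y" using fiber_open[OF Y 0 \<epsilon>] by blast
    have "eventually (\<lambda>\<zeta>. ?y z \<zeta> \<in> ball z (min 1 \<delta>)) (at 1)"
      using topological_tendstoD[OF ylim[of z] open_ball, of z "min 1 \<delta>"] \<delta>(1) by simp
    then have ev: "eventually (\<lambda>\<zeta>. norm (P (?y z \<zeta>)) \<le> \<epsilon> * C ^ m) (at 1)" using yG[of z]
    proof eventually_elim
      case (elim \<zeta>)
      let ?F = "fiber Y v (?y z \<zeta>)"
      obtain t where t: "norm t < \<epsilon>" "t \<in> ?F" using \<delta>(2) elim(1) by fastforce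
      have ny: "norm (?y z \<zeta>) \<le> 1 + norm z"
        using elim(1) norm_triangle_ineq2[of "?y z \<zeta>" z] by (simp add: dist_norm norm_minus_commute)
      have nC: "norm s \<le> C" if "s \<in> ?F" for s
      proof -
        have "norm s \<le> K * (1 + norm (?y z \<zeta>))" by (rule K(2)[OF that])
        also have "\<dots> \<le> K * (2 + norm z)" using ny K(1) by (intro mult_left_mono) auto
        finally show ?thesis by (simp add: C_def)
      qed
      have "norm (P (?y z \<zeta>)) = (\<Prod>s\<in>?F. norm s)" using P(2)[OF elim(2)] by (simp add: prod_norm)
      also have "\<dots> = norm t * (\<Prod>s\<in>?F - {t}. norm s)" by (rule prod.remove[OF fin t(2)])
      also have "\<dots> \<le> \<epsilon> * (\<Prod>s\<in>?F - {t}. C)"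
        using t(1) \<epsilon> nC by (intro mult_mono prod_mono prod_nonneg) auto
      also have "(\<Prod>s\<in>?F - {t}. C) \<le> C ^ m"
        using C elim(2) t(2) fin by (auto simp: G_def intro!: power_increasing)
      finally show ?case using \<epsilon> by simp
    qed
    have "norm (P z) \<le> \<epsilon> * C ^ m"
      by (rule tendsto_le[OF _ tendsto_const tendsto_norm[OF Plim[of z]] ev]) simp
    also have "\<dots> = norm (P z) / 2" using C by (simp add: \<epsilon>_def)
    finally show False using Pz by simp
  qed
  have line: "P (z1 + x *s v) = (\<Prod>t\<in>fiber Y v z1. t - x)" for x
  proof -
    have im: "fiber Y v (z1 + x *s v) = (\<lambda>t. t - x) ` fiber Y v z1"
    proof (intro equalityI subsetI)
      fix t assume "t \<in> fiber Y v (z1 + x *s v)"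
      then have "t + x \<in> fiber Y v z1" by (simp add: fiber_add)
      then show "t \<in> (\<lambda>t. t - x) ` fiber Y v z1" by (intro image_eqI[of _ _ "t + x"]) auto
    qed (auto simp: fiber_add)
    have inj: "inj_on (\<lambda>t. t - x) (fiber Y v z1)" by (auto simp: inj_on_def)
    have "card (fiber Y v (z1 + x *s v)) = m" unfolding im card_image[OF inj] m_def ..
    then have "z1 + x *s v \<in> G" by (simp add: G_def)
    then have "P (z1 + x *s v) = ?E (z1 + x *s v)" by (rule P(2))
    also have "\<dots> = (\<Prod>t\<in>fiber Y v z1. t - x)" unfolding im by (simp add: prod.reindex[OF inj])
    finally show ?thesis .
  qed
  show ?thesis
  proof (rule that[OF P(1) _ _ Pgr line])
    show "Y = {z. P z = 0}" using nz zn by blast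
    show "0 \<le> K ^ m" using K(1) by simp
    show "?N z1 = m" by (simp add: m_def)
  qed
qed

section \<open>Frames and cylinders\<close>

text \<open>A basis with its dual forms. Coordinate changes are made by replacing \<open>b\<close>
  and \<open>l\<close>, while \<open>X\<close> stays in place.\<close>

locale frame =
  fixes b :: "'n::finite \<Rightarrow> complex^'n" and l :: "'n \<Rightarrow> complex^'n \<Rightarrow> complex"
  assumes l_add: "l i (x + y) = l i x + l i y"
    and l_smult: "l i (c *s x) = c * l i x"
    and l_b: "l i (b j) = (if i = j then 1 else 0)"
    and expand: "z = (\<Sum>i\<in>UNIV. l i z *s b i)"
begin

lemma l_zero: "l i 0 = 0"
  using l_smult[of i 0 0] by simp

lemma l_uminus: "l i (- x) = - l i x"
  using l_smult[of i "-1" x] by (simp add: vector_sneg_minus1[symmetric])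

lemma l_diff: "l i (x - y) = l i x - l i y"
  using l_add[of i x "- y"] by (simp add: l_uminus)

lemma l_sum: "l i (\<Sum>k\<in>S. f k) = (\<Sum>k\<in>S. l i (f k))"
  by (induction S rule: infinite_finite_induct) (auto simp: l_zero l_add)

lemma l_scaleR: "l i (r *\<^sub>R x) = of_real r * l i x"
proof -
  have "r *\<^sub>R x = of_real r *s x" by (simp add: vec_eq_iff scaleR_conv_of_real[where 'a=complex])
  then show ?thesis by (simp add: l_smult)
qed

lemmas l_simps = l_add l_diff l_smult l_uminus l_zero l_b l_sum l_scaleR

lemma frame_eqI: "(\<And>i. l i x = l i y) \<Longrightarrow> x = y"
  by (subst expand[of x], subst expand[of y]) simp

lemma l_polyfun: "polyfun (l i)"
proof -
  have ax: "z = (\<Sum>j\<in>UNIV. z $ j *s axis j 1)" for z :: "complex^'n"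
    by (simp add: vec_eq_iff axis_def if_distrib sum.delta cong: if_cong)
  have "l i z = (\<Sum>j\<in>UNIV. z $ j * l i (axis j 1))" for z
    using arg_cong[OF ax[of z], of "l i"] by (simp add: l_sum l_smult)
  then have "l i = (\<lambda>z. \<Sum>j\<in>UNIV. z $ j * l i (axis j 1))" by (rule ext)
  moreover have "polyfun (\<lambda>z. \<Sum>j\<in>UNIV. z $ j * l i (axis j 1))"
    by (intro polyfun_sum polyfun.mult polyfun.coord polyfun.const)
  ultimately show ?thesis by simp
qed

lemma l_continuous [continuous_intros]:
  "continuous_on S f \<Longrightarrow> continuous_on S (\<lambda>x. l i (f x))"
  by (rule continuous_on_compose2[OF polyfun_continuous[OF l_polyfun, of UNIV]]) auto

lemma l_tendsto [tendsto_intros]: "(f \<longlongrightarrow> a) F \<Longrightarrow> ((\<lambda>x. l i (f x)) \<longlongrightarrow> l i a) F"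
  using polyfun_continuous[OF l_polyfun, of UNIV]
  by (metis UNIV_I continuous_on_eq_continuous_at isCont_tendsto_compose open_UNIV)

lemma l_bounded: "\<exists>K>0. \<forall>i z. norm (l i z) \<le> K * norm z"
proof -
  have lin: "\<exists>K. \<forall>z. norm (l i z) \<le> K * norm z" for i
  proof -
    have "linear (l i)" by (rule linearI) (simp_all add: l_simps scaleR_conv_of_real[where 'a=complex])
    then show ?thesis using linear_bounded by blast
  qed
  then obtain K where K: "\<And>i z. norm (l i z) \<le> K i * norm z" by metis
  have "norm (l i z) \<le> (1 + (\<Sum>j\<in>UNIV. \<bar>K j\<bar>)) * norm z" for i z
  proof -
    have "K i \<le> (\<Sum>j\<in>UNIV. \<bar>K j\<bar>)"
      using member_le_sum[of i UNIV "\<lambda>j. \<bar>K j\<bar>"] by (simp add: abs_le_iff)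
    then have "K i * norm z \<le> (1 + (\<Sum>j\<in>UNIV. \<bar>K j\<bar>)) * norm z" by (intro mult_right_mono) auto
    then show ?thesis using K[of i z] by linarith
  qed
  moreover have "1 + (\<Sum>j\<in>UNIV. \<bar>K j\<bar>) > 0" by (simp add: add_pos_nonneg sum_nonneg)
  ultimately show ?thesis by blast
qed

lemma norm_le_coords: "\<exists>K>0. \<forall>z. norm z \<le> K * (\<Sum>i\<in>UNIV. norm (l i z))"
proof -
  let ?K = "1 + (\<Sum>i\<in>UNIV. norm (b i))"
  have "norm z \<le> ?K * (\<Sum>i\<in>UNIV. norm (l i z))" for z
  proof -
    have "norm z \<le> (\<Sum>i\<in>UNIV. norm (l i z *s b i))" by (subst expand) (rule norm_sum)
    also have "\<dots> \<le> (\<Sum>i\<in>UNIV. norm (l i z) * ?K)"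
    proof (rule sum_mono)
      fix i
      have "norm (b i) \<le> ?K" using member_le_sum[of i UNIV "\<lambda>j. norm (b j)"] by simp
      then show "norm (l i z *s b i) \<le> norm (l i z) * ?K" unfolding norm_smult by (rule mult_left_mono) simp
    qed
    finally show ?thesis by (simp add: sum_distrib_right mult.commute)
  qed
  moreover have "?K > 0" by (simp add: add_pos_nonneg sum_nonneg)
  ultimately show ?thesis by blast
qed

text \<open>The vectors \<open>b j\<close> with j in \<open>J\<close> span the subspace L of the
  overview. This is the projection along L, and \<open>- J\<close> indexes coordinates on the
  quotient.\<close>

definition proj :: "'n set \<Rightarrow> complex^'n \<Rightarrow> complex^'n" where
  "proj J z = (\<Sum>i\<in>- J. l i z *s b i)"

lemma l_proj: "l i (proj J z) = (if i \<in> J then 0 else l i z)"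
  by (simp add: proj_def l_sum l_smult l_b if_distrib sum.delta' cong: if_cong)

lemma proj_empty: "proj {} z = z"
  by (rule frame_eqI) (simp add: l_proj)

lemma proj_eq_iff: "proj J x = proj J y \<longleftrightarrow> (\<forall>i. i \<notin> J \<longrightarrow> l i x = l i y)"
proof
  show "\<forall>i. i \<notin> J \<longrightarrow> l i x = l i y" if "proj J x = proj J y"
    using that l_proj[of _ J x] l_proj[of _ J y] by metis
qed (auto intro: frame_eqI simp: l_proj)

lemma proj_continuous [continuous_intros]: "continuous_on S f \<Longrightarrow> continuous_on S (\<lambda>x. proj J (f x))"
  unfolding proj_def by (intro continuous_intros)

lemma proj_tendsto [tendsto_intros]: "(f \<longlongrightarrow> a) F \<Longrightarrow> ((\<lambda>x. proj J (f x)) \<longlongrightarrow> proj J a) F"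
  unfolding proj_def by (intro tendsto_intros)

lemma proj_bounded: "\<exists>K>0. \<forall>z. norm (proj J z) \<le> K * norm z"
proof -
  obtain K where K: "K > 0" "\<And>i z. norm (l i z) \<le> K * norm z" using l_bounded by blast
  obtain M where M: "M > 0" "\<And>z. norm z \<le> M * (\<Sum>i\<in>UNIV. norm (l i z))" using norm_le_coords by blast
  have "norm (proj J z) \<le> (M * (real CARD('n) * K)) * norm z" for z
  proof -
    have "(\<Sum>i\<in>UNIV. norm (l i (proj J z))) \<le> (\<Sum>i\<in>(UNIV::'n set). K * norm z)"
      by (rule sum_mono) (use K in \<open>auto simp: l_proj\<close>)
    then have "M * (\<Sum>i\<in>UNIV. norm (l i (proj J z))) \<le> M * (real CARD('n) * (K * norm z))"
      using M(1) by (intro mult_left_mono) auto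
    then show ?thesis using M(2)[of "proj J z"] by (simp add: mult.assoc)
  qed
  then show ?thesis using K(1) M(1) by (intro exI[of _ "M * (real CARD('n) * K)"]) auto
qed

section \<open>Coordinate subspaces, cylinders and transversality\<close>

definition coord_space :: "'n set \<Rightarrow> (complex^'n) set" where
  "coord_space J = {z. \<forall>i\<in>J. l i z = 0}"

lemma proj_in_coord_space: "proj J z \<in> coord_space J"
  by (simp add: coord_space_def l_proj)

lemma proj_of_coord_space: "z \<in> coord_space J \<Longrightarrow> proj J z = z"
  by (rule frame_eqI) (auto simp: coord_space_def l_proj)

lemma subspace_coord_space: "subspace (coord_space J)"
  by (rule subspaceI) (auto simp: coord_space_def l_simps)

text \<open>X + L, kept inside C^n rather than projected to a smaller space, so that one type and
  one frame serve all stages.\<close>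

definition cyl :: "'n set \<Rightarrow> (complex^'n) set \<Rightarrow> (complex^'n) set" where
  "cyl J X = {z. \<exists>x\<in>X. \<forall>i. i \<notin> J \<longrightarrow> l i z = l i x}"

lemma cyl_empty: "cyl {} X = X"
proof (intro equalityI subsetI)
  fix z assume "z \<in> cyl {} X"
  then obtain x where "x \<in> X" "\<And>i. l i z = l i x" by (auto simp: cyl_def)
  then show "z \<in> X" using frame_eqI[of z x] by simp
qed (auto simp: cyl_def)

lemma fiber_cyl: "t \<in> fiber (cyl J X) (b j) z \<longleftrightarrow> (\<exists>x\<in>X. \<forall>i. i \<notin> J \<longrightarrow> l i x = l i z + (if i = j then t else 0))"
proof -
  have *: "l i (z + t *s b j) = l i z + (if i = j then t else 0)" for i by (simp add: l_simps)
  show ?thesis unfolding fiber_def cyl_def mem_Collect_eq * by (simp only: eq_commute)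
qed

lemma cyl_insert:
  assumes "j \<notin> J"
  shows "cyl (insert j J) X = {z. fiber (cyl J X) (b j) z \<noteq> {}}"
proof (intro equalityI subsetI)
  fix z assume "z \<in> cyl (insert j J) X"
  then obtain x where x: "x \<in> X" "\<And>i. i \<notin> insert j J \<Longrightarrow> l i z = l i x" by (auto simp: cyl_def)
  then have "l j x - l j z \<in> fiber (cyl J X) (b j) z" unfolding fiber_cyl by (intro bexI[of _ x]) auto
  then show "z \<in> {z. fiber (cyl J X) (b j) z \<noteq> {}}" by blast
next
  fix z assume "z \<in> {z. fiber (cyl J X) (b j) z \<noteq> {}}"
  then obtain t where "t \<in> fiber (cyl J X) (b j) z" by blast
  then obtain x where x: "x \<in> X" "\<And>i. i \<notin> J \<Longrightarrow> l i x = l i z + (if i = j then t else 0)" unfolding fiber_cyl by blast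
  then show "z \<in> cyl (insert j J) X" by (auto simp: cyl_def intro!: bexI[of _ x])
qed

definition transversal :: "'n set \<Rightarrow> (complex^'n) set \<Rightarrow> bool" where
  "transversal J X \<longleftrightarrow> (\<forall>c\<in>cone_at_infinity X. (\<forall>i. i \<notin> J \<longrightarrow> l i c = 0) \<longrightarrow> c = 0)"

text \<open>Otherwise points much longer than their projections, normalised, accumulate at a unit
  vector of the cone lying in L.\<close>

lemma transversal_bound:
  assumes "transversal J X"
  shows "\<exists>K\<ge>0. \<forall>x\<in>X. norm x \<le> K * (1 + norm (proj J x))"
proof (rule ccontr)
  assume neg: "\<not> ?thesis"
  have "\<exists>x\<in>X. norm x > real n * (1 + norm (proj J x))" for n :: nat
    using neg by (meson not_le of_nat_0_le_iff)
  then obtain x where x: "\<And>n. x n \<in> X" "\<And>n. norm (x n) > real n * (1 + norm (proj J (x n)))" by metis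
  have big: "norm (x n) > real n" for n
  proof -
    have "real n * 1 \<le> real n * (1 + norm (proj J (x n)))" by (intro mult_left_mono) auto
    then show ?thesis using x(2)[of n] by linarith
  qed
  then have pos: "norm (x n) > 0" for n by (meson le_less_trans of_nat_0_le_iff)
  let ?c = "\<lambda>n. x n /\<^sub>R norm (x n)"
  have "?c n \<in> sphere 0 1" for n using pos[of n] by simp
  with compact_sphere[of "0::complex^'n" 1, unfolded compact_def, rule_format, of ?c]
  obtain c r where c: "c \<in> sphere 0 1" "strict_mono (r::nat\<Rightarrow>nat)" "(?c \<circ> r) \<longlonglongrightarrow> c" by blast
  have inf: "filterlim (\<lambda>n. norm (x n)) at_top sequentially"
    by (rule filterlim_at_top_mono[OF filterlim_real_sequentially]) (use big in \<open>auto simp: less_imp_le\<close>)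
  have infr: "filterlim (\<lambda>n. norm (x (r n))) at_top sequentially"
    using filterlim_compose[OF inf filterlim_subseq[OF c(2)]] .
  have cone: "c \<in> cone_at_infinity X"
    unfolding cone_at_infinity_def mem_Collect_eq
    by (rule exI[of _ "\<lambda>n. x (r n)"], rule exI[of _ "\<lambda>n. norm (x (r n))"])
      (use x(1) pos infr c(3) in \<open>simp add: o_def\<close>)
  have "(\<lambda>n. norm (proj J (?c (r n)))) \<longlonglongrightarrow> norm (proj J c)"
    using c(3) unfolding o_def by (intro tendsto_intros)
  moreover have "(\<lambda>n. norm (proj J (?c (r n)))) \<longlonglongrightarrow> 0"
  proof (rule tendsto_sandwich[where f="\<lambda>_. 0" and h="\<lambda>n. inverse (real n)"])
    show "eventually (\<lambda>n. norm (proj J (?c (r n))) \<le> inverse (real n)) sequentially"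
      using eventually_gt_at_top[of 0]
    proof eventually_elim
      case (elim n)
      have "n \<le> r n" using c(2) by (rule seq_suble)
      have "proj J (?c (r n)) = proj J (x (r n)) /\<^sub>R norm (x (r n))"
        by (rule frame_eqI) (simp add: l_proj l_scaleR)
      then have "norm (proj J (?c (r n))) = norm (proj J (x (r n))) / norm (x (r n))"
        by (simp add: divide_inverse_commute)
      also have "real n * norm (proj J (x (r n))) \<le> real (r n) * (1 + norm (proj J (x (r n))))"
        using \<open>n \<le> r n\<close> by (intro mult_mono) auto
      then have "real n * norm (proj J (x (r n))) \<le> norm (x (r n))" using x(2)[of "r n"] by linarith
      then have "norm (proj J (x (r n))) / norm (x (r n)) \<le> inverse (real n)"
        using elim pos[of "r n"] by (simp add: field_simps)
      finally show ?case .
    qed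
  qed (auto intro: lim_inverse_n)
  ultimately have "norm (proj J c) = 0" using LIMSEQ_unique by blast
  then have "\<forall>i. i \<notin> J \<longrightarrow> l i c = 0" using l_proj[of _ J c] by (metis l_zero norm_eq_zero)
  then have "c = 0" using assms cone unfolding transversal_def by blast
  then show False using c(1) by simp
qed

text \<open>Moving along \<open>b j\<close> with j in \<open>J\<close> does not change
  \<open>proj J\<close>, and transversality bounds points of X by that projection.\<close>

lemma cyl_fiber_growth:
  assumes "transversal J X" "J' \<subseteq> J" "j \<in> J - J'"
  shows "fiber_growth (cyl J' X) (b j)"
proof -
  obtain K where K: "K \<ge> 0" "\<And>x. x \<in> X \<Longrightarrow> norm x \<le> K * (1 + norm (proj J x))" using transversal_bound[OF assms(1)] by blast
  obtain L where L: "L > 0" "\<And>i z. norm (l i z) \<le> L * norm z" using l_bounded by blast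
  obtain M where M: "M > 0" "\<And>z. norm (proj J z) \<le> M * norm z" using proj_bounded by blast
  have "norm t \<le> (L * K * (1 + M) + L) * (1 + norm z)" if t: "t \<in> fiber (cyl J' X) (b j) z" for t z
  proof -
    obtain x where x: "x \<in> X" "\<And>i. i \<notin> J' \<Longrightarrow> l i x = l i z + (if i = j then t else 0)" using t unfolding fiber_cyl by blast
    have "proj J x = proj J z" unfolding proj_eq_iff
    proof (intro allI impI)
      fix i assume "i \<notin> J"
      then have "i \<notin> J'" "i \<noteq> j" using assms(2,3) by auto
      then show "l i x = l i z" using x(2) by simp
    qed
    then have "norm x \<le> K * (1 + M * norm z)"
      using K(2)[OF x(1)] M(2)[of z] K(1) by (smt (verit) mult_left_mono)
    also have "\<dots> \<le> K * ((1 + M) * (1 + norm z))"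
      using K(1) M(1) by (intro mult_left_mono) (auto simp: algebra_simps)
    finally have nx: "norm x \<le> K * ((1 + M) * (1 + norm z))" .
    have "t = l j x - l j z" using x(2)[of j] assms(3) by simp
    then have "norm t \<le> norm (l j x) + norm (l j z)" by (simp add: norm_triangle_ineq4)
    also have "\<dots> \<le> L * norm x + L * norm z" using L(2) by (intro add_mono)
    also have "\<dots> \<le> L * (K * ((1 + M) * (1 + norm z))) + L * (1 + norm z)"
      using nx L(1) by (intro add_mono mult_left_mono) auto
    finally show ?thesis by (simp add: algebra_simps)
  qed
  moreover have "L * K * (1 + M) + L \<ge> 0" using L M K by simp
  ultimately show ?thesis unfolding fiber_growth_def by blast
qed

lemma cyl_locally_analytic:
  assumes "locally_analytic X" "transversal J X" "J' \<subseteq> J"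
  shows "locally_analytic (cyl J' X)"
proof -
  have "finite J'" by simp
  then show ?thesis using assms(3)
  proof (induction J' rule: finite_induct)
    case empty
    then show ?case using assms(1) by (simp add: cyl_empty)
  next
    case (insert j J')
    then have "fiber_growth (cyl J' X) (b j)" by (intro cyl_fiber_growth[OF assms(2)]) auto
    then show ?case using insert by (simp add: cyl_insert projection_locally_analytic)
  qed
qed

text \<open>Each of the successive projections along a line has finite fibers, and finitely many
  such steps make up the projection along \<open>J'\<close>.\<close>

lemma transversal_fiber_finite:
  assumes "locally_analytic X" "transversal J X" "J' \<subseteq> J"
  shows "finite {x \<in> X. \<forall>i. i \<notin> J' \<longrightarrow> l i x = l i p}"
proof -
  have "finite J'" by simp
  then show ?thesis using assms(3)
  proof (induction J' arbitrary: p rule: finite_induct)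
    case empty
    have "{x \<in> X. \<forall>i. i \<notin> {} \<longrightarrow> l i x = l i p} \<subseteq> {p}" by (auto intro: frame_eqI)
    then show ?case using finite_subset by blast
  next
    case (insert j J')
    have gr: "fiber_growth (cyl J' X) (b j)" using insert by (intro cyl_fiber_growth[OF assms(2)]) auto
    have an: "locally_analytic (cyl J' X)" using insert by (intro cyl_locally_analytic[OF assms(1,2)]) auto
    have "{x \<in> X. \<forall>i. i \<notin> insert j J' \<longrightarrow> l i x = l i p} \<subseteq>
       (\<Union>t\<in>fiber (cyl J' X) (b j) p. {x \<in> X. \<forall>i. i \<notin> J' \<longrightarrow> l i x = l i (p + t *s b j)})"
    proof
      fix x assume x: "x \<in> {x \<in> X. \<forall>i. i \<notin> insert j J' \<longrightarrow> l i x = l i p}"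
      let ?t = "l j x - l j p"
      have eq: "l i x = l i p + (if i = j then ?t else 0)" if "i \<notin> J'" for i using x that by auto
      then have "?t \<in> fiber (cyl J' X) (b j) p" unfolding fiber_cyl using x by (intro bexI[of _ x]) auto
      moreover have "\<forall>i. i \<notin> J' \<longrightarrow> l i x = l i (p + ?t *s b j)"
      proof (intro allI impI)
        fix i assume "i \<notin> J'"
        from eq[OF this] show "l i x = l i (p + ?t *s b j)" by (simp add: l_simps)
      qed
      ultimately show "x \<in> (\<Union>t\<in>fiber (cyl J' X) (b j) p. {x \<in> X. \<forall>i. i \<notin> J' \<longrightarrow> l i x = l i (p + t *s b j)})"
        using x by blast
    qed
    moreover have "finite \<dots>" using fiber_finite[OF an gr] insert by auto
    ultimately show ?case by (rule finite_subset)
  qed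
qed

text \<open>Directions are forgotten one at a time: on a suitable piece of X the coordinate
  \<open>l j\<close> is a single sheet \<open>xx a\<close> over the projection, so injectivity is
  preserved.\<close>

lemma proj_locally_injective:
  assumes X: "locally_analytic X" "transversal J X" "J' \<subseteq> J" and W: "open W" "W \<inter> X \<noteq> {}"
  shows "\<exists>W'. open W' \<and> W' \<subseteq> W \<and> W' \<inter> X \<noteq> {} \<and> inj_on (proj J') (W' \<inter> X)"
proof -
  have "finite J'" by simp
  then show ?thesis using X(3)
  proof (induction J' rule: finite_induct)
    case empty
    then show ?case using W by (intro exI[of _ W]) (auto simp: inj_on_def proj_empty)
  next
    case (insert j J')
    then obtain W1 where W1: "open W1" "W1 \<subseteq> W" "W1 \<inter> X \<noteq> {}" "inj_on (proj J') (W1 \<inter> X)" by auto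
    have gr: "fiber_growth (cyl J' X) (b j)" using insert by (intro cyl_fiber_growth[OF X(2)]) auto
    have an: "locally_analytic (cyl J' X)" using insert by (intro cyl_locally_analytic[OF X(1,2)]) auto
    let ?p = "proj (insert j J')"
    have fib: "l j x \<in> fiber (cyl J' X) (b j) (?p x)" if "x \<in> X" for x
      unfolding fiber_cyl using that insert.hyps(2) by (intro bexI[of _ x]) (auto simp: l_proj)
    have "?p ` (W1 \<inter> X) \<noteq> {}" using W1(3) by blast
    then obtain y U and A :: "complex set" and xx D where
      s: "y \<in> ?p ` (W1 \<inter> X)" "open U" "y \<in> U" "\<And>a. a \<in> A \<Longrightarrow> open (D a)"
      "\<And>a. a \<in> A \<Longrightarrow> continuous_on (?p ` (W1 \<inter> X) \<inter> U) (xx a)"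
      "\<And>a c. a \<in> A \<Longrightarrow> c \<in> A \<Longrightarrow> a \<noteq> c \<Longrightarrow> D a \<inter> D c = {}"
      "\<And>z. z \<in> ?p ` (W1 \<inter> X) \<inter> U \<Longrightarrow> fiber (cyl J' X) (b j) z = (\<lambda>a. xx a z) ` A"
      "\<And>z a. z \<in> ?p ` (W1 \<inter> X) \<inter> U \<Longrightarrow> a \<in> A \<Longrightarrow> xx a z \<in> D a"
      by (rule fiber_selection[OF an gr]) (rule that; assumption)
    obtain x0 where x0: "x0 \<in> W1 \<inter> X" "y = ?p x0" using s(1) by blast
    have "l j x0 \<in> (\<lambda>a. xx a y) ` A" using fib[of x0] x0 s(1,3) s(7)[of y] by simp
    then obtain a where a: "a \<in> A" "l j x0 = xx a y" by blast
    have uniq: "l j x = xx a (?p x)" if x: "x \<in> W1 \<inter> X" "?p x \<in> U" "l j x \<in> D a" for x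
    proof -
      have px: "?p x \<in> ?p ` (W1 \<inter> X) \<inter> U" using x by blast
      then have "l j x \<in> (\<lambda>a. xx a (?p x)) ` A" using fib[of x] x s(7)[OF px] by simp
      then obtain a' where a': "a' \<in> A" "l j x = xx a' (?p x)" by blast
      then have "l j x \<in> D a'" using s(8)[OF px] by simp
      then have "a' = a" using s(6)[OF a'(1) a(1)] x(3) by blast
      then show ?thesis using a' by simp
    qed
    let ?W = "W1 \<inter> (?p -` U \<inter> (l j) -` (D a))"
    have "continuous_on UNIV ?p" "continuous_on UNIV (l j)" by (intro continuous_intros)+
    then have "open ?W" using W1(1) s(2) s(4)[OF a(1)] by (intro open_Int open_vimage) auto
    moreover have "x0 \<in> ?W \<inter> X" using x0 s(1,3) s(8)[of y a] a by simp
    moreover have "inj_on ?p (?W \<inter> X)"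
    proof (rule inj_onI)
      fix x x' assume x: "x \<in> ?W \<inter> X" "x' \<in> ?W \<inter> X" "?p x = ?p x'"
      have "l j x = xx a (?p x)" "l j x' = xx a (?p x')" using x(1,2) by (auto intro!: uniq)
      then have "l j x = l j x'" using x(3) by simp
      then have "proj J' x = proj J' x'" using x(3) unfolding proj_eq_iff by auto
      then show "x = x'" using W1(4) x(1,2) by (auto dest: inj_onD)
    qed
    ultimately show ?case using W1(2) by (intro exI[of _ ?W]) blast
  qed
qed

text \<open>The projection is inverted by restoring one direction at a time, choosing a sheet of the
  fibers over a relatively open piece. The open set \<open>W\<close> records that the lifted piece
  is open in X, as the dimension count requires.\<close>

lemma continuous_section:
  assumes X: "locally_analytic X" "transversal J X" and full: "cyl J X = UNIV"
  shows "\<exists>S \<sigma> W. openin (top_of_set (coord_space J)) S \<and> S \<noteq> {} \<and> continuous_on S \<sigma> \<and> open W \<and>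
     \<sigma> ` S = X \<inter> W \<and> (\<forall>s\<in>S. proj J (\<sigma> s) = s)"
proof -
  have main: "\<exists>S \<sigma> W. openin (top_of_set (coord_space J)) S \<and> S \<noteq> {} \<and> continuous_on S \<sigma> \<and> open W \<and>
     \<sigma> ` S = proj (J - R) ` X \<inter> W \<and> (\<forall>s\<in>S. proj J (\<sigma> s) = s)" if "finite R" "R \<subseteq> J" for R
    using that
  proof (induction R rule: finite_induct)
    case empty
    have "coord_space J = proj J ` X"
    proof (intro equalityI subsetI)
      fix s assume s: "s \<in> coord_space J"
      have "s \<in> cyl J X" using full by simp
      then obtain x where x: "x \<in> X" "\<And>i. i \<notin> J \<Longrightarrow> l i s = l i x" by (auto simp: cyl_def)
      then have "proj J x = proj J s" unfolding proj_eq_iff by auto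
      then show "s \<in> proj J ` X" using x(1) proj_of_coord_space[OF s] by (metis image_eqI)
    qed (auto simp: proj_in_coord_space)
    then show ?case
    proof (intro exI conjI)
      show "coord_space J \<noteq> {}" using proj_in_coord_space by blast
      show "(\<lambda>s. s) ` coord_space J = proj (J - {}) ` X \<inter> UNIV" using \<open>coord_space J = proj J ` X\<close> by simp
      show "\<forall>s\<in>coord_space J. proj J s = s" by (simp add: proj_of_coord_space)
    qed (auto intro: continuous_intros)
  next
    case (insert j R)
    then obtain S \<sigma> W where S: "openin (top_of_set (coord_space J)) S" "S \<noteq> {}" "continuous_on S \<sigma>" "open W"
      "\<sigma> ` S = proj (J - R) ` X \<inter> W" "\<forall>s\<in>S. proj J (\<sigma> s) = s" by auto
    define J' where "J' = J - insert j R"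
    have J': "J - R = insert j J'" "j \<notin> J'" "J' \<subseteq> J" "j \<in> J - J'" using insert by (auto simp: J'_def)
    have gr: "fiber_growth (cyl J' X) (b j)" by (rule cyl_fiber_growth[OF X(2) J'(3,4)])
    have an: "locally_analytic (cyl J' X)" by (rule cyl_locally_analytic[OF X J'(3)])
    let ?p = "proj (insert j J')"
    have fib: "l j x \<in> fiber (cyl J' X) (b j) (?p x)" if "x \<in> X" for x
      unfolding fiber_cyl using that J'(2) by (intro bexI[of _ x]) (auto simp: l_proj)
    have T: "\<sigma> ` S = ?p ` X \<inter> W" using S(5) J'(1) by simp
    have "\<sigma> ` S \<noteq> {}" using S(2) by blast
    then obtain y U and A :: "complex set" and xx D where
      s: "y \<in> \<sigma> ` S" "open U" "y \<in> U" "\<And>a. a \<in> A \<Longrightarrow> open (D a)"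
      "\<And>a. a \<in> A \<Longrightarrow> continuous_on (\<sigma> ` S \<inter> U) (xx a)"
      "\<And>a c. a \<in> A \<Longrightarrow> c \<in> A \<Longrightarrow> a \<noteq> c \<Longrightarrow> D a \<inter> D c = {}"
      "\<And>z. z \<in> \<sigma> ` S \<inter> U \<Longrightarrow> fiber (cyl J' X) (b j) z = (\<lambda>a. xx a z) ` A"
      "\<And>z a. z \<in> \<sigma> ` S \<inter> U \<Longrightarrow> a \<in> A \<Longrightarrow> xx a z \<in> D a"
      by (rule fiber_selection[OF an gr]) (rule that; assumption)
    have "A \<noteq> {}"
    proof -
      obtain x where x: "x \<in> X" "y = ?p x" using s(1) T by blast
      have "fiber (cyl J' X) (b j) y \<noteq> {}" using fib[OF x(1)] x(2) by blast
      then show ?thesis using s(1,3) s(7)[of y] by auto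
    qed
    then obtain a where a: "a \<in> A" by blast
    define S' where "S' = S \<inter> \<sigma> -` U"
    define \<sigma>' where "\<sigma>' s = \<sigma> s + xx a (\<sigma> s) *s b j" for s
    \<comment> \<open>\<open>D a\<close> contains no value of any other sheet, so this open
      condition singles out the image of \<open>\<sigma>'\<close>.\<close>
    define W' where "W' = ?p -` (W \<inter> U) \<inter> (l j) -` (D a)"
    have "openin (top_of_set S) S'" unfolding S'_def using S(3) s(2) by (rule continuous_openin_preimage_gen)
    then have opS': "openin (top_of_set (coord_space J)) S'" using S(1) openin_trans by blast
    have neS': "S' \<noteq> {}" using s(1,3) by (auto simp: S'_def)
    have "continuous_on S' \<sigma>" using S(3) by (rule continuous_on_subset) (auto simp: S'_def)
    moreover have "continuous_on S' (\<lambda>s. xx a (\<sigma> s))"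
      by (rule continuous_on_compose2[OF _ \<open>continuous_on S' \<sigma>\<close>]) (use s(5)[OF a] in \<open>auto simp: S'_def\<close>)
    ultimately have cont: "continuous_on S' \<sigma>'" unfolding \<sigma>'_def by (intro continuous_intros)
    have opW': "open W'"
    proof -
      have "continuous_on UNIV ?p" "continuous_on UNIV (l j)" by (intro continuous_intros)+
      then show ?thesis unfolding W'_def using S(4) s(2) s(4)[OF a] by (intro open_Int open_vimage) auto
    qed
    have pj: "proj J (\<sigma>' s) = s" if "s \<in> S'" for s
    proof -
      have "proj J (\<sigma>' s) = proj J (\<sigma> s)" unfolding proj_eq_iff using J'(4) by (auto simp: \<sigma>'_def l_simps)
      then show ?thesis using S(6) that by (auto simp: S'_def)
    qed
    have "\<sigma>' ` S' = proj J' ` X \<inter> W'"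
    proof (intro equalityI subsetI)
      fix w assume "w \<in> \<sigma>' ` S'"
      then obtain s' where s': "s' \<in> S" "\<sigma> s' \<in> U" "w = \<sigma>' s'" by (auto simp: S'_def)
      let ?y = "\<sigma> s'"
      have yT: "?y \<in> \<sigma> ` S \<inter> U" using s' by blast
      then have yE: "l i ?y = 0" if "i \<in> insert j J'" for i using T that by (auto simp: l_proj)
      have "xx a ?y \<in> fiber (cyl J' X) (b j) ?y" "xx a ?y \<in> D a" using s(7,8)[OF yT] a by auto
      then obtain x where x: "x \<in> X" "\<And>i. i \<notin> J' \<Longrightarrow> l i x = l i ?y + (if i = j then xx a ?y else 0)"
        unfolding fiber_cyl by blast
      have "w = proj J' x"
        by (rule frame_eqI) (use x(2) yE J'(2) in \<open>auto simp: s'(3) \<sigma>'_def l_simps l_proj\<close>)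
      moreover have "?p w = ?y" by (rule frame_eqI) (use yE in \<open>auto simp: s'(3) \<sigma>'_def l_simps l_proj\<close>)
      moreover have "l j w = xx a ?y" using yE by (simp add: s'(3) \<sigma>'_def l_simps)
      moreover have "?y \<in> W" using yT T by blast
      ultimately show "w \<in> proj J' ` X \<inter> W'" using x(1) yT \<open>xx a ?y \<in> D a\<close> by (auto simp: W'_def)
    next
      fix w assume w: "w \<in> proj J' ` X \<inter> W'"
      then obtain x where x: "x \<in> X" "w = proj J' x" by blast
      have pw: "?p w = ?p x" by (rule frame_eqI) (auto simp: x(2) l_proj)
      have "?p w \<in> \<sigma> ` S \<inter> U" using w T pw x(1) by (auto simp: W'_def)
      then obtain s' where s': "s' \<in> S" "?p w = \<sigma> s'" "\<sigma> s' \<in> U" by auto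
      have lw: "l j w = l j x" using J'(2) by (simp add: x(2) l_proj)
      have yT: "\<sigma> s' \<in> \<sigma> ` S \<inter> U" using s' by blast
      have "l j w \<in> fiber (cyl J' X) (b j) (\<sigma> s')" using fib[OF x(1)] lw pw s'(2) by simp
      then obtain a' where a': "a' \<in> A" "l j w = xx a' (\<sigma> s')" using s(7)[OF yT] by blast
      have "l j w \<in> D a'" using s(8)[OF yT] a' by auto
      moreover have "l j w \<in> D a" using w by (auto simp: W'_def)
      ultimately have "a' = a" using s(6)[OF a'(1) a] by blast
      have "w = \<sigma>' s'"
        by (rule frame_eqI) (use J'(2) a'(2) \<open>a' = a\<close> in \<open>auto simp: \<sigma>'_def l_simps l_proj x(2) simp flip: s'(2)\<close>)
      then show "w \<in> \<sigma>' ` S'" using s' by (auto simp: S'_def)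
    qed
    then show ?case using opS' neS' cont opW' pj unfolding J'_def[symmetric]
      by (intro exI[of _ S'] exI[of _ \<sigma>'] exI[of _ W']) auto
  qed
  have "proj (J - J) = (\<lambda>z. z)" by (auto simp: proj_empty)
  then show ?thesis using main[of J] by simp
qed

text \<open>Real dimension, as invariance of domain speaks of real subspaces; hence the factor
  2.\<close>

lemma dim_coord_space: "dim (coord_space J) = 2 * card (- J)"
proof -
  let ?\<Phi> = "\<lambda>z. \<chi> i. l i z"
  have lin: "linear ?\<Phi>" by (rule linearI) (auto simp: vec_eq_iff l_simps scaleR_conv_of_real[where 'a=complex])
  have inj: "inj ?\<Phi>" 
  proof (rule injI, rule frame_eqI)
    fix x y i assume "?\<Phi> x = ?\<Phi> y"
    from arg_cong[OF this, of "\<lambda>w. vec_nth w i"] show "l i x = l i y" by simp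
  qed
  have im: "?\<Phi> ` coord_space J = {w. \<forall>i\<in>J. w $ i = 0}"
  proof (intro equalityI subsetI)
    fix w :: "complex^'n" assume w: "w \<in> {w. \<forall>i\<in>J. w $ i = 0}"
    let ?z = "\<Sum>i\<in>UNIV. w $ i *s b i"
    have lz: "l i ?z = w $ i" for i by (simp add: l_simps if_distrib sum.delta' cong: if_cong)
    then have "?\<Phi> ?z = w" by (simp only: vec_lambda_eta)
    moreover have "?z \<in> coord_space J" using w lz by (auto simp: coord_space_def)
    ultimately show "w \<in> ?\<Phi> ` coord_space J" by (intro image_eqI[of w ?\<Phi> ?z]) simp_all
  qed (auto simp: coord_space_def)
  let ?D = "(\<lambda>(i,c). axis i c) ` ((- J) \<times> {1, \<i>}) :: (complex^'n) set"
  have "{w. \<forall>i\<in>J. w $ i = 0} = {x. \<forall>k\<in>Basis. k \<notin> ?D \<longrightarrow> x \<bullet> k = 0}"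
  proof (intro equalityI subsetI)
    fix x :: "complex^'n" assume x: "x \<in> {w. \<forall>i\<in>J. w $ i = 0}"
    have "x \<bullet> k = 0" if k: "k \<in> Basis" "k \<notin> ?D" for k
    proof -
      obtain i c where ic: "k = axis i c" "c \<in> Basis" using k(1) by (auto simp: Basis_vec_def)
      have "i \<in> J"
      proof (rule ccontr)
        assume "i \<notin> J"
        then have "k \<in> ?D" using ic by (intro image_eqI[of _ _ "(i,c)"]) (auto simp: Basis_complex_def)
        then show False using k by blast
      qed
      then show ?thesis using x ic by (simp add: inner_axis)
    qed
    then show "x \<in> {x. \<forall>k\<in>Basis. k \<notin> ?D \<longrightarrow> x \<bullet> k = 0}" by blast
  next
    fix x :: "complex^'n" assume x: "x \<in> {x. \<forall>k\<in>Basis. k \<notin> ?D \<longrightarrow> x \<bullet> k = 0}"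
    have "x $ i = 0" if i: "i \<in> J" for i
    proof -
      have "x \<bullet> axis i c = 0" if "c \<in> {1, \<i>}" for c
      proof -
        have "axis i c \<in> Basis" using that by (auto simp: Basis_vec_def Basis_complex_def)
        moreover have "axis i c \<notin> ?D" using i that by (auto simp: axis_eq_axis)
        ultimately show ?thesis using x by blast
      qed
      from this[of 1] this[of \<i>] show ?thesis by (simp add: inner_axis complex_eq_iff inner_complex_def)
    qed
    then show "x \<in> {w. \<forall>i\<in>J. w $ i = 0}" by blast
  qed
  moreover have "?D \<subseteq> Basis" by (auto simp: Basis_vec_def Basis_complex_def)
  ultimately have "dim {w :: complex^'n. \<forall>i\<in>J. w $ i = 0} = card ?D" using dim_substandard[of ?D] by simp
  also have "card ?D = card ((- J) \<times> {1, \<i>})"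
    by (rule card_image) (auto simp: inj_on_def axis_eq_axis)
  also have "\<dots> = 2 * card (- J)" by (simp add: card_cartesian_product)
  finally have "dim (?\<Phi> ` coord_space J) = 2 * card (- J)" unfolding im .
  moreover have "dim (?\<Phi> ` coord_space J) = dim (coord_space J)"
    by (rule dim_image_eq[OF lin]) (rule inj_on_subset[OF inj], simp)
  ultimately show ?thesis by simp
qed

end

lemma frame_standard: "frame (\<lambda>i. axis i 1) (\<lambda>i z. z $ i)"
  by unfold_locales (auto simp: axis_def vec_eq_iff if_distrib sum.delta cong: if_cong)

section \<open>Charts of pure-dimensional sets\<close>

lemma holomorphic_map_on_continuous:
  assumes "holomorphic_map_on \<phi> U" shows "continuous_on U \<phi>"
proof -
  have "continuous_on U (\<lambda>z. \<phi> z $ i)" for i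
    using assms unfolding holomorphic_map_on_def holomorphic_fun_on_def
    by (meson continuous_at_imp_continuous_on has_derivative_continuous)
  then have "continuous_on U (\<lambda>z. \<chi> i. \<phi> z $ i)" by (rule continuous_on_vec_lambda)
  then show ?thesis by simp
qed

text \<open>Regular points of dimension d are dense in X, so any open piece contains a chart. Only
  its continuity in both directions is kept, which is what topological dimension theory
  needs.\<close>

lemma pure_analytic_chart:
  fixes X :: "(complex^'n) set"
  assumes X: "closed_pure_analytic_set d X" and W: "open W" "W \<inter> X \<noteq> {}"
  obtains I S \<psi> \<phi> W' where "card I = d" "openin (top_of_set {w::complex^'n. \<forall>i. i \<notin> I \<longrightarrow> w $ i = 0}) S" "S \<noteq> {}"
    "continuous_on S \<psi>" "\<psi> ` S = X \<inter> W'" "open W'" "W' \<subseteq> W" "continuous_on (X \<inter> W') \<phi>"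
    "\<And>s. s \<in> S \<Longrightarrow> \<phi> (\<psi> s) = s"
proof -
  obtain x where "x \<in> W" "x \<in> X" using W by blast
  then have "x \<in> closure (regular_points X d)"
    using X unfolding closed_pure_analytic_set_def has_analytic_dim_at_def by blast
  then have "W \<inter> regular_points X d \<noteq> {}" using W(1) \<open>x \<in> W\<close> open_Int_closure_eq_empty by blast
  then obtain a where a: "a \<in> W" "a \<in> regular_points X d" by blast
  then obtain U V \<phi> I where r: "a \<in> X" "a \<in> U" "biholomorphic_between U V \<phi>" "card I = d"
    "\<phi> ` (X \<inter> U) = {w \<in> (V :: (complex^'n) set). \<forall>i. i \<notin> I \<longrightarrow> w $ i = 0}"
    unfolding regular_points_def by blast
  have bh: "open U" "open V" "bij_betw \<phi> U V" "holomorphic_map_on \<phi> U" "holomorphic_map_on (inv_into U \<phi>) V"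
    using r(3) unfolding biholomorphic_between_def by auto
  let ?\<psi> = "inv_into U \<phi>"
  have inj: "inj_on \<phi> U" using bh(3) by (simp add: bij_betw_def)
  have c\<phi>: "continuous_on U \<phi>" and c\<psi>: "continuous_on V ?\<psi>" using bh by (auto intro: holomorphic_map_on_continuous)
  have \<psi>\<phi>: "?\<psi> (\<phi> z) = z" if "z \<in> U" for z using inj that by (rule inv_into_f_f)
  let ?E = "{w :: complex^'n. \<forall>i. i \<notin> I \<longrightarrow> w $ i = 0}"
  let ?W' = "W \<inter> U"
  let ?S = "\<phi> ` (X \<inter> ?W')"
  have Seq: "?S = ?E \<inter> (V \<inter> ?\<psi> -` W)"
  proof (intro equalityI subsetI)
    fix w assume "w \<in> ?S"
    then obtain z where z: "z \<in> X" "z \<in> W" "z \<in> U" "w = \<phi> z" by blast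
    then have "w \<in> \<phi> ` (X \<inter> U)" by blast
    then show "w \<in> ?E \<inter> (V \<inter> ?\<psi> -` W)" using r(5) z \<psi>\<phi> by auto
  next
    fix w assume w: "w \<in> ?E \<inter> (V \<inter> ?\<psi> -` W)"
    then have "w \<in> \<phi> ` (X \<inter> U)" unfolding r(5) by blast
    then obtain z where "z \<in> X" "z \<in> U" "w = \<phi> z" by blast
    then show "w \<in> ?S" using w \<psi>\<phi> by auto
  qed
  have "open (V \<inter> ?\<psi> -` W)" using c\<psi> bh(2) W(1) by (rule continuous_open_preimage)
  then have opS: "openin (top_of_set ?E) ?S" unfolding Seq by (auto simp: openin_open)
  have SV: "?S \<subseteq> V" unfolding Seq by blast
  have im: "?\<psi> ` ?S = X \<inter> ?W'" using \<psi>\<phi> by (auto simp: image_image)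
  show ?thesis
  proof (rule that[OF r(4) opS _ _ im])
    show "?S \<noteq> {}" using a r by blast
    show "continuous_on ?S ?\<psi>" using c\<psi> SV continuous_on_subset by blast
    show "open ?W'" using W bh by blast
    show "continuous_on (X \<inter> ?W') \<phi>" using c\<phi> by (rule continuous_on_subset) blast
    show "\<phi> (?\<psi> s) = s" if "s \<in> ?S" for s using that \<psi>\<phi> by auto
  qed simp
qed

section \<open>Dimension and thickness\<close>

lemma dim_standard_coord_space: "dim {w :: complex^'n. \<forall>i. i \<notin> I \<longrightarrow> w $ i = 0} = 2 * card I"
    and subspace_standard_coord_space: "subspace {w :: complex^'n. \<forall>i. i \<notin> I \<longrightarrow> w $ i = 0}"
proof -
  interpret std: frame "\<lambda>i. axis i 1 :: complex^'n" "\<lambda>i z. vec_nth z i" by (rule frame_standard)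
  have eq: "{w :: complex^'n. \<forall>i. i \<notin> I \<longrightarrow> w $ i = 0} = std.coord_space (- I)"
    by (auto simp: std.coord_space_def)
  show "dim {w :: complex^'n. \<forall>i. i \<notin> I \<longrightarrow> w $ i = 0} = 2 * card I" unfolding eq std.dim_coord_space by simp
  show "subspace {w :: complex^'n. \<forall>i. i \<notin> I \<longrightarrow> w $ i = 0}" unfolding eq by (rule std.subspace_coord_space)
qed

context frame
begin

text \<open>A piece of X on which \<open>proj J\<close> is injective contains a chart of real
  dimension 2d, the dimension of the target because card (- J) = d. Invariance of domain makes the
  projected chart open, so for all z near a suitable point the line along \<open>b j\<close> meets
  the cylinder near the prescribed place.\<close>

lemma cyl_thick:
  assumes pure: "closed_pure_analytic_set d X" and X: "locally_analytic X" "transversal J X"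
    and dJ: "card (- J) = d" and j: "j \<in> J"
  shows "thick (cyl (J - {j}) X) (b j)"
  unfolding thick_def
proof (intro allI impI)
  let ?J' = "J - {j}"
  let ?Y = "cyl ?J' X"
  fix W assume W: "open W \<and> W \<inter> ?Y \<noteq> {}"
  then obtain y x where y: "y \<in> W" and x: "x \<in> X" "\<And>i. i \<notin> ?J' \<Longrightarrow> l i y = l i x" by (auto simp: cyl_def)
  obtain \<eta> where \<eta>: "\<eta> > 0" "ball y \<eta> \<subseteq> W" using W y by (meson openE)
  \<comment> \<open>Translation by \<open>L\<close> stays in the cylinder and moves
    \<open>x\<close>, around which the chart is taken, to the prescribed point
    \<open>y\<close>.\<close>
  define L where "L = y - x"
  have lL: "l i L = 0" if "i \<notin> ?J'" for i using x(2)[OF that] by (simp add: L_def l_diff)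
  define p' where "p' z = z - proj ?J' z" for z
  have lp': "l i (p' z) = (if i \<in> ?J' then l i z else 0)" for i z by (simp add: p'_def l_diff l_proj)
  obtain C0 where C0: "C0 > 0" "\<And>z. norm (proj ?J' z) \<le> C0 * norm z" using proj_bounded by blast
  define C where "C = 1 + C0"
  have C: "norm (p' z) \<le> C * norm z" "C > 0" for z
    using norm_triangle_ineq4[of z "proj ?J' z"] C0 by (auto simp: p'_def C_def distrib_right intro: order_trans add_pos_pos)
  \<comment> \<open>The constructed point will be within (1 + 3C)e of \<open>y\<close>: e from the
    chart, Ce from z, and 2Ce from comparing two points of the chart.\<close>
  define e where "e = \<eta> / (4 * (C + 1))"
  have "0 < C * \<eta> + \<eta> * 3" using \<eta>(1) C(2) by (intro add_pos_pos) auto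
  then have e: "e > 0" "(1 + 3 * C) * e < \<eta>" using \<eta>(1) C(2) by (auto simp: e_def field_simps)
  have "ball x e \<inter> X \<noteq> {}" using x(1) e(1) by (metis IntI centre_in_ball empty_iff)
  from proj_locally_injective[OF X order_refl open_ball this]
  obtain W2 where W2: "open W2" "W2 \<subseteq> ball x e" "W2 \<inter> X \<noteq> {}" "inj_on (proj J) (W2 \<inter> X)"
    by (elim exE conjE)
  obtain I S \<psi> \<phi> W3 where ch: "card I = d" "openin (top_of_set {w::complex^'n. \<forall>i. i \<notin> I \<longrightarrow> w $ i = 0}) S" "S \<noteq> {}"
    "continuous_on S \<psi>" "\<psi> ` S = X \<inter> W3" "open W3" "W3 \<subseteq> W2" "continuous_on (X \<inter> W3) \<phi>"
    "\<And>s. s \<in> S \<Longrightarrow> \<phi> (\<psi> s) = s"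
    by (rule pure_analytic_chart[OF pure W2(1,3)]) (rule that; assumption)
  let ?h = "\<lambda>s. proj J (\<psi> s)"
  have "openin (top_of_set (coord_space J)) (?h ` S)"
  proof (rule invariance_of_domain_subspaces[OF ch(2) subspace_standard_coord_space subspace_coord_space])
    show "dim (coord_space J) \<le> dim {w::complex^'n. \<forall>i. i \<notin> I \<longrightarrow> w $ i = 0}"
      unfolding dim_coord_space dim_standard_coord_space using ch(1) dJ by simp
    show "continuous_on S ?h" using ch(4) by (intro continuous_intros)
    show "?h \<in> S \<rightarrow> coord_space J" by (simp add: proj_in_coord_space)
    show "inj_on ?h S"
    proof (rule inj_onI)
      fix s s' assume s: "s \<in> S" "s' \<in> S" "?h s = ?h s'"
      have "\<psi> s \<in> W2 \<inter> X" "\<psi> s' \<in> W2 \<inter> X" using ch(5,7) s(1,2) by blast+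
      then have "\<psi> s = \<psi> s'" using W2(4) s(3) by (auto dest: inj_onD)
      then show "s = s'" using ch(9) s(1,2) by metis
    qed
  qed
  then obtain T where T: "open T" "?h ` S = coord_space J \<inter> T" unfolding openin_open by blast
  have img: "\<psi> s \<in> X" "\<psi> s \<in> ball x e" if "s \<in> S" for s
  proof -
    have "\<psi> s \<in> X \<inter> W3" using that unfolding ch(5)[symmetric] by blast
    then show "\<psi> s \<in> X" "\<psi> s \<in> ball x e" using ch(7) W2(2) by blast+
  qed
  obtain s0 where s0: "s0 \<in> S" using ch(3) by blast
  define x0 where "x0 = \<psi> s0"
  have x0: "x0 \<in> X" "x0 \<in> ball x e" unfolding x0_def by (rule img[OF s0])+
  define z0 where "z0 = x0 + L"
  let ?V = "ball z0 e \<inter> proj J -` T"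
  have "continuous_on UNIV (proj J)" by (intro continuous_intros)
  then have opV: "open ?V" using T(1) by (intro open_Int open_vimage) auto
  have "proj J z0 = ?h s0" unfolding proj_eq_iff x0_def[symmetric] by (auto simp: z0_def l_add lL)
  then have z0V: "z0 \<in> ?V" using T(2) s0 e(1) by auto
  have "?V \<subseteq> {z. \<exists>t. z + t *s b j \<in> W \<inter> ?Y}"
  proof
    fix z assume z: "z \<in> ?V"
    then have "proj J z \<in> ?h ` S" unfolding T(2) by (simp add: proj_in_coord_space)
    then obtain s' where s': "s' \<in> S" "proj J z = ?h s'" by blast
    define x' where "x' = \<psi> s'"
    have x': "x' \<in> X" "x' \<in> ball x e" unfolding x'_def by (rule img[OF s'(1)])+
    have pz: "l i z = l i x'" if "i \<notin> J" for i using s'(2) that unfolding proj_eq_iff x'_def by blast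
    define q where "q = z + (l j x' - l j z) *s b j"
    have lq: "l i q = l i x'" if "i \<notin> ?J'" for i
      using pz[of i] that by (cases "i = j") (auto simp: q_def l_simps)
    then have "q \<in> ?Y" using x'(1) by (auto simp: cyl_def)
    moreover have "q \<in> W"
    proof -
      \<comment> \<open>Checked coordinatewise: the coordinates of q in \<open>J - {j}\<close> come
        from z, all others from x'.\<close>
      have "q - y = (x' - x) + p' (z - z0) + p' (x0 - x')"
      proof (rule frame_eqI)
        fix i
        show "l i (q - y) = l i ((x' - x) + p' (z - z0) + p' (x0 - x'))"
        proof (cases "i \<in> ?J'")
          case True
          then have "l i q = l i z" by (auto simp: q_def l_simps)
          then show ?thesis using True by (simp add: l_simps lp' z0_def L_def)
        next
          case False
          then show ?thesis using lq[OF False] x(2)[OF False] by (auto simp: l_simps lp')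
        qed
      qed
      then have "norm (q - y) \<le> norm (x' - x) + norm (p' (z - z0)) + norm (p' (x0 - x'))"
        by (metis norm_triangle_ineq norm_triangle_mono order_refl)
      also have "\<dots> \<le> e + C * e + C * (2 * e)"
      proof (intro add_mono)
        show "norm (x' - x) \<le> e" using x'(2) by (simp add: dist_norm norm_minus_commute)
        have "norm (z - z0) \<le> e" using z by (simp add: dist_norm norm_minus_commute)
        then show "norm (p' (z - z0)) \<le> C * e" using C(1)[of "z - z0"] C(2) by (meson mult_left_mono less_imp_le order_trans)
        have "norm (x0 - x') \<le> 2 * e" using dist_triangle3[of x0 x' x] x0(2) x'(2) by (simp add: dist_norm)
        then show "norm (p' (x0 - x')) \<le> C * (2 * e)" using C(1)[of "x0 - x'"] C(2) by (meson mult_left_mono less_imp_le order_trans)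
      qed
      also have "\<dots> = (1 + 3 * C) * e" by (simp add: algebra_simps)
      finally have "norm (q - y) < \<eta>" using e(2) by simp
      then show ?thesis using \<eta>(2) by (auto simp: dist_norm norm_minus_commute)
    qed
    ultimately show "z \<in> {z. \<exists>t. z + t *s b j \<in> W \<inter> ?Y}" unfolding q_def by blast
  qed
  then have "?V \<subseteq> interior {z. \<exists>t. z + t *s b j \<in> W \<inter> ?Y}" using opV by (rule interior_maximal)
  then show "interior {z. \<exists>t. z + t *s b j \<in> W \<inter> ?Y} \<noteq> {}" using z0V by blast
qed

text \<open>X and \<open>coord_space J\<close> embed locally into each other: a chart of X projects
  injectively where the section lives, and the section followed by the chart map goes the other way.
  Invariance of dimension gives both inequalities.\<close>

lemma dimension_eq:
  assumes pure: "closed_pure_analytic_set d X" and X: "locally_analytic X" "transversal J X"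
    and full: "cyl J X = UNIV"
  shows "card (- J) = d"
proof -
  obtain S \<sigma> W where S: "openin (top_of_set (coord_space J)) S" "S \<noteq> {}" "continuous_on S \<sigma>" "open W"
     "\<sigma> ` S = X \<inter> W" "\<And>s. s \<in> S \<Longrightarrow> proj J (\<sigma> s) = s" using continuous_section[OF X full] by blast
  have "W \<inter> X \<noteq> {}" using S(2,5) by blast
  then obtain I S2 \<psi> \<phi> W' where ch: "card I = d" "openin (top_of_set {w::complex^'n. \<forall>i. i \<notin> I \<longrightarrow> w $ i = 0}) S2" "S2 \<noteq> {}"
    "continuous_on S2 \<psi>" "\<psi> ` S2 = X \<inter> W'" "open W'" "W' \<subseteq> W" "continuous_on (X \<inter> W') \<phi>"
    "\<And>s. s \<in> S2 \<Longrightarrow> \<phi> (\<psi> s) = s"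
    by (rule pure_analytic_chart[OF pure S(4)]) (rule that; assumption)
  let ?E = "{w::complex^'n. \<forall>i. i \<notin> I \<longrightarrow> w $ i = 0}"
  have injW: "x = x'" if xx: "x \<in> X \<inter> W" "x' \<in> X \<inter> W" "proj J x = proj J x'" for x x'
  proof -
    obtain s s' where "s \<in> S" "s' \<in> S" "x = \<sigma> s" "x' = \<sigma> s'" using xx(1,2) unfolding S(5)[symmetric] by blast
    then show ?thesis using S(6) xx(3) by metis
  qed
  have "dim ?E \<le> dim (coord_space J)"
  proof (rule invariance_of_dimension_subspaces[OF ch(2) subspace_standard_coord_space subspace_coord_space _ _ _ ch(3)])
    show "continuous_on S2 (\<lambda>s. proj J (\<psi> s))" using ch(4) by (intro continuous_intros)
    show "(\<lambda>s. proj J (\<psi> s)) \<in> S2 \<rightarrow> coord_space J" by (simp add: proj_in_coord_space)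
    show "inj_on (\<lambda>s. proj J (\<psi> s)) S2"
    proof (rule inj_onI)
      fix s s' assume s: "s \<in> S2" "s' \<in> S2" "proj J (\<psi> s) = proj J (\<psi> s')"
      have "\<psi> s \<in> X \<inter> W" "\<psi> s' \<in> X \<inter> W" using ch(5,7) s(1,2) by blast+
      then have "\<psi> s = \<psi> s'" using injW s(3) by blast
      then show "s = s'" using ch(9) s(1,2) by metis
    qed
  qed
  moreover have "dim (coord_space J) \<le> dim ?E"
  proof -
    let ?S' = "S \<inter> \<sigma> -` W'"
    have "openin (top_of_set S) ?S'" using S(3) ch(6) by (rule continuous_openin_preimage_gen)
    then have op: "openin (top_of_set (coord_space J)) ?S'" using S(1) openin_trans by blast
    have in': "\<sigma> s \<in> X \<inter> W'" if "s \<in> ?S'" for s using that S(5) by blast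
    show ?thesis
    proof (rule invariance_of_dimension_subspaces[OF op subspace_coord_space subspace_standard_coord_space])
      have "continuous_on ?S' \<sigma>" using S(3) by (rule continuous_on_subset) blast
      then show "continuous_on ?S' (\<lambda>s. \<phi> (\<sigma> s))"
        by (rule continuous_on_compose2[OF ch(8)]) (use in' in blast)
      have E: "S2 \<subseteq> ?E" using ch(2) openin_imp_subset by blast
      have \<phi>S: "\<exists>s2\<in>S2. \<sigma> s = \<psi> s2 \<and> \<phi> (\<sigma> s) = s2" if s: "s \<in> ?S'" for s
      proof -
        obtain s2 where "s2 \<in> S2" "\<sigma> s = \<psi> s2" using in'[OF s] unfolding ch(5)[symmetric] by blast
        then show ?thesis using ch(9) by auto
      qed
      show "(\<lambda>s. \<phi> (\<sigma> s)) \<in> ?S' \<rightarrow> ?E" using \<phi>S E by blast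
      show "inj_on (\<lambda>s. \<phi> (\<sigma> s)) ?S'"
      proof (rule inj_onI)
        fix s s' assume s: "s \<in> ?S'" "s' \<in> ?S'" "\<phi> (\<sigma> s) = \<phi> (\<sigma> s')"
        then have "\<sigma> s = \<sigma> s'" using \<phi>S by metis
        then show "s = s'" using S(6) s(1,2) by (metis IntD1)
      qed
      have "X \<inter> W' \<noteq> {}" using ch(3,5) by blast
      then obtain x where x: "x \<in> X \<inter> W'" by blast
      then have "x \<in> \<sigma> ` S" unfolding S(5) using ch(7) by blast
      then show "?S' \<noteq> {}" using x by blast
    qed
  qed
  ultimately show ?thesis unfolding dim_coord_space dim_standard_coord_space using ch(1) by simp
qed

end

text \<open>A chart gives X interior by invariance of domain, and the identity theorem makes the
  interior closed. This is the case L = 0, where no direction is available for building a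
  hypersurface.\<close>

lemma pure_full_dimension:
  fixes X :: "(complex^'n) set"
  assumes pure: "closed_pure_analytic_set CARD('n) X" and X: "locally_analytic X"
  shows "X = UNIV"
proof -
  have ne: "UNIV \<inter> X \<noteq> {}" using pure unfolding closed_pure_analytic_set_def by blast
  obtain I S \<psi> \<phi> W where ch: "card I = CARD('n)" "openin (top_of_set {w::complex^'n. \<forall>i. i \<notin> I \<longrightarrow> w $ i = 0}) S" "S \<noteq> {}"
    "continuous_on S \<psi>" "\<psi> ` S = X \<inter> W" "open W" "W \<subseteq> UNIV" "continuous_on (X \<inter> W) \<phi>"
    "\<And>s. s \<in> S \<Longrightarrow> \<phi> (\<psi> s) = s"
    by (rule pure_analytic_chart[OF pure open_UNIV ne]) (rule that; assumption)
  have "I = UNIV" using ch(1) by (simp add: card_eq_UNIV_imp_eq_UNIV)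
  then have "open S" using ch(2) by simp
  have "inj_on \<psi> S" using ch(9) by (rule inj_on_inverseI)
  then have "open (\<psi> ` S)" using invariance_of_domain[OF ch(4) \<open>open S\<close>] by blast
  then have ine: "interior X \<noteq> {}" using ch(3,5) by (metis Int_lower1 image_is_empty interior_maximal subset_empty)
  have "closure (interior X) \<subseteq> interior X"
  proof
    fix a assume a: "a \<in> closure (interior X)"
    obtain U where U: "open U" "a \<in> U"
      "\<And>w. w \<in> U - X \<Longrightarrow> \<exists>f. line_holomorphic_on f U \<and> (\<forall>x\<in>X \<inter> U. f x = 0) \<and> f w \<noteq> 0"
      using X unfolding locally_analytic_def by metis
    obtain \<delta> where \<delta>: "\<delta> > 0" "ball a \<delta> \<subseteq> U" using U openE by blast
    have "ball a \<delta> \<inter> interior X \<noteq> {}" using a \<delta>(1) open_Int_closure_eq_empty[OF open_ball] by (metis centre_in_ball disjoint_iff)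
    then obtain p where p: "p \<in> ball a \<delta>" "p \<in> interior X" by blast
    obtain e where e: "e > 0" "ball p e \<subseteq> X" using p(2) by (auto simp: mem_interior)
    have "ball a \<delta> \<subseteq> X"
    proof (rule ccontr)
      assume "\<not> ?thesis"
      then obtain z where z: "z \<in> ball a \<delta>" "z \<notin> X" by blast
      then obtain f where f: "line_holomorphic_on f U" "\<And>x. x \<in> X \<inter> U \<Longrightarrow> f x = 0" "f z \<noteq> 0" using U(3) \<delta>(2) by blast
      have "f z = 0"
      proof (rule line_holomorphic_zero_on_ball[OF line_holomorphic_on_subset[OF f(1) \<delta>(2)] p(1) e(1) _ z(1)])
        show "f x = 0" if "x \<in> ball p e" "x \<in> ball a \<delta>" for x using that e(2) \<delta>(2) by (intro f(2)) blast
      qed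
      then show False using f(3) by blast
    qed
    then show "a \<in> interior X" using \<delta>(1) by (auto simp: mem_interior)
  qed
  then have "closed (interior X)" using closure_subset_eq by blast
  then have "interior X = UNIV" using clopen[of "interior X"] ine by simp
  then show ?thesis using interior_subset by blast
qed

section \<open>Algebraicity from a transversal coordinate plane\<close>

text \<open>Replaces the form \<open>l j\<close> by a combination of the forms in \<open>J\<close>.
  The forms outside \<open>J\<close> stay, so L and transversality are untouched.\<close>

lemma frame_dual_exchange:
  assumes "frame b l" and c: "c j \<noteq> 0" "j \<in> J"
  shows "frame (\<lambda>i. if i = j then (1 / c j) *s b j else if i \<in> J then b i - (c i / c j) *s b j else b i)
     (\<lambda>i. if i = j then (\<lambda>z. \<Sum>i\<in>J. c i * l i z) else l i)" (is "frame ?b0 ?l")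
proof -
  interpret frame b l by fact
  define bb where "bb = ?b0"
  have lb: "l k (bb i) = (if k = j then (if i = j then 1 / c j else if i \<in> J then - (c i / c j) else 0)
      else if k = i then 1 else 0)" for k i
    by (auto simp: l_simps bb_def)
  show ?thesis unfolding bb_def[symmetric]
  proof
    show "?l i (x + y) = ?l i x + ?l i y" for i x y by (simp add: l_simps distrib_left sum.distrib)
    show "?l i (a *s x) = a * ?l i x" for i a x by (simp add: l_simps sum_distrib_left mult_ac)
    show "?l i (bb k) = (if i = k then 1 else 0)" for i k
    proof (cases "i = j")
      case False
      then show ?thesis using lb[of i k] by simp
    next
      case True
      have fJ: "finite J" by simp
      have "(\<Sum>m\<in>J. c m * l m (bb k)) = c j * l j (bb k) + (\<Sum>m\<in>J - {j}. c m * l m (bb k))"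
        using c(2) by (simp add: sum.remove[OF fJ])
      also have "(\<Sum>m\<in>J - {j}. c m * l m (bb k)) = (\<Sum>m\<in>J - {j}. if m = k then c k else 0)"
        by (rule sum.cong) (auto simp: lb)
      also have "\<dots> = (if k \<in> J - {j} then c k else 0)" by simp
      finally have "(\<Sum>m\<in>J. c m * l m (bb k)) = (if k = j then 1 else 0)" using c by (auto simp: lb)
      then show ?thesis using True by auto
    qed
    fix z
    show "z = (\<Sum>i\<in>UNIV. ?l i z *s bb i)"
    proof (rule frame_eqI)
      fix k
      have "l k (\<Sum>i\<in>UNIV. ?l i z *s bb i) = (\<Sum>i\<in>UNIV. ?l i z * l k (bb i))"
        unfolding l_sum l_smult ..
      also have "\<dots> = l k z"
      proof (cases "k = j")
        case False
        have "(\<Sum>i\<in>UNIV. ?l i z * l k (bb i)) = (\<Sum>i\<in>UNIV. if i = k then l k z else 0)"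
          by (rule sum.cong) (use False in \<open>auto simp: lb\<close>)
        then show ?thesis by simp
      next
        case True
        have "(\<Sum>i\<in>UNIV. ?l i z * l j (bb i)) = ?l j z * l j (bb j) + (\<Sum>i\<in>UNIV - {j}. ?l i z * l j (bb i))"
          by (rule sum.remove) auto
        also have "(\<Sum>i\<in>UNIV - {j}. ?l i z * l j (bb i)) = (\<Sum>i\<in>UNIV - {j}. if i \<in> J then - (l i z * c i / c j) else 0)"
          by (rule sum.cong) (auto simp: lb)
        also have "\<dots> = (\<Sum>i\<in>J - {j}. - (l i z * c i / c j))"
          by (rule sum.mono_neutral_cong_right) auto
        also have "?l j z * l j (bb j) = (c j * l j z + (\<Sum>i\<in>J - {j}. c i * l i z)) / c j"
          using c(2) sum.remove[of J j "\<lambda>i. c i * l i z"] by (simp add: lb)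
        finally show ?thesis using True c(1)
          by (simp add: add_divide_distrib sum_negf sum_divide_distrib mult.commute)
      qed
      finally show "l k z = l k (\<Sum>i\<in>UNIV. ?l i z *s bb i)" ..
    qed
  qed
qed

text \<open>Replaces the vector \<open>b j\<close> by \<open>v\<close>. It is applied with j outside
  \<open>J\<close>, so that adding j to \<open>J\<close> enlarges L by the direction
  \<open>v\<close>.\<close>

lemma frame_vector_exchange:
  assumes "frame b l" and v: "l j v \<noteq> 0"
  shows "frame (b(j := v)) (\<lambda>i. if i = j then (\<lambda>z. l j z / l j v) else (\<lambda>z. l i z - l i v * (l j z / l j v)))"
    (is "frame ?b ?l")
proof -
  interpret frame b l by fact
  show ?thesis
  proof
    show "?l i (x + y) = ?l i x + ?l i y" for i x y by (simp add: l_simps add_divide_distrib algebra_simps)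
    show "?l i (a *s x) = a * ?l i x" for i a x by (simp add: l_simps algebra_simps)
    show "?l i (?b k) = (if i = k then 1 else 0)" for i k using v by (auto simp: l_simps)
    fix z
    show "z = (\<Sum>i\<in>UNIV. ?l i z *s ?b i)"
    proof (rule frame_eqI)
      fix k
      have "l k (\<Sum>i\<in>UNIV. ?l i z *s ?b i) = (\<Sum>i\<in>UNIV. ?l i z * l k (?b i))"
        unfolding l_sum l_smult ..
      also have "\<dots> = ?l j z * l k v + (\<Sum>i\<in>UNIV - {j}. ?l i z * l k (?b i))"
        by (subst sum.remove[of UNIV j]) auto
      also have "(\<Sum>i\<in>UNIV - {j}. ?l i z * l k (?b i)) = (\<Sum>i\<in>UNIV - {j}. if i = k then ?l k z else 0)"
        by (rule sum.cong) (auto simp: l_simps)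
      also have "\<dots> = (if k = j then 0 else ?l k z)" by simp
      finally show "l k z = l k (\<Sum>i\<in>UNIV. ?l i z *s ?b i)" using v by (auto simp: mult.commute)
    qed
  qed
qed

text \<open>For p outside X, a generic combination of the coordinates in \<open>J\<close> separates
  p from the finitely many points of X in p + L. Its kernel in L is a hyperplane L', and the
  equation of the hypersurface X + L' vanishes on X but not at p.\<close>

lemma (in frame) transversal_imp_algebraic:
  assumes pure: "closed_pure_analytic_set d X" and X: "locally_analytic X" "transversal J X"
    and dJ: "card (- J) = d"
  shows "algebraic_set X"
  unfolding algebraic_set_iff_polyfun
proof (intro allI impI)
  fix p assume p: "p \<notin> X"
  show "\<exists>P. polyfun P \<and> (\<forall>x\<in>X. P x = 0) \<and> P p \<noteq> 0"
  proof (cases "J = {}")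
    case True
    then have "X = UNIV" using pure_full_dimension[OF _ X(1)] pure dJ by simp
    then show ?thesis using p by blast
  next
    case False
    then obtain j where j: "j \<in> J" by blast
    let ?F = "{x \<in> X. \<forall>i. i \<notin> J \<longrightarrow> l i x = l i p}"
    \<comment> \<open>Including \<open>b j\<close> forces c j to be nonzero, as the exchange of
      forms requires.\<close>
    let ?T = "insert (b j) ((\<lambda>x. x - p) ` ?F)"
    let ?M = "range (\<lambda>c z. \<Sum>i\<in>J. c i * l i z)"
    have finT: "finite ?T" using transversal_fiber_finite[OF X order_refl] by blast
    have "\<exists>f\<in>?M. \<forall>t\<in>?T. f t \<noteq> 0"
    proof (rule span_avoid[OF _ _ finT])
      show "(\<lambda>x. f x + a * g x) \<in> ?M" if fg: "f \<in> ?M" "g \<in> ?M" for f g a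
      proof -
        obtain c c' where "f = (\<lambda>z. \<Sum>i\<in>J. c i * l i z)" "g = (\<lambda>z. \<Sum>i\<in>J. c' i * l i z)" using fg by blast
        then have "(\<lambda>x. f x + a * g x) = (\<lambda>z. \<Sum>i\<in>J. (c i + a * c' i) * l i z)"
          by (auto simp: sum_distrib_left sum.distrib[symmetric] algebra_simps)
        then show ?thesis by (auto intro!: image_eqI[of _ _ "\<lambda>i. c i + a * c' i"])
      qed
      show "?M \<noteq> {}" by blast
      fix t assume t: "t \<in> ?T"
      have "\<exists>i\<in>J. l i t \<noteq> 0"
      proof (cases "t = b j")
        case True
        then show ?thesis using j by (intro bexI[of _ j]) (auto simp: l_b)
      next
        case False
        then obtain x where x: "x \<in> X" "\<And>i. i \<notin> J \<Longrightarrow> l i x = l i p" "t = x - p" using t by blast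
        have "x \<noteq> p" using x p by blast
        then obtain i where "l i x \<noteq> l i p" using frame_eqI by blast
        then show ?thesis using x by (intro bexI[of _ i]) (auto simp: l_diff)
      qed
      then obtain i where i: "i \<in> J" "l i t \<noteq> 0" by blast
      have "(\<Sum>k\<in>J. (if k = i then 1 else 0) * l k t) = l i t"
        using i(1) by (simp add: if_distrib[of "\<lambda>a. a * _"] sum.delta' cong: if_cong)
      then show "\<exists>f\<in>?M. f t \<noteq> 0" using i(2)
        by (intro bexI[of _ "\<lambda>z. \<Sum>k\<in>J. (if k = i then 1 else 0) * l k z"]) auto
    qed
    then obtain c where c: "\<And>t. t \<in> ?T \<Longrightarrow> (\<Sum>i\<in>J. c i * l i t) \<noteq> 0" by blast
    have "(\<Sum>i\<in>J. c i * l i (b j)) = c j"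
      using j by (simp add: l_b if_distrib sum.delta cong: if_cong)
    then have cj: "c j \<noteq> 0" using c[of "b j"] by auto
    define b' where "b' = (\<lambda>i. if i = j then (1 / c j) *s b j else if i \<in> J then b i - (c i / c j) *s b j else b i)"
    define l' where "l' = (\<lambda>i. if i = j then (\<lambda>z. \<Sum>i\<in>J. c i * l i z) else l i)"
    interpret F: frame b' l' unfolding b'_def l'_def
      using frame_dual_exchange[where c=c and j=j and J=J, OF frame_axioms cj j] .
    have l'l: "l' i = l i" if "i \<noteq> j" for i using that by (simp add: l'_def)
    have tr: "F.transversal J X" using X(2) j unfolding F.transversal_def transversal_def by (metis l'l)
    let ?Y = "F.cyl (J - {j}) X"
    have an: "locally_analytic ?Y" by (rule F.cyl_locally_analytic[OF X(1) tr]) blast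
    have gr: "fiber_growth ?Y (b' j)" by (rule F.cyl_fiber_growth[OF tr]) (use j in auto)
    have th: "thick ?Y (b' j)" by (rule F.cyl_thick[OF pure X(1) tr dJ j])
    have sub: "X \<subseteq> ?Y" by (auto simp: F.cyl_def)
    have "X \<noteq> {}" using pure unfolding closed_pure_analytic_set_def by blast
    then have "?Y \<noteq> {}" using sub by blast
    then obtain P where P: "polyfun P" "?Y = {z. P z = 0}" by (rule hypersurface_polynomial[OF an gr th]) blast
    have "p \<notin> ?Y"
    proof
      assume "p \<in> ?Y"
      then obtain x where x: "x \<in> X" "\<And>i. i \<notin> J - {j} \<Longrightarrow> l' i p = l' i x" by (auto simp: F.cyl_def)
      have "l i x = l i p" if "i \<notin> J" for i
      proof -
        have "i \<noteq> j" "i \<notin> J - {j}" using that j by auto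
        then show ?thesis using x(2)[of i] l'l[of i] by simp
      qed
      then have "x \<in> ?F" using x(1) by blast
      then have "(\<Sum>i\<in>J. c i * l i (x - p)) \<noteq> 0" using c by blast
      moreover have "(\<Sum>i\<in>J. c i * l i (x - p)) = l' j x - l' j p"
        by (simp add: l'_def l_diff right_diff_distrib sum_subtractf)
      ultimately show False using x(2)[of j] by simp
    qed
    then show ?thesis using P sub by blast
  qed
qed

section \<open>Elimination\<close>

lemma polyfun_locally_analytic: "polyfun P \<Longrightarrow> locally_analytic {z. P z = 0}"
  unfolding locally_analytic_def
proof (intro conjI allI)
  assume P: "polyfun P"
  show "closed {z. P z = 0}" using polyfun_continuous[OF P, of UNIV] by (intro closed_Collect_eq) auto
  show "\<exists>U. open U \<and> a \<in> U \<and> (\<forall>z\<in>U - {z. P z = 0}. \<exists>f. line_holomorphic_on f U \<and> (\<forall>x\<in>{z. P z = 0} \<inter> U. f x = 0) \<and> f z \<noteq> 0)" for a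
    using polyfun_line_holomorphic[OF P, of UNIV] by (intro exI[of _ UNIV] conjI ballI exI[of _ P]) auto
qed

text \<open>\<open>T D v\<close> is the leading coefficient of P along v. Roots growing faster than
  linearly would, after division by t^D, make it zero.\<close>

lemma top_form_fiber_growth:
  fixes T :: "nat \<Rightarrow> complex^'n \<Rightarrow> complex"
  assumes T: "\<And>k. polyfun (T k)" "\<And>k c z. T k (c *s z) = c ^ k * T k z"
    and P: "\<And>z. P z = (\<Sum>k\<le>D. T k z)" and v: "T D v \<noteq> 0"
  shows "fiber_growth {z. P z = 0} v"
proof (rule ccontr)
  assume neg: "\<not> ?thesis"
  have "\<exists>z. \<exists>t\<in>fiber {z. P z = 0} v z. norm t > real n * (1 + norm z)" for n :: nat
  proof (rule ccontr)
    assume "\<not> ?thesis"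
    then have "\<forall>z. \<forall>t\<in>fiber {z. P z = 0} v z. norm t \<le> real n * (1 + norm z)" by (simp add: not_less)
    then show False using neg of_nat_0_le_iff[of n] unfolding fiber_growth_def by blast
  qed
  then have "\<forall>n::nat. \<exists>z t. P (z + t *s v) = 0 \<and> norm t > real n * (1 + norm z)" unfolding fiber_def by blast
  then obtain z t where zt: "\<And>n. P (z n + t n *s v) = 0" "\<And>n. norm (t n) > real n * (1 + norm (z n))"
    unfolding choice_iff by blast
  have big: "norm (t n) > real n" for n
  proof -
    have "real n * 1 \<le> real n * (1 + norm (z n))" by (intro mult_left_mono) auto
    then show ?thesis using zt(2)[of n] by linarith
  qed
  have inf: "filterlim t at_infinity sequentially"
    unfolding filterlim_at_infinity_conv_norm_at_top
    by (rule filterlim_at_top_mono[OF filterlim_real_sequentially]) (use big in \<open>auto simp: less_imp_le\<close>)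
  have "(\<lambda>n. inverse (t n) *s z n) \<longlonglongrightarrow> 0"
  proof (rule Lim_null_comparison[OF _ lim_inverse_n])
    show "eventually (\<lambda>n. norm (inverse (t n) *s z n) \<le> inverse (real n)) sequentially"
      using eventually_gt_at_top[of 0]
    proof eventually_elim
      case (elim n)
      have "real n * norm (z n) \<le> real n * (1 + norm (z n))" by (intro mult_left_mono) auto
      then have "real n * norm (z n) \<le> norm (t n)" using zt(2)[of n] by linarith
      moreover have "norm (t n) > 0" using big[of n] elim by linarith
      ultimately show ?case using elim by (simp only: norm_smult norm_inverse) (simp add: field_simps)
    qed
  qed
  then have lim: "(\<lambda>n. inverse (t n) *s z n + v) \<longlonglongrightarrow> 0 + v" by (intro tendsto_intros)
  have "eventually (\<lambda>n. inverse (t n) *s z n + v = inverse (t n) *s (z n + t n *s v)) sequentially"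
    using filterlim_at_infinity_imp_eventually_ne[OF inf, of 0]
    by eventually_elim (simp add: vector_add_ldistrib vector_smult_assoc)
  then have "(\<lambda>n. inverse (t n) *s (z n + t n *s v)) \<longlonglongrightarrow> v" using Lim_transform_eventually[OF lim] by simp
  from top_form_limit[OF T P inf this] have "(\<lambda>n. 0) \<longlonglongrightarrow> T D v" by (simp add: zt(1))
  then show False using v LIMSEQ_unique[OF tendsto_const] by metis
qed

text \<open>R z, the product of Q over the roots of P on the line through z, is the resultant of P
  and Q along \<open>v\<close>, with Q vanishing on X but at no root of P over the excluded point.
  The number of roots is constant and they grow linearly, so R is entire of polynomial
  growth.\<close>

lemma elimination:
  fixes v :: "complex^'n"
  assumes alg: "algebraic_set X" and P: "polyfun P" "\<And>x. x \<in> X \<Longrightarrow> P x = 0" and gr: "fiber_growth {z. P z = 0} v"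
  shows "algebraic_set {z. fiber X v z \<noteq> {}}"
  unfolding algebraic_set_iff_polyfun
proof (intro allI impI)
  let ?Z = "fiber {z. P z = 0} v"
  fix y assume y: "y \<notin> {z. fiber X v z \<noteq> {}}"
  have fin: "finite (?Z z)" for z by (rule fiber_finite[OF polyfun_locally_analytic[OF P(1)] gr])
  let ?F = "{Q. polyfun Q \<and> (\<forall>x\<in>X. Q x = 0)}"
  have "\<exists>Q\<in>?F. \<forall>x\<in>(\<lambda>u. y + u *s v) ` ?Z y. Q x \<noteq> 0"
  proof (rule span_avoid)
    show "(\<lambda>x. f x + c * g x) \<in> ?F" if "f \<in> ?F" "g \<in> ?F" for f g c
      using that by (auto intro!: polyfun.add polyfun.mult polyfun.const)
    show "?F \<noteq> {}" using P by blast
    show "finite ((\<lambda>u. y + u *s v) ` ?Z y)" using fin by blast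
    fix x assume "x \<in> (\<lambda>u. y + u *s v) ` ?Z y"
    then have "x \<notin> X" using y by (auto simp: fiber_def)
    then show "\<exists>f\<in>?F. f x \<noteq> 0" using alg unfolding algebraic_set_iff_polyfun by blast
  qed
  then obtain Q where Q: "polyfun Q" "\<And>x. x \<in> X \<Longrightarrow> Q x = 0" "\<And>u. u \<in> ?Z y \<Longrightarrow> Q (y + u *s v) \<noteq> 0" by blast
  define g where "g z u = P (z + u *s v)" for z u
  define R where "R z = (\<Prod>u\<in>?Z z. Q (z + u *s v) ^ zmult (g z) u)" for z
  obtain K where K: "K \<ge> 0" "\<And>z t. t \<in> ?Z z \<Longrightarrow> norm t \<le> K * (1 + norm z)" using gr unfolding fiber_growth_def by blast
  \<comment> \<open>Roots over the ball of radius \<rho> have modulus at most r \<rho> - 1; the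
    added 1 keeps the circle free of roots.\<close>
  define r where "r \<rho> = K * (1 + \<rho>) + 1" for \<rho> :: real
  have gph: "param_holomorphic B D g" for B D
    unfolding g_def by (rule param_holomorphic_translate[OF polyfun_line_holomorphic[OF P(1), of UNIV]]) auto
  have zer: "zeros_in (g z) 0 (r \<rho>) = ?Z z" and nz: "\<And>w. w \<in> sphere 0 (r \<rho>) \<Longrightarrow> g z w \<noteq> 0"
    if "z \<in> ball 0 \<rho>" for z \<rho>
  proof -
    have b: "norm t < r \<rho>" if "t \<in> ?Z z" for t
    proof -
      have "K * (1 + norm z) \<le> K * (1 + \<rho>)" using K(1) \<open>z \<in> ball 0 \<rho>\<close> by (intro mult_left_mono) auto
      then show ?thesis using K(2)[OF that] by (simp add: r_def)
    qed
    then show "zeros_in (g z) 0 (r \<rho>) = ?Z z" by (auto simp: zeros_in_def g_def fiber_def)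
    show "g z w \<noteq> 0" if w: "w \<in> sphere 0 (r \<rho>)" for w
      using b[of w] w by (auto simp: g_def fiber_def)
  qed
  have rpos: "0 < r \<rho>" if "\<rho> > 0" for \<rho> using K(1) that by (simp add: r_def add_nonneg_pos)
  have hol: "line_holomorphic_on R (ball 0 \<rho>)" if \<rho>: "\<rho> > 0" for \<rho>
  proof -
    obtain M where M: "\<And>x. norm x \<le> \<rho> + (r \<rho> + 1) * norm v \<Longrightarrow> norm (Q x) \<le> M"
      using polyfun_lipschitz[OF Q(1), of "\<rho> + (r \<rho> + 1) * norm v"] by blast
    have "line_holomorphic_on (\<lambda>z. \<Prod>p\<in>zeros_in (g z) 0 (r \<rho>). Q (z + p *s v) ^ zmult (g z) p) (ball 0 \<rho>)"
    proof (rule zero_prod_line_holomorphic[OF gph _ open_ball connected_ball rpos[OF \<rho>], where R="r \<rho> + 1"])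
      show "param_holomorphic (ball 0 \<rho>) (ball 0 (r \<rho> + 1)) (\<lambda>z p. Q (z + p *s v))"
        by (rule param_holomorphic_translate[OF polyfun_line_holomorphic[OF Q(1), of UNIV]]) auto
      fix z w assume zw: "z \<in> ball (0::complex^'n) \<rho>" "w \<in> ball (0::complex) (r \<rho> + 1)"
      have "norm (z + w *s v) \<le> norm z + norm w * norm v" by (metis norm_triangle_ineq norm_smult)
      also have "\<dots> \<le> \<rho> + (r \<rho> + 1) * norm v" using zw by (intro add_mono mult_right_mono) auto
      finally show "norm (Q (z + w *s v)) < M + 1" using M by fastforce
    qed (use nz in auto)
    then show ?thesis
      by (rule line_holomorphic_on_cong[THEN iffD1, rotated]) (simp add: R_def zer)
  qed
  have holU: "line_holomorphic_on R UNIV"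
  proof (rule line_holomorphic_local)
    fix z :: "complex^'n"
    show "\<exists>V. open V \<and> z \<in> V \<and> line_holomorphic_on R V"
      using hol[of "norm z + 1"] by (intro exI[of _ "ball 0 (norm z + 1)"]) (auto simp: add_nonneg_pos)
  qed
  have pos: "zmult (g z) u > 0" if "u \<in> ?Z z" for z u
  proof -
    have zb: "z \<in> ball 0 (norm z + 1)" by simp
    have rp: "0 < r (norm z + 1)" by (rule rpos) (simp add: add_nonneg_pos)
    show ?thesis
      by (rule zmult_pos[OF param_holomorphicD(2)[OF gph zb] rp, of "r (norm z + 1) + 1"])
        (use nz[OF zb] zer[OF zb] that in auto)
  qed
  define cnt where "cnt z = (\<Sum>u\<in>?Z z. zmult (g z) u)" for z
  have cnt: "cnt z = cnt 0" for z
  proof -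
    have \<rho>: "norm z + 1 > 0" by (simp add: add_nonneg_pos)
    have "\<exists>p. \<forall>x\<in>ball 0 (norm z + 1). (\<Sum>q\<in>zeros_in (g x) 0 (r (norm z + 1)). zmult (g x) q) = p"
      by (rule zero_count_constant[OF gph open_ball connected_ball rpos[OF \<rho>], where R="r (norm z + 1) + 1"])
        (simp, erule nz)
    then obtain p where p: "\<And>x. x \<in> ball 0 (norm z + 1) \<Longrightarrow> (\<Sum>q\<in>zeros_in (g x) 0 (r (norm z + 1)). zmult (g x) q) = p"
      by blast
    have "cnt x = p" if "x \<in> ball 0 (norm z + 1)" for x using p[OF that] unfolding zer[OF that] cnt_def .
    from this[of z] this[of 0] show ?thesis using \<rho> by simp
  qed
  obtain C N where C: "C \<ge> 0" "\<And>z. norm (Q z) \<le> C * (1 + norm z) ^ N" using polyfun_growth[OF Q(1)] by blast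
  let ?k = "C * (1 + K * norm v) ^ N"
  have "norm (R z) \<le> ?k ^ cnt 0 * (1 + norm z) ^ (N * cnt 0)" for z
  proof -
    let ?\<beta> = "?k * (1 + norm z) ^ N"
    have Qb: "norm (Q (z + u *s v)) \<le> ?\<beta>" if "u \<in> ?Z z" for u
    proof -
      have "norm (z + u *s v) \<le> norm z + norm u * norm v" by (metis norm_triangle_ineq norm_smult)
      also have "\<dots> \<le> norm z + (K * (1 + norm z)) * norm v" using K(2)[OF that] by (intro add_mono mult_right_mono) auto
      finally have "1 + norm (z + u *s v) \<le> (1 + K * norm v) * (1 + norm z)" by (simp add: algebra_simps)
      then have "C * (1 + norm (z + u *s v)) ^ N \<le> C * ((1 + K * norm v) * (1 + norm z)) ^ N"
        using C(1) by (intro mult_left_mono power_mono) (auto simp: add_nonneg_nonneg)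
      then show ?thesis using C(2)[of "z + u *s v"] by (simp add: power_mult_distrib mult.assoc)
    qed
    have "norm (R z) = (\<Prod>u\<in>?Z z. norm (Q (z + u *s v)) ^ zmult (g z) u)"
      unfolding R_def by (simp add: prod_norm[symmetric] norm_power)
    also have "\<dots> \<le> (\<Prod>u\<in>?Z z. ?\<beta> ^ zmult (g z) u)"
      by (rule prod_mono) (use Qb in \<open>auto intro!: power_mono\<close>)
    also have "\<dots> = ?\<beta> ^ cnt z" unfolding cnt_def by (simp add: power_sum)
    also have "\<dots> = ?k ^ cnt 0 * (1 + norm z) ^ (N * cnt 0)"
      unfolding cnt[of z] by (simp add: power_mult_distrib power_mult)
    finally show ?thesis .
  qed
  then have "polyfun R" by (rule entire_line_growth_polyfun[OF holU]) (use C K in simp)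
  moreover have "R z = 0" if z: "fiber X v z \<noteq> {}" for z
  proof -
    obtain u where u: "u \<in> fiber X v z" using z by blast
    then have "u \<in> ?Z z" "Q (z + u *s v) = 0" using P(2) Q(2) by (auto simp: fiber_def)
    then show ?thesis unfolding R_def using fin pos by (auto simp: prod_zero_iff)
  qed
  moreover have "R y \<noteq> 0" unfolding R_def using fin Q(3) by (simp add: prod_zero_iff)
  ultimately show "\<exists>P. polyfun P \<and> (\<forall>x\<in>{z. fiber X v z \<noteq> {}}. P x = 0) \<and> P y \<noteq> 0" by blast
qed

text \<open>P vanishes at the points x_j + t_j m, and dividing these by t_j gives c + m in the
  limit.\<close>

lemma top_form_cone:
  fixes T :: "nat \<Rightarrow> complex^'n \<Rightarrow> complex"
  assumes T: "\<And>k. polyfun (T k)" "\<And>k c z. T k (c *s z) = c ^ k * T k z"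
    and P: "\<And>z. P z = (\<Sum>k\<le>D. T k z)" and c: "c \<in> cone_at_infinity X"
    and z: "\<And>x t. x \<in> X \<Longrightarrow> P (x + of_real t *s m) = 0"
  shows "T D (c + m) = 0"
proof -
  obtain x and t :: "nat \<Rightarrow> real" where xt: "\<And>j. x j \<in> X" "\<And>j. t j > 0" "filterlim t at_top sequentially"
    "(\<lambda>j. x j /\<^sub>R t j) \<longlonglongrightarrow> c"
    using c unfolding cone_at_infinity_def by blast
  let ?t = "\<lambda>j. of_real (t j) :: complex"
  have inf: "filterlim ?t at_infinity sequentially"
    unfolding filterlim_at_infinity_conv_norm_at_top
    by (rule filterlim_at_top_mono[OF xt(3)]) (simp add: abs_ge_self)
  have eq: "inverse (?t j) *s (x j + ?t j *s m) = x j /\<^sub>R t j + m" for j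
  proof -
    have "inverse (?t j) *s x j = x j /\<^sub>R t j"
      by (simp add: vec_eq_iff scaleR_conv_of_real[where 'a=complex])
    moreover have "inverse (?t j) *s (?t j *s m) = m" using xt(2)[of j] by (simp add: vector_smult_assoc)
    ultimately show ?thesis by (simp add: vector_add_ldistrib)
  qed
  have "(\<lambda>j. inverse (?t j) *s (x j + ?t j *s m)) \<longlonglongrightarrow> c + m" unfolding eq by (intro tendsto_intros xt(4))
  from top_form_limit[OF T P inf this] have "(\<lambda>j. 0) \<longlonglongrightarrow> T D (c + m)" by (simp add: z xt(1))
  then show ?thesis using LIMSEQ_unique[OF tendsto_const] by metis
qed

text \<open>A cone vector in L + Cw projects to a multiple t of the projection of w. The hypothesis
  excludes nonzero t, and for t = 0 the vector lies in L. The factor a is complex because t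
  is.\<close>

lemma (in frame) transversal_exchange:
  assumes tr: "transversal J X" and j: "j \<notin> J" "l j w \<noteq> 0"
    and w: "\<And>c a. c \<in> cone_at_infinity X \<Longrightarrow> proj J w \<noteq> a *s proj J c"
  shows "frame.transversal (\<lambda>i. if i = j then (\<lambda>z. l j z / l j w) else (\<lambda>z. l i z - l i w * (l j z / l j w))) (insert j J) X"
    (is "frame.transversal ?l _ _")
proof -
  interpret F: frame "b(j := w)" ?l by (rule frame_vector_exchange[OF frame_axioms j(2)])
  show ?thesis unfolding F.transversal_def
  proof (intro ballI impI)
    fix c assume c: "c \<in> cone_at_infinity X" and zero: "\<forall>i. i \<notin> insert j J \<longrightarrow> ?l i c = 0"
    define t where "t = l j c / l j w"
    have lc: "l i c = t * l i w" if "i \<notin> J" for i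
      using zero[rule_format, of i] that j(2) by (cases "i = j") (auto simp: t_def mult.commute)
    have "t = 0"
    proof (rule ccontr)
      assume t: "t \<noteq> 0"
      have "proj J w = (1 / t) *s proj J c"
        by (rule frame_eqI) (use lc t in \<open>auto simp: l_proj l_smult\<close>)
      then show False using w[OF c] by blast
    qed
    then show "c = 0" using tr c lc unfolding transversal_def by auto
  qed
qed

text \<open>\<open>J\<close> is taken of maximal size such that L is transversal and X + L is
  algebraic. If X + L were proper, elimination would allow a direction v off the zeros of the top
  form of one of its equations to be added to L.\<close>

lemma algebraic_imp_transversal:
  fixes X :: "(complex^'n) set"
  assumes alg: "algebraic_set X" and pure: "closed_pure_analytic_set d X" and X: "locally_analytic X"
  obtains b l J where "frame b l" "frame.transversal l J X" "card (- J) = d" "frame.cyl l J X = UNIV"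
proof -
  let ?Q = "\<lambda>k. \<exists>b l J. frame b l \<and> frame.transversal l J X \<and> algebraic_set (frame.cyl l J X) \<and> card (J :: 'n set) = k"
  have "?Q 0"
  proof -
    interpret std: frame "\<lambda>i. axis i 1 :: complex^'n" "\<lambda>i z. vec_nth z i" by (rule frame_standard)
    have "std.transversal {} X" unfolding std.transversal_def by (auto simp: vec_eq_iff)
    then show ?thesis using alg frame_standard
      by (intro exI[of _ "\<lambda>i. axis i 1"] exI[of _ "\<lambda>i z. vec_nth z i"] exI[of _ "{}"]) (simp add: std.cyl_empty)
  qed
  moreover have "\<forall>k. ?Q k \<longrightarrow> k \<le> CARD('n)" by (auto intro: card_mono)
  ultimately obtain k where k: "?Q k" "\<And>k'. ?Q k' \<Longrightarrow> k' \<le> k"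
    using Nat.ex_has_greatest_nat[of ?Q 0 "CARD('n)"] by blast
  then obtain b l J where fr: "frame b l" and tr: "frame.transversal l J X"
    and algc: "algebraic_set (frame.cyl l J X)" and cJ: "card J = k" by blast
  interpret frame b l by fact
  have "cyl J X = UNIV"
  proof (rule ccontr)
    assume "cyl J X \<noteq> UNIV"
    then obtain p where "p \<notin> cyl J X" by blast
    then obtain P where P: "polyfun P" "\<And>x. x \<in> cyl J X \<Longrightarrow> P x = 0" "P p \<noteq> 0"
      using algc unfolding algebraic_set_iff_polyfun by blast
    obtain D' T where T: "\<And>k. polyfun (T k)" "\<And>k c z. T k (c *s z) = c ^ k * T k z"
      "\<And>z. P z = (\<Sum>k\<le>D'. T k z)" "\<And>k z. k > D' \<Longrightarrow> T k z = 0"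
      using polyfun_homogeneous[OF P(1)] by metis
    let ?N = "\<lambda>k. \<exists>z. T k z \<noteq> 0"
    have "\<exists>k. ?N k" using P(3) T(3)[of p] by (metis sum.neutral)
    moreover have "\<forall>k. ?N k \<longrightarrow> k \<le> D'" using T(4) not_le by blast
    ultimately obtain D where D: "?N D" "\<And>k. ?N k \<Longrightarrow> k \<le> D" using Nat.ex_has_greatest_nat[of ?N _ D'] by blast
    then obtain v where v: "T D v \<noteq> 0" by blast
    have PD: "P z = (\<Sum>k\<le>D. T k z)" for z
    proof -
      have "D \<le> D'" using D(1) T(4) not_le by blast
      then show ?thesis unfolding T(3) by (intro sum.mono_neutral_right) (use D(2) in \<open>auto simp: not_le[symmetric]\<close>)
    qed
    \<comment> \<open>P vanishes on all of X + L, so its top form vanishes on cone + L and not just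
      on the cone.\<close>
    have inL: "T D (c + m) = 0" if c: "c \<in> cone_at_infinity X" and m: "\<And>i. i \<notin> J \<Longrightarrow> l i m = 0" for c m
    proof (rule top_form_cone[OF T(1,2) PD c])
      show "P (x + of_real t *s m) = 0" if "x \<in> X" for x t
        by (rule P(2)) (use that m in \<open>auto simp: cyl_def l_simps intro!: bexI[of _ x]\<close>)
    qed
    \<comment> \<open>v is not in L: otherwise P(x + n v) = 0 for all n, and the leading coefficient
      of P along v would vanish.\<close>
    have "\<exists>j. j \<notin> J \<and> l j v \<noteq> 0"
    proof (rule ccontr)
      assume "\<not> ?thesis"
      then have m: "l i v = 0" if "i \<notin> J" for i using that by blast
      obtain x where x: "x \<in> X" using pure unfolding closed_pure_analytic_set_def by blast
      have "P (x + of_real t *s v) = 0" for t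
        by (rule P(2)) (use x m in \<open>auto simp: cyl_def l_simps intro!: bexI[of _ x]\<close>)
      then have z: "P (x + of_nat n *s v) = 0" for n using of_real_of_nat_eq[of n] by metis
      have inf: "filterlim (\<lambda>n. of_nat n :: complex) at_infinity sequentially"
        by (rule tendsto_of_nat)
      have "(\<lambda>n. inverse (of_nat n) *s x) \<longlonglongrightarrow> 0 *s x"
        by (intro tendsto_intros) (use lim_inverse_n in blast)
      then have lim: "(\<lambda>n. inverse (of_nat n) *s x + v) \<longlonglongrightarrow> 0 *s x + v" by (rule tendsto_add[OF _ tendsto_const])
      have "eventually (\<lambda>n. inverse (of_nat n) *s x + v = inverse (of_nat n) *s (x + of_nat n *s v)) sequentially"
        using eventually_gt_at_top[of 0] by eventually_elim (simp add: vector_add_ldistrib vector_smult_assoc)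
      then have "(\<lambda>n. inverse (of_nat n) *s (x + of_nat n *s v)) \<longlonglongrightarrow> v"
        using Lim_transform_eventually[OF lim] by simp
      from top_form_limit[OF T(1,2) PD inf this] have "(\<lambda>n. 0) \<longlonglongrightarrow> T D v" by (simp add: z)
      then show False using v LIMSEQ_unique[OF tendsto_const] by metis
    qed
    then obtain j where j: "j \<notin> J" "l j v \<noteq> 0" by blast
    define b' where "b' = b(j := v)"
    define l' where "l' = (\<lambda>i. if i = j then (\<lambda>z. l j z / l j v) else (\<lambda>z. l i z - l i v * (l j z / l j v)))"
    have fr': "frame b' l'" unfolding b'_def l'_def by (rule frame_vector_exchange[OF fr j(2)])
    interpret F: frame b' l' by fact
    have "proj J v \<noteq> a *s proj J c" if c: "c \<in> cone_at_infinity X" for a c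
    proof
      assume e: "proj J v = a *s proj J c"
      have lv: "l i v = a * l i c" if "i \<notin> J" for i using l_proj[of i J v] e that by (simp add: l_smult l_proj)
      then have a: "a \<noteq> 0" using j by auto
      have "T D (c + ((1 / a) *s v - c)) = 0" by (rule inL[OF c]) (use lv a in \<open>simp add: l_simps\<close>)
      then have "(1 / a) ^ D * T D v = 0" by (simp add: T(2))
      then show False using v a by simp
    qed
    then have tr': "F.transversal (insert j J) X" unfolding l'_def by (rule transversal_exchange[OF tr j])
    have zeq: "(\<forall>i. i \<notin> J \<longrightarrow> l' i w = 0) \<longleftrightarrow> (\<forall>i. i \<notin> J \<longrightarrow> l i w = 0)" for w
    proof
      assume a: "\<forall>i. i \<notin> J \<longrightarrow> l' i w = 0"
      then have "l' j w = 0" using j(1) by blast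
      then have "l j w = 0" using j(2) by (simp add: l'_def)
      then show "\<forall>i. i \<notin> J \<longrightarrow> l i w = 0" using a by (auto simp: l'_def split: if_splits)
    next
      assume "\<forall>i. i \<notin> J \<longrightarrow> l i w = 0"
      then show "\<forall>i. i \<notin> J \<longrightarrow> l' i w = 0" using j(1) by (simp add: l'_def)
    qed
    have ceq: "F.cyl J X = cyl J X"
    proof -
      have "(\<forall>i. i \<notin> J \<longrightarrow> l' i z = l' i x) \<longleftrightarrow> (\<forall>i. i \<notin> J \<longrightarrow> l i z = l i x)" for z x
        using zeq[of "z - x"] by (simp add: l_diff F.l_diff)
      then show ?thesis by (simp add: F.cyl_def cyl_def)
    qed
    have "F.cyl (insert j J) X = {z. fiber (cyl J X) v z \<noteq> {}}"
      using F.cyl_insert[OF j(1)] ceq by (simp add: b'_def)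
    moreover have "algebraic_set {z. fiber (cyl J X) v z \<noteq> {}}"
      by (rule elimination[OF algc P(1,2) top_form_fiber_growth[OF T(1,2) PD v]])
    ultimately have "?Q (Suc k)" using fr' tr' j(1) cJ
      by (intro exI[of _ b'] exI[of _ l'] exI[of _ "insert j J"]) simp
    then show False using k(2) by fastforce
  qed
  then show ?thesis using that[OF fr tr dimension_eq[OF pure X tr]] by blast
qed

section \<open>Comparison of the geodesic distance with the ambient norm\<close>

locale projective_metric =
  fixes g :: "complex^'n \<Rightarrow> complex^'n \<Rightarrow> complex^'n \<Rightarrow> real"
  assumes metric: "riemannian_metric_on_projective_space g"
begin

lemma g_bilinear: "v \<noteq> 0 \<Longrightarrow> bilinear (g v)"
  and g_sym: "v \<noteq> 0 \<Longrightarrow> g v a b = g v b a"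
  and g_nonneg: "v \<noteq> 0 \<Longrightarrow> g v a a \<ge> 0"
  and g_null: "v \<noteq> 0 \<Longrightarrow> g v a a = 0 \<longleftrightarrow> a \<in> complex_line v"
  and g_scale: "v \<noteq> 0 \<Longrightarrow> c \<noteq> 0 \<Longrightarrow> g (c *s v) (c *s a) (c *s b) = g v a b"
  using metric unfolding riemannian_metric_on_projective_space_def by blast+

lemma g_continuous: "continuous_on (- {0}) (\<lambda>v. g v a b)"
proof -
  have "smooth_fun_on (\<lambda>v. g v a b) (- {0})"
    using metric unfolding riemannian_metric_on_projective_space_def by blast
  then have "Ck_on 0 (\<lambda>v. g v a b) (- {0})" unfolding smooth_fun_on_def by blast
  then show ?thesis by simp
qed

text \<open>Reduces continuity of the quadratic form in point and vector to that of the finitely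
  many coefficients of the metric.\<close>

lemma g_expand:
  assumes "v \<noteq> 0"
  shows "g v a b = (\<Sum>i\<in>Basis. \<Sum>j\<in>Basis. (a \<bullet> i) * (b \<bullet> j) * g v i j)"
proof -
  note bl = g_bilinear[OF assms]
  have l: "linear (\<lambda>x. g v x y)" and r: "linear (\<lambda>y. g v x y)" for x y
    using bl unfolding bilinear_def by blast+
  have "g v a b = g v (\<Sum>i\<in>Basis. (a \<bullet> i) *\<^sub>R i) (\<Sum>j\<in>Basis. (b \<bullet> j) *\<^sub>R j)"
    by (simp add: euclidean_representation)
  also have "\<dots> = (\<Sum>i\<in>Basis. (a \<bullet> i) * g v i (\<Sum>j\<in>Basis. (b \<bullet> j) *\<^sub>R j))"
    by (simp only: linear_sum[OF l] linear_cmul[OF l] real_scaleR_def)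
  also have "\<dots> = (\<Sum>i\<in>Basis. \<Sum>j\<in>Basis. (a \<bullet> i) * (b \<bullet> j) * g v i j)"
    by (simp only: linear_sum[OF r] linear_cmul[OF r] real_scaleR_def sum_distrib_left mult.assoc)
  finally show ?thesis .
qed

lemma g_continuous_on:
  assumes "continuous_on S f" "continuous_on S h" "\<And>x. x \<in> S \<Longrightarrow> f x \<noteq> 0"
  shows "continuous_on S (\<lambda>x. g (f x) (h x) (h x))"
proof -
  have "continuous_on S (\<lambda>x. g (f x) i j)" for i j
    by (rule continuous_on_compose2[OF g_continuous assms(1)]) (use assms(3) in auto)
  then have "continuous_on S (\<lambda>x. \<Sum>i\<in>Basis. \<Sum>j\<in>Basis. (h x \<bullet> i) * (h x \<bullet> j) * g (f x) i j)"
    by (intro continuous_intros assms(2))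
  then show ?thesis by (rule continuous_on_eq) (use assms(3) in \<open>simp add: g_expand\<close>)
qed

text \<open>A null vector of a positive semidefinite form is orthogonal to everything: otherwise the
  values at b + t u, which are affine in t, would become negative.\<close>

lemma g_null_right:
  assumes v: "v \<noteq> 0"
  shows "g v b (c *s v) = 0"
proof -
  note bl = g_bilinear[OF v]
  let ?u = "c *s v"
  have u: "g v ?u ?u = 0" using g_null[OF v] by (auto simp: complex_line_def)
  have "0 \<le> g v b b + 2 * t * g v b ?u" for t
  proof -
    have "g v (b + t *\<^sub>R ?u) (b + t *\<^sub>R ?u) = g v b b + 2 * t * g v b ?u"
      using u g_sym[OF v, of ?u b]
      by (simp add: bilinear_ladd[OF bl] bilinear_radd[OF bl] bilinear_lmul[OF bl] bilinear_rmul[OF bl] algebra_simps)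
    then show ?thesis using g_nonneg[OF v] by metis
  qed
  \<comment> \<open>This t would give the value -1.\<close>
  from this[of "- (g v b b + 1) / (2 * g v b ?u)"] show ?thesis by (cases "g v b ?u = 0") (auto simp: field_simps)
qed

lemma g_add_null:
  assumes v: "v \<noteq> 0"
  shows "g v (a + c *s v) (a + c *s v) = g v a a"
  using g_null_right[OF v, of _ c] g_sym[OF v, of "c *s v"]
  by (simp add: bilinear_ladd[OF g_bilinear[OF v]] bilinear_radd[OF g_bilinear[OF v]])

text \<open>The Hermitian product of a with v; its vanishing means that a is horizontal, that is,
  orthogonal to the complex line through v.\<close>

definition herm :: "complex^'n \<Rightarrow> complex^'n \<Rightarrow> complex" where
  "herm v a = (\<Sum>i\<in>UNIV. a $ i * cnj (v $ i))"

lemma herm_self: "herm v v = of_real ((norm v)\<^sup>2)"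
proof -
  have "(norm v)\<^sup>2 = (\<Sum>i\<in>UNIV. (cmod (v $ i))\<^sup>2)"
    by (simp add: norm_vec_def L2_set_def sum_nonneg)
  then show ?thesis unfolding herm_def by (simp add: complex_norm_square[symmetric])
qed

lemma herm_add: "herm v (a + b) = herm v a + herm v b"
  by (simp add: herm_def distrib_right sum.distrib)

lemma herm_smult: "herm v (c *s a) = c * herm v a"
  by (simp add: herm_def sum_distrib_left mult.assoc)

lemma Re_herm: "Re (herm v a) = v \<bullet> a"
  by (simp add: herm_def inner_vec_def inner_complex_def algebra_simps)

text \<open>On orthonormal pairs (v, a) the metric is positive and continuous, hence bounded below
  by compactness. Invariance under scaling and homogeneity in a produce the quotient
  |a|/|v|.\<close>

lemma horizontal_lower_bound:
  "\<exists>\<kappa>>0. \<forall>v a. v \<noteq> 0 \<longrightarrow> herm v a = 0 \<longrightarrow> \<kappa> * (norm a / norm v)\<^sup>2 \<le> g v a a"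
proof -
  let ?S = "{p :: (complex^'n) \<times> (complex^'n). fst p \<in> sphere 0 1 \<and> snd p \<in> sphere 0 1 \<and> herm (fst p) (snd p) = 0}"
  have "?S = (sphere 0 1 \<times> sphere 0 1) \<inter> {p. herm (fst p) (snd p) = 0}" by auto
  moreover have "closed {p :: (complex^'n) \<times> (complex^'n). herm (fst p) (snd p) = 0}"
    unfolding herm_def by (intro closed_Collect_eq continuous_intros)
  ultimately have comp: "compact ?S"
    using compact_Int_closed[OF compact_Times[OF compact_sphere compact_sphere]] by (simp only:)
  have cont: "continuous_on ?S (\<lambda>p. g (fst p) (snd p) (snd p))"
    by (intro g_continuous_on continuous_intros) auto
  have pos: "g (fst p) (snd p) (snd p) > 0" if p: "p \<in> ?S" for p
  proof -
    have v: "fst p \<noteq> 0" using p by auto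
    have "g (fst p) (snd p) (snd p) \<noteq> 0"
    proof
      assume "g (fst p) (snd p) (snd p) = 0"
      then obtain c where c: "snd p = c *s fst p" using g_null[OF v] by (auto simp: complex_line_def)
      then have "c * herm (fst p) (fst p) = 0" using p by (simp add: herm_smult)
      then have "c = 0" using v by (simp add: herm_self)
      then show False using c p by auto
    qed
    then show ?thesis using g_nonneg[OF v, of "snd p"] by simp
  qed
  obtain \<kappa> where \<kappa>: "\<kappa> > 0" "\<And>p. p \<in> ?S \<Longrightarrow> \<kappa> \<le> g (fst p) (snd p) (snd p)"
  proof (cases "?S = {}")
    case True
    then show ?thesis using that[of 1] by auto
  next
    case False
    then obtain p where "p \<in> ?S" "\<forall>q\<in>?S. g (fst p) (snd p) (snd p) \<le> g (fst q) (snd q) (snd q)"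
      using continuous_attains_inf[OF comp False cont] by blast
    then show ?thesis using that[of "g (fst p) (snd p) (snd p)"] pos by blast
  qed
  have "\<kappa> * (norm a / norm v)\<^sup>2 \<le> g v a a" if v: "v \<noteq> 0" and h: "herm v a = 0" for v a
  proof (cases "a = 0")
    case True
    then show ?thesis using g_nonneg[OF v] by simp
  next
    case False
    define s where "s = norm a / norm v"
    have s: "s > 0" using v False by (simp add: s_def)
    let ?c = "of_real (1 / norm v) :: complex"
    define a' where "a' = of_real (1 / norm a) *s a"
    have na: "norm a' = 1" using False by (simp add: a'_def norm_smult norm_divide)
    have nv: "norm (?c *s v) = 1" using v by (simp add: norm_smult norm_divide)
    have "herm (?c *s v) a' = 0"
    proof -
      have "herm (?c *s v) x = cnj ?c * herm v x" for x by (simp add: herm_def sum_distrib_left mult_ac)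
      then show ?thesis using h by (simp add: a'_def herm_smult)
    qed
    then have low: "\<kappa> \<le> g (?c *s v) a' a'" using \<kappa>(2)[of "(?c *s v, a')"] na nv by simp
    have ca: "?c *s a = s *\<^sub>R a'"
      using False by (simp add: a'_def s_def vec_eq_iff scaleR_conv_of_real[where 'a=complex])
    have cv: "?c *s v \<noteq> 0" using nv by auto
    have "g (?c *s v) (?c *s a) (?c *s a) = s\<^sup>2 * g (?c *s v) a' a'" unfolding ca
      by (simp only: bilinear_lmul[OF g_bilinear[OF cv]] bilinear_rmul[OF g_bilinear[OF cv]] power2_eq_square
          real_scaleR_def mult.assoc)
    then have "\<kappa> * s\<^sup>2 \<le> g (?c *s v) (?c *s a) (?c *s a)"
      using mult_left_mono[OF low, of "s\<^sup>2"] by (simp only: mult.commute zero_le_power2)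
    then show ?thesis using g_scale[OF v, of ?c] v by (simp add: s_def)
  qed
  then show ?thesis using \<kappa>(1) by blast
qed

text \<open>The entries of the orthogonal projection onto the line spanned by \<open>v\<close>.\<close>

definition proj_entry :: "'n \<Rightarrow> 'n \<Rightarrow> complex^'n \<Rightarrow> complex" where
  "proj_entry i j v = v $ i * cnj (v $ j) / of_real (v \<bullet> v)"

lemma proj_entry_smult:
  assumes c: "c \<noteq> 0"
  shows "proj_entry i j (c *s v) = proj_entry i j v"
proof -
  have "(c *s v) \<bullet> (c *s v) = (cmod c)\<^sup>2 * (v \<bullet> v)"
    by (simp add: dot_square_norm norm_smult power_mult_distrib)
  moreover have "(c *s v) $ i * cnj ((c *s v) $ j) = of_real ((cmod c)\<^sup>2) * (v $ i * cnj (v $ j))"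
    by (simp add: complex_norm_square mult_ac del: of_real_power)
  ultimately show ?thesis using c unfolding proj_entry_def by (simp only: of_real_mult) simp
qed

definition curve_length :: "(real \<Rightarrow> complex^'n) \<Rightarrow> real" where
  "curve_length \<gamma> = integral {0..1} (\<lambda>t. sqrt (g (\<gamma> t) (vector_derivative \<gamma> (at t)) (vector_derivative \<gamma> (at t))))"

lemma speed_continuous:
  assumes "\<gamma> C1_differentiable_on {0..1}" "\<And>t. t \<in> {0..1} \<Longrightarrow> \<gamma> t \<noteq> 0"
  shows "continuous_on {0..1} (\<lambda>t. sqrt (g (\<gamma> t) (vector_derivative \<gamma> (at t)) (vector_derivative \<gamma> (at t))))"
  using assms
  by (intro continuous_intros g_continuous_on)
     (auto simp: C1_differentiable_on_eq C1_differentiable_imp_continuous_on)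

lemma curve_length_nonneg:
  assumes "\<gamma> C1_differentiable_on {0..1}" "\<And>t. t \<in> {0..1} \<Longrightarrow> \<gamma> t \<noteq> 0"
  shows "curve_length \<gamma> \<ge> 0"
  unfolding curve_length_def
  by (intro integral_nonneg integrable_continuous_real speed_continuous assms)
     (use assms(2) g_nonneg in auto)

text \<open>The left side is the derivative of \<open>proj_entry i j\<close> at v in direction a. As
  \<open>proj_entry\<close> is constant on complex lines through 0, only the horizontal part of a
  contributes to it, just as for g.\<close>

lemma proj_entry_derivative_bound:
  assumes \<kappa>: "\<kappa> > 0" "\<And>v a. v \<noteq> 0 \<Longrightarrow> herm v a = 0 \<Longrightarrow> \<kappa> * (norm a / norm v)\<^sup>2 \<le> g v a a" and v: "v \<noteq> 0"
  shows "norm ((a $ i * cnj (v $ j) + v $ i * cnj (a $ j)) / of_real (v \<bullet> v)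
      - v $ i * cnj (v $ j) * of_real (2 * (v \<bullet> a)) / of_real ((v \<bullet> v)\<^sup>2)) \<le> 2 / sqrt \<kappa> * sqrt (g v a a)" (is "norm ?D \<le> _")
proof -
  define \<mu> where "\<mu> = herm v a / of_real (v \<bullet> v)"
  define a' where "a' = a - \<mu> *s v"
  have vv: "v \<bullet> v > 0" using v by simp
  have a: "a = a' + \<mu> *s v" by (simp add: a'_def)
  have "herm v a = herm v a' + \<mu> * herm v v" unfolding a herm_add herm_smult by (simp add: a'_def)
  then have h: "herm v a' = 0" using vv by (simp add: \<mu>_def herm_self dot_square_norm)
  have "v \<bullet> a = Re \<mu> * (v \<bullet> v)" using vv Re_herm[of v a]
    by (simp add: \<mu>_def Re_divide_of_real)
  then have "of_real (2 * (v \<bullet> a)) = (\<mu> + cnj \<mu>) * of_real (v \<bullet> v)" by (simp add: complex_add_cnj)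
  then have "?D = (a' $ i * cnj (v $ j) + v $ i * cnj (a' $ j)) / of_real (v \<bullet> v)"
    using vv by (subst (1 2) a) (simp add: field_simps power2_eq_square)
  then have "norm ?D = norm (a' $ i * cnj (v $ j) + v $ i * cnj (a' $ j)) / (norm v)\<^sup>2"
    by (simp only: norm_divide norm_of_real) (simp add: dot_square_norm)
  also have "\<dots> \<le> (norm a' * norm v + norm v * norm a') / (norm v)\<^sup>2"
  proof (intro divide_right_mono)
    have "norm (a' $ i * cnj (v $ j) + v $ i * cnj (a' $ j)) \<le> norm (a' $ i) * norm (v $ j) + norm (v $ i) * norm (a' $ j)"
      by (rule norm_triangle_le) (simp add: norm_mult)
    also have "\<dots> \<le> norm a' * norm v + norm v * norm a'"
      by (intro add_mono mult_mono Finite_Cartesian_Product.norm_nth_le) auto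
    finally show "norm (a' $ i * cnj (v $ j) + v $ i * cnj (a' $ j)) \<le> norm a' * norm v + norm v * norm a'" .
  qed simp
  also have "\<dots> = 2 / sqrt \<kappa> * (sqrt \<kappa> * (norm a' / norm v))"
    using v \<kappa>(1) by (simp add: power2_eq_square field_simps)
  also have "\<dots> = 2 / sqrt \<kappa> * sqrt (\<kappa> * (norm a' / norm v)\<^sup>2)" by (simp add: real_sqrt_mult)
  also have "\<dots> \<le> 2 / sqrt \<kappa> * sqrt (g v a a)"
  proof -
    have "\<kappa> * (norm a' / norm v)\<^sup>2 \<le> g v a a" unfolding a g_add_null[OF v] by (rule \<kappa>(2)[OF v h])
    then show ?thesis using \<kappa>(1) by (intro mult_left_mono) auto
  qed
  finally show ?thesis .
qed

text \<open>Integrates the derivative bound along the curve; the constant depends on the metric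
  only.\<close>

lemma proj_entry_curve_bound:
  "\<exists>C\<ge>0. \<forall>\<gamma> i j. \<gamma> C1_differentiable_on {0..1} \<longrightarrow> (\<forall>t\<in>{0..1}. \<gamma> t \<noteq> 0) \<longrightarrow>
     norm (proj_entry i j (\<gamma> 1) - proj_entry i j (\<gamma> 0)) \<le> C * curve_length \<gamma>"
proof -
  obtain \<kappa> where \<kappa>: "\<kappa> > 0" "\<And>v a. v \<noteq> 0 \<Longrightarrow> herm v a = 0 \<Longrightarrow> \<kappa> * (norm a / norm v)\<^sup>2 \<le> g v a a"
    using horizontal_lower_bound by blast
  let ?C = "2 / sqrt \<kappa>"
  have "norm (proj_entry i j (\<gamma> 1) - proj_entry i j (\<gamma> 0)) \<le> ?C * curve_length \<gamma>"
    if c1: "\<gamma> C1_differentiable_on {0..1}" and nz: "\<And>t. t \<in> {0..1} \<Longrightarrow> \<gamma> t \<noteq> 0" for \<gamma> i j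
  proof -
    let ?a = "\<lambda>t. vector_derivative \<gamma> (at t)"
    let ?D = "\<lambda>t. (?a t $ i * cnj (\<gamma> t $ j) + \<gamma> t $ i * cnj (?a t $ j)) / of_real (\<gamma> t \<bullet> \<gamma> t)
      - \<gamma> t $ i * cnj (\<gamma> t $ j) * of_real (2 * (\<gamma> t \<bullet> ?a t)) / of_real ((\<gamma> t \<bullet> \<gamma> t)\<^sup>2)"
    have der: "((\<lambda>t. proj_entry i j (\<gamma> t)) has_vector_derivative ?D t) (at t within {0..1})" if t: "t \<in> {0..1}" for t
    proof -
      have g: "(\<gamma> has_vector_derivative ?a t) (at t within {0..1})"
        using c1 t unfolding C1_differentiable_on_eq by (meson has_vector_derivative_at_within vector_derivative_works)
      have comp: "((\<lambda>t. \<gamma> t $ k) has_vector_derivative ?a t $ k) (at t within {0..1})" for k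
        by (rule bounded_linear.has_vector_derivative[OF bounded_linear_vec_nth g])
      have nn: "of_real (\<gamma> t \<bullet> \<gamma> t) \<noteq> (0::complex)" using nz[OF t] by simp
      have inn: "((\<lambda>t. \<gamma> t \<bullet> \<gamma> t) has_vector_derivative 2 * (\<gamma> t \<bullet> ?a t)) (at t within {0..1})"
        using g unfolding has_vector_derivative_def
        by (auto intro!: derivative_eq_intros simp: inner_commute algebra_simps)
      have inn': "((\<lambda>t. of_real (\<gamma> t \<bullet> \<gamma> t) :: complex) has_vector_derivative of_real (2 * (\<gamma> t \<bullet> ?a t))) (at t within {0..1})"
        by (rule bounded_linear.has_vector_derivative[OF bounded_linear_of_real inn])
      have inv: "((\<lambda>t. inverse (of_real (\<gamma> t \<bullet> \<gamma> t)) :: complex) has_vector_derivative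
          of_real (2 * (\<gamma> t \<bullet> ?a t)) * - inverse ((of_real (\<gamma> t \<bullet> \<gamma> t))\<^sup>2)) (at t within {0..1})"
      proof -
        have "(inverse has_field_derivative - inverse ((of_real (\<gamma> t \<bullet> \<gamma> t) :: complex)\<^sup>2)) (at (of_real (\<gamma> t \<bullet> \<gamma> t)))"
          using nn by (auto intro!: derivative_eq_intros simp: power2_eq_square)
        from field_vector_diff_chain_within[OF inn' DERIV_subset[OF this subset_UNIV]] show ?thesis by (simp add: o_def)
      qed
      have cj: "((\<lambda>t. cnj (\<gamma> t $ j)) has_vector_derivative cnj (?a t $ j)) (at t within {0..1})"
        by (rule bounded_linear.has_vector_derivative[OF bounded_linear_cnj comp])
      have "((\<lambda>t. \<gamma> t $ i * cnj (\<gamma> t $ j) * inverse (of_real (\<gamma> t \<bullet> \<gamma> t))) has_vector_derivative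
          \<gamma> t $ i * cnj (\<gamma> t $ j) * (of_real (2 * (\<gamma> t \<bullet> ?a t)) * - inverse ((of_real (\<gamma> t \<bullet> \<gamma> t))\<^sup>2)) +
          (\<gamma> t $ i * cnj (?a t $ j) + ?a t $ i * cnj (\<gamma> t $ j)) * inverse (of_real (\<gamma> t \<bullet> \<gamma> t))) (at t within {0..1})"
        by (rule has_vector_derivative_mult[OF has_vector_derivative_mult[OF comp cj] inv])
      then show ?thesis unfolding proj_entry_def by (simp add: divide_inverse algebra_simps)
    qed
    have int: "(?D has_integral proj_entry i j (\<gamma> 1) - proj_entry i j (\<gamma> 0)) {0..1}"
      by (rule fundamental_theorem_of_calculus) (use der in auto)
    have sp: "(\<lambda>t. sqrt (g (\<gamma> t) (?a t) (?a t))) integrable_on {0..1}"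
      by (intro integrable_continuous_real speed_continuous c1 nz)
    have "norm (integral {0..1} ?D) \<le> integral {0..1} (\<lambda>t. ?C * sqrt (g (\<gamma> t) (?a t) (?a t)))"
    proof (rule integral_norm_bound_integral)
      show "?D integrable_on {0..1}" using int by blast
      show "(\<lambda>t. ?C * sqrt (g (\<gamma> t) (?a t) (?a t))) integrable_on {0..1}" using sp by (rule integrable_on_mult_right)
      show "norm (?D t) \<le> ?C * sqrt (g (\<gamma> t) (?a t) (?a t))" if "t \<in> {0..1}" for t
        by (rule proj_entry_derivative_bound[OF \<kappa> nz[OF that]])
    qed
    then show ?thesis using int by (simp add: integral_unique curve_length_def)
  qed
  then show ?thesis using \<kappa>(1) by (intro exI[of _ ?C]) auto
qed

lemma segment_C1: "(\<lambda>t. a + t *\<^sub>R (b - a)) C1_differentiable_on S"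
  and segment_derivative: "vector_derivative (\<lambda>t. a + t *\<^sub>R (b - a)) (at t) = b - a"
  for a b :: "complex^'n"
proof -
  have d: "((\<lambda>t. a + t *\<^sub>R (b - a)) has_vector_derivative b - a) (at t)" for t
    by (auto intro!: derivative_eq_intros)
  then show "(\<lambda>t. a + t *\<^sub>R (b - a)) C1_differentiable_on S"
    unfolding C1_differentiable_on_def by (intro exI[of _ "\<lambda>_. b - a"]) auto
  show "vector_derivative (\<lambda>t. a + t *\<^sub>R (b - a)) (at t) = b - a" using d by (rule vector_derivative_at)
qed

section \<open>Lower and upper bounds for the geodesic distance\<close>

abbreviation curves :: "(complex^'n) set \<Rightarrow> (complex^'n) set \<Rightarrow> (real \<Rightarrow> complex^'n) set" where
  "curves K L \<equiv> {\<gamma>. \<gamma> C1_differentiable_on {0..1} \<and> (\<forall>t\<in>{0..1}. \<gamma> t \<noteq> 0) \<and> \<gamma> 0 \<in> K \<and> \<gamma> 1 \<in> L}"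

lemma riemannian_dist_eq: "riemannian_dist g K L = Inf (curve_length ` curves K L)"
  unfolding riemannian_dist_def curve_length_def by (rule arg_cong[of _ _ Inf]) blast

lemma riemannian_dist_le:
  assumes "\<gamma> \<in> curves K L"
  shows "riemannian_dist g K L \<le> curve_length \<gamma>"
  unfolding riemannian_dist_eq
proof (rule cInf_lower)
  show "curve_length \<gamma> \<in> curve_length ` curves K L" using assms by blast
  show "bdd_below (curve_length ` curves K L)"
    by (rule bdd_belowI[of _ 0]) (auto intro!: curve_length_nonneg)
qed

lemma curves_nonempty:
  assumes a: "a \<noteq> 0" and b: "b \<noteq> 0"
  shows "curves (complex_line a) (complex_line b) \<noteq> {}"
proof -
  \<comment> \<open>The sign makes the real inner product with \<open>a\<close> nonnegative, so that
    the segment from \<open>a\<close> to b' avoids 0. Some curve must be exhibited because an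
    infimum over the empty set would carry no information.\<close>
  define b' where "b' = (if a \<bullet> b \<ge> 0 then b else - b)"
  have b': "a \<bullet> b' \<ge> 0" "b' \<noteq> 0" using b by (auto simp: b'_def)
  have in_b: "b' \<in> complex_line b"
    by (auto simp: b'_def complex_line_def image_iff vec_eq_iff intro: exI[of _ 1] exI[of _ "-1"])
  have in_a: "a \<in> complex_line a" by (auto simp: complex_line_def intro: image_eqI[of _ _ 1])
  have "a + t *\<^sub>R (b' - a) \<noteq> 0" if t: "t \<in> {0..1}" for t
  proof
    assume z: "a + t *\<^sub>R (b' - a) = 0"
    then have "a \<bullet> (a + t *\<^sub>R (b' - a)) = 0" by simp
    then have e: "(1 - t) * (a \<bullet> a) + t * (a \<bullet> b') = 0" by (simp add: inner_add_right inner_diff_right algebra_simps)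
    have "(1 - t) * (a \<bullet> a) \<ge> 0" "t * (a \<bullet> b') \<ge> 0" using t b'(1) by auto
    then have "(1 - t) * (a \<bullet> a) = 0" using e by linarith
    then have "t = 1" using a by simp
    then show False using z b'(2) by simp
  qed
  then have "(\<lambda>t. a + t *\<^sub>R (b' - a)) \<in> curves (complex_line a) (complex_line b)"
    using segment_C1 in_a in_b by simp
  then show ?thesis by blast
qed

lemma riemannian_dist_nonneg:
  assumes a: "a \<noteq> 0" and b: "b \<noteq> 0"
  shows "riemannian_dist g (complex_line a) (complex_line b) \<ge> 0"
  unfolding riemannian_dist_eq
  by (rule cInf_greatest) (use curves_nonempty[OF assms] in \<open>auto intro!: curve_length_nonneg\<close>)

text \<open>With P_a the orthogonal projection onto the line of a, and \<mu> a = P_a b, one has b -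
  \<mu> a = (P_b - P_a) b; the entries of P_b - P_a are bounded by the length of every joining
  curve.\<close>

lemma riemannian_dist_lower_bound:
  "\<exists>C\<ge>0. \<forall>a b. a \<noteq> 0 \<longrightarrow> b \<noteq> 0 \<longrightarrow>
     (\<exists>\<mu>. norm (b - \<mu> *s a) \<le> C * norm b * riemannian_dist g (complex_line a) (complex_line b))"
proof -
  obtain C where C: "C \<ge> 0" "\<And>\<gamma> i j. \<gamma> C1_differentiable_on {0..1} \<Longrightarrow> (\<forall>t\<in>{0..1}. \<gamma> t \<noteq> 0) \<Longrightarrow>
     norm (proj_entry i j (\<gamma> 1) - proj_entry i j (\<gamma> 0)) \<le> C * curve_length \<gamma>"
    using proj_entry_curve_bound by blast
  let ?N = "real CARD('n)"
  have "\<exists>\<mu>. norm (b - \<mu> *s a) \<le> (?N * (?N * C)) * norm b * riemannian_dist g (complex_line a) (complex_line b)"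
    if a: "a \<noteq> 0" and b: "b \<noteq> 0" for a b
  proof -
    let ?d = "riemannian_dist g (complex_line a) (complex_line b)"
    have F: "norm (proj_entry i j b - proj_entry i j a) \<le> C * ?d" for i j
    \<comment> \<open>The infimum is compared with a quotient by C. For C = 0 a single joining curve
      already shows the entries to agree.\<close>
    proof (cases "C = 0")
      case True
      obtain \<gamma> where \<gamma>: "\<gamma> \<in> curves (complex_line a) (complex_line b)" using curves_nonempty[OF a b] by blast
      then obtain c c' where c: "\<gamma> 0 = c *s a" "\<gamma> 1 = c' *s b" by (auto simp: complex_line_def)
      have "\<gamma> 0 \<noteq> 0" "\<gamma> 1 \<noteq> 0" using \<gamma> by auto
      then have "c \<noteq> 0" "c' \<noteq> 0" using c by auto
      then show ?thesis using C(2)[of \<gamma> i j] \<gamma> True c by (simp add: proj_entry_smult)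
    next
      case False
      then have Cp: "C > 0" using C(1) by simp
      have "norm (proj_entry i j b - proj_entry i j a) / C \<le> ?d"
        unfolding riemannian_dist_eq
      proof (rule cInf_greatest)
        show "curve_length ` curves (complex_line a) (complex_line b) \<noteq> {}" using curves_nonempty[OF a b] by blast
        fix x assume "x \<in> curve_length ` curves (complex_line a) (complex_line b)"
        then obtain \<gamma> where \<gamma>: "\<gamma> \<in> curves (complex_line a) (complex_line b)" "x = curve_length \<gamma>" by blast
        then obtain c c' where c: "\<gamma> 0 = c *s a" "\<gamma> 1 = c' *s b" by (auto simp: complex_line_def)
        have "\<gamma> 0 \<noteq> 0" "\<gamma> 1 \<noteq> 0" using \<gamma> by auto
        then have "c \<noteq> 0" "c' \<noteq> 0" using c by auto
        then show "norm (proj_entry i j b - proj_entry i j a) / C \<le> x"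
          using C(2)[of \<gamma> i j] \<gamma> c Cp by (simp add: proj_entry_smult field_simps)
      qed
      then show ?thesis using Cp by (simp add: field_simps)
    qed
    have row: "(\<Sum>j\<in>UNIV. proj_entry i j v * b $ j) = herm v b / of_real (v \<bullet> v) * v $ i" for i v
      by (simp add: proj_entry_def herm_def sum_distrib_left sum_distrib_right sum_divide_distrib mult_ac)
    define \<mu> where "\<mu> = herm a b / of_real (a \<bullet> a)"
    have "norm ((b - \<mu> *s a) $ i) \<le> ?N * (C * ?d * norm b)" for i
    proof -
      have "(b - \<mu> *s a) $ i = (\<Sum>j\<in>UNIV. (proj_entry i j b - proj_entry i j a) * b $ j)"
        using b by (simp add: left_diff_distrib sum_subtractf row \<mu>_def herm_self dot_square_norm)
      also have "norm \<dots> \<le> (\<Sum>j\<in>(UNIV :: 'n set). C * ?d * norm b)"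
      proof (rule sum_norm_le)
        fix j
        show "norm ((proj_entry i j b - proj_entry i j a) * b $ j) \<le> C * ?d * norm b"
          unfolding norm_mult using C(1) riemannian_dist_nonneg[OF a b]
          by (intro mult_mono F Finite_Cartesian_Product.norm_nth_le) auto
      qed
      finally show ?thesis by simp
    qed
    then have "(\<Sum>i\<in>UNIV. norm ((b - \<mu> *s a) $ i)) \<le> (\<Sum>i\<in>(UNIV :: 'n set). ?N * (C * ?d * norm b))"
      by (intro sum_mono)
    moreover have "norm (b - \<mu> *s a) \<le> (\<Sum>i\<in>UNIV. norm ((b - \<mu> *s a) $ i))"
      unfolding norm_vec_def by (rule L2_set_le_sum) auto
    ultimately show ?thesis by (intro exI[of _ \<mu>]) (simp add: mult_ac)
  qed
  then show ?thesis using C(1) by (intro exI[of _ "?N * (?N * C)"]) auto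
qed

text \<open>The straight segment stays in the convex compact set, where g is bounded by a multiple
  of the Euclidean metric.\<close>

lemma riemannian_dist_upper_bound:
  assumes S: "compact S" "convex S" "0 \<notin> S"
  shows "\<exists>C\<ge>0. \<forall>a\<in>S. \<forall>b\<in>S. riemannian_dist g (complex_line a) (complex_line b) \<le> C * norm (a - b)"
proof -
  have "continuous_on (S \<times> sphere 0 1) (\<lambda>p. g (fst p) (snd p) (snd p))"
    by (intro g_continuous_on continuous_intros) (use S(3) in auto)
  then have "bounded ((\<lambda>p. g (fst p) (snd p) (snd p)) ` (S \<times> sphere 0 1))"
    using S(1) by (intro compact_imp_bounded compact_continuous_image compact_Times compact_sphere)
  then obtain M where M: "\<And>v u. v \<in> S \<Longrightarrow> norm u = 1 \<Longrightarrow> \<bar>g v u u\<bar> \<le> M"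
    unfolding bounded_iff by force
  define M' where "M' = max M 0"
  have "riemannian_dist g (complex_line a) (complex_line b) \<le> sqrt M' * norm (a - b)" if ab: "a \<in> S" "b \<in> S" for a b
  proof -
    let ?\<gamma> = "\<lambda>t. a + t *\<^sub>R (b - a)"
    have inS: "?\<gamma> t \<in> S" if "t \<in> {0..1}" for t
    proof -
      have "?\<gamma> t = (1 - t) *\<^sub>R a + t *\<^sub>R b" by (simp add: algebra_simps)
      then show ?thesis using convexD[OF S(2) ab, of "1 - t" t] that by simp
    qed
    have nz: "?\<gamma> t \<noteq> 0" if "t \<in> {0..1}" for t using inS[OF that] S(3) by metis
    have in_line: "x \<in> complex_line x" for x :: "complex^'n" by (auto simp: complex_line_def intro: image_eqI[of _ _ 1])
    have "?\<gamma> \<in> curves (complex_line a) (complex_line b)" using nz segment_C1 in_line by simp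
    then have "riemannian_dist g (complex_line a) (complex_line b) \<le> curve_length ?\<gamma>" by (rule riemannian_dist_le)
    also have "\<dots> \<le> integral {0..1} (\<lambda>t::real. sqrt M' * norm (a - b))"
      unfolding curve_length_def
    proof (rule integral_le)
      show "(\<lambda>t. sqrt (g (?\<gamma> t) (vector_derivative ?\<gamma> (at t)) (vector_derivative ?\<gamma> (at t)))) integrable_on {0..1}"
        by (intro integrable_continuous_real speed_continuous segment_C1 nz)
      show "(\<lambda>t::real. sqrt M' * norm (a - b)) integrable_on {0..1}" by (intro integrable_continuous_real continuous_intros)
      fix t :: real assume t: "t \<in> {0..1}"
      show "sqrt (g (?\<gamma> t) (vector_derivative ?\<gamma> (at t)) (vector_derivative ?\<gamma> (at t))) \<le> sqrt M' * norm (a - b)"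
      proof (cases "a = b")
        case True
        then show ?thesis using g_expand[OF nz[OF t], of 0 0] by (simp add: segment_derivative)
      next
        case False
        define u where "u = (1 / norm (b - a)) *\<^sub>R (b - a)"
        have u: "norm u = 1" "b - a = norm (b - a) *\<^sub>R u" using False by (auto simp: u_def)
        note bl = g_bilinear[OF nz[OF t]]
        have "g (?\<gamma> t) (b - a) (b - a) = (norm (b - a))\<^sup>2 * g (?\<gamma> t) u u"
          by (subst (2 3) u(2)) (simp add: bilinear_lmul[OF bl] bilinear_rmul[OF bl] power2_eq_square)
        also have "\<dots> \<le> (norm (b - a))\<^sup>2 * M'"
          using M[OF inS[OF t] u(1)] by (intro mult_left_mono) (auto simp: M'_def)
        finally have "sqrt (g (?\<gamma> t) (b - a) (b - a)) \<le> sqrt ((norm (b - a))\<^sup>2 * M')" by simp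
        then show ?thesis by (simp add: segment_derivative real_sqrt_mult norm_minus_commute mult.commute)
      qed
    qed
    also have "\<dots> = sqrt M' * norm (a - b)" by simp
    finally show ?thesis .
  qed
  then show ?thesis by (intro exI[of _ "sqrt M'"]) (auto simp: M'_def)
qed

end

section \<open>Null sets of Hausdorff measure\<close>

text \<open>Cells are given by the integer parts of Re/r and Im/r of the functions, 2 card I numbers
  in all. With N the ceiling of K/r each takes at most 2N + 2 values, and 2N + 2 <= 2(K/r + 1) + 2
  <= (2K + 4)/r for r <= 1.\<close>

lemma grid_partition:
  fixes \<mu> :: "'i \<Rightarrow> 'a \<Rightarrow> complex"
  assumes I: "finite I" and r: "0 < r" "r \<le> 1" and K: "0 \<le> K" "\<And>x i. x \<in> A \<Longrightarrow> i \<in> I \<Longrightarrow> norm (\<mu> i x) \<le> K"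
  obtains P where "finite P" "real (card P) \<le> ((2 * K + 4) / r) ^ (2 * card I)" "A = \<Union>P"
    "\<And>S x y i. S \<in> P \<Longrightarrow> x \<in> S \<Longrightarrow> y \<in> S \<Longrightarrow> i \<in> I \<Longrightarrow> norm (\<mu> i x - \<mu> i y) \<le> 2 * r"
proof -
  define N where "N = \<lceil>K / r\<rceil>"
  define f where "f x = (\<lambda>i\<in>I. (\<lfloor>Re (\<mu> i x) / r\<rfloor>, \<lfloor>Im (\<mu> i x) / r\<rfloor>))" for x
  let ?B = "{- N - 1..N} \<times> {- N - 1..N}"
  let ?G = "I \<rightarrow>\<^sub>E ?B"
  define P where "P = (\<lambda>c. {x \<in> A. f x = c}) ` ?G"
  have "K / r \<ge> 0" using K(1) r(1) by simp
  then have N0: "N \<ge> 0" unfolding N_def by linarith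
  have finG: "finite ?G" by (intro finite_PiE I) auto
  have fl: "\<lfloor>t / r\<rfloor> \<in> {- N - 1..N}" if "\<bar>t\<bar> \<le> K" for t
  proof -
    have "(- K) / r \<le> t / r" "t / r \<le> K / r" by (rule divide_right_mono; use that r(1) in linarith)+
    moreover have "K / r \<le> of_int N" by (simp add: N_def)
    ultimately have "- of_int N \<le> t / r" "t / r \<le> of_int N" by auto
    then have "- N \<le> \<lfloor>t / r\<rfloor>" "\<lfloor>t / r\<rfloor> \<le> N" by linarith+
    then show ?thesis by simp
  qed
  have fG: "f x \<in> ?G" if x: "x \<in> A" for x
  proof -
    have "\<bar>Re (\<mu> i x)\<bar> \<le> K" "\<bar>Im (\<mu> i x)\<bar> \<le> K" if "i \<in> I" for i
      using K(2)[OF x that] abs_Re_le_cmod[of "\<mu> i x"] abs_Im_le_cmod[of "\<mu> i x"] by linarith+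
    then show ?thesis using fl by (auto simp: f_def)
  qed
  show thesis
  proof (rule that[of P])
    show "finite P" unfolding P_def using finG by blast
    have "card ?B = nat (2 * N + 2) ^ 2" using N0 by (simp add: card_cartesian_product power2_eq_square add.commute)
    then have "card ?G = nat (2 * N + 2) ^ (2 * card I)" using I by (simp add: card_PiE power_mult)
    moreover have "card P \<le> card ?G" unfolding P_def using finG by (rule card_image_le)
    ultimately have "real (card P) \<le> real (nat (2 * N + 2)) ^ (2 * card I)" by (metis of_nat_le_iff of_nat_power)
    also have "\<dots> \<le> ((2 * K + 4) / r) ^ (2 * card I)"
    proof (rule power_mono)
      have "real (nat (2 * N + 2)) = 2 * of_int N + 2" using N0 by simp
      also have "\<dots> \<le> 2 * (K / r + 1) + 2" unfolding N_def by (intro add_right_mono mult_left_mono of_int_ceiling_le_add_one) simp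
      also have "\<dots> \<le> (2 * K + 4) / r" using r by (simp add: field_simps)
      finally show "real (nat (2 * N + 2)) \<le> (2 * K + 4) / r" .
    qed simp
    finally show "real (card P) \<le> ((2 * K + 4) / r) ^ (2 * card I)" .
    show "A = \<Union>P" unfolding P_def using fG by blast
    fix S x y i assume S: "S \<in> P" "x \<in> S" "y \<in> S" and i: "i \<in> I"
    then have "f x i = f y i" by (auto simp: P_def)
    then have e: "\<lfloor>Re (\<mu> i x) / r\<rfloor> = \<lfloor>Re (\<mu> i y) / r\<rfloor>" "\<lfloor>Im (\<mu> i x) / r\<rfloor> = \<lfloor>Im (\<mu> i y) / r\<rfloor>"
      using i by (auto simp: f_def)
    have near: "\<bar>s - t\<bar> \<le> r" if "\<lfloor>s / r\<rfloor> = \<lfloor>t / r\<rfloor>" for s t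
    proof -
      have "\<bar>s / r - t / r\<bar> \<le> 1" using that by linarith
      then have "\<bar>s - t\<bar> / r \<le> 1" using r(1) by (simp add: diff_divide_distrib[symmetric])
      then show ?thesis using r(1) by simp
    qed
    have "norm (\<mu> i x - \<mu> i y) \<le> \<bar>Re (\<mu> i x - \<mu> i y)\<bar> + \<bar>Im (\<mu> i x - \<mu> i y)\<bar>" by (rule cmod_le)
    also have "\<dots> \<le> r + r" using near[OF e(1)] near[OF e(2)] by simp
    finally show "norm (\<mu> i x - \<mu> i y) \<le> 2 * r" by simp
  qed
qed

text \<open>One \<epsilon> serves both as mesh and as bound for the sum: the hypothesis is applied
  to the smaller of the two tolerances.\<close>

lemma hausdorff_nullI:
  assumes "\<And>\<epsilon>. 0 < \<epsilon> \<Longrightarrow> \<exists>U :: nat \<Rightarrow> 'a set. A \<subseteq> (\<Union>i. U i) \<and> (\<forall>i. U i \<subseteq> M) \<and> (\<forall>i. \<forall>x\<in>U i. \<forall>y\<in>U i. \<delta> x y \<le> \<epsilon>) \<and>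
      suminf (\<lambda>i. diam_power \<delta> s (U i)) \<le> ennreal \<epsilon>"
  shows "hausdorff_measure M \<delta> s A = 0"
proof -
  have "hausdorff_premeasure M \<delta> s \<epsilon> A \<le> 0" if \<epsilon>: "\<epsilon> > 0" for \<epsilon>
  proof (rule ennreal_le_epsilon)
    fix e :: real assume e: "0 < e"
    obtain U :: "nat \<Rightarrow> 'a set" where U: "A \<subseteq> (\<Union>i. U i)" "\<And>i. U i \<subseteq> M"
      "\<And>i x y. x \<in> U i \<Longrightarrow> y \<in> U i \<Longrightarrow> \<delta> x y \<le> min e \<epsilon>"
      "suminf (\<lambda>i. diam_power \<delta> s (U i)) \<le> ennreal (min e \<epsilon>)"
    proof -
      have "0 < min e \<epsilon>" using e \<epsilon> by simp
      from assms[OF this] obtain U :: "nat \<Rightarrow> 'a set" where U: "A \<subseteq> (\<Union>i. U i) \<and> (\<forall>i. U i \<subseteq> M) \<and>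
          (\<forall>i. \<forall>x\<in>U i. \<forall>y\<in>U i. \<delta> x y \<le> min e \<epsilon>) \<and> suminf (\<lambda>i. diam_power \<delta> s (U i)) \<le> ennreal (min e \<epsilon>)" ..
      show thesis by (rule that[of U]) (use U in blast)+
    qed
    have "hausdorff_premeasure M \<delta> s \<epsilon> A \<le> suminf (\<lambda>i. diam_power \<delta> s (U i))"
      unfolding hausdorff_premeasure_def by (rule INF_lower) (use U(1-3) in fastforce)
    also have "\<dots> \<le> ennreal e" using U(4) by (rule order_trans) (simp add: ennreal_leI)
    finally show "hausdorff_premeasure M \<delta> s \<epsilon> A \<le> 0 + ennreal e" by simp
  qed
  then have "hausdorff_measure M \<delta> s A \<le> 0" unfolding hausdorff_measure_def by (intro SUP_least) auto
  then show ?thesis by simp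
qed

lemma hausdorff_nullD:
  assumes "hausdorff_measure M \<delta> s A = 0" "0 < \<epsilon>" "0 < \<eta>"
  obtains U :: "nat \<Rightarrow> 'a set" where "A \<subseteq> (\<Union>i. U i)" "\<And>i. U i \<subseteq> M"
    "\<And>i x y. x \<in> U i \<Longrightarrow> y \<in> U i \<Longrightarrow> \<delta> x y \<le> \<epsilon>" "suminf (\<lambda>i. diam_power \<delta> s (U i)) < ennreal \<eta>"
proof -
  have "hausdorff_premeasure M \<delta> s \<epsilon> A \<le> hausdorff_measure M \<delta> s A"
    unfolding hausdorff_measure_def using assms(2) by (intro SUP_upper) simp
  then have "hausdorff_premeasure M \<delta> s \<epsilon> A < ennreal \<eta>" using assms(1,3) by simp
  then show thesis unfolding hausdorff_premeasure_def INF_less_iff using that by blast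
qed

lemma hausdorff_null_empty: "hausdorff_measure M \<delta> s {} = 0"
  by (rule hausdorff_nullI) (auto intro!: exI[of _ "\<lambda>_. {}"] simp: diam_power_def)

lemma hausdorff_null_mono:
  assumes "hausdorff_measure M \<delta> s B = 0" "A \<subseteq> B"
  shows "hausdorff_measure M \<delta> s A = 0"
proof (rule hausdorff_nullI)
  fix \<epsilon> :: real assume \<epsilon>: "0 < \<epsilon>"
  obtain U :: "nat \<Rightarrow> 'a set" where U: "B \<subseteq> (\<Union>i. U i)" "\<And>i. U i \<subseteq> M"
    "\<And>i x y. x \<in> U i \<Longrightarrow> y \<in> U i \<Longrightarrow> \<delta> x y \<le> \<epsilon>" "suminf (\<lambda>i. diam_power \<delta> s (U i)) < ennreal \<epsilon>"
    by (rule hausdorff_nullD[OF assms(1) \<epsilon> \<epsilon>]) (rule that; assumption)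
  show "\<exists>U :: nat \<Rightarrow> 'a set. A \<subseteq> (\<Union>i. U i) \<and> (\<forall>i. U i \<subseteq> M) \<and> (\<forall>i. \<forall>x\<in>U i. \<forall>y\<in>U i. \<delta> x y \<le> \<epsilon>) \<and>
      suminf (\<lambda>i. diam_power \<delta> s (U i)) \<le> ennreal \<epsilon>"
    using U assms(2) by (intro exI[of _ U]) (auto simp: less_imp_le)
qed

lemma hausdorff_null_UN:
  fixes A :: "nat \<Rightarrow> 'a set"
  assumes null: "\<And>n. hausdorff_measure M \<delta> s (A n) = 0"
  shows "hausdorff_measure M \<delta> s (\<Union>n. A n) = 0"
proof (rule hausdorff_nullI)
  fix \<epsilon> :: real assume \<epsilon>: "0 < \<epsilon>"
  have "\<exists>U :: nat \<Rightarrow> 'a set. A n \<subseteq> (\<Union>i. U i) \<and> (\<forall>i. U i \<subseteq> M) \<and> (\<forall>i. \<forall>x\<in>U i. \<forall>y\<in>U i. \<delta> x y \<le> \<epsilon>) \<and>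
      suminf (\<lambda>i. diam_power \<delta> s (U i)) \<le> ennreal (\<epsilon> * (1/2) ^ Suc n)" for n
  proof -
    have "0 < \<epsilon> * (1/2) ^ Suc n" using \<epsilon> by simp
    from hausdorff_nullD[OF null[of n] \<epsilon> this] show ?thesis by (metis less_imp_le)
  qed
  then have "\<exists>U. \<forall>n. A n \<subseteq> (\<Union>i. U n i) \<and> (\<forall>i. U n i \<subseteq> M) \<and> (\<forall>i. \<forall>x\<in>U n i. \<forall>y\<in>U n i. \<delta> x y \<le> \<epsilon>) \<and>
      suminf (\<lambda>i. diam_power \<delta> s (U n i)) \<le> ennreal (\<epsilon> * (1/2) ^ Suc n)"
    by (intro choice allI)
  then obtain U :: "nat \<Rightarrow> nat \<Rightarrow> 'a set" where U0: "\<forall>n. A n \<subseteq> (\<Union>i. U n i) \<and> (\<forall>i. U n i \<subseteq> M) \<and>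
      (\<forall>i. \<forall>x\<in>U n i. \<forall>y\<in>U n i. \<delta> x y \<le> \<epsilon>) \<and> suminf (\<lambda>i. diam_power \<delta> s (U n i)) \<le> ennreal (\<epsilon> * (1/2) ^ Suc n)" ..
  have U: "\<And>n. A n \<subseteq> (\<Union>i. U n i)" "\<And>n i. U n i \<subseteq> M"
    "\<And>n i x y. x \<in> U n i \<Longrightarrow> y \<in> U n i \<Longrightarrow> \<delta> x y \<le> \<epsilon>"
    "\<And>n. suminf (\<lambda>i. diam_power \<delta> s (U n i)) \<le> ennreal (\<epsilon> * (1/2) ^ Suc n)"
    using U0 by simp_all
  let ?V = "\<lambda>k. U (fst (prod_decode k)) (snd (prod_decode k))"
  have sum: "suminf (\<lambda>k. diam_power \<delta> s (?V k)) = suminf (\<lambda>n. suminf (\<lambda>i. diam_power \<delta> s (U n i)))"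
    using suminf_ennreal_2dimen[of "\<lambda>n. suminf (\<lambda>i. diam_power \<delta> s (U n i))" "\<lambda>p. diam_power \<delta> s (U (fst p) (snd p))"] by simp
  have "suminf (\<lambda>n. suminf (\<lambda>i. diam_power \<delta> s (U n i))) \<le> suminf (\<lambda>n. ennreal (\<epsilon> * (1/2) ^ Suc n))"
    by (rule suminf_le) (use U(4) in auto)
  also have "\<dots> = ennreal \<epsilon>"
  proof (rule suminf_ennreal_eq)
    show "(\<lambda>n. \<epsilon> * (1/2) ^ Suc n) sums \<epsilon>" using sums_mult[OF power_half_series, of \<epsilon>] by simp
  qed (use \<epsilon> in simp)
  finally have le: "suminf (\<lambda>k. diam_power \<delta> s (?V k)) \<le> ennreal \<epsilon>" unfolding sum .
  show "\<exists>U :: nat \<Rightarrow> 'a set. (\<Union>n. A n) \<subseteq> (\<Union>i. U i) \<and> (\<forall>i. U i \<subseteq> M) \<and> (\<forall>i. \<forall>x\<in>U i. \<forall>y\<in>U i. \<delta> x y \<le> \<epsilon>) \<and>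
      suminf (\<lambda>i. diam_power \<delta> s (U i)) \<le> ennreal \<epsilon>"
  proof (intro exI[of _ ?V] conjI)
    show "(\<Union>n. A n) \<subseteq> (\<Union>k. ?V k)"
    proof
      fix x assume "x \<in> (\<Union>n. A n)"
      then obtain n i where "x \<in> U n i" using U(1) by blast
      then have "x \<in> ?V (prod_encode (n, i))" by simp
      then show "x \<in> (\<Union>k. ?V k)" by blast
    qed
  qed (use U(2,3) le in auto)
qed

lemma hausdorff_null_countable:
  assumes "countable F" "\<And>B. B \<in> F \<Longrightarrow> hausdorff_measure M \<delta> s B = 0" "A \<subseteq> \<Union>F"
  shows "hausdorff_measure M \<delta> s A = 0"
proof (cases "F = {}")
  case True
  then show ?thesis using assms(3) by (simp add: hausdorff_null_empty)
next
  case False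
  have "hausdorff_measure M \<delta> s (\<Union>n. from_nat_into F n) = 0"
    by (rule hausdorff_null_UN) (use False assms(2) in \<open>simp add: from_nat_into\<close>)
  moreover have "A \<subseteq> (\<Union>n. from_nat_into F n)" using assms(3) False by (simp add: range_from_nat_into assms(1))
  ultimately show ?thesis using hausdorff_null_mono by blast
qed

text \<open>At most C/r^m cells of diameter at most C r have total cost at most C C^s r^(s-m), which
  tends to 0 for s > m.\<close>

lemma hausdorff_null_of_box_count:
  fixes m :: nat
  assumes \<delta>: "\<And>x y. x \<in> A \<Longrightarrow> y \<in> A \<Longrightarrow> \<delta> x y \<ge> 0" and A: "A \<subseteq> M" and s: "s > real m" and C: "C > 0"
    and cov: "\<And>r. 0 < r \<Longrightarrow> r \<le> 1 \<Longrightarrow> \<exists>P. finite P \<and> real (card P) \<le> C / r ^ m \<and> A = \<Union>P \<and>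
       (\<forall>S\<in>P. \<forall>x\<in>S. \<forall>y\<in>S. \<delta> x y \<le> C * r)"
  shows "hausdorff_measure M \<delta> s A = 0"
proof (rule hausdorff_nullI)
  fix \<epsilon> :: real assume \<epsilon>: "0 < \<epsilon>"
  let ?D = "C * C powr s"
  have D: "?D > 0" using C by simp
  \<comment> \<open>The last bound solves D r^(s-m) <= \<epsilon> for r, with \<open>?D\<close> the
    constant in the total cost.\<close>
  define r where "r = min (min 1 (\<epsilon> / C)) ((\<epsilon> / ?D) powr (1 / (s - m)))"
  have r: "0 < r" "r \<le> 1" "C * r \<le> \<epsilon>" and r': "r \<le> (\<epsilon> / ?D) powr (1 / (s - m))"
  proof -
    show "0 < r" "r \<le> 1" "r \<le> (\<epsilon> / ?D) powr (1 / (s - m))" using \<epsilon> C D by (auto simp: r_def)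
    have "r \<le> \<epsilon> / C" by (simp add: r_def)
    then show "C * r \<le> \<epsilon>" using C by (simp add: field_simps)
  qed
  have "r powr (s - m) \<le> ((\<epsilon> / ?D) powr (1 / (s - m))) powr (s - m)" using r r' s by (intro powr_mono2) auto
  also have "\<dots> = \<epsilon> / ?D" using s \<epsilon> D by (simp add: powr_powr)
  finally have small: "?D * r powr (s - m) \<le> \<epsilon>" using D by (simp add: field_simps)
  obtain P where P: "finite P" "real (card P) \<le> C / r ^ m" "A = \<Union>P" "\<And>S x y. S \<in> P \<Longrightarrow> x \<in> S \<Longrightarrow> y \<in> S \<Longrightarrow> \<delta> x y \<le> C * r"
    using cov[OF r(1,2)] by blast
  obtain h where h: "bij_betw h {0..<card P} P" using ex_bij_betw_nat_finite[OF P(1)] by blast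
  define U where "U i = (if i < card P then h i else {})" for i
  have UP: "U i \<in> P" if "i < card P" for i using h that by (auto simp: U_def bij_betw_def)
  have dp: "diam_power \<delta> s (U i) \<le> ennreal ((C * r) powr s)" for i
  proof (cases "U i = {}")
    case False
    then have i: "U i \<in> P" using UP by (auto simp: U_def split: if_splits)
    have le: "\<delta> x y \<le> C * r" "\<delta> x y \<ge> 0" if "x \<in> U i" "y \<in> U i" for x y using P(3,4) i \<delta> that by blast+
    obtain x where x: "x \<in> U i" using False by blast
    have ub: "(SUP (x, y)\<in>U i \<times> U i. \<delta> x y) \<le> C * r" by (rule cSUP_least) (use False le in auto)
    have "bdd_above ((\<lambda>(x, y). \<delta> x y) ` (U i \<times> U i))" by (rule bdd_aboveI[of _ "C * r"]) (use le in auto)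
    from cSUP_upper[OF _ this, of "(x, x)"] have "0 \<le> (SUP (x, y)\<in>U i \<times> U i. \<delta> x y)" using x le(2)[OF x x] by auto
    then show ?thesis using ub False s unfolding diam_power_def by (auto intro!: ennreal_leI powr_mono2)
  qed (simp add: diam_power_def)
  have "suminf (\<lambda>i. diam_power \<delta> s (U i)) = (\<Sum>i<card P. diam_power \<delta> s (U i))"
    by (rule suminf_finite) (auto simp: U_def diam_power_def)
  also have "\<dots> \<le> (\<Sum>i<card P. ennreal ((C * r) powr s))" by (intro sum_mono dp)
  also have "\<dots> = ennreal (real (card P) * (C * r) powr s)" by (simp add: ennreal_mult ennreal_of_nat_eq_real_of_nat)
  also have "\<dots> \<le> ennreal (C / r ^ m * (C * r) powr s)" by (intro ennreal_leI mult_right_mono P(2)) simp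
  also have "C / r ^ m * (C * r) powr s = ?D * r powr (s - m)"
    using r(1) C by (simp add: powr_mult powr_diff powr_realpow)
  also have "ennreal \<dots> \<le> ennreal \<epsilon>" by (intro ennreal_leI small)
  finally have sum: "suminf (\<lambda>i. diam_power \<delta> s (U i)) \<le> ennreal \<epsilon>" .
  have cover: "A \<subseteq> (\<Union>i. U i)"
  proof
    fix x assume "x \<in> A"
    then obtain S where S: "S \<in> P" "x \<in> S" using P(3) by blast
    then obtain i where "i < card P" "h i = S" using h by (metis atLeastLessThan_iff bij_betw_iff_bijections)
    then have "x \<in> U i" using S by (simp add: U_def)
    then show "x \<in> (\<Union>i. U i)" by blast
  qed
  have UM: "U i \<subseteq> M" for i using UP[of i] A P(3) by (cases "i < card P") (auto simp: U_def)
  have Ud: "\<delta> x y \<le> \<epsilon>" if "x \<in> U i" "y \<in> U i" for i x y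
  proof -
    have "i < card P" using that by (auto simp: U_def split: if_splits)
    then show ?thesis using P(4)[OF UP that] r(3) by simp
  qed
  show "\<exists>U :: nat \<Rightarrow> 'a set. A \<subseteq> (\<Union>i. U i) \<and> (\<forall>i. U i \<subseteq> M) \<and> (\<forall>i. \<forall>x\<in>U i. \<forall>y\<in>U i. \<delta> x y \<le> \<epsilon>) \<and>
      suminf (\<lambda>i. diam_power \<delta> s (U i)) \<le> ennreal \<epsilon>"
  proof (intro exI[of _ U] conjI allI ballI)
    show "A \<subseteq> (\<Union>i. U i)" by (rule cover)
    show "U i \<subseteq> M" for i by (rule UM)
    show "\<delta> x y \<le> \<epsilon>" if "x \<in> U i" "y \<in> U i" for i x y using that by (rule Ud)
    show "suminf (\<lambda>i. diam_power \<delta> s (U i)) \<le> ennreal \<epsilon>" by (rule sum)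
  qed
qed

section \<open>Upper bound for algebraic sets\<close>

lemma polyfun_directional:
  fixes P :: "complex^'n \<Rightarrow> complex"
  assumes "polyfun P"
  shows "\<exists>P'. polyfun P' \<and> (\<forall>z x. ((\<lambda>x. P (z + x *s v)) has_field_derivative P' (z + x *s v)) (at x))"
proof -
  have "polyfun (\<lambda>z. z $ i)" "polyfun (\<lambda>z. v $ i)" for i :: 'n by (auto intro: polyfun.coord polyfun.const)
  from polyfun_expand[OF assms this]
  obtain q where q: "\<And>z x. P (z + x *s v) = poly (q z) x" "\<And>k. polyfun (\<lambda>z. coeff (q z) k)" by blast
  have "((\<lambda>x. P (z + x *s v)) has_field_derivative coeff (q (z + x *s v)) 1) (at x)" for z x
  proof -
    have "(poly (q (z + x *s v)) has_field_derivative poly (pderiv (q (z + x *s v))) 0) (at 0)" by (rule poly_DERIV)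
    moreover have "poly (pderiv (q (z + x *s v))) 0 = coeff (q (z + x *s v)) 1"
      by (simp add: poly_0_coeff_0 coeff_pderiv)
    moreover have "poly (q (z + x *s v)) = (\<lambda>h. P (z + (h + x) *s v))"
      by (rule ext) (simp add: q(1)[symmetric] vector_sadd_rdistrib add_ac)
    ultimately have "((\<lambda>h. P (z + (h + x) *s v)) has_field_derivative coeff (q (z + x *s v)) 1) (at 0)" by simp
    then show ?thesis using DERIV_shift[of "\<lambda>x. P (z + x *s v)" _ 0 x] by simp
  qed
  then show ?thesis using q(2) by blast
qed

text \<open>A quantitative implicit function estimate: between the two zeros, Q changes by about p
  Q'(y) in direction \<open>v\<close> and by at most K1 |u| otherwise, so |p| is controlled by
  |u|.\<close>

lemma polyfun_graph_bound:
  fixes Q :: "complex^'n \<Rightarrow> complex"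
  assumes Q: "polyfun Q" "polyfun Q'" "\<And>z p. ((\<lambda>p. Q (z + p *s v)) has_field_derivative Q' (z + p *s v)) (at p)"
    and \<epsilon>: "\<epsilon> > 0"
  shows "\<exists>\<theta> K. \<theta> > 0 \<and> K \<ge> 0 \<and> (\<forall>y u p. norm y \<le> R \<longrightarrow> norm (y + u + p *s v) \<le> R \<longrightarrow> Q y = 0 \<longrightarrow>
    Q (y + u + p *s v) = 0 \<longrightarrow> norm (Q' y) \<ge> \<epsilon> \<longrightarrow> norm p \<le> \<theta> \<longrightarrow> norm p \<le> K * norm u)"
proof -
  let ?R = "R + norm v"
  obtain K1 where K1: "K1 \<ge> 0" "\<And>x y. norm x \<le> ?R \<Longrightarrow> norm y \<le> ?R \<Longrightarrow> norm (Q x - Q y) \<le> K1 * norm (x - y)"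
    using polyfun_lipschitz[OF Q(1), of ?R] by blast
  obtain K2 where K2: "K2 \<ge> 0" "\<And>x y. norm x \<le> ?R \<Longrightarrow> norm y \<le> ?R \<Longrightarrow> norm (Q' x - Q' y) \<le> K2 * norm (x - y)"
    using polyfun_lipschitz[OF Q(2), of ?R] by blast
  let ?k = "K2 * norm v"
  have k: "?k \<ge> 0" using K2 by simp
  \<comment> \<open>\<theta> makes the second order remainder K2 |v| |p|^2 at most \<epsilon> |p| /
    2, which is absorbed on the left; \<theta> <= 1 keeps the points y + s v in the ball of radius R
    + |v|.\<close>
  define \<theta> where "\<theta> = min 1 (\<epsilon> / (2 * (?k + 1)))"
  have \<theta>: "\<theta> > 0" "\<theta> \<le> 1" "?k * \<theta> \<le> \<epsilon> / 2"
  proof -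
    show "\<theta> > 0" "\<theta> \<le> 1" using \<epsilon> k by (auto simp: \<theta>_def)
    have "?k * \<theta> \<le> (?k + 1) * (\<epsilon> / (2 * (?k + 1)))" using \<epsilon> k by (intro mult_mono) (auto simp: \<theta>_def)
    also have "\<dots> = \<epsilon> / 2" using k by (simp add: field_simps)
    finally show "?k * \<theta> \<le> \<epsilon> / 2" .
  qed
  have "norm p \<le> (2 * K1 / \<epsilon>) * norm u"
    if y: "norm y \<le> R" and y': "norm (y + u + p *s v) \<le> R" and z: "Q y = 0" "Q (y + u + p *s v) = 0"
      and e: "norm (Q' y) \<ge> \<epsilon>" and t: "norm p \<le> \<theta>" for y u p
  proof -
    have in_ball: "norm (y + s *s v) \<le> ?R" if "norm s \<le> norm p" for s
    proof -
      have "norm (y + s *s v) \<le> norm y + norm s * norm v" by (metis norm_triangle_ineq norm_smult)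
      also have "\<dots> \<le> R + 1 * norm v" using that t \<theta>(2) y by (intro add_mono mult_right_mono) auto
      finally show ?thesis by simp
    qed
    have yR: "norm y \<le> ?R" using in_ball[of 0] by simp
    have "norm ((Q (y + p *s v) - p * Q' y) - (Q (y + 0 *s v) - 0 * Q' y)) \<le> (?k * norm p) * norm (p - 0)"
    proof (rule field_differentiable_bound[of "cball 0 (norm p)"])
      fix s :: complex assume s: "s \<in> cball 0 (norm p)"
      show "((\<lambda>s. Q (y + s *s v) - s * Q' y) has_field_derivative (Q' (y + s *s v) - Q' y)) (at s within cball 0 (norm p))"
        by (auto intro!: derivative_eq_intros DERIV_subset[OF Q(3)])
      have "norm (Q' (y + s *s v) - Q' y) \<le> K2 * norm ((y + s *s v) - y)"
        using s by (intro K2(2) in_ball yR) simp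
      also have "\<dots> \<le> K2 * (norm p * norm v)" using s K2(1) by (intro mult_left_mono) (auto simp: norm_smult mult_right_mono)
      finally show "norm (Q' (y + s *s v) - Q' y) \<le> ?k * norm p" by (simp add: mult_ac)
    qed auto
    then have d: "norm (Q (y + p *s v) - p * Q' y) \<le> ?k * norm p * norm p" using z(1) by simp
    have "norm (Q (y + u + p *s v) - Q (y + p *s v)) \<le> K1 * norm ((y + u + p *s v) - (y + p *s v))"
      using y' by (intro K1(2) in_ball) (auto simp: add_increasing2)
    then have q: "norm (Q (y + p *s v)) \<le> K1 * norm u" using z(2) by simp
    have "\<epsilon> * norm p \<le> norm (p * Q' y)" 
      using mult_right_mono[OF e norm_ge_zero[of p]] by (simp only: norm_mult mult.commute)
    also have "\<dots> \<le> norm (Q (y + p *s v)) + norm (Q (y + p *s v) - p * Q' y)"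
      using norm_triangle_ineq4[of "Q (y + p *s v)" "Q (y + p *s v) - p * Q' y"] by simp
    also have "\<dots> \<le> K1 * norm u + ?k * norm p * norm p" using d q by simp
    also have "\<dots> \<le> K1 * norm u + \<epsilon> / 2 * norm p"
    proof -
      have "?k * norm p \<le> ?k * \<theta>" using t k by (rule mult_left_mono)
      then have "?k * norm p \<le> \<epsilon> / 2" using \<theta>(3) by linarith
      from mult_right_mono[OF this, of "norm p"] show ?thesis by simp
    qed
    finally show ?thesis using \<epsilon> by (simp add: field_simps)
  qed
  then show ?thesis using \<theta>(1) K1(1) \<epsilon> by (intro exI[of _ \<theta>] exI[of _ "2 * K1 / \<epsilon>"]) auto
qed

lemma complex_line_smult: "c \<noteq> 0 \<Longrightarrow> complex_line (c *s v) = complex_line v"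
proof -
  assume c: "c \<noteq> 0"
  have "x *s v = (x / c) *s (c *s v)" for x using c by (simp add: vector_smult_assoc)
  then have "x *s v \<in> range (\<lambda>x. x *s (c *s v))" for x by (rule range_eqI)
  then show ?thesis unfolding complex_line_def by (auto simp: vector_smult_assoc)
qed

context frame
begin

text \<open>The slice l_i1 = 1 represents lines by vectors. Only the card (- J) - 1 remaining
  coordinates outside \<open>J\<close> need a grid, since those in \<open>J\<close> follow with
  Lipschitz constant \<open>K\<close>; the real box dimension is thus at most twice that
  number.\<close>

lemma graph_piece_null:
  assumes "projective_metric g" and i1: "i1 \<notin> J" and A: "A \<subseteq> {c. l i1 c = 1 \<and> norm c \<le> R}" and K: "K \<ge> 0"
    and graph: "\<And>c c' j. c \<in> A \<Longrightarrow> c' \<in> A \<Longrightarrow> j \<in> J \<Longrightarrow> norm (l j c - l j c') \<le> K * norm (proj J (c - c'))"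
    and s: "s > real (2 * (card (- J) - 1))"
  shows "hausdorff_measure projective_space (riemannian_dist g) s (complex_line ` A) = 0"
proof -
  interpret projective_metric g by fact
  let ?S = "{c. l i1 c = 1 \<and> norm c \<le> R}"
  have Seq: "?S = {c. l i1 c = 1} \<inter> cball 0 R" by auto
  have "compact ?S" unfolding Seq by (intro closed_Int_compact closed_Collect_eq continuous_intros compact_cball)
  moreover have "convex ?S" unfolding Seq
  proof (intro convex_Int convex_cball convexI)
    fix x y and u w :: real assume "x \<in> {c. l i1 c = 1}" "y \<in> {c. l i1 c = 1}" "u + w = 1"
    then show "u *\<^sub>R x + w *\<^sub>R y \<in> {c. l i1 c = 1}" by (simp add: l_simps flip: of_real_add)
  qed
  moreover have S0: "0 \<notin> ?S" by (simp add: l_zero)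
  ultimately obtain Cm where Cm: "Cm \<ge> 0"
    "\<And>a b. a \<in> ?S \<Longrightarrow> b \<in> ?S \<Longrightarrow> riemannian_dist g (complex_line a) (complex_line b) \<le> Cm * norm (a - b)"
    using riemannian_dist_upper_bound[of ?S] by blast
  obtain L where L: "L > 0" "\<And>i z. norm (l i z) \<le> L * norm z" using l_bounded by blast
  obtain M where M: "M > 0" "\<And>z. norm z \<le> M * (\<Sum>i\<in>UNIV. norm (l i z))" using norm_le_coords by blast
  let ?n = "real CARD('n)"
  let ?I = "- J - {i1}"
  have cI: "card ?I = card (- J) - 1" using i1 by simp
  define K0 where "K0 = L * max R 0"
  define m where "m = 2 * card ?I"
  \<comment> \<open>\<open>B\<close> times r bounds every coordinate difference in a cell: 2r
    outside \<open>J\<close>, and \<open>K\<close> times the norm of the projected difference in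
    \<open>J\<close>.\<close>
  define B where "B = 2 + K * (M * (?n * 2))"
  define C where "C = (2 * K0 + 4) ^ m + Cm * (M * (?n * B))"
  have K0: "K0 \<ge> 0" using L by (simp add: K0_def)
  have B: "B \<ge> 2" using K M by (simp add: B_def)
  have C1: "(2 * K0 + 4) ^ m > 0" "(2 * K0 + 4) ^ m \<le> C" and C2: "Cm * (M * (?n * B)) \<le> C"
    using K0 Cm(1) M(1) B by (auto simp: C_def)
  show ?thesis
  proof (rule hausdorff_null_of_box_count[where m=m and C=C])
    show "riemannian_dist g x y \<ge> 0" if xy: "x \<in> complex_line ` A" "y \<in> complex_line ` A" for x y
    proof -
      obtain a c where ac: "a \<in> A" "c \<in> A" "x = complex_line a" "y = complex_line c" using xy by blast
      have "a \<noteq> 0" "c \<noteq> 0" using ac A S0 by blast+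
      then show ?thesis unfolding ac by (rule riemannian_dist_nonneg)
    qed
    have "A \<subseteq> - {0}" using A S0 by blast
    then show "complex_line ` A \<subseteq> projective_space" unfolding projective_space_def by blast
    show "real m < s" using s cI by (simp add: m_def)
    show "C > 0" using C1 by linarith
    fix r :: real assume r: "0 < r" "r \<le> 1"
    have bd: "norm (l i c) \<le> K0" if "c \<in> A" for c i
    proof -
      have "norm (l i c) \<le> L * norm c" by (rule L(2))
      also have "\<dots> \<le> L * max R 0" using that A L(1) by (intro mult_left_mono) auto
      finally show ?thesis by (simp add: K0_def)
    qed
    obtain P where P: "finite P" "real (card P) \<le> ((2 * K0 + 4) / r) ^ (2 * card ?I)" "A = \<Union>P"
      "\<And>S x y i. S \<in> P \<Longrightarrow> x \<in> S \<Longrightarrow> y \<in> S \<Longrightarrow> i \<in> ?I \<Longrightarrow> norm (l i x - l i y) \<le> 2 * r"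
      by (rule grid_partition[where I="?I" and r=r and K=K0 and A=A and \<mu>=l]) (use r K0 bd in \<open>auto\<close>)
    have close: "norm (x - y) \<le> M * (?n * B) * r" if S: "S \<in> P" "x \<in> S" "y \<in> S" for S x y
    proof -
      have A': "x \<in> A" "y \<in> A" using S P(3) by blast+
      have nJ: "norm (l i (x - y)) \<le> 2 * r" if "i \<notin> J" for i
      proof (cases "i = i1")
        case True
        have "l i1 x = 1" "l i1 y = 1" using A' A by blast+
        then show ?thesis using True r by (simp add: l_diff)
      next
        case False
        then show ?thesis using P(4)[OF S, of i] that by (simp add: l_diff)
      qed
      have "norm (proj J (x - y)) \<le> M * (\<Sum>i\<in>UNIV. norm (l i (proj J (x - y))))" by (rule M(2))
      also have "\<dots> \<le> M * (\<Sum>i\<in>(UNIV :: 'n set). 2 * r)"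
        using M(1) r nJ by (intro mult_left_mono sum_mono) (auto simp: l_proj)
      finally have pj: "norm (proj J (x - y)) \<le> M * (?n * 2) * r" by (simp add: mult_ac)
      have "norm (l i (x - y)) \<le> B * r" for i
      proof (cases "i \<in> J")
        case True
        have "norm (l i (x - y)) \<le> K * norm (proj J (x - y))" using graph[OF A' True] by (simp add: l_diff)
        also have "\<dots> \<le> K * (M * (?n * 2) * r)" using pj K by (rule mult_left_mono)
        also have "\<dots> \<le> B * r" using r by (simp add: B_def algebra_simps)
        finally show ?thesis .
      next
        case False
        have "2 * r \<le> B * r" using B r by (intro mult_right_mono) auto
        then show ?thesis using nJ[OF False] by linarith
      qed
      then have "(\<Sum>i\<in>UNIV. norm (l i (x - y))) \<le> (\<Sum>i\<in>(UNIV::'n set). B * r)" by (intro sum_mono)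
      then have "M * (\<Sum>i\<in>UNIV. norm (l i (x - y))) \<le> M * (?n * (B * r))" using M(1) by (intro mult_left_mono) auto
      then show ?thesis using M(2)[of "x - y"] by (simp add: mult_ac)
    qed
    show "\<exists>P. finite P \<and> real (card P) \<le> C / r ^ m \<and> complex_line ` A = \<Union>P \<and>
       (\<forall>S\<in>P. \<forall>x\<in>S. \<forall>y\<in>S. riemannian_dist g x y \<le> C * r)"
    proof (intro exI[of _ "(\<lambda>S. complex_line ` S) ` P"] conjI ballI)
      show "finite ((\<lambda>S. complex_line ` S) ` P)" using P(1) by blast
      have "real (card ((\<lambda>S. complex_line ` S) ` P)) \<le> real (card P)" using card_image_le[OF P(1)] by simp
      also have "\<dots> \<le> (2 * K0 + 4) ^ m / r ^ m" using P(2) by (simp add: m_def power_divide)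
      also have "\<dots> \<le> C / r ^ m" using C1 r by (intro divide_right_mono) auto
      finally show "real (card ((\<lambda>S. complex_line ` S) ` P)) \<le> C / r ^ m" .
      show "complex_line ` A = \<Union> ((\<lambda>S. complex_line ` S) ` P)" unfolding P(3) by (rule image_Union)
      fix S' x' y' assume "S' \<in> (\<lambda>S. complex_line ` S) ` P" "x' \<in> S'" "y' \<in> S'"
      then obtain S x y where S: "S \<in> P" "x \<in> S" "y \<in> S" "x' = complex_line x" "y' = complex_line y" by blast
      have "x \<in> ?S" "y \<in> ?S" using S P(3) A by blast+
      then have "riemannian_dist g x' y' \<le> Cm * norm (x - y)" unfolding S(4,5) by (rule Cm(2))
      also have "\<dots> \<le> Cm * (M * (?n * B) * r)" using close[OF S(1-3)] Cm(1) by (rule mult_left_mono)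
      also have "\<dots> = (Cm * (M * (?n * B))) * r" by (simp add: mult_ac)
      also have "\<dots> \<le> C * r" using C2 r by (intro mult_right_mono) auto
      finally show "riemannian_dist g x' y' \<le> C * r" .
    qed
  qed
qed

text \<open>On the cone each coordinate \<open>l j\<close> with j in \<open>J\<close> is a root of
  \<open>T j\<close>, which is monic along \<open>b j\<close> up to a nonzero factor. At a multiple
  root some iterated derivative along \<open>b j\<close> has a simple zero; fixing its order and a
  lower bound for the next derivative leaves pieces that are Lipschitz graphs over the coordinates
  outside \<open>J\<close>.\<close>

lemma asymptotic_directions_null:
  assumes g: "projective_metric g" and tr: "transversal J X"
    and T: "\<And>j. j \<in> J \<Longrightarrow> polyfun (T j)" "\<And>j c z. j \<in> J \<Longrightarrow> T j (c *s z) = c ^ m j * T j z" "\<And>j. j \<in> J \<Longrightarrow> T j (b j) \<noteq> 0"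
    and cone: "\<And>c j. c \<in> cone_at_infinity X \<Longrightarrow> j \<in> J \<Longrightarrow> T j (proj (J - {j}) c) = 0"
    and s: "s > real (2 * (card (- J) - 1))"
  shows "hausdorff_measure projective_space (riemannian_dist g) s (asymptotic_directions X) = 0"
proof -
  have "\<forall>(P :: complex^'n \<Rightarrow> complex) v. \<exists>P'. polyfun P \<longrightarrow> polyfun P' \<and>
      (\<forall>z p. ((\<lambda>p. P (z + p *s v)) has_field_derivative P' (z + p *s v)) (at p))"
    using polyfun_directional by blast
  then obtain D :: "(complex^'n \<Rightarrow> complex) \<Rightarrow> complex^'n \<Rightarrow> complex^'n \<Rightarrow> complex" where
    D: "\<And>P v. polyfun P \<Longrightarrow> polyfun (D P v)"
      "\<And>P v z p. polyfun P \<Longrightarrow> ((\<lambda>p. P (z + p *s v)) has_field_derivative D P v (z + p *s v)) (at p)"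
    unfolding choice_iff by blast
  define TT where "TT j k = ((\<lambda>P. D P (b j)) ^^ k) (T j)" for j k
  have TT0: "TT j 0 = T j" and TTS: "TT j (Suc k) = D (TT j k) (b j)" for j k by (auto simp: TT_def)
  have TTp: "polyfun (TT j k)" if "j \<in> J" for j k
    by (induction k) (use T(1) that D(1) in \<open>auto simp: TT0 TTS\<close>)
  have TTd: "((\<lambda>p. TT j k (z + p *s b j)) has_field_derivative TT j (Suc k) (z + p *s b j)) (at p)" if "j \<in> J" for j k z p
    unfolding TTS by (rule D(2)[OF TTp[OF that]])
  \<comment> \<open>If all derivatives along \<open>b j\<close> vanished at y, \<open>T j\<close>
    would vanish on the whole line through y in that direction, and by homogeneity and continuity at
    \<open>b j\<close> itself.\<close>
  have level: "\<exists>k. TT j k y = 0 \<and> TT j (Suc k) y \<noteq> 0" if j: "j \<in> J" and y: "T j y = 0" for j y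
  proof -
    have "\<exists>k. TT j k y \<noteq> 0"
    proof (rule ccontr)
      assume "\<not> ?thesis"
      then have z: "TT j k y = 0" for k by blast
      define f where "f p = T j (y + p *s b j)" for p
      have der: "(deriv ^^ k) f = (\<lambda>p. TT j k (y + p *s b j))" for k
      proof (induction k)
        case 0
        then show ?case by (simp add: f_def TT0)
      next
        case (Suc k)
        then show ?case using TTd[OF j, of k y] by (auto intro!: DERIV_imp_deriv)
      qed
      have hol: "f holomorphic_on UNIV"
        using TTd[OF j, of 0 y] unfolding f_def TT0[symmetric] holomorphic_on_def field_differentiable_def by auto
      have "f p = 0" for p
        by (rule holomorphic_fun_eq_0_on_connected[OF hol open_UNIV connected_UNIV, of 0]) (auto simp: der z)
      then have "T j (inverse (of_nat (Suc n)) *s y + b j) = 0" for n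
      proof -
        have "inverse (of_nat (Suc n)) *s y + b j = inverse (of_nat (Suc n)) *s (y + of_nat (Suc n) *s b j)"
          by (simp add: vector_add_ldistrib vector_smult_assoc del: of_nat_Suc)
        then show ?thesis using \<open>f (of_nat (Suc n)) = 0\<close> unfolding f_def by (simp only: T(2)[OF j] mult_zero_right)
      qed
      moreover have "(\<lambda>n. T j (inverse (of_nat (Suc n)) *s y + b j)) \<longlonglongrightarrow> T j (0 *s y + b j)"
      proof -
        have "(\<lambda>n. inverse (of_nat (Suc n)) :: complex) \<longlonglongrightarrow> 0" using LIMSEQ_Suc[OF lim_inverse_n[where 'a=complex]] .
        then have "(\<lambda>n. inverse (of_nat (Suc n)) *s y + b j) \<longlonglongrightarrow> 0 *s y + b j"
          by (intro tendsto_add[OF _ tendsto_const] tendsto_smult tendsto_const)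
        then show ?thesis using polyfun_continuous[OF T(1)[OF j], of UNIV]
          by (intro continuous_on_tendsto_compose[of UNIV "T j"]) auto
      qed
      ultimately have "(\<lambda>n::nat. 0) \<longlonglongrightarrow> T j (b j)" by simp
      then have "T j (b j) = 0" by (simp add: LIMSEQ_const_iff)
      then show False using T(3)[OF j] by blast
    qed
    then obtain k where k: "TT j k y \<noteq> 0" "\<And>i. i < k \<Longrightarrow> TT j i y = 0" using exists_least_iff[of "\<lambda>k. TT j k y \<noteq> 0"] by blast
    then obtain k' where "k = Suc k'" using y TT0 by (cases k) auto
    then show ?thesis using k by blast
  qed
  \<comment> \<open>\<open>\<kappa> j\<close> is the order of the derivative used for the coordinate
    j, and \<open>N\<close> bounds both c and the inverse of the next derivative. Only countably
    many index triples occur.\<close>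
  define A where "A i1 \<kappa> N = {c. l i1 c = 1 \<and> norm c \<le> real N \<and> (\<forall>j\<in>J. TT j (\<kappa> j) (proj (J - {j}) c) = 0 \<and>
      norm (TT j (Suc (\<kappa> j)) (proj (J - {j}) c)) \<ge> 1 / (real N + 1))}" for i1 N and \<kappa> :: "'n \<Rightarrow> nat"
  have null: "hausdorff_measure projective_space (riemannian_dist g) s (complex_line ` A i1 \<kappa> N) = 0" if i1: "i1 \<notin> J" for i1 \<kappa> N
  proof -
    have pb: "\<exists>Cp. \<forall>z. norm (proj (J - {j}) z) \<le> Cp * norm z \<and> Cp > 0" for j using proj_bounded by meson
    then obtain Cp where Cp: "\<And>j z. norm (proj (J - {j}) z) \<le> Cp j * norm z" "\<And>j. Cp j > 0" by metis
    let ?Q = "\<lambda>j \<theta> K. \<theta> > 0 \<and> K \<ge> 0 \<and> (j \<in> J \<longrightarrow> (\<forall>y u p. norm y \<le> Cp j * real N \<longrightarrow> norm (y + u + p *s b j) \<le> Cp j * real N \<longrightarrow>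
        TT j (\<kappa> j) y = 0 \<longrightarrow> TT j (\<kappa> j) (y + u + p *s b j) = 0 \<longrightarrow> norm (TT j (Suc (\<kappa> j)) y) \<ge> 1 / (real N + 1) \<longrightarrow>
        norm p \<le> \<theta> \<longrightarrow> norm p \<le> K * norm u))"
    have ex: "\<exists>\<theta> K. ?Q j \<theta> K" for j
    proof (cases "j \<in> J")
      case True
      have "0 < 1 / (real N + 1)" by (simp add: add_nonneg_pos)
      from polyfun_graph_bound[OF TTp[OF True] TTp[OF True] TTd[OF True] this, of "Cp j * real N"]
      show ?thesis using True by simp
    next
      case False
      then show ?thesis by (intro exI[of _ 1]) auto
    qed
    have "\<exists>\<theta>. \<forall>j. \<exists>K. ?Q j (\<theta> j) K" by (intro choice allI ex)
    then obtain \<theta> where "\<forall>j. \<exists>K. ?Q j (\<theta> j) K" ..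
    then have "\<exists>K. \<forall>j. ?Q j (\<theta> j) (K j)" by (rule choice)
    then obtain K where Q: "\<forall>j. ?Q j (\<theta> j) (K j)" ..
    have \<theta>: "\<And>j. \<theta> j > 0" and K: "\<And>j. K j \<ge> 0" and bound: "\<And>j y u p. j \<in> J \<Longrightarrow> norm y \<le> Cp j * real N \<Longrightarrow>
        norm (y + u + p *s b j) \<le> Cp j * real N \<Longrightarrow> TT j (\<kappa> j) y = 0 \<Longrightarrow> TT j (\<kappa> j) (y + u + p *s b j) = 0 \<Longrightarrow>
        norm (TT j (Suc (\<kappa> j)) y) \<ge> 1 / (real N + 1) \<Longrightarrow> norm p \<le> \<theta> j \<Longrightarrow> norm p \<le> K j * norm u"
      using Q by blast+
    define \<theta>0 where "\<theta>0 = Min (insert 1 (range \<theta>))"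
    define K0 where "K0 = Max (insert 0 (range K))"
    have \<theta>0: "\<theta>0 > 0" "\<theta>0 \<le> 1" using \<theta> by (auto simp: \<theta>0_def)
    have \<theta>0': "\<theta>0 \<le> \<theta> j" for j unfolding \<theta>0_def by (rule Min_le) auto
    have K0: "K0 \<ge> 0" "K j \<le> K0" for j unfolding K0_def by (rule Max_ge; auto)+
    obtain L where L: "L > 0" "\<And>i z. norm (l i z) \<le> L * norm z" using l_bounded by blast
    \<comment> \<open>The graph estimate needs parameter differences up to \<theta>, so the piece is
      cut into cells on which each \<open>l j\<close> varies by at most
      \<open>\<theta>0\<close>.\<close>
    obtain P where P: "finite P" "A i1 \<kappa> N = \<Union>P"
      "\<And>S x y j. S \<in> P \<Longrightarrow> x \<in> S \<Longrightarrow> y \<in> S \<Longrightarrow> j \<in> J \<Longrightarrow> norm (l j x - l j y) \<le> 2 * (\<theta>0 / 2)"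
    proof (rule grid_partition[where I=J and r="\<theta>0 / 2" and K="L * real N" and A="A i1 \<kappa> N" and \<mu>=l])
      show "norm (l i x) \<le> L * real N" if "x \<in> A i1 \<kappa> N" for x i
      proof -
        have "norm (l i x) \<le> L * norm x" by (rule L(2))
        also have "\<dots> \<le> L * real N" using that L(1) by (intro mult_left_mono) (auto simp: A_def)
        finally show ?thesis .
      qed
    qed (use \<theta>0 L in auto)
    have "hausdorff_measure projective_space (riemannian_dist g) s (complex_line ` S) = 0" if S: "S \<in> P" for S
    proof (rule graph_piece_null[OF g i1 _ K0(1) _ s])
      have SA: "S \<subseteq> A i1 \<kappa> N" using S P(2) by blast
      then show "S \<subseteq> {c. l i1 c = 1 \<and> norm c \<le> real N}" by (auto simp: A_def)
      fix c c' j assume c: "c \<in> S" "c' \<in> S" and j: "j \<in> J"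
      let ?y = "proj (J - {j}) c'" and ?u = "proj J (c - c')" and ?t = "l j c - l j c'"
      have eq: "proj (J - {j}) c = ?y + ?u + ?t *s b j"
        by (rule frame_eqI) (use j in \<open>auto simp: l_simps l_proj\<close>)
      have inA: "c \<in> A i1 \<kappa> N" "c' \<in> A i1 \<kappa> N" using c SA by blast+
      have nb: "norm (proj (J - {j}) z) \<le> Cp j * real N" if "z \<in> A i1 \<kappa> N" for z
      proof -
        have "Cp j * norm z \<le> Cp j * real N" using that Cp(2)[of j] by (intro mult_left_mono) (auto simp: A_def)
        then show ?thesis using Cp(1)[of j z] by linarith
      qed
      have "norm ?t \<le> K j * norm ?u"
      proof (rule bound[OF j, of ?y])
        show "norm ?y \<le> Cp j * real N" by (rule nb[OF inA(2)])
        show "norm (?y + ?u + ?t *s b j) \<le> Cp j * real N" unfolding eq[symmetric] by (rule nb[OF inA(1)])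
        show "TT j (\<kappa> j) ?y = 0" "norm (TT j (Suc (\<kappa> j)) ?y) \<ge> 1 / (real N + 1)" using inA(2) j by (auto simp: A_def)
        show "TT j (\<kappa> j) (?y + ?u + ?t *s b j) = 0" unfolding eq[symmetric] using inA(1) j by (auto simp: A_def)
        show "norm ?t \<le> \<theta> j" using P(3)[OF S c j] \<theta>0'[of j] by simp
      qed
      also have "\<dots> \<le> K0 * norm ?u" using K0(2) by (intro mult_right_mono) auto
      finally show "norm ?t \<le> K0 * norm ?u" .
    qed
    then have nullP: "hausdorff_measure projective_space (riemannian_dist g) s B = 0"
      if "B \<in> (\<lambda>S. complex_line ` S) ` P" for B using that by blast
    show ?thesis
    proof (rule hausdorff_null_countable[OF _ nullP])
      show "countable ((\<lambda>S. complex_line ` S) ` P)" using P(1) by (intro countable_finite finite_imageI)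
      show "complex_line ` A i1 \<kappa> N \<subseteq> \<Union> ((\<lambda>S. complex_line ` S) ` P)" unfolding P(2) image_Union ..
    qed
  qed
  let ?F = "(\<lambda>(i1, \<kappa>, N). complex_line ` A i1 \<kappa> N) ` ((- J) \<times> UNIV \<times> UNIV)"
  show ?thesis
  proof (rule hausdorff_null_countable[of ?F])
    show "countable ?F" by (intro countable_image countable_SIGMA countableI_type)
    show "hausdorff_measure projective_space (riemannian_dist g) s B = 0" if "B \<in> ?F" for B using that null by auto
    show "asymptotic_directions X \<subseteq> \<Union>?F"
    proof
      fix x assume "x \<in> asymptotic_directions X"
      then obtain c where c: "c \<in> cone_at_infinity X" "c \<noteq> 0" "x = complex_line c" unfolding asymptotic_directions_def by blast
      then obtain i1 where i1: "i1 \<notin> J" "l i1 c \<noteq> 0" using tr unfolding transversal_def by blast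
      define a where "a = 1 / l i1 c"
      define c' where "c' = a *s c"
      have a: "a \<noteq> 0" using i1 by (simp add: a_def)
      have xc': "x = complex_line c'" unfolding c'_def c(3) by (simp add: complex_line_smult[OF a])
      have zero: "T j (proj (J - {j}) c') = 0" if j: "j \<in> J" for j
      proof -
        have "proj (J - {j}) c' = a *s proj (J - {j}) c" by (rule frame_eqI) (simp add: c'_def l_simps l_proj)
        then show ?thesis using T(2)[OF j] cone[OF c(1) j] by simp
      qed
      have "\<forall>j. \<exists>k. j \<in> J \<longrightarrow> TT j k (proj (J - {j}) c') = 0 \<and> TT j (Suc k) (proj (J - {j}) c') \<noteq> 0"
        using level zero by blast
      then obtain \<kappa> where \<kappa>: "\<And>j. j \<in> J \<Longrightarrow> TT j (\<kappa> j) (proj (J - {j}) c') = 0"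
          "\<And>j. j \<in> J \<Longrightarrow> TT j (Suc (\<kappa> j)) (proj (J - {j}) c') \<noteq> 0" unfolding choice_iff by blast
      let ?h = "\<lambda>j. 1 / norm (TT j (Suc (\<kappa> j)) (proj (J - {j}) c'))"
      obtain N :: nat where N: "real N \<ge> norm c' + (\<Sum>j\<in>J. ?h j)" using real_arch_simple by blast
      have sp: "(\<Sum>j\<in>J. ?h j) \<ge> 0" by (intro sum_nonneg) auto
      have "norm (TT j (Suc (\<kappa> j)) (proj (J - {j}) c')) \<ge> 1 / (real N + 1)" if j: "j \<in> J" for j
      proof -
        have "?h j \<le> (\<Sum>j\<in>J. ?h j)" by (rule member_le_sum[OF j]) auto
        then have "?h j \<le> real N + 1" using N norm_ge_zero[of c'] by linarith
        moreover have "norm (TT j (Suc (\<kappa> j)) (proj (J - {j}) c')) > 0" using \<kappa>(2)[OF j] by simp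
        ultimately show ?thesis by (simp add: field_simps)
      qed
      moreover have "norm c' \<le> real N" using N sp by linarith
      moreover have "l i1 c' = 1" using i1 by (simp add: c'_def a_def l_smult)
      ultimately have "c' \<in> A i1 \<kappa> N" using \<kappa>(1) by (auto simp: A_def)
      then show "x \<in> \<Union>?F" unfolding xc' using i1(1) by force
    qed
  qed
qed

text \<open>\<open>T j\<close> is the top form, of degree m, of the equation of X + L', with L'
  spanned by the \<open>b i\<close> for i in J - {j}. The factorisation of that equation along
  \<open>b j\<close> gives T m (b j) = (-1)^m.\<close>

lemma transversal_directions_null:
  assumes g: "projective_metric g" and pure: "closed_pure_analytic_set d X" and X: "locally_analytic X" "transversal J X"
    and dJ: "card (- J) = d" and s: "s > real (2 * (d - 1))"
  shows "hausdorff_measure projective_space (riemannian_dist g) s (asymptotic_directions X) = 0"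
proof -
  have "\<exists>T m. polyfun T \<and> (\<forall>c z. T (c *s z) = c ^ m * T z) \<and> T (b j) \<noteq> 0 \<and>
      (\<forall>c\<in>cone_at_infinity X. T (proj (J - {j}) c) = 0)" if j: "j \<in> J" for j
  proof -
    let ?Y = "cyl (J - {j}) X"
    have an: "locally_analytic ?Y" by (rule cyl_locally_analytic[OF X]) blast
    have gr: "fiber_growth ?Y (b j)" by (rule cyl_fiber_growth[OF X(2)]) (use j in auto)
    have th: "thick ?Y (b j)" by (rule cyl_thick[OF pure X dJ j])
    have sub: "X \<subseteq> ?Y" by (auto simp: cyl_def)
    have "X \<noteq> {}" using pure unfolding closed_pure_analytic_set_def by blast
    then have ne: "?Y \<noteq> {}" using sub by blast
    obtain P m K z1 where P: "polyfun P" "?Y = {z. P z = 0}" "K \<ge> 0" "\<And>z. norm (P z) \<le> K * (1 + norm z) ^ m"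
      "\<And>y. P (z1 + y *s b j) = (\<Prod>t\<in>fiber ?Y (b j) z1. t - y)" "card (fiber ?Y (b j) z1) = m"
      by (rule hypersurface_polynomial[OF an gr th ne]) (rule that; assumption)
    obtain T where T: "\<And>k. polyfun (T k)" "\<And>k c z. T k (c *s z) = c ^ k * T k z" "\<And>z. P z = (\<Sum>k\<le>m. T k z)"
      using polyfun_homogeneous_growth[OF P(1,4,3)] by blast
    have "T m (b j) \<noteq> 0"
    proof -
      let ?F = "fiber ?Y (b j) z1"
      have inf: "filterlim (\<lambda>n. of_nat n :: complex) at_infinity sequentially" by (rule tendsto_of_nat)
      have inv: "(\<lambda>n. inverse (of_nat n) :: complex) \<longlonglongrightarrow> 0" by (rule lim_inverse_n)
      have "(\<lambda>n. inverse (of_nat n) *s z1) \<longlonglongrightarrow> 0 *s z1" by (rule tendsto_smult[OF inv tendsto_const])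
      then have lim: "(\<lambda>n. inverse (of_nat n) *s z1 + b j) \<longlonglongrightarrow> 0 *s z1 + b j" by (rule tendsto_add[OF _ tendsto_const])
      have "eventually (\<lambda>n. inverse (of_nat n) *s z1 + b j = inverse (of_nat n) *s (z1 + of_nat n *s b j)) sequentially"
        using eventually_gt_at_top[of 0] by eventually_elim (simp add: vector_add_ldistrib vector_smult_assoc)
      then have "(\<lambda>n. inverse (of_nat n) *s (z1 + of_nat n *s b j)) \<longlonglongrightarrow> b j"
        using Lim_transform_eventually[OF lim] by simp
      from top_form_limit[OF T inf this]
      have l1: "(\<lambda>n. P (z1 + of_nat n *s b j) / of_nat n ^ m) \<longlonglongrightarrow> T m (b j)" .
      have "(\<lambda>n. \<Prod>t\<in>?F. t * inverse (of_nat n) - 1) \<longlonglongrightarrow> (\<Prod>t\<in>?F. t * 0 - 1)"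
        by (intro tendsto_prod tendsto_diff tendsto_mult tendsto_const inv)
      moreover have "eventually (\<lambda>n. (\<Prod>t\<in>?F. t * inverse (of_nat n) - 1) = P (z1 + of_nat n *s b j) / of_nat n ^ m) sequentially"
        using eventually_gt_at_top[of 0]
      proof eventually_elim
        case (elim n)
        have "P (z1 + of_nat n *s b j) / of_nat n ^ m = (\<Prod>t\<in>?F. (t - of_nat n) / of_nat n)"
          unfolding P(5) prod_dividef by (simp add: P(6))
        also have "\<dots> = (\<Prod>t\<in>?F. t * inverse (of_nat n) - 1)"
          using elim by (intro prod.cong) (auto simp: field_simps)
        finally show ?case ..
      qed
      ultimately have "(\<lambda>n. P (z1 + of_nat n *s b j) / of_nat n ^ m) \<longlonglongrightarrow> (\<Prod>t\<in>?F. t * 0 - 1)"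
        by (rule Lim_transform_eventually)
      then have "T m (b j) = (\<Prod>t\<in>?F. - 1)" using LIMSEQ_unique[OF l1] by simp
      then show ?thesis by simp
    qed
    moreover have "T m (proj (J - {j}) c) = 0" if c: "c \<in> cone_at_infinity X" for c
    proof -
      \<comment> \<open>The correction \<open>proj (J - {j}) c - c\<close> lies in L', along which
        the hypersurface is invariant.\<close>
      have "T m (c + (proj (J - {j}) c - c)) = 0"
      proof (rule top_form_cone[OF T c])
        fix x t assume x: "x \<in> X"
        have "x + of_real t *s (proj (J - {j}) c - c) \<in> ?Y"
          unfolding cyl_def using x by (auto intro!: bexI[of _ x] simp: l_simps l_proj)
        then show "P (x + of_real t *s (proj (J - {j}) c - c)) = 0" using P(2) by blast
      qed
      then show ?thesis by simp
    qed
    ultimately show ?thesis using T(1,2) by blast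
  qed
  then have "\<forall>j. \<exists>T m. j \<in> J \<longrightarrow> polyfun T \<and> (\<forall>c z. T (c *s z) = c ^ m * T z) \<and> T (b j) \<noteq> 0 \<and>
      (\<forall>c\<in>cone_at_infinity X. T (proj (J - {j}) c) = 0)" by blast
  then obtain T m where "\<And>j. j \<in> J \<Longrightarrow> polyfun (T j) \<and> (\<forall>c z. T j (c *s z) = c ^ m j * T j z) \<and> T j (b j) \<noteq> 0 \<and>
      (\<forall>c\<in>cone_at_infinity X. T j (proj (J - {j}) c) = 0)" unfolding choice_iff by blast
  then show ?thesis using s dJ
    by (intro asymptotic_directions_null[OF g X(2), where T=T and m=m]) auto
qed

end

section \<open>Directions avoided by a small asymptotic cone\<close>

lemma card_complement: "card (- J) = CARD('n) - card (J :: 'n::finite set)"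
  by (simp add: Compl_eq_Diff_UNIV card_Diff_subset)

context frame
begin

text \<open>A slab around the complex line spanned by q modulo L. A grid of mesh r in the
  coordinates \<open>J\<close> and i1 determines the others up to a multiple of r. It has about
  r^(-2(card J + 1)) cells, each in a ball of volume about r^(2n), and the exponents add up to
  2(card (- J) - 1).\<close>

lemma slab_cover:
  assumes K: "K \<ge> 0"
  shows "\<exists>C>0. \<forall>i1 q r. i1 \<notin> J \<longrightarrow> (\<forall>i. norm (q i) \<le> 1) \<longrightarrow> 0 < r \<longrightarrow> r \<le> 1 \<longrightarrow>
    (\<exists>V\<in>sets lborel. {w. (\<forall>i. norm (l i w) \<le> 1) \<and> (\<forall>i. i \<notin> J \<longrightarrow> norm (l i w - q i * l i1 w) \<le> K * r)} \<subseteq> V \<and>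
      emeasure lborel V \<le> ennreal (C * r ^ (2 * (card (- J) - 1))))"
proof -
  obtain M where M: "M > 0" "\<And>z. norm z \<le> M * (\<Sum>i\<in>UNIV. norm (l i z))" using norm_le_coords by blast
  let ?n = "CARD('n)"
  define B where "B = 2 + 2 * K"
  define \<rho> where "\<rho> = M * (real ?n * B)"
  have B: "B \<ge> 2" using K by (simp add: B_def)
  have \<rho>: "\<rho> > 0" using M B by (simp add: \<rho>_def)
  let ?v = "unit_ball_vol (real DIM(complex^'n))"
  have v: "?v > 0" by (rule unit_ball_vol_pos) simp
  \<comment> \<open>6 is the constant 2K + 4 of \<open>grid_partition\<close> for coordinates
    bounded by K = 1.\<close>
  define C where "C = 6 ^ (2 * Suc (card J)) * (?v * \<rho> ^ (2 * ?n))"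
  have C: "C > 0" using v \<rho> by (simp add: C_def)
  have "\<exists>V\<in>sets lborel. {w. (\<forall>i. norm (l i w) \<le> 1) \<and> (\<forall>i. i \<notin> J \<longrightarrow> norm (l i w - q i * l i1 w) \<le> K * r)} \<subseteq> V \<and>
      emeasure lborel V \<le> ennreal (C * r ^ (2 * (card (- J) - 1)))"
    if i1: "i1 \<notin> J" and q: "\<And>i. norm (q i) \<le> 1" and r: "0 < r" "r \<le> 1" for i1 q r
  proof -
    let ?A = "{w. (\<forall>i. norm (l i w) \<le> 1) \<and> (\<forall>i. i \<notin> J \<longrightarrow> norm (l i w - q i * l i1 w) \<le> K * r)}"
    have cI: "card (insert i1 J) = Suc (card J)" using i1 by simp
    obtain P where P: "finite P" "real (card P) \<le> ((2 * 1 + 4) / r) ^ (2 * card (insert i1 J))" "?A = \<Union>P"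
      "\<And>S x y i. S \<in> P \<Longrightarrow> x \<in> S \<Longrightarrow> y \<in> S \<Longrightarrow> i \<in> insert i1 J \<Longrightarrow> norm (l i x - l i y) \<le> 2 * r"
      by (rule grid_partition[where I="insert i1 J" and r=r and K=1 and A="?A" and \<mu>=l]) (use r in auto)
    have close: "norm (x - y) \<le> \<rho> * r" if S: "S \<in> P" "x \<in> S" "y \<in> S" for S x y
    proof -
      have A': "x \<in> ?A" "y \<in> ?A" using S P(3) by blast+
      have d1: "norm (l i1 x - l i1 y) \<le> 2 * r" using P(4)[OF S, of i1] by simp
      have "norm (l i (x - y)) \<le> B * r" for i
      proof (cases "i \<in> J")
        case True
        have "2 * r \<le> B * r" using B r by (intro mult_right_mono) auto
        then show ?thesis using P(4)[OF S, of i] True by (simp add: l_diff)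
      next
        case False
        have a: "norm (l i x - q i * l i1 x) \<le> K * r" "norm (l i y - q i * l i1 y) \<le> K * r" using A' False by auto
        have "norm (q i * (l i1 x - l i1 y)) \<le> 1 * (2 * r)" unfolding norm_mult using q[of i] d1 by (intro mult_mono) auto
        then have "norm ((l i x - q i * l i1 x) - (l i y - q i * l i1 y) + q i * (l i1 x - l i1 y)) \<le> (K * r + K * r) + 1 * (2 * r)"
          by (rule norm_triangle_mono[OF order_trans[OF norm_triangle_ineq4 add_mono[OF a]]])
        moreover have "l i (x - y) = (l i x - q i * l i1 x) - (l i y - q i * l i1 y) + q i * (l i1 x - l i1 y)"
          by (simp add: l_diff algebra_simps)
        ultimately have "norm (l i (x - y)) \<le> K * r + K * r + 2 * r" by (simp only: mult_1)
        then show ?thesis by (simp add: B_def algebra_simps)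
      qed
      then have "(\<Sum>i\<in>UNIV. norm (l i (x - y))) \<le> (\<Sum>i\<in>(UNIV::'n set). B * r)" by (intro sum_mono)
      then have "M * (\<Sum>i\<in>UNIV. norm (l i (x - y))) \<le> M * (real ?n * (B * r))" using M(1) by (intro mult_left_mono) auto
      then show ?thesis using M(2)[of "x - y"] by (simp add: \<rho>_def mult_ac)
    qed
    define ctr where "ctr S = (SOME x. x \<in> S)" for S :: "(complex^'n) set"
    let ?V = "\<Union>S\<in>P. cball (ctr S) (\<rho> * r)"
    have "?A \<subseteq> ?V"
    proof
      fix w assume "w \<in> ?A"
      then obtain S where S: "S \<in> P" "w \<in> S" using P(3) by blast
      then have "ctr S \<in> S" unfolding ctr_def by (metis someI)
      then have "w \<in> cball (ctr S) (\<rho> * r)" using close[OF S(1) _ S(2)] by (simp add: dist_norm)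
      then show "w \<in> ?V" using S(1) by blast
    qed
    moreover have "emeasure lborel ?V \<le> ennreal (C * r ^ (2 * (card (- J) - 1)))"
    proof -
      have rr: "\<rho> * r \<ge> 0" using \<rho> r by simp
      have "emeasure lborel ?V \<le> (\<Sum>S\<in>P. emeasure lborel (cball (ctr S) (\<rho> * r)))"
        by (rule emeasure_subadditive_finite) (use P(1) in auto)
      also have "\<dots> = (\<Sum>S\<in>P. ennreal (?v * (\<rho> * r) ^ DIM(complex^'n)))" using rr by (simp add: emeasure_cball)
      also have "\<dots> = ennreal (real (card P) * (?v * (\<rho> * r) ^ DIM(complex^'n)))"
        using v rr by (simp add: ennreal_mult ennreal_of_nat_eq_real_of_nat)
      also have "\<dots> \<le> ennreal ((6 / r) ^ (2 * Suc (card J)) * (?v * (\<rho> * r) ^ DIM(complex^'n)))"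
        using P(2) v rr cI by (intro ennreal_leI mult_right_mono) auto
      also have "(6 / r) ^ (2 * Suc (card J)) * (?v * (\<rho> * r) ^ DIM(complex^'n)) = C * r ^ (2 * (card (- J) - 1))"
      proof -
        have "card (- J) = ?n - card J" by (rule card_complement)
        moreover have "card J < ?n" using i1 by (metis UNIV_I finite psubset_card_mono subset_UNIV psubsetI)
        ultimately have "2 * ?n = 2 * Suc (card J) + 2 * (card (- J) - 1)" by simp
        then have "r ^ (2 * ?n) = r ^ (2 * Suc (card J)) * r ^ (2 * (card (- J) - 1))" by (simp only: power_add)
        moreover have "DIM(complex^'n) = 2 * ?n" by simp
        ultimately show ?thesis using r(1) unfolding C_def
          by (simp only: power_divide power_mult_distrib) (simp add: field_simps del: power_Suc mult_Suc_right)
      qed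
      finally show ?thesis .
    qed
    moreover have "?V \<in> sets lborel" using P(1) by (intro sets.finite_UN) auto
    ultimately show ?thesis by blast
  qed
  then show ?thesis using C by blast
qed

text \<open>The estimate of \<open>transversal_bound\<close> passes to the limits of x/t, where its
  additive constant disappears.\<close>

lemma cone_bound:
  assumes tr: "transversal J X"
  shows "\<exists>K>0. \<forall>c\<in>cone_at_infinity X. \<forall>B\<ge>0. (\<forall>i. i \<notin> J \<longrightarrow> norm (l i c) \<le> B) \<longrightarrow> norm c \<le> K * B"
proof -
  obtain K where K: "K \<ge> 0" "\<And>x. x \<in> X \<Longrightarrow> norm x \<le> K * (1 + norm (proj J x))" using transversal_bound[OF tr] by blast
  obtain M where M: "M > 0" "\<And>z. norm z \<le> M * (\<Sum>i\<in>UNIV. norm (l i z))" using norm_le_coords by blast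
  have le: "norm c \<le> K * norm (proj J c)" if c: "c \<in> cone_at_infinity X" for c
  proof -
    obtain x and t :: "nat \<Rightarrow> real" where xt: "\<And>k. x k \<in> X" "\<And>k. t k > 0" "filterlim t at_top sequentially"
      "(\<lambda>k. x k /\<^sub>R t k) \<longlonglongrightarrow> c" using c unfolding cone_at_infinity_def by blast
    have "norm (x k /\<^sub>R t k) \<le> K * (inverse (t k) + norm (proj J (x k /\<^sub>R t k)))" for k
    proof -
      have "proj J (x k /\<^sub>R t k) = proj J (x k) /\<^sub>R t k" by (rule frame_eqI) (simp add: l_proj l_scaleR)
      then have "inverse (t k) + norm (proj J (x k /\<^sub>R t k)) = inverse (t k) * (1 + norm (proj J (x k)))"
        using xt(2)[of k] by (simp add: algebra_simps)
      moreover have "inverse (t k) * norm (x k) \<le> inverse (t k) * (K * (1 + norm (proj J (x k))))"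
        using xt(2)[of k] K(2)[OF xt(1)] by (intro mult_left_mono) auto
      ultimately show ?thesis using xt(2)[of k] by (simp add: mult_ac)
    qed
    moreover have "(\<lambda>k. K * (inverse (t k) + norm (proj J (x k /\<^sub>R t k)))) \<longlonglongrightarrow> K * (0 + norm (proj J c))"
      by (intro tendsto_intros xt(4) tendsto_inverse_0_at_top xt(3))
    moreover have "(\<lambda>k. norm (x k /\<^sub>R t k)) \<longlonglongrightarrow> norm c" by (intro tendsto_intros xt(4))
    ultimately show ?thesis using LIMSEQ_le by fastforce
  qed
  have "norm c \<le> (1 + K * (M * real CARD('n))) * B" if c: "c \<in> cone_at_infinity X" and B: "B \<ge> 0" "\<And>i. i \<notin> J \<Longrightarrow> norm (l i c) \<le> B" for c B
  proof -
    have "norm (proj J c) \<le> M * (\<Sum>i\<in>UNIV. norm (l i (proj J c)))" by (rule M(2))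
    also have "\<dots> \<le> M * (\<Sum>i\<in>(UNIV :: 'n set). B)" using M(1) B by (intro mult_left_mono sum_mono) (auto simp: l_proj)
    finally have "K * norm (proj J c) \<le> K * (M * (real CARD('n) * B))" using K(1) by (intro mult_left_mono) auto
    then show ?thesis using le[OF c] B(1) by (simp add: algebra_simps)
  qed
  moreover have "1 + K * (M * real CARD('n)) > 0" using K(1) M(1) by (simp add: add_pos_nonneg)
  ultimately show ?thesis by blast
qed

text \<open>Cone vectors with direction in U lie near multiples of one of them, so the vectors of
  the unit polydisc projecting to multiples of their projections lie in a slab as thick as the
  diameter of U, up to a constant. Its volume is of order diam^(2(k-1)) <= diam^s with k = card (-
  J). The summand \<eta> pays for sets of diameter 0, whose slab still needs positive
  thickness.\<close>

lemma direction_patch_cover: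
  assumes g: "projective_metric g" and tr: "transversal J X" and s: "0 < s" "s \<le> real (2 * (card (- J) - 1))"
  shows "\<exists>C>0. \<forall>U \<eta>. 0 < \<eta> \<longrightarrow> \<eta> \<le> 1 \<longrightarrow> U \<inter> asymptotic_directions X \<noteq> {} \<longrightarrow> U \<subseteq> projective_space \<longrightarrow>
    (\<forall>x\<in>U. \<forall>y\<in>U. riemannian_dist g x y \<le> 1) \<longrightarrow>
    (\<exists>V\<in>sets lborel. emeasure lborel V \<le> ennreal C * (diam_power (riemannian_dist g) s U + ennreal \<eta>) \<and>
      (\<forall>w a c. (\<forall>i. norm (l i w) \<le> 1) \<longrightarrow> c \<in> cone_at_infinity X \<longrightarrow>
        proj J w = 0 \<or> c \<noteq> 0 \<and> complex_line c \<in> U \<and> proj J w = a *s proj J c \<longrightarrow> w \<in> V))"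
proof -
  interpret projective_metric g by fact
  obtain C where C: "C \<ge> 0" "\<And>a b. a \<noteq> 0 \<Longrightarrow> b \<noteq> 0 \<Longrightarrow>
     \<exists>\<mu>. norm (b - \<mu> *s a) \<le> C * norm b * riemannian_dist g (complex_line a) (complex_line b)"
    using riemannian_dist_lower_bound by blast
  obtain L where L: "L > 0" "\<And>i z. norm (l i z) \<le> L * norm z" using l_bounded by blast
  obtain K2 where K2: "K2 > 0" "\<And>c B. c \<in> cone_at_infinity X \<Longrightarrow> B \<ge> 0 \<Longrightarrow> (\<And>i. i \<notin> J \<Longrightarrow> norm (l i c) \<le> B) \<Longrightarrow> norm c \<le> K2 * B"
    using cone_bound[OF tr] by blast
  \<comment> \<open>The losses in the estimate to come: 2L for two coordinates of the error vector,
    \<open>C\<close> for norm against distance, \<open>K2\<close> for the size of a c.\<close>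
  define K where "K = 2 * L * C * K2"
  have K: "K \<ge> 0" using L C K2 by (simp add: K_def)
  let ?k = "2 * (card (- J) - 1)"
  obtain Cs where Cs: "Cs > 0" "\<And>i1 q r. i1 \<notin> J \<Longrightarrow> (\<And>i. norm (q i) \<le> 1) \<Longrightarrow> 0 < r \<Longrightarrow> r \<le> 1 \<Longrightarrow>
    (\<exists>V\<in>sets lborel. {w. (\<forall>i. norm (l i w) \<le> 1) \<and> (\<forall>i. i \<notin> J \<longrightarrow> norm (l i w - q i * l i1 w) \<le> K * r)} \<subseteq> V \<and>
      emeasure lborel V \<le> ennreal (Cs * r ^ ?k))"
    using slab_cover[OF K, of J] by blast
  have piece: "\<exists>V\<in>sets lborel. emeasure lborel V \<le> ennreal Cs * (diam_power (riemannian_dist g) s U + ennreal \<eta>) \<and>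
      (\<forall>w a c. (\<forall>i. norm (l i w) \<le> 1) \<longrightarrow> c \<in> cone_at_infinity X \<longrightarrow>
        proj J w = 0 \<or> c \<noteq> 0 \<and> complex_line c \<in> U \<and> proj J w = a *s proj J c \<longrightarrow> w \<in> V)"
    if \<eta>: "0 < \<eta>" "\<eta> \<le> 1" and U: "U \<inter> asymptotic_directions X \<noteq> {}" "U \<subseteq> projective_space"
      "\<And>x y. x \<in> U \<Longrightarrow> y \<in> U \<Longrightarrow> riemannian_dist g x y \<le> 1" for U \<eta>
  proof -
    obtain v where v: "v \<in> cone_at_infinity X" "v \<noteq> 0" "complex_line v \<in> U"
      using U(1) unfolding asymptotic_directions_def by blast
    define R where "R = (SUP (x, y)\<in>U \<times> U. riemannian_dist g x y)"
    have bdd: "bdd_above ((\<lambda>(x, y). riemannian_dist g x y) ` (U \<times> U))" by (rule bdd_aboveI[of _ 1]) (use U(3) in auto)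
    have Rge: "riemannian_dist g x y \<le> R" if "x \<in> U" "y \<in> U" for x y
      unfolding R_def using cSUP_upper[OF _ bdd, of "(x, y)"] that by simp
    have R0: "R \<ge> 0" using Rge[OF v(3) v(3)] riemannian_dist_nonneg[OF v(2,2)] by linarith
    have R1: "R \<le> 1" unfolding R_def by (rule cSUP_least) (use U(3) v(3) in auto)
    have dp: "diam_power (riemannian_dist g) s U = ennreal (R powr s)"
      using v(3) s(1) unfolding diam_power_def R_def by auto
    define r where "r = (if R > 0 then R else \<eta>)"
    have r: "0 < r" "r \<le> 1" "R \<le> r" using \<eta> R0 R1 by (auto simp: r_def)
    have kpos: "?k \<ge> 1" using s by (cases "?k") auto
    have rk: "r ^ ?k \<le> R powr s + \<eta>"
    proof (cases "R > 0")
      case True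
      have "R ^ ?k = R powr real ?k" by (rule powr_realpow[OF True, symmetric])
      also have "\<dots> \<le> R powr s" using True R1 s(2) by (intro powr_mono') auto
      finally show ?thesis using True \<eta> by (simp add: r_def)
    next
      case False
      have "\<eta> ^ ?k \<le> \<eta> ^ 1" using kpos \<eta> by (intro power_decreasing) auto
      then show ?thesis using False by (simp add: r_def add_increasing)
    qed
    have Jne: "- J \<noteq> {}" using s by (metis card.empty diff_0_eq_0 mult_0_right not_less of_nat_0)
    have "finite ((\<lambda>i. norm (l i v)) ` (- J))" by simp
    then have "Max ((\<lambda>i. norm (l i v)) ` (- J)) \<in> (\<lambda>i. norm (l i v)) ` (- J)" using Jne by (intro Max_in) auto
    \<comment> \<open>The largest coordinate of v outside \<open>J\<close> makes the slopes q at
      most 1 in modulus; it is nonzero because \<open>cone_bound\<close> controls v by it.\<close>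
    then obtain i1 where i1: "i1 \<notin> J" "Max ((\<lambda>i. norm (l i v)) ` (- J)) = norm (l i1 v)" by auto
    have mx: "norm (l i v) \<le> norm (l i1 v)" if "i \<notin> J" for i unfolding i1(2)[symmetric] using that by (intro Max_ge) auto
    have "norm v \<le> K2 * norm (l i1 v)" by (rule K2(2)[OF v(1)]) (use mx in auto)
    then have lv: "l i1 v \<noteq> 0" using v(2) by auto
    define q where "q i = (if i \<in> J then 0 else l i v / l i1 v)" for i
    have q: "norm (q i) \<le> 1" for i using mx[of i] lv by (auto simp: q_def norm_divide)
    from Cs(2)[where q=q, OF i1(1) q r(1,2)] obtain V where V: "V \<in> sets lborel"
      "{w. (\<forall>i. norm (l i w) \<le> 1) \<and> (\<forall>i. i \<notin> J \<longrightarrow> norm (l i w - q i * l i1 w) \<le> K * r)} \<subseteq> V"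
      "emeasure lborel V \<le> ennreal (Cs * r ^ ?k)" by (elim bexE conjE)
    have "emeasure lborel V \<le> ennreal Cs * (diam_power (riemannian_dist g) s U + ennreal \<eta>)"
    proof -
      have "ennreal (Cs * r ^ ?k) \<le> ennreal (Cs * (R powr s + \<eta>))" using rk Cs(1) by (intro ennreal_leI mult_left_mono) auto
      also have "\<dots> = ennreal Cs * (diam_power (riemannian_dist g) s U + ennreal \<eta>)"
        unfolding dp using Cs(1) \<eta> by (simp add: ennreal_mult ennreal_plus)
      finally show ?thesis using V(3) by (rule order_trans[rotated])
    qed
    moreover have "w \<in> V" if w: "\<forall>i. norm (l i w) \<le> 1" and c: "c \<in> cone_at_infinity X"
      and pw: "proj J w = 0 \<or> c \<noteq> 0 \<and> complex_line c \<in> U \<and> proj J w = a *s proj J c" for w a c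
    proof -
      have "norm (l i w - q i * l i1 w) \<le> K * r" if i: "i \<notin> J" for i
        using pw
      proof
        assume "proj J w = 0"
        then have "l k w = 0" if "k \<notin> J" for k using l_proj[of k J w] that by (simp add: l_zero)
        then show ?thesis using i i1(1) K r by simp
      next
        assume pw: "c \<noteq> 0 \<and> complex_line c \<in> U \<and> proj J w = a *s proj J c"
        have lw: "l k w = a * l k c" if "k \<notin> J" for k
          using l_proj[of k J w] pw that by (simp add: l_smult l_proj)
        obtain \<mu> where \<mu>: "norm (c - \<mu> *s v) \<le> C * norm c * riemannian_dist g (complex_line v) (complex_line c)"
          using C(2)[of v c] v(2) pw by blast
        define e where "e = c - \<mu> *s v"
        have "C * norm c * riemannian_dist g (complex_line v) (complex_line c) \<le> C * norm c * r"
          using Rge[OF v(3), of "complex_line c"] pw r(3) C(1) by (intro mult_left_mono) auto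
        then have e: "norm e \<le> C * norm c * r" using \<mu> by (simp add: e_def)
        have le: "l k c = l k e + \<mu> * l k v" for k by (simp add: e_def l_simps)
        have "q i * l i1 v = l i v" using i lv by (simp add: q_def)
        then have "l i w - q i * l i1 w = a * (l i e - q i * l i1 e)"
          unfolding lw[OF i] lw[OF i1(1)] le by (simp add: algebra_simps)
        moreover have "norm (l i e - q i * l i1 e) \<le> 2 * L * norm e"
        proof -
          have "norm (q i * l i1 e) \<le> 1 * (L * norm e)" unfolding norm_mult using q L by (intro mult_mono) auto
          then show ?thesis using norm_triangle_ineq4[of "l i e" "q i * l i1 e"] L(2)[of i e] by simp
        qed
        ultimately have n1: "norm (l i w - q i * l i1 w) \<le> norm a * (2 * L * norm e)"
          by (simp add: norm_mult mult_left_mono)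
        \<comment> \<open>The coordinates of a c outside \<open>J\<close> are those of w, at most 1.
          The cone bound is applied to c with B = 1/|a|, as a c itself is not known to lie in the
          cone for complex a.\<close>
        have n2: "norm a * norm c \<le> K2"
        proof (cases "a = 0")
          case False
          have "norm c \<le> K2 * (1 / norm a)"
          proof (rule K2(2)[OF c])
            fix k assume "k \<notin> J"
            then have "norm a * norm (l k c) \<le> 1" using w lw[of k] by (metis norm_mult)
            then show "norm (l k c) \<le> 1 / norm a" using False by (simp add: field_simps)
          qed simp
          then show ?thesis using False by (simp add: field_simps)
        qed (use K2 in simp)
        have "norm a * (2 * L * norm e) \<le> norm a * (2 * L * (C * norm c * r))"
          using e L by (intro mult_left_mono) auto
        also have "\<dots> = (2 * L * C * r) * (norm a * norm c)" by simp
        also have "\<dots> \<le> (2 * L * C * r) * K2" using n2 L C r by (intro mult_left_mono) auto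
        also have "\<dots> = K * r" by (simp add: K_def)
        finally show ?thesis using n1 by linarith
      qed
      then show ?thesis using V(2) w by blast
    qed
    ultimately show ?thesis using V(1) by blast
  qed
  show ?thesis by (intro exI[of _ Cs] conjI allI impI Cs(1)) (rule piece; blast)
qed

text \<open>If every direction modulo L came from the cone, a fine cover of the directions would
  yield slabs covering a fixed ball with total volume below that of the ball.\<close>

lemma null_directions_avoid:
  assumes g: "projective_metric g" and tr: "transversal J X" and s: "0 \<le> s" "s \<le> 2 * (real (card (- J)) - 1)"
    and null: "hausdorff_measure projective_space (riemannian_dist g) s (asymptotic_directions X) = 0"
  shows "\<exists>w. proj J w \<noteq> 0 \<and> (\<forall>c\<in>cone_at_infinity X. \<forall>a. proj J w \<noteq> a *s proj J c)"
proof (rule ccontr)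
  assume neg: "\<not> ?thesis"
  let ?\<Sigma> = "asymptotic_directions X"
  have "0 \<le> 2 * (real (card (- J)) - 1)" using s by (rule order_trans)
  then have card: "card (- J) \<ge> 1" by simp
  then obtain i0 where i0: "i0 \<notin> J" by (metis ComplD card.empty ex_in_conv not_one_le_zero)
  have "l i0 (proj J (b i0)) \<noteq> 0" using i0 by (simp add: l_proj l_b)
  then have pb: "proj J (b i0) \<noteq> 0" by (metis l_zero)
  have repr: "\<exists>c\<in>cone_at_infinity X. c \<noteq> 0 \<and> (\<exists>a. proj J w = a *s proj J c)" if w: "proj J w \<noteq> 0" for w
  proof -
    obtain c a where ca: "c \<in> cone_at_infinity X" "proj J w = a *s proj J c" using neg w by blast
    have "proj J 0 = 0" by (rule frame_eqI) (simp add: l_proj l_zero)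
    then have "c \<noteq> 0" using ca(2) w by auto
    then show ?thesis using ca by blast
  qed
  from repr[OF pb] obtain c0 where c0: "c0 \<in> cone_at_infinity X" "c0 \<noteq> 0" by blast
  then have x0: "complex_line c0 \<in> ?\<Sigma>" unfolding asymptotic_directions_def by blast
  show False
  proof (cases "s = 0")
    \<comment> \<open>For exponent 0 no volume estimate is available, but a nonempty set in the
      cover already costs 1.\<close>
    case True
    obtain U :: "nat \<Rightarrow> (complex^'n) set set" where U: "?\<Sigma> \<subseteq> (\<Union>i. U i)"
        "suminf (\<lambda>i. diam_power (riemannian_dist g) s (U i)) < ennreal 1"
      using hausdorff_nullD[OF null, of 1 1] by (metis zero_less_one)
    obtain i where "complex_line c0 \<in> U i" using U(1) x0 by blast
    then have "diam_power (riemannian_dist g) s (U i) = 1" using True by (auto simp: diam_power_def)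
    moreover have "diam_power (riemannian_dist g) s (U i) < ennreal 1" by (rule ennreal_suminf_lessD[OF U(2)])
    ultimately show False by simp
  next
    case False
    then have s': "0 < s" "s \<le> real (2 * (card (- J) - 1))" using s card by (auto simp: of_nat_diff)
    obtain C where C: "C > 0" and patch: "\<And>U \<eta>. 0 < \<eta> \<Longrightarrow> \<eta> \<le> 1 \<Longrightarrow> U \<inter> ?\<Sigma> \<noteq> {} \<Longrightarrow> U \<subseteq> projective_space \<Longrightarrow>
      (\<forall>x\<in>U. \<forall>y\<in>U. riemannian_dist g x y \<le> 1) \<Longrightarrow>
      (\<exists>V\<in>sets lborel. emeasure lborel V \<le> ennreal C * (diam_power (riemannian_dist g) s U + ennreal \<eta>) \<and>
      (\<forall>w a c. (\<forall>i. norm (l i w) \<le> 1) \<longrightarrow> c \<in> cone_at_infinity X \<longrightarrow>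
        proj J w = 0 \<or> c \<noteq> 0 \<and> complex_line c \<in> U \<and> proj J w = a *s proj J c \<longrightarrow> w \<in> V))"
      using direction_patch_cover[OF g tr s'] by blast
    obtain L where L: "L > 0" "\<And>i z. norm (l i z) \<le> L * norm z" using l_bounded by blast
    define vol where "vol = unit_ball_vol (real DIM(complex^'n)) * (1 / L) ^ DIM(complex^'n)"
    have vol: "vol > 0" using L by (simp add: vol_def unit_ball_vol_pos)
    have em: "emeasure lborel (cball 0 (1 / L) :: (complex^'n) set) = ennreal vol"
      unfolding vol_def by (rule emeasure_cball) (use L in simp)
    \<comment> \<open>One \<eta> is spent on the cover and one on the summands \<open>?h\<close>,
      which add up to \<eta>; 2C\<eta> is at most half the volume of the ball.\<close>
    define \<eta> where "\<eta> = min 1 (vol / (4 * C))"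
    have \<eta>: "0 < \<eta>" "\<eta> \<le> 1" "C * (\<eta> + \<eta>) < vol"
    proof -
      show "0 < \<eta>" "\<eta> \<le> 1" using vol C by (auto simp: \<eta>_def)
      have "C * \<eta> \<le> C * (vol / (4 * C))" using C by (intro mult_left_mono) (auto simp: \<eta>_def)
      also have "\<dots> = vol / 4" using C by simp
      finally show "C * (\<eta> + \<eta>) < vol" using vol by (simp add: distrib_left)
    qed
    obtain U :: "nat \<Rightarrow> (complex^'n) set set" where U: "?\<Sigma> \<subseteq> (\<Union>i. U i)" "\<And>i. U i \<subseteq> projective_space"
        "\<And>i x y. x \<in> U i \<Longrightarrow> y \<in> U i \<Longrightarrow> riemannian_dist g x y \<le> 1"
        "suminf (\<lambda>i. diam_power (riemannian_dist g) s (U i)) < ennreal \<eta>"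
      by (rule hausdorff_nullD[OF null zero_less_one \<eta>(1)]) (rule that; assumption)
    let ?h = "\<lambda>k. \<eta> * (1/2) ^ Suc k"
    let ?Q = "\<lambda>k V. V \<in> sets lborel \<and> emeasure lborel V \<le> ennreal C * (diam_power (riemannian_dist g) s (U k) + ennreal (?h k)) \<and>
      (U k \<inter> ?\<Sigma> \<noteq> {} \<longrightarrow> (\<forall>w a c. (\<forall>i. norm (l i w) \<le> 1) \<longrightarrow> c \<in> cone_at_infinity X \<longrightarrow>
        proj J w = 0 \<or> c \<noteq> 0 \<and> complex_line c \<in> U k \<and> proj J w = a *s proj J c \<longrightarrow> w \<in> V))"
    have "\<exists>V. ?Q k V" for k
    proof (cases "U k \<inter> ?\<Sigma> = {}")
      case True
      then show ?thesis by (intro exI[of _ "{}"]) auto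
    next
      case False
      have "(1/2 :: real) ^ Suc k \<le> 1" by (rule power_le_one) auto
      then have "0 < ?h k" "?h k \<le> 1" using \<eta>(1,2) mult_le_one[of \<eta> "(1/2) ^ Suc k"] by simp_all
      from patch[OF this False U(2)] U(3) show ?thesis by blast
    qed
    then have "\<exists>V. \<forall>k. ?Q k (V k)" by (intro choice allI)
    then obtain V where V: "\<forall>k. ?Q k (V k)" ..
    have inV: "w \<in> V k" if "U k \<inter> ?\<Sigma> \<noteq> {}" "\<forall>i. norm (l i w) \<le> 1" "c \<in> cone_at_infinity X"
        "proj J w = 0 \<or> c \<noteq> 0 \<and> complex_line c \<in> U k \<and> proj J w = a *s proj J c" for k w a c
      using V that by blast
    have "cball 0 (1 / L) \<subseteq> (\<Union>k. V k)"
    proof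
      fix w :: "complex^'n" assume "w \<in> cball 0 (1 / L)"
      then have nw: "norm w \<le> 1 / L" by simp
      have w: "\<forall>i. norm (l i w) \<le> 1"
      proof
        fix i
        have "norm (l i w) \<le> L * norm w" by (rule L(2))
        also have "\<dots> \<le> L * (1 / L)" using nw L(1) by (intro mult_left_mono) auto
        finally show "norm (l i w) \<le> 1" using L(1) by simp
      qed
      show "w \<in> (\<Union>k. V k)"
      proof (cases "proj J w = 0")
        case True
        obtain k where "complex_line c0 \<in> U k" using U(1) x0 by blast
        then have "U k \<inter> ?\<Sigma> \<noteq> {}" using x0 by blast
        then have "w \<in> V k" using inV[OF _ w c0(1)] True by blast
        then show ?thesis by blast
      next
        case False
        from repr[OF this] obtain c a where c: "c \<in> cone_at_infinity X" "c \<noteq> 0" "proj J w = a *s proj J c" by blast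
        then have xc: "complex_line c \<in> ?\<Sigma>" unfolding asymptotic_directions_def by blast
        then obtain k where k: "complex_line c \<in> U k" using U(1) by blast
        then have "U k \<inter> ?\<Sigma> \<noteq> {}" using xc by blast
        then have "w \<in> V k" using inV[OF _ w c(1)] c k by blast
        then show ?thesis by blast
      qed
    qed
    then have "ennreal vol \<le> emeasure lborel (\<Union>k. V k)" unfolding em[symmetric] by (rule emeasure_mono) (use V in auto)
    also have "\<dots> \<le> suminf (\<lambda>k. emeasure lborel (V k))"
      by (rule emeasure_subadditive_countably) (use V in auto)
    also have "\<dots> \<le> suminf (\<lambda>k. ennreal C * (diam_power (riemannian_dist g) s (U k) + ennreal (?h k)))"
      by (rule suminf_le) (use V in auto)
    also have "\<dots> = ennreal C * (suminf (\<lambda>k. diam_power (riemannian_dist g) s (U k)) + suminf (\<lambda>k. ennreal (?h k)))"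
      by (simp add: suminf_add[symmetric])
    also have "suminf (\<lambda>k. ennreal (?h k)) = ennreal \<eta>"
    proof (rule suminf_ennreal_eq)
      show "?h sums \<eta>" using sums_mult[OF power_half_series, of \<eta>] by simp
    qed (use \<eta> in simp)
    also have "ennreal C * (suminf (\<lambda>k. diam_power (riemannian_dist g) s (U k)) + ennreal \<eta>) \<le> ennreal C * (ennreal \<eta> + ennreal \<eta>)"
      using U(4) by (intro mult_left_mono add_right_mono) auto
    also have "\<dots> = ennreal (C * (\<eta> + \<eta>))" using C \<eta> by (simp add: ennreal_mult ennreal_plus[symmetric] del: ennreal_plus)
    finally have "vol \<le> C * (\<eta> + \<eta>)" using C \<eta> by (simp add: ennreal_le_iff)
    then show False using \<eta>(3) by linarith
  qed
qed

text \<open>Fullness gives points of X above the multiples (k + 1) w. Divided by k + 1 they stay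
  bounded by transversality, and a limit is a cone vector with the projection of w.\<close>

lemma full_cylinder_cone:
  assumes tr: "transversal J X" and full: "cyl J X = UNIV" and w: "proj J w \<noteq> 0"
  shows "\<exists>c\<in>cone_at_infinity X. proj J w = proj J c"
proof -
  obtain K where K: "K \<ge> 0" "\<And>x. x \<in> X \<Longrightarrow> norm x \<le> K * (1 + norm (proj J x))" using transversal_bound[OF tr] by blast
  have "\<exists>x. x \<in> X \<and> proj J x = of_nat (Suc k) *s proj J w" for k
  proof -
    have "of_nat (Suc k) *s w \<in> cyl J X" using full by blast
    then obtain x where x: "x \<in> X" "\<And>i. i \<notin> J \<Longrightarrow> l i (of_nat (Suc k) *s w) = l i x" unfolding cyl_def by blast
    have "proj J x = of_nat (Suc k) *s proj J w"
      by (rule frame_eqI) (use x(2) in \<open>auto simp: l_proj l_smult simp del: of_nat_Suc\<close>)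
    then show ?thesis using x(1) by blast
  qed
  then obtain x where x: "\<And>k. x k \<in> X" "\<And>k. proj J (x k) = of_nat (Suc k) *s proj J w" by metis
  have np: "norm (proj J (x k)) = real (Suc k) * norm (proj J w)" for k unfolding x(2) norm_smult norm_of_nat ..
  define y where "y k = x k /\<^sub>R real (Suc k)" for k
  have py: "proj J (y k) = proj J w" for k
  proof -
    have "proj J (y k) = proj J (x k) /\<^sub>R real (Suc k)" by (rule frame_eqI) (simp add: y_def l_proj l_scaleR)
    also have "\<dots> = proj J w"
      unfolding x(2) by (simp add: vec_eq_iff scaleR_conv_of_real[where 'a=complex] del: of_nat_Suc)
    finally show ?thesis .
  qed
  have "norm (y k) \<le> K * (1 + norm (proj J w))" for k
  proof -
    have "norm (x k) \<le> K * (1 + real (Suc k) * norm (proj J w))" using K(2)[OF x(1)] np by metis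
    also have "\<dots> \<le> K * (real (Suc k) * (1 + norm (proj J w)))" using K(1) by (intro mult_left_mono) (auto simp: algebra_simps)
    finally have "norm (x k) \<le> real (Suc k) * (K * (1 + norm (proj J w)))" by (simp add: mult_ac)
    then show ?thesis by (simp add: y_def field_simps)
  qed
  then have "bounded (range y)" by (auto intro!: boundedI)
  then obtain c r where r: "strict_mono r" "(y \<circ> r) \<longlonglongrightarrow> c" using bounded_imp_convergent_subsequence by blast
  have "(\<lambda>k. proj J ((y \<circ> r) k)) \<longlonglongrightarrow> proj J c" by (intro tendsto_intros r(2))
  then have pc: "proj J w = proj J c" by (simp add: py LIMSEQ_const_iff)
  obtain C where C: "C > 0" "\<And>z. norm (proj J z) \<le> C * norm z" using proj_bounded by blast
  have lim: "filterlim (\<lambda>k. real (Suc (r k))) at_top sequentially"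
    using filterlim_compose[OF filterlim_real_sequentially filterlim_compose[OF filterlim_Suc filterlim_subseq[OF r(1)]]] by simp
  have "filterlim (\<lambda>k. norm (x (r k))) at_top sequentially"
  proof (rule filterlim_at_top_mono)
    show "filterlim (\<lambda>k. (norm (proj J w) / C) * real (Suc (r k))) at_top sequentially"
      by (rule filterlim_tendsto_pos_mult_at_top[OF tendsto_const _ lim]) (use w C in simp)
    show "eventually (\<lambda>k. norm (proj J w) / C * real (Suc (r k)) \<le> norm (x (r k))) sequentially"
    proof (rule always_eventually, rule allI)
      fix k
      show "norm (proj J w) / C * real (Suc (r k)) \<le> norm (x (r k))"
        using C(2)[of "x (r k)"] np[of "r k"] C(1) by (simp add: field_simps del: of_nat_Suc)
    qed
  qed
  then have "c \<in> cone_at_infinity X" unfolding cone_at_infinity_def mem_Collect_eq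
    using x(1) lim r(2) by (intro exI[of _ "\<lambda>k. x (r k)"] exI[of _ "\<lambda>k. real (Suc (r k))"]) (auto simp: y_def o_def)
  then show ?thesis using pc by blast
qed

end

text \<open>Directions are added one at a time. While the codimension is at least d + 1, s <= 2d
  stays in the range s <= 2(codimension - 1) of \<open>null_directions_avoid\<close>, so codimension
  d is reached.\<close>

lemma null_directions_transversal:
  fixes X :: "(complex^'n) set"
  assumes g: "projective_metric g" and s: "0 \<le> s" "s \<le> 2 * real d" and d: "d \<le> CARD('n)"
    and null: "hausdorff_measure projective_space (riemannian_dist g) s (asymptotic_directions X) = 0"
  obtains b l J where "frame b l" "frame.transversal l J X" "card (- J) = d"
proof -
  have "k \<le> CARD('n) - d \<Longrightarrow> \<exists>b l J. frame b l \<and> frame.transversal l J X \<and> card (J :: 'n set) = k" for k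
  proof (induction k)
    case 0
    interpret std: frame "\<lambda>i. axis i 1 :: complex^'n" "\<lambda>i z. vec_nth z i" by (rule frame_standard)
    have "std.transversal {} X" unfolding std.transversal_def by (auto simp: vec_eq_iff)
    then show ?case using frame_standard
      by (intro exI[of _ "\<lambda>i. axis i 1"] exI[of _ "\<lambda>i z. vec_nth z i"] exI[of _ "{}"]) simp
  next
    case (Suc k)
    then obtain b l and J :: "'n set" where fr: "frame b l" and tr: "frame.transversal l J X" and cJ: "card J = k" by auto
    interpret frame b l by fact
    have "card (- J) = CARD('n) - k" using cJ card_complement[of J] by simp
    then have "d + 1 \<le> card (- J)" using Suc.prems by linarith
    then have "real d + 1 \<le> real (card (- J))" by (metis of_nat_1 of_nat_add of_nat_le_iff)
    then have "s \<le> 2 * (real (card (- J)) - 1)" using s(2) by (simp add: algebra_simps)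
    from null_directions_avoid[OF g tr s(1) this null]
    obtain w where w: "proj J w \<noteq> 0" "\<And>c a. c \<in> cone_at_infinity X \<Longrightarrow> proj J w \<noteq> a *s proj J c" by blast
    have "\<exists>j. j \<notin> J \<and> l j w \<noteq> 0"
    proof (rule ccontr)
      assume "\<not> ?thesis"
      then have "proj J w = 0" by (intro frame_eqI) (auto simp: l_proj l_zero)
      then show False using w(1) by blast
    qed
    then obtain j where j: "j \<notin> J" "l j w \<noteq> 0" by blast
    show ?case using frame_vector_exchange[OF fr j(2)] transversal_exchange[OF tr j w(2)] j(1) cJ
      by (intro exI conjI) auto
  qed
  from this[of "CARD('n) - d"] obtain b l and J :: "'n set" where
    J: "frame b l" "frame.transversal l J X" "card J = CARD('n) - d" by auto
  have "card (- J) = d" using J(3) d card_complement[of J] by simp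
  then show thesis using that J by blast
qed

section \<open>The equivalences and the exact dimension\<close>

theorem theorem3p1:
  fixes X :: "(complex ^ 'n) set"
    and d :: nat
    and g :: "complex ^ 'n \<Rightarrow> complex ^ 'n \<Rightarrow> complex ^ 'n \<Rightarrow> real"
  assumes "riemannian_metric_on_projective_space g"
    and "d \<le> CARD('n)"
    and "closed_pure_analytic_set d X"
  shows "(algebraic_set X \<longleftrightarrow>
           hausdorff_measure projective_space (riemannian_dist g) (2 * real d)
             (asymptotic_directions X) = 0) \<and>
         (algebraic_set X \<longleftrightarrow>
           hausdorff_dim projective_space (riemannian_dist g) (asymptotic_directions X)
             < ereal (2 * real d)) \<and>
         (d > 0 \<and> algebraic_set X \<longrightarrow>
           hausdorff_dim projective_space (riemannian_dist g) (asymptotic_directions X)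
             = ereal (2 * real d - 2))"
proof -
  let ?\<Sigma> = "asymptotic_directions X"
  let ?H = "\<lambda>s. hausdorff_measure projective_space (riemannian_dist g) s ?\<Sigma>"
  let ?dim = "hausdorff_dim projective_space (riemannian_dist g) ?\<Sigma>"
  have g: "projective_metric g" by unfold_locales (rule assms(1))
  have X: "locally_analytic X"
    using assms(3) closed_analytic_imp_locally_analytic unfolding closed_pure_analytic_set_def by blast
  \<comment> \<open>Stated for every s up to 2d, so that it serves the measure condition with s = 2d
    and the dimension condition with some s < 2d.\<close>
  have alg: "algebraic_set X" if h: "?H s = 0" and s: "0 \<le> s" "s \<le> 2 * real d" for s
  proof -
    obtain b l J where J: "frame b l" "frame.transversal l J X" "card (- J) = d"
      by (rule null_directions_transversal[OF g s assms(2) h])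
    show ?thesis by (rule frame.transversal_imp_algebraic[OF J(1) assms(3) X J(2,3)])
  qed
  have alg_dim: "algebraic_set X" if dim: "?dim < ereal (2 * real d)"
  proof (cases "?\<Sigma> = {}")
    case True
    then show ?thesis using alg[of "2 * real d"] by (simp add: hausdorff_null_empty)
  next
    case False
    then have "Inf {ereal s | s. s \<ge> 0 \<and> ?H s = 0} < ereal (2 * real d)" using dim unfolding hausdorff_dim_def by simp
    then obtain s where "s \<ge> 0" "?H s = 0" "ereal s < ereal (2 * real d)" unfolding Inf_less_iff by blast
    then show ?thesis using alg[of s] by simp
  qed
  have conv: "?H (2 * real d) = 0 \<and> ?dim < ereal (2 * real d) \<and> (d > 0 \<longrightarrow> ?dim = ereal (2 * real d - 2))"
    if a: "algebraic_set X"
  proof -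
    obtain b l J where J: "frame b l" "frame.transversal l J X" "card (- J) = d" "frame.cyl l J X = UNIV"
      by (rule algebraic_imp_transversal[OF a assms(3) X])
    interpret frame b l by fact
    show ?thesis
    proof (cases "d = 0")
      \<comment> \<open>Here L is the whole space, so transversality leaves no nonzero cone vector
        and the convention for the empty set applies.\<close>
      case True
      then have "- J = {}" using J(3) by simp
      then have "J = UNIV" by blast
      then have "cone_at_infinity X \<subseteq> {0}" using J(2) unfolding transversal_def by blast
      then have "?\<Sigma> = {}" unfolding asymptotic_directions_def by blast
      then show ?thesis using True by (simp add: hausdorff_null_empty hausdorff_dim_def)
    next
      case False
      have upper: "?H s = 0" if "s > 2 * real d - 2" for s
        by (rule transversal_directions_null[OF g assms(3) X J(2,3)]) (use that False in \<open>simp add: of_nat_diff\<close>)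
      \<comment> \<open>A null set of directions would leave a class w modulo L that is no multiple
        of a projected cone vector; but X + L is everything, so the cone projects onto every nonzero
        class.\<close>
      have lower: "s > 2 * real d - 2" if h: "?H s = 0" and s: "s \<ge> 0" for s
      proof (rule ccontr)
        assume "\<not> s > 2 * real d - 2"
        then have le: "s \<le> 2 * (real (card (- J)) - 1)" using J(3) by simp
        from null_directions_avoid[OF g J(2) s le h]
        obtain w where w: "proj J w \<noteq> 0" "\<And>c a. c \<in> cone_at_infinity X \<Longrightarrow> proj J w \<noteq> a *s proj J c" by blast
        obtain c where c: "c \<in> cone_at_infinity X" "proj J w = proj J c" using full_cylinder_cone[OF J(2,4) w(1)] by blast
        then show False using w(2)[OF c(1), of 1] by simp
      qed
      have ne: "?\<Sigma> \<noteq> {}" using lower[of 0] False by (auto simp: hausdorff_null_empty)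
      have "Inf {ereal s | s. s \<ge> 0 \<and> ?H s = 0} = ereal (2 * real d - 2)"
      proof (rule antisym)
        show "ereal (2 * real d - 2) \<le> Inf {ereal s | s. s \<ge> 0 \<and> ?H s = 0}"
          by (rule Inf_greatest) (use lower in \<open>auto simp: less_imp_le\<close>)
        show "Inf {ereal s | s. s \<ge> 0 \<and> ?H s = 0} \<le> ereal (2 * real d - 2)"
        \<comment> \<open>The infimum is not attained: the measure vanishes for every s above 2d - 2
          but, by \<open>lower\<close>, not at 2d - 2 itself.\<close>
        proof (rule ereal_le_epsilon2)
          fix e :: real assume e: "0 < e"
          have "2 * real d - 2 + e \<ge> 0" using e False by linarith
          then have "Inf {ereal s | s. s \<ge> 0 \<and> ?H s = 0} \<le> ereal (2 * real d - 2 + e)"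
            using upper[of "2 * real d - 2 + e"] e by (intro Inf_lower) auto
          then show "Inf {ereal s | s. s \<ge> 0 \<and> ?H s = 0} \<le> ereal (2 * real d - 2) + ereal e" by simp
        qed
      qed
      then have "?dim = ereal (2 * real d - 2)" unfolding hausdorff_dim_def using ne by simp
      then show ?thesis using upper[of "2 * real d"] by simp
    qed
  qed
  have "algebraic_set X \<longleftrightarrow> ?H (2 * real d) = 0" using alg[of "2 * real d"] conv by auto
  moreover have "algebraic_set X \<longleftrightarrow> ?dim < ereal (2 * real d)" using alg_dim conv by blast
  ultimately show ?thesis using conv by blast
qed

end
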